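(* There is an absolute constant $C>0$ such that the following holds. Let $N$ be a positive integer, let $0<\delta\le 1$, let $A \subset \{1,2,\dots, N\}$ with $|A| \geq \delta N$, and let $0<\varepsilon \leq 1/2$. Then either $N \leq \exp\big(C\varepsilon^{-C}\big)$, or there exists an integer $d \neq 0$ such that $$\#\{x \in A : x+d\in A \text{ and } x+d^2 \in A\} \geq (\delta^3-\varepsilon) N.$$ *)

theory Defs
  imports Complex_Main
begin

end

theory Submission
 imports Defs "HOL-Library.Product_Plus"
begin

text \<open>With \<open>Q\<close> a factorial, Cauchy-Schwarz differencing bounds the count of \<open>x, x + q1 d, x + q2 d\<^sup>2\<close>, \<open>d < Q ^ m\<close>,
by a local Gowers norm at scales that lose only powers of \<open>Q\<close> (two concatenation steps make the differencing
directions free). Degree lowering of the dual functions, where rational phases have denominators dividing \<open>Q\<close>,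
reduces this to correlation with averages along progressions of step \<open>Q ^ k\<close>. For \<open>q1 = Q ^ i\<close>, \<open>q2 = Q ^ (2 * i)\<close>,
an energy increment over i finds a scale at which f may be replaced by conditional expectations on congruence
classes inside blocks, and these contribute at least the cube of the density by convexity.\<close>

text \<open>The bound \<open>exp (C * \<epsilon> powr (- C))\<close> shapes the proof: no step may
  lose more than a fixed power of Q in length and a fixed power of \<eta> in size, uniformly in the
  scale. A factorial is used because the denominator of a phase varies with the point and the
  frequency; as every candidate divides Q, one step serves all of them at once and nothing has to be
  pigeonholed. Divisibility also nests the partitions of different scales, so that energy increments
  are exact differences. The factorial is affordable: log Q is polynomial in 1 / \<epsilon>, and so
  is the number of powers of Q consumed by the roughly 2 / \<eta>^2 scales. The coefficients q1, q2
  stay arbitrary in the inverse theorems since a scale i enters only through D = Q^i d. The interval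
  is embedded in a cycle whose length is a multiple of a high power of Q; translations and Fourier
  inversion are then exact, and boundary errors come only from the short ranges of the parameters.
  Exponents are not optimised: an absorbed error costs a factor \<eta>, an absorbed constant a
  factor Q.\<close>

section \<open>Normalised averages over finite sets\<close>

definition av :: "'a set => ('a => 'b::real_vector) => 'b" where
 "av S f = (1 / real (card S)) *\<^sub>R (\<Sum>x\<in>S. f x)"

lemma av_cong: "S = T ==> (!!x. x \<in> T ==> f x = g x) ==> av S f = av T g"
 unfolding av_def by (metis (no_types, lifting) sum.cong)

lemma av_const: "finite S ==> S ~= {} ==> av S (%_. c) = c"
 unfolding av_def by (simp add: sum_constant_scaleR)

lemma av_zero [simp]: "av S (%_. 0) = 0"
 by (simp add: av_def)

lemma av_add: "av S (%x. f x + g x) = av S f + av S g"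
 unfolding av_def by (simp add: sum.distrib scaleR_add_right)

lemma av_diff: "av S (%x. f x - g x) = av S f - av S g"
 unfolding av_def by (simp add: sum_subtractf scaleR_diff_right)

lemma av_mult_left: "av S (%x. c * f x) = c * av S f" for c :: "'b::real_algebra"
 unfolding av_def by (simp add: sum_distrib_left)

lemma av_mult_right: "av S (%x. f x * c) = av S f * c" for c :: "'b::real_algebra"
 unfolding av_def by (simp add: sum_distrib_right)

lemma av_divide: "av S (%x. f x / c) = av S f / c" for c :: "'b::real_normed_field"
 unfolding av_def by (simp add: sum_divide_distrib scaleR_conv_of_real mult.commute)

lemma av_mono: "(!!x. x \<in> S ==> f x <= g x) ==> av S f <= av S g" for f g :: "'a => real"
 unfolding av_def by (simp add: mult_left_mono sum_mono divide_right_mono)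

lemma av_nonneg: "(!!x. x \<in> S ==> 0 <= f x) ==> 0 <= av S f" for f :: "'a => real"
 unfolding av_def by (simp add: sum_nonneg)

text \<open>The sign condition on \<open>c\<close> covers sets of cardinality 0, infinite ones
  included, where \<open>av\<close> is 0.\<close>

lemma av_le: assumes "!!x. x \<in> S ==> f x <= c" "0 <= c" shows "av S f <= (c::real)"
proof (cases "finite S \<and> S ~= {}")
 case True
 have "av S f <= av S (%_. c)" by (rule av_mono) (use assms in auto)
 then show ?thesis using True av_const by metis
next
 case False
 then have "card S = 0" by (metis card_eq_0_iff)
 then have "av S f = 0" by (simp add: av_def)
 then show ?thesis using assms by simp
qed

lemma norm_av_le: "norm (av S f) <= av S (%x. norm (f x))"
 unfolding av_def by (simp add: divide_right_mono norm_sum)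

lemma norm_av_bound: "(!!x. x \<in> S ==> norm (f x) <= c) ==> 0 <= c ==> norm (av S f) <= c"
 by (rule order_trans[OF norm_av_le av_le])

lemma av_swap: "av S (%x. av T (%y. f x y)) = av T (%y. av S (%x. f x y))"
 unfolding av_def
 by (simp add: scaleR_sum_right[symmetric] scaleR_scaleR mult.commute sum.swap[of _ T S] del: scaleR_scaleR)
   (simp add: mult.commute)

lemma av_Times: "av (S \<times> T) f = av S (%x. av T (%y. f (x, y)))"
proof -
 have "(\<Sum>x\<in>S. \<Sum>y\<in>T. f (x, y)) = (\<Sum>z\<in>S \<times> T. f z)"
  if "finite S" "finite T" using that by (simp add: sum.cartesian_product)
 then show ?thesis
  by (cases "finite S \<and> finite T")
    (auto simp: av_def card_cartesian_product scaleR_sum_right[symmetric])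
qed

lemma Re_av: "Re (av S f) = av S (%x. Re (f x))"
 unfolding av_def by simp

lemma cnj_av: "cnj (av S f) = av S (%x. cnj (f x))"
 unfolding av_def by (simp add: scaleR_conv_of_real)

lemma of_real_av: "complex_of_real (av S f) = av S (%x. complex_of_real (f x))"
 unfolding av_def by (simp add: complex_eq_iff)

lemma av_reindex: assumes "bij_betw h S T" shows "av T f = av S (%x. f (h x))"
 unfolding av_def using sum.reindex_bij_betw[OF assms, of f] bij_betw_same_card[OF assms] by simp

lemma av_square_le: "(av S f)\<^sup>2 <= av S (%x. (f x)\<^sup>2)" for f :: "'a => real"
proof (cases "card S = 0")
 case True then show ?thesis by (simp add: av_def)
next
 case False
 then have S: "finite S" "S ~= {}" by (auto intro: card_ge_0_finite)
 define m where "m = av S f"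
 have "0 <= av S (%x. (f x - m)\<^sup>2)" by (rule av_nonneg) simp
 also have "... = av S (%x. (f x)\<^sup>2 + (m\<^sup>2 - 2 * m * f x))"
  by (rule av_cong) (auto simp: power2_eq_square algebra_simps)
 also have "... = av S (%x. (f x)\<^sup>2) + (m\<^sup>2 - 2 * m * m)"
  unfolding av_add av_diff av_mult_left using S by (simp add: av_const m_def)
 finally show ?thesis by (simp add: m_def power2_eq_square)
qed

lemma norm_av_square_le: "(norm (av S f))\<^sup>2 <= av S (%x. (norm (f x))\<^sup>2)"
 by (rule order_trans[OF power_mono[OF norm_av_le norm_ge_zero] av_square_le])

text \<open>Cauchy-Schwarz iterated n times; exponents in this development arise by repeated
  squaring, so powers of two suffice.\<close>

lemma av_power_le: "(!!x. x \<in> S ==> 0 <= f x) ==> (av S f) ^ (2 ^ n) <= av S (%x. f x ^ (2 ^ n))"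
 for f :: "'a => real"
proof (induction n)
 case (Suc n)
 have "(av S f) ^ (2 ^ Suc n) = ((av S f) ^ 2 ^ n)\<^sup>2" by (simp add: power_mult[symmetric] mult.commute)
 also have "... <= (av S (%x. f x ^ (2 ^ n)))\<^sup>2"
  by (intro power_mono Suc) (use Suc in "auto intro!: zero_le_power av_nonneg")
 also have "... <= av S (%x. (f x ^ (2 ^ n))\<^sup>2)" by (rule av_square_le)
 finally show ?case by (simp add: power_mult[symmetric] mult.commute)
qed simp

lemma av_pigeonhole:
 assumes "finite S" "S ~= {}" "c <= av S f" shows "\<exists>x\<in>S. (c::real) <= f x"
proof (rule ccontr)
 assume "\<not> ?thesis"
 then have *: "!!x. x \<in> S ==> f x < c" by auto
 have "(\<Sum>x\<in>S. f x) < (\<Sum>x\<in>S. c)" by (rule sum_strict_mono) (use assms * in auto)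
 moreover have "card S > 0" using assms by (simp add: card_gt_0_iff)
 ultimately have "av S f < c" by (simp add: av_def field_simps)
 then show False using assms by simp
qed

text \<open>The Cauchy-Schwarz step of every differencing argument: a bounded weight that does not
  involve the variables averaged inside \<open>g\<close> is discarded at the cost of a
  square.\<close>

lemma av_kill:
 fixes g :: "'a => 'b::real_normed_field"
 assumes "!!x. x \<in> S ==> norm (b x) <= 1"
 shows "(norm (av S (%x. b x * g x)))\<^sup>2 <= av S (%x. (norm (g x))\<^sup>2)"
proof -
 have "(norm (av S (%x. b x * g x)))\<^sup>2 <= av S (%x. (norm (b x * g x))\<^sup>2)"
  by (rule norm_av_square_le)
 also have "... <= av S (%x. (norm (g x))\<^sup>2)"
  by (rule av_mono, rule power_mono)
    (use assms in "auto simp: norm_mult intro: mult_left_le_one_le")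
 finally show ?thesis .
qed

text \<open>Opens the square left by \<open>av_kill\<close> by duplicating the averaged variable;
  stated over the complex numbers so that further averages can be exchanged with it.\<close>

lemma av_norm_square:
 "complex_of_real ((norm (av S g))\<^sup>2) = av S (%s. av S (%s'. g s * cnj (g s')))"
 unfolding av_mult_left av_mult_right cnj_av[symmetric]
 by (rule complex_norm_square)

text \<open>Reverse Markov inequality: pointwise, f is at most c plus B times the indicator of c
  \<le> f.\<close>

lemma av_markov:
 assumes "!!x. x \<in> S ==> f x <= B" "finite S" "S ~= {}" "c + d <= av S f" "0 <= B" "0 <= c"
 shows "d <= B * av S (%x. of_bool (c <= (f x :: real)))"
proof -
 have "av S f <= av S (%x. c + B * of_bool (c <= f x))"
  by (rule av_mono) (use assms in "force simp: of_bool_def")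
 also have "... = c + B * av S (%x. of_bool (c <= f x))"
  unfolding av_add av_mult_left using assms by (simp add: av_const)
 finally show ?thesis using assms by linarith
qed

lemma av_of_bool: "finite S ==> av S (%x. of_bool (Q x)) = real (card {x\<in>S. Q x}) / real (card S)"
 unfolding av_def by (simp add: Int_def of_bool_def sum.If_cases)

section \<open>Periodic functions and averages over a period\<close>

definition per :: "nat => (int => 'a) => bool" where
 "per P f \<longleftrightarrow> (\<forall>x. f (x + int P) = f x)"

abbreviation zp :: "nat => int set" where "zp P \<equiv> {0..<int P}"

lemma per_mult: "per P f ==> f (x + k * int P) = f x"
proof -
 assume p: "per P f"
 have *: "f (x + int n * int P) = f x" for n x
  by (induction n) (use p in "auto simp: per_def algebra_simps", metis add.assoc add.commute)
 show ?thesis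
 proof (cases "k \<ge> 0")
  case True then show ?thesis using *[of x "nat k"] by simp
 next
  case False then show ?thesis using *[of "x + k * int P" "nat (-k)"] by (simp add: algebra_simps)
 qed
qed

lemma per_mod: "per P f ==> f (x mod int P) = f x"
 using per_mult[of P f x "- (x div int P)"] by (simp add: minus_div_mult_eq_mod)

lemma bij_zp_shift: "P > 0 ==> bij_betw (%x. (x + a) mod int P) (zp P) (zp P)"
proof (rule bij_betw_byWitness[where f' = "%x. (x - a) mod int P"])
qed (auto simp: mod_simps)

lemma av_shift: "P > 0 ==> per P f ==> av (zp P) (%x. f (x + a)) = av (zp P) f"
 by (subst (2) av_reindex[OF bij_zp_shift[of P a]]) (auto simp: per_mod)

lemma av_shift_mod: "P > 0 ==> av (zp P) (%x. f ((x + a) mod int P)) = av (zp P) f"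
 by (subst (2) av_reindex[OF bij_zp_shift[of P a]]) auto

lemma zp_ne: "P > 0 ==> zp P ~= {}" by simp

lemma per_shift: "per P f ==> per P (%x. f (x + a))"
 unfolding per_def by (metis add.assoc add.commute)

lemma per_shift2: "per P f ==> per P (%x. f (x - a))"
 using per_shift[of P f "-a"] by simp

lemma per_times: "per P f ==> per P g ==> per P (%x. f x * g x)"
 unfolding per_def by auto

lemma per_cnj: "per P f ==> per P (%x. cnj (f x))"
 unfolding per_def by auto

lemma per_av: "(!!s. s \<in> S ==> per P (%x. f x s)) ==> per P (%x. av S (f x))"
 unfolding per_def by (auto intro!: av_cong)

section \<open>Approximate translation invariance of boxes and van der Corput differencing\<close>

text \<open>Invariance up to an error is tested against bounded functions instead of being read off
  symmetric differences: in this form it passes to products of boxes one coordinate at a time, and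
  it is what is needed to insert an extra average over shifts.\<close>

definition shiftok :: "'p::ab_group_add set => 'p => real => bool" where
 "shiftok B v e \<longleftrightarrow> 0 <= e \<and> (\<forall>f::'p => complex. (\<forall>p. norm (f p) <= 1) -->
   norm (av B (%p. f (p + v)) - av B f) <= e)"

lemma shiftok_0 [intro]: "0 <= e ==> shiftok B 0 e"
 by (simp add: shiftok_def)

lemma shiftokD: "shiftok B v e ==> (!!p. norm (f p) <= 1) ==> norm (av B (%p. f (p + v)) - av B f) <= e"
 for f :: "_ => complex"
 by (simp add: shiftok_def)

lemma shiftok_nonneg: "shiftok B v e ==> 0 <= e"
 by (simp add: shiftok_def)

lemma shiftok_mono: "shiftok B v e ==> e <= e' ==> shiftok B v e'"
 unfolding shiftok_def using order_trans by blast

lemma sum_int_shift: "(\<Sum>x\<in>{a..<b::int}. f (x + k)) = (\<Sum>x\<in>{a+k..<b+k}. f x)"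
 by (rule sum.reindex_bij_witness[of _ "%x. x - k" "%x. x + k"]) auto

text \<open>The two index ranges agree except for at most |k| terms at either end.\<close>

lemma sum_interval_shift_bound:
 fixes f :: "int => complex"
 assumes "!!x. norm (f x) <= 1"
 shows "norm ((\<Sum>x\<in>{a..<b}. f (x + k)) - (\<Sum>x\<in>{a..<b}. f x)) <= 2 * \<bar>real_of_int k\<bar>"
proof -
 have *: "norm ((\<Sum>x\<in>{a..<b}. g (x + int n)) - (\<Sum>x\<in>{a..<b}. g x)) <= 2 * real n"
  if g: "!!x. norm (g x) <= 1" for g :: "int => complex" and n :: nat
 proof -
  let ?A = "{a + int n..<b + int n}" and ?B = "{a..<b}"
  have "(\<Sum>x\<in>?B. g (x + int n)) - sum g ?B = sum g ?A - sum g ?B"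
   by (simp only: sum_int_shift)
  also have "... = sum g (?A - ?B) - sum g (?B - ?A)"
   using sum.Int_Diff[of ?A g ?B] sum.Int_Diff[of ?B g ?A] by (simp add: Int_commute)
  also have "norm ... <= norm (sum g (?A - ?B)) + norm (sum g (?B - ?A))" by (rule norm_triangle_ineq4)
  also have "norm (sum g (?A - ?B)) <= real (card (?A - ?B))"
   using sum_norm_bound[of "?A - ?B" g 1] g by simp
  also have "card (?A - ?B) <= card {max b (a + int n)..<b + int n}" by (rule card_mono) auto
  also have "... <= n" by auto
  also have "norm (sum g (?B - ?A)) <= real (card (?B - ?A))"
   using sum_norm_bound[of "?B - ?A" g 1] g by simp
  also have "card (?B - ?A) <= card {a..<a + int n}" by (rule card_mono) auto
  also have "... <= n" by auto
  finally show ?thesis by simp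
 qed
 show ?thesis
 proof (cases "k \<ge> 0")
  case True then show ?thesis using *[of f "nat k"] assms by simp
 next
  case False then show ?thesis using *[of "%x. f (x + k)" "nat (-k)"] assms
   by (simp add: norm_minus_commute)
 qed
qed

lemma shiftok_int: "M > 0 ==> shiftok {a..<a + int M} k (2 * \<bar>real_of_int k\<bar> / real M)"
 unfolding shiftok_def
proof safe
 fix f :: "int => complex" assume "0 < M" "\<forall>p. norm (f p) <= 1"
 moreover have "av {a..<a + int M} (%p. f (p + k)) - av {a..<a + int M} f =
   (1 / real M) *\<^sub>R ((\<Sum>x\<in>{a..<a + int M}. f (x + k)) - (\<Sum>x\<in>{a..<a + int M}. f x))"
  unfolding av_def by (simp add: algebra_simps)
 ultimately show "norm (av {a..<a + int M} (%p. f (p + k)) - av {a..<a + int M} f) <= 2 * \<bar>real_of_int k\<bar> / real M"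
  using sum_interval_shift_bound[of f k "a" "a + int M"] by (simp add: divide_right_mono)
qed auto

lemma shiftok_int': "M > 0 ==> b = a + int M ==> 2 * \<bar>real_of_int k\<bar> / real M <= e ==> shiftok {a..<b} k e"
 using shiftok_mono[OF shiftok_int] by simp

lemma shiftok_Times:
 assumes "shiftok A v e1" "shiftok B w e2" "finite A" "A ~= {}" "finite B" "B ~= {}"
 shows "shiftok (A \<times> B) (v, w) (e1 + e2)"
 unfolding shiftok_def
proof safe
 show "0 <= e1 + e2" using assms by (simp add: shiftok_def)
 fix f :: "'a \<times> 'b => complex" assume f: "\<forall>p. norm (f p) <= 1"
 have 1: "norm (av A (%x. av B (%y. f (x + v, y + w)) - av B (%y. f (x + v, y)))) <= e2"
  by (rule norm_av_bound, rule shiftokD[OF assms(2)]) (use f shiftok_nonneg[OF assms(2)] in auto)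
 have 2: "norm (av B (%y. av A (%x. f (x + v, y)) - av A (%x. f (x, y)))) <= e1"
 proof (rule norm_av_bound)
  fix y
  show "norm (av A (%x. f (x + v, y)) - av A (%x. f (x, y))) <= e1"
   using assms(1) f unfolding shiftok_def by (auto elim!: allE[where x = "%x. f (x, y)"])
 qed (use assms in "auto simp: shiftok_def")
 have eq: "av (A \<times> B) (%p. f (p + (v, w))) - av (A \<times> B) f =
   av A (%x. av B (%y. f (x + v, y + w)) - av B (%y. f (x + v, y))) +
   av B (%y. av A (%x. f (x + v, y)) - av A (%x. f (x, y)))"
  unfolding av_diff av_Times by (simp add: av_swap[of B A])
 show "norm (av (A \<times> B) (%p. f (p + (v, w))) - av (A \<times> B) f) <= e1 + e2"
  unfolding eq by (rule norm_triangle_le) (use 1 2 in linarith)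
qed

text \<open>Inside [0,1] an additive error grows only linearly when an inequality is raised to a
  power; this keeps boundary errors harmless through repeated squaring.\<close>

lemma abs_power_diff_le:
 fixes y a :: real
 assumes "0 <= y" "y <= 1" "0 <= a" "a <= 1" "y <= a + e" "0 <= e"
 shows "y ^ n <= a ^ n + real n * e"
proof (induction n)
 case (Suc n)
 have "y ^ Suc n = y * y ^ n" by simp
 also have "... <= (a + e) * y ^ n" using assms by (intro mult_right_mono) auto
 also have "... = a * y ^ n + e * y ^ n" by (simp add: algebra_simps)
 also have "e * y ^ n <= e * 1" using assms by (intro mult_left_mono power_le_one) auto
 also have "a * y ^ n <= a * (a ^ n + real n * e)" using assms Suc by (intro mult_left_mono) auto
 also have "a * (a ^ n + real n * e) <= a ^ Suc n + real n * e"
  using assms mult_left_le_one_le[of "real n * e" a] by (simp add: algebra_simps)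
 finally show ?case by (simp add: algebra_simps)
qed simp

text \<open>Averaging over the shifts \<open>h s\<close> moves the mean by at most \<open>e\<close>,
  and Cauchy-Schwarz in d leaves the inner average. Squaring turns the error into 2 e because both
  means are bounded by 1.\<close>

lemma vdC:
 fixes v :: "int => complex"
 assumes v: "!!d. norm (v d) <= 1" and M: "M > 0" and S: "finite S" "S ~= {}"
  and e: "!!s. s \<in> S ==> shiftok {a..<a + int M} (h s) e"
 shows "(norm (av {a..<a + int M} v))\<^sup>2 <= av {a..<a + int M} (%d. (norm (av S (%s. v (d + h s))))\<^sup>2) + 2 * e"
proof -
 let ?I = "{a..<a + int M}"
 define A where "A = av ?I v"
 define B where "B = av ?I (%d. av S (%s. v (d + h s)))"
 have e0: "0 <= e" using e S by (auto simp: shiftok_def)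
 have "B - A = av S (%s. av ?I (%d. v (d + h s)) - av ?I v)"
  unfolding A_def B_def av_diff av_const[OF S] by (subst av_swap) simp
 moreover have "norm ... <= e"
  by (rule norm_av_bound) (use e e0 v in "auto simp: shiftok_def")
 ultimately have AB: "norm A <= norm B + e"
  using norm_triangle_ineq3[of A B] norm_minus_commute[of A B] by simp
 have A1: "norm A <= 1" unfolding A_def by (rule norm_av_bound) (use v in auto)
 have B1: "norm B <= 1" unfolding B_def by (intro norm_av_bound) (use v in auto)
 have "(norm A)\<^sup>2 <= (norm B)\<^sup>2 + 2 * e"
  using abs_power_diff_le[of "norm A" "norm B" e 2] AB A1 B1 e0 by simp
 moreover have "(norm B)\<^sup>2 <= av ?I (%d. (norm (av S (%s. v (d + h s))))\<^sup>2)"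
  unfolding B_def by (rule norm_av_square_le)
 ultimately show ?thesis by (simp add: A_def)
qed

section \<open>Exponential phases and the distance to the nearest integer\<close>

definition ee :: "real => complex" where "ee x = cis (2 * pi * x)"

lemma ee_add: "ee (x + y) = ee x * ee y"
 by (simp add: ee_def cis_mult ring_distribs)

lemma ee_0 [simp]: "ee 0 = 1" by (simp add: ee_def)

lemma norm_ee [simp]: "norm (ee x) = 1" by (simp add: ee_def)

lemma cnj_ee: "cnj (ee x) = ee (- x)" by (simp add: ee_def cis_cnj)

lemma ee_diff: "ee (x - y) = ee x * cnj (ee y)"
 using ee_add[of x "-y"] by (simp add: cnj_ee)

lemma ee_of_int [simp]: "ee (of_int n) = 1"
 by (simp add: ee_def cis.ctr complex_eq_iff cos_int_2pin sin_int_2pin)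

lemma ee_add_int: "ee (x + of_int n) = ee x" by (simp add: ee_add)

definition dn :: "real => real" where "dn x = \<bar>x - of_int (round x)\<bar>"

lemma dn_le: "dn x <= \<bar>x - of_int n\<bar>"
 unfolding dn_def using round_diff_minimal[of x n] by (simp add: abs_minus_commute)

lemma dn_nonneg [simp]: "0 <= dn x" by (simp add: dn_def)

lemma dn_half: "dn x <= 1/2"
 unfolding dn_def using of_int_round_abs_le[of x] by (simp add: abs_minus_commute)

lemma dn_ex: "\<exists>n s. x = of_int n + s \<and> \<bar>s\<bar> = dn x"
 unfolding dn_def by (rule exI[of _ "round x"], rule exI[of _ "x - of_int (round x)"]) simp

lemma dn_of_int [simp]: "dn (of_int n) = 0" by (simp add: dn_def)

lemma dn_add: "dn (x + y) <= dn x + dn y"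
proof -
 have "dn (x + y) <= \<bar>(x + y) - of_int (round x + round y)\<bar>" by (rule dn_le)
 also have "... <= dn x + dn y" unfolding dn_def by simp
 finally show ?thesis .
qed

lemma dn_minus: "dn (- x) <= dn x"
 using dn_le[of "-x" "- round x"] by (simp add: dn_def)

lemma dn_minus_eq [simp]: "dn (- x) = dn x"
 using dn_minus[of x] dn_minus[of "-x"] by simp

lemma dn_diff: "dn (x - y) <= dn x + dn y"
 using dn_add[of x "-y"] by simp

lemma dn_add_int [simp]: "dn (x + of_int n) = dn x"
 by (metis add_diff_cancel_right' diff_add_cancel dn_add dn_diff dn_of_int add.right_neutral diff_zero order_antisym)

lemma dn_mult: "dn (of_int k * x) <= \<bar>of_int k\<bar> * dn x"
proof -
 have "dn (of_int k * x) <= \<bar>of_int k * x - of_int (k * round x)\<bar>" by (rule dn_le)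
 also have "... = \<bar>of_int k\<bar> * dn x" by (simp add: dn_def abs_mult[symmetric] right_diff_distrib)
 finally show ?thesis .
qed

text \<open>A denominator r may be replaced by any multiple q at the cost of a factor of at most
  |q|. This is how all denominators are merged into one.\<close>

lemma dn_dvd: "int r dvd q ==> r > 0 ==> dn (of_nat r * x) <= t ==> dn (of_int q * x) <= \<bar>of_int q\<bar> * t"
proof (elim dvdE)
 fix k assume h: "q = int r * k" "r > 0" "dn (of_nat r * x) <= t"
 have "of_int q * x = of_int k * (of_nat r * x)" using h by simp
 then have "dn (of_int q * x) <= \<bar>of_int k\<bar> * dn (of_nat r * x)" using dn_mult by metis
 also have "... <= \<bar>of_int k\<bar> * t" using h by (intro mult_left_mono) auto
 also have "... <= \<bar>of_int q\<bar> * t"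
 proof (rule mult_right_mono)
  have "1 * \<bar>k\<bar> <= int r * \<bar>k\<bar>" using h(2) by (intro mult_right_mono) auto
  then have "\<bar>k\<bar> <= \<bar>q\<bar>" using h by (simp add: abs_mult)
  then show "\<bar>real_of_int k\<bar> <= \<bar>real_of_int q\<bar>" by linarith
 qed (use h dn_nonneg order_trans in blast)
 finally show ?thesis .
qed

lemma norm_ee_minus_1: "norm (ee x - 1) = 2 * \<bar>sin (pi * x)\<bar>"
proof -
 have "(norm (ee x - 1))\<^sup>2 = (cos (2 * pi * x) - 1)\<^sup>2 + (sin (2 * pi * x))\<^sup>2"
  by (simp add: ee_def cmod_power2)
 also have "... = 2 - 2 * cos (2 * (pi * x))"
  using sin_cos_squared_add[of "2 * pi * x"] by (simp add: power2_eq_square algebra_simps)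
 also have "... = (2 * \<bar>sin (pi * x)\<bar>)\<^sup>2"
  by (simp add: cos_double_sin power2_eq_square)
 finally show ?thesis by (metis abs_ge_zero mult_nonneg_nonneg norm_ge_zero power2_eq_imp_eq zero_le_numeral)
qed

lemma norm_ee_minus_1_dn: "norm (ee x - 1) = 2 * sin (pi * dn x)"
proof -
 obtain n s where ns: "x = of_int n + s" "\<bar>s\<bar> = dn x" using dn_ex by blast
 have "ee x = ee s" using ns ee_add_int[of s n] by (simp add: add.commute)
 then have "norm (ee x - 1) = 2 * \<bar>sin (pi * s)\<bar>" using norm_ee_minus_1 by simp
 also have "\<bar>sin (pi * s)\<bar> = sin (pi * dn x)"
 proof -
  have "0 <= sin (pi * dn x)" by (rule sin_ge_zero) (use dn_half[of x] pi_gt_zero in "auto simp: mult_le_cancel_left1")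
  moreover have "s = dn x \<or> s = - dn x" using ns by linarith
  ultimately show ?thesis by auto
 qed
 finally show ?thesis .
qed

lemma ee_near: "norm (ee x - ee y) <= 2 * pi * dn (x - y)"
proof -
 have "norm (ee x - ee y) = norm (ee y * (ee (x - y) - 1))"
  by (simp add: algebra_simps flip: ee_add)
 also have "... = 2 * sin (pi * dn (x - y))" by (simp add: norm_mult norm_ee_minus_1_dn)
 also have "... <= 2 * (pi * dn (x - y))" using sin_x_le_x[of "pi * dn (x - y)"] by simp
 finally show ?thesis by simp
qed

text \<open>A weak form of Jordan's inequality, sin (pi t) \<ge> t for 0 \<le> t \<le> 1/2, drawn
  from the cubic Taylor bound.\<close>

lemma ee_far: "2 * dn x <= norm (ee x - 1)"
proof -
 define y where "y = pi * dn x"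
 have y0: "0 <= y" by (simp add: y_def)
 have yp: "y <= pi / 2" using dn_half[of x] by (simp add: y_def)
 have "\<bar>sin y - (\<Sum>m<3. sin_coeff m * y ^ m)\<bar> <= inverse (fact 3) * \<bar>y\<bar> ^ 3"
  by (rule Maclaurin_sin_bound)
 then have "\<bar>sin y - y\<bar> <= y ^ 3 / 6"
  using y0 by (simp add: eval_nat_numeral sin_coeff_def)
 then have 1: "y - y ^ 3 / 6 <= sin y" by linarith
 have "y ^ 3 <= y * (pi / 2)\<^sup>2"
  unfolding power3_eq_cube power2_eq_square mult.assoc using y0 yp by (intro mult_left_mono mult_mono) auto
 also have "... = dn x * pi ^ 3 / 4" by (simp add: y_def power2_eq_square power3_eq_cube)
 finally have 2: "pi * dn x - dn x * pi ^ 3 / 24 <= sin y" using 1 by (simp add: y_def)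
 \<comment> \<open>The product equals 28 pi - pi^3 - 48, so pi < 4 yields 24 pi - pi^3 \<ge> 48 - 4
   pi > 32.\<close>
 have "(pi - 2) * (4 - pi) * (pi + 6) \<ge> 0" using pi_ge_two pi_less_4 by (intro mult_nonneg_nonneg) auto
 then have "24 <= 24 * pi - pi ^ 3" using pi_less_4 by (simp add: algebra_simps power3_eq_cube)
 then have "dn x * 24 <= dn x * (24 * pi - pi ^ 3)" by (rule mult_left_mono) simp
 then have "dn x <= sin y" using 2 by (simp add: algebra_simps)
 then show ?thesis by (simp add: norm_ee_minus_1_dn y_def)
qed

text \<open>Multiplying by e(\<theta>) - 1 telescopes the sum to two unimodular terms, and
  \<open>ee_far\<close> bounds the multiplier from below. The product form remains meaningful when
  \<theta> is an integer.\<close>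

lemma geometric_bound: "norm (\<Sum>t\<in>{a..<b::int}. ee (\<theta> * of_int t + c)) * dn \<theta> <= 1"
proof (cases "a <= b")
 case True
 let ?S = "\<Sum>t\<in>{a..<b}. ee (\<theta> * of_int t + c)"
 have "(ee \<theta> - 1) * ?S = (\<Sum>t\<in>{a..<b}. ee (\<theta> * of_int (t + 1) + c) - ee (\<theta> * of_int t + c))"
  by (simp add: sum_distrib_left sum_subtractf algebra_simps flip: ee_add)
 also have "... = ee (\<theta> * of_int b + c) - ee (\<theta> * of_int a + c)"
  using True
 proof (induction "nat (b - a)" arbitrary: b)
  case 0 then show ?case by simp
 next
  case (Suc n)
  have b: "{a..<b} = insert (b - 1) {a..<b - 1}" using Suc by auto
  have IH: "(\<Sum>t\<in>{a..<b-1}. ee (\<theta> * of_int (t + 1) + c) - ee (\<theta> * of_int t + c))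
   = ee (\<theta> * of_int (b - 1) + c) - ee (\<theta> * of_int a + c)" using Suc by (intro Suc(1)) auto
  have "(\<Sum>t\<in>{a..<b}. ee (\<theta> * of_int (t + 1) + c) - ee (\<theta> * of_int t + c)) =
   (ee (\<theta> * of_int (b - 1 + 1) + c) - ee (\<theta> * of_int (b - 1) + c)) +
   (\<Sum>t\<in>{a..<b-1}. ee (\<theta> * of_int (t + 1) + c) - ee (\<theta> * of_int t + c))"
   unfolding b by (subst sum.insert) (auto simp del: of_int_add of_int_diff)
  then show ?case by (simp only: IH) simp
 qed
 finally have "norm (ee \<theta> - 1) * norm ?S <= 1 + 1"
  by (metis norm_ee norm_mult norm_triangle_ineq4)
 moreover have "2 * dn \<theta> * norm ?S <= norm (ee \<theta> - 1) * norm ?S"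
  by (intro mult_right_mono ee_far) auto
 ultimately show ?thesis by (simp add: mult.commute)
qed simp

section \<open>Diophantine approximation: recurrent linear phases and quadratic Weyl sums\<close>

lemma card_int_interval: "finite A ==> (!!x. x \<in> A ==> a <= of_int x \<and> of_int x <= b) ==> A ~= {} ==> real (card A) <= b - a + 1" for a b :: real
proof -
 assume A: "finite A" "!!x. x \<in> A ==> a <= of_int x \<and> of_int x <= b" "A ~= {}"
 have m: "Min A \<in> A" "Max A \<in> A" using A by auto
 have "A \<subseteq> {Min A..Max A}" using A by auto
 then have "card A <= card {Min A..Max A}" by (intro card_mono) auto
 moreover have "Min A <= Max A" using A by auto
 ultimately have "real (card A) <= of_int (Max A) - of_int (Min A) + 1" by auto
 moreover have "of_int (Max A) <= b" "a <= of_int (Min A)" using A(2)[OF m(1)] A(2)[OF m(2)] by auto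
 ultimately show ?thesis by linarith
qed

text \<open>The integers nearest to g + j s lie in an interval of length n |s| + 2 \<tau>, and the j
  that share one nearest integer lie in an interval of length 2 \<tau> / |s|; the bound is the
  product of the two counts.\<close>

lemma card_near_int:
 fixes s g \<tau> :: real
 assumes s: "s ~= 0" and J: "finite J" "!!j. j \<in> J ==> 0 <= j \<and> real_of_int j <= n" and n: "0 <= n" "0 <= \<tau>"
  and near: "!!j. j \<in> J ==> dn (g + of_int j * s) <= \<tau>"
 shows "real (card J) <= (n * \<bar>s\<bar> + 2 * \<tau> + 1) * (2 * \<tau> / \<bar>s\<bar> + 1)"
proof (cases "J = {}")
 case True
 then show ?thesis using n by simp
next
 case False
 define z where "z j = round (g + of_int j * s)" for j
 have zj: "\<bar>g + of_int j * s - of_int (z j)\<bar> <= \<tau>" if "j \<in> J" for j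
  using near[OF that] unfolding dn_def z_def by simp
 have fib: "real (card {j\<in>J. z j = y}) <= 2 * \<tau> / \<bar>s\<bar> + 1" for y
 proof (cases "{j\<in>J. z j = y} = {}")
  case True
  have "card {j\<in>J. z j = y} = 0" using True by (metis card.empty)
  then show ?thesis using n by simp
 next
  case False
  define a where "a = (of_int y - g) / s"
  have *: "\<bar>of_int j - a\<bar> <= \<tau> / \<bar>s\<bar>" if "j \<in> J" "z j = y" for j
  proof -
   have "\<bar>of_int j - a\<bar> * \<bar>s\<bar> = \<bar>(of_int j - a) * s\<bar>" by (simp add: abs_mult)
   also have "(of_int j - a) * s = g + of_int j * s - of_int (z j)" using s that by (simp add: a_def field_simps)
   finally show ?thesis using zj[OF that(1)] s by (simp add: field_simps)
  qed
  have "real (card {j\<in>J. z j = y}) <= (a + \<tau> / \<bar>s\<bar>) - (a - \<tau> / \<bar>s\<bar>) + 1"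
  proof (rule card_int_interval)
   fix x assume "x \<in> {j\<in>J. z j = y}"
   then show "a - \<tau> / \<bar>s\<bar> <= of_int x \<and> of_int x <= a + \<tau> / \<bar>s\<bar>" using *[of x] by (auto simp: abs_le_iff)
  qed (use J False in auto)
  then show ?thesis by simp
 qed
 have im: "real (card (z ` J)) <= n * \<bar>s\<bar> + 2 * \<tau> + 1"
 proof -
  define lo where "lo = (if s > 0 then g - \<tau> else g + n * s - \<tau>)"
  define hi where "hi = (if s > 0 then g + n * s + \<tau> else g + \<tau>)"
  have "real (card (z ` J)) <= hi - lo + 1"
  proof (rule card_int_interval)
   fix x assume "x \<in> z ` J"
   then obtain j where j: "j \<in> J" "x = z j" by auto
   have "0 <= real_of_int j" "real_of_int j <= n" using J(2)[OF j(1)] by auto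
   then have A: "s > 0 ==> 0 <= of_int j * s \<and> of_int j * s <= n * s"
    and B: "\<not> s > 0 ==> n * s <= of_int j * s \<and> of_int j * s <= 0"
    using s by (auto simp: mult_right_mono_neg mult_nonneg_nonpos)
   show "lo <= of_int x \<and> of_int x <= hi"
   proof (cases "s > 0")
    case True
    show ?thesis using zj[OF j(1)] A[OF True] unfolding lo_def hi_def if_P[OF True] j(2) by linarith
   next
    case False
    show ?thesis using zj[OF j(1)] B[OF False] unfolding lo_def hi_def if_not_P[OF False] j(2) by linarith
   qed
  qed (use J False in auto)
  then show ?thesis unfolding lo_def hi_def using s by (auto split: if_splits)
 qed
 have "card J = (\<Sum>y\<in>z ` J. card {j\<in>J. z j = y})"
  by (subst card_UN_disjoint[symmetric]) (use J in "auto intro!: arg_cong[where f = card]")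
 then have "real (card J) = (\<Sum>y\<in>z ` J. real (card {j\<in>J. z j = y}))" by simp
 also have "... <= (\<Sum>y\<in>z ` J. 2 * \<tau> / \<bar>s\<bar> + 1)" by (intro sum_mono fib)
 also have "... = real (card (z ` J)) * (2 * \<tau> / \<bar>s\<bar> + 1)" by simp
 also have "... <= (n * \<bar>s\<bar> + 2 * \<tau> + 1) * (2 * \<tau> / \<bar>s\<bar> + 1)"
  using im n by (intro mult_right_mono) auto
 finally show ?thesis .
qed

lemma dirichlet_dn:
 assumes R: "R > 0" shows "\<exists>r::nat. 1 <= r \<and> r <= R \<and> dn (real r * \<theta>) <= 1 / real R"
proof -
 define f where "f k = nat \<lfloor>real R * frac (real k * \<theta>)\<rfloor>" for k
 have fl: "0 <= real R * frac (real k * \<theta>)" "real R * frac (real k * \<theta>) < real R" for k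
  using R frac_lt_1[of "real k * \<theta>"] by auto
 have "f k < R" for k using fl[of k] unfolding f_def by linarith
 then have "f ` {0..R} \<subseteq> {0..<R}" by auto
 then have "card (f ` {0..R}) <= card {0..<R}" by (intro card_mono) auto
 then have "\<not> inj_on f {0..R}" using card_image[of f "{0..R}"] by auto
 then obtain k l where kl: "k <= R" "l <= R" "k < l" "f k = f l"
  unfolding inj_on_def by (metis atLeastAtMost_iff linorder_neqE_nat)
 have "\<bar>real R * frac (real l * \<theta>) - real R * frac (real k * \<theta>)\<bar> <= 1"
  using kl(4) fl[of k] fl[of l] unfolding f_def by linarith
 then have "real R * \<bar>frac (real l * \<theta>) - frac (real k * \<theta>)\<bar> <= 1"
  by (simp add: abs_mult flip: right_diff_distrib)
 then have 1: "\<bar>frac (real l * \<theta>) - frac (real k * \<theta>)\<bar> <= 1 / real R" using R by (simp add: field_simps)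
 have "dn (real (l - k) * \<theta>) <= \<bar>real (l - k) * \<theta> - of_int (\<lfloor>real l * \<theta>\<rfloor> - \<lfloor>real k * \<theta>\<rfloor>)\<bar>" by (rule dn_le)
 also have "real (l - k) * \<theta> - of_int (\<lfloor>real l * \<theta>\<rfloor> - \<lfloor>real k * \<theta>\<rfloor>) = frac (real l * \<theta>) - frac (real k * \<theta>)"
  using kl by (simp add: frac_def of_nat_diff algebra_simps)
 finally show ?thesis using 1 kl by (intro exI[of _ "l - k"]) auto
qed

text \<open>Vinogradov's lemma. Dirichlet supplies r of size at most 9 / \<eta> such that r \<theta>
  is within |s| \<le> \<eta> / 8 of an integer. Along a residue class mod r the phases advance by s
  modulo 1, so \<open>card_near_int\<close> applies; if |s| were larger than claimed, the classes
  together would hold fewer than \<eta> N elements of \<open>G\<close>.\<close>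

lemma vinogradov:
 fixes \<theta> c \<tau> \<eta> :: real and a :: int and N :: nat
 assumes G: "G \<subseteq> {a..<a + int N}" "\<eta> * real N <= real (card G)" and eta: "0 < \<eta>" "\<eta> <= 1"
  and near: "!!k. k \<in> G ==> dn (of_int k * \<theta> + c) <= \<tau>" and tau: "0 <= \<tau>" "\<tau> <= \<eta> / 16" and N: "72 / \<eta>\<^sup>2 <= real N"
 shows "\<exists>r::nat. 1 <= r \<and> real r <= 9 / \<eta> \<and> dn (real r * \<theta>) <= 144 * \<tau> / (\<eta>\<^sup>2 * real N)"
proof -
 \<comment> \<open>This size makes the Dirichlet bound 1 / R at most \<eta> / 8, a fraction of the
   density.\<close>
 define R where "R = nat \<lceil>8 / \<eta>\<rceil>"
 have R: "8 / \<eta> <= real R" unfolding R_def by linarith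
 have "1 <= 1 / \<eta>" using eta by simp
 moreover have "real R <= 8 / \<eta> + 1" unfolding R_def using eta by (simp add: of_nat_ceiling)
 moreover have "9 / \<eta> = 8 / \<eta> + 1 / \<eta>" by (simp add: add_divide_distrib[symmetric])
 ultimately have R9: "real R <= 9 / \<eta>" by linarith
 have R0: "R > 0" using R eta by (metis divide_pos_pos gr0I not_le of_nat_0 zero_less_numeral)
 obtain r where r: "1 <= r" "r <= R" "dn (real r * \<theta>) <= 1 / real R"
  using dirichlet_dn[OF R0, of \<theta>] by metis
 obtain z s where zs: "real r * \<theta> = of_int z + s" "\<bar>s\<bar> = dn (real r * \<theta>)" using dn_ex by blast
 have "dn (real r * \<theta>) <= 1 / real R" by (rule r(3))
 also have "... <= 1 / (8 / \<eta>)" using R R0 eta by (intro divide_left_mono) auto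
 finally have s8: "\<bar>s\<bar> <= \<eta> / 8" using zs by simp
 have rN: "real r <= 9 / \<eta>" using r R9 by linarith
 have rN2: "8 * real r <= \<eta> * real N"
 proof -
  have "8 * real r <= 72 / \<eta>" using rN by simp
  also have "... = \<eta> * (72 / \<eta>\<^sup>2)" using eta by (simp add: power2_eq_square)
  also have "... <= \<eta> * real N" using N eta by (intro mult_left_mono) auto
  finally show ?thesis .
 qed
 have "\<bar>s\<bar> <= 144 * \<tau> / (\<eta>\<^sup>2 * real N)"
 proof (cases "s = 0")
  case True then show ?thesis using tau by simp
 next
  case False
  define n where "n = real N / real r"
  have cls: "real (card {k\<in>G. k mod int r = \<rho>}) <= (n * \<bar>s\<bar> + 2 * \<tau> + 1) * (2 * \<tau> / \<bar>s\<bar> + 1)"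
   if rho: "\<rho> \<in> {0..<int r}" for \<rho>
  proof -
   define Gr where "Gr = {k\<in>G. k mod int r = \<rho>}"
   \<comment> \<open>The first integer from a onwards in the class \<rho>, so that the index (k - b)
     div r is nonnegative on the class.\<close>
   define b where "b = a + (\<rho> - a) mod int r"
   have bm: "b mod int r = \<rho>" unfolding b_def using rho by (simp add: mod_simps)
   have b0: "a <= b" using r by (simp add: b_def)
   define f where "f k = (k - b) div int r" for k
   have fk: "k = b + int r * f k" "0 <= f k" "real_of_int (f k) <= n" if "k \<in> Gr" for k
   proof -
    have "(k - b) mod int r = 0" using that bm by (auto simp: Gr_def mod_eq_dvd_iff[symmetric] mod_eq_0_iff_dvd)
    then show e: "k = b + int r * f k" unfolding f_def by (metis add.commute diff_add_cancel add.right_neutral mult_div_mod_eq)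
    have kb: "a <= k" "k < a + int N" using that G by (auto simp: Gr_def)
    have "k \<ge> b"
    proof (rule ccontr)
     assume "\<not> k \<ge> b"
     then have "int r * f k < 0" using e by linarith
     then have "f k <= -1" using r(1) by (simp add: mult_less_0_iff)
     then have "int r * f k <= int r * (-1)" by (rule mult_left_mono) simp
     moreover have "b - a < int r" unfolding b_def using r by simp
     ultimately show False using e kb by linarith
    qed
    then have "0 <= int r * f k" using e by linarith
    then show "0 <= f k" using r by (simp add: zero_le_mult_iff)
    have "int r * f k <= int N" using e kb b0 by linarith
    then have "real r * real_of_int (f k) <= real N" by (metis of_int_le_iff of_int_mult of_int_of_nat_eq)
    then show "real_of_int (f k) <= n" using r(1) by (simp add: n_def field_simps)
   qed
   have inj: "inj_on f Gr" by (rule inj_onI) (metis fk(1))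
   have fin: "finite Gr" using G finite_subset[of G "{a..<a + int N}"] by (auto simp: Gr_def)
   have "real (card (f ` Gr)) <= (n * \<bar>s\<bar> + 2 * \<tau> + 1) * (2 * \<tau> / \<bar>s\<bar> + 1)"
   proof (rule card_near_int[where g = "of_int b * \<theta> + c"])
    fix j assume "j \<in> f ` Gr"
    then obtain k where k: "k \<in> Gr" "j = f k" by auto
    then show "0 <= j \<and> real_of_int j <= n" using fk by auto
    have "of_int k * \<theta> + c = (of_int b * \<theta> + c + of_int j * s) + of_int (j * z)"
    proof -
     have "real_of_int k = of_int b + real r * of_int j" using fk(1)[OF k(1)] k(2)
      by (metis of_int_add of_int_mult of_int_of_nat_eq)
     then have "of_int k * \<theta> = of_int b * \<theta> + of_int j * (real r * \<theta>)" by (simp add: algebra_simps)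
     also have "... = of_int b * \<theta> + of_int j * (of_int z + s)" by (simp only: zs(1))
     finally show ?thesis by (simp add: algebra_simps)
    qed
    then have "dn (of_int b * \<theta> + c + of_int j * s) = dn (of_int k * \<theta> + c)" by (metis dn_add_int)
    then show "dn (of_int b * \<theta> + c + of_int j * s) <= \<tau>" using near k by (auto simp: Gr_def)
   qed (use False fin tau in "auto simp: n_def")
   then show ?thesis using card_image[OF inj] by (simp add: Gr_def)
  qed
  have finG: "finite G" using G finite_subset by blast
  have "card G = (\<Sum>\<rho>\<in>{0..<int r}. card {k\<in>G. k mod int r = \<rho>})"
   by (subst card_UN_disjoint[symmetric]) (use finG r in "auto intro!: arg_cong[where f = card]")
  then have "real (card G) = (\<Sum>\<rho>\<in>{0..<int r}. real (card {k\<in>G. k mod int r = \<rho>}))" by simp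
  also have "... <= (\<Sum>\<rho>\<in>{0..<int r}. (n * \<bar>s\<bar> + 2 * \<tau> + 1) * (2 * \<tau> / \<bar>s\<bar> + 1))"
   by (intro sum_mono cls) auto
  also have "... = real r * ((n * \<bar>s\<bar> + 2 * \<tau> + 1) * (2 * \<tau> / \<bar>s\<bar> + 1))" by simp
  \<comment> \<open>Here r n = N. The terms proportional to N amount to at most \<eta> N / 4, and 2
    r to another \<eta> N / 4; only 4 r \<tau> / |s| can make up the rest.\<close>
  also have "... = real N * (2 * \<tau> + \<bar>s\<bar>) + real r * (2 * \<tau> + 1) * (2 * \<tau> / \<bar>s\<bar> + 1)"
   using False r by (simp add: n_def field_simps)
  also have "real r * (2 * \<tau> + 1) * (2 * \<tau> / \<bar>s\<bar> + 1) <= real r * 2 * (2 * \<tau> / \<bar>s\<bar> + 1)"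
   using tau eta by (intro mult_right_mono mult_left_mono) auto
  finally have "\<eta> * real N <= real N * (2 * \<tau> + \<bar>s\<bar>) + (4 * real r * \<tau> / \<bar>s\<bar> + 2 * real r)"
   using G by (simp add: algebra_simps)
  moreover have "real N * (2 * \<tau> + \<bar>s\<bar>) <= real N * (\<eta> / 4)" using tau s8 by (intro mult_left_mono) auto
  ultimately have "\<eta> * real N / 2 <= 4 * real r * \<tau> / \<bar>s\<bar>" using rN2 by (simp add: mult.commute)
  then have "\<bar>s\<bar> * (\<eta> * real N) <= 8 * real r * \<tau>" using False by (simp add: field_simps)
  also have "... <= 8 * (9 / \<eta>) * \<tau>" using rN tau by (intro mult_right_mono mult_left_mono) auto
  finally have "\<bar>s\<bar> * (\<eta>\<^sup>2 * real N) <= 72 * \<tau>" using eta by (simp add: field_simps power2_eq_square)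
  moreover have "0 < \<eta>\<^sup>2 * real N"
  proof -
   have "0 < 8 * real r" using r(1) by simp
   then have "0 < \<eta> * real N" using rN2 by linarith
   then show ?thesis using eta by (simp add: zero_less_mult_iff)
  qed
  ultimately show ?thesis using tau by (simp add: field_simps)
 qed
 then show ?thesis using r rN zs by auto
qed

lemma dn_of_sum:
 assumes "X <= norm (\<Sum>t\<in>{a..<b::int}. ee (\<theta> * of_int t + c))" "0 < X"
 shows "dn \<theta> <= 1 / X"
proof -
 have "X * dn \<theta> <= norm (\<Sum>t\<in>{a..<b}. ee (\<theta> * of_int t + c)) * dn \<theta>"
  using assms by (intro mult_right_mono) auto
 also have "... <= 1" by (rule geometric_bound)
 finally show ?thesis using assms by (simp add: field_simps)
qed

text \<open>Weyl differencing: the squared sum is a sum over h of linear exponential sums of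
  frequency 2 A h. Many h give a large sum, so 2 A h is near an integer for many h, and
  \<open>vinogradov\<close> in the variable h turns this into information on A. A range of n \<le> W
  points is measured against W because differenced ranges vary in length.\<close>

lemma weyl_quadratic_A:
 fixes A B \<eta> :: real and n W :: nat and a :: int
 assumes S: "\<eta> * real W <= norm (\<Sum>w\<in>{a..<a + int n}. ee (A * (of_int w)\<^sup>2 + B * of_int w))"
  and n: "n <= W" and eta: "0 < \<eta>" "\<eta> <= 1" and W: "1152 / \<eta> ^ 4 <= real W"
 shows "\<exists>r::nat. 1 <= r \<and> real r <= 72 / \<eta>\<^sup>2 \<and> dn (real r * A) <= 9216 / (\<eta> ^ 6 * (real W)\<^sup>2)"
proof -
 let ?I = "{a..<a + int n}"
 define f where "f w = ee (A * (of_int w)\<^sup>2 + B * of_int w)" for w :: int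
 define J where "J h = {max a (a - h)..<min (a + int n) (a + int n - h)}" for h :: int
 define T where "T h = (\<Sum>w\<in>J h. f (w + h) * cnj (f w))" for h
 have W0: "0 < real W" by (rule less_le_trans[OF _ W]) (use eta in simp)
 have W1: "W \<ge> 1" using W0 by simp
 have "(norm (sum f ?I))\<^sup>2 <= (\<Sum>h\<in>{-int W<..<int W}. norm (T h))"
 proof -
  have "complex_of_real ((norm (sum f ?I))\<^sup>2) = (\<Sum>w\<in>?I. \<Sum>v\<in>?I. f v * cnj (f w))"
   by (simp only: complex_norm_square cnj_sum sum_product) (rule sum.swap)
  also have "... = (\<Sum>w\<in>?I. \<Sum>h\<in>{h\<in>{-int W<..<int W}. w \<in> J h}. f (w + h) * cnj (f w))"
  proof (rule sum.cong[OF refl])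
   fix w assume w: "w \<in> ?I"
   show "(\<Sum>v\<in>?I. f v * cnj (f w)) = (\<Sum>h\<in>{h\<in>{-int W<..<int W}. w \<in> J h}. f (w + h) * cnj (f w))"
    by (rule sum.reindex_bij_witness[of _ "%h. w + h" "%v. v - w"])
      (use w n in "auto simp: J_def")
  qed
  also have "... = (\<Sum>h\<in>{-int W<..<int W}. \<Sum>w\<in>{w\<in>?I. w \<in> J h}. f (w + h) * cnj (f w))"
   by (rule sum.swap_restrict) auto
  also have "... = (\<Sum>h\<in>{-int W<..<int W}. T h)"
   unfolding T_def by (intro sum.cong) (auto simp: J_def)
  finally have "(norm (sum f ?I))\<^sup>2 = norm (\<Sum>h\<in>{-int W<..<int W}. T h)"
   by (metis abs_power2 norm_of_real)
  then show ?thesis by (simp add: norm_sum)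
 qed
 moreover have "(\<eta> * real W)\<^sup>2 <= (norm (sum f ?I))\<^sup>2"
  using S eta W0 by (intro power_mono) (auto simp: f_def)
 ultimately have sumT: "(\<eta> * real W)\<^sup>2 <= (\<Sum>h\<in>{-int W<..<int W}. norm (T h))" by linarith
 \<comment> \<open>With this threshold the shifts outside \<open>G\<close> contribute at most half
   of the lower bound (\<eta> W)^2.\<close>
 define G where "G = {h\<in>{-int W<..<int W}. \<eta>\<^sup>2 * real W / 4 <= norm (T h)}"
 have Tle: "norm (T h) <= real W" for h
 proof -
  have "norm (T h) <= (\<Sum>w\<in>J h. 1)" unfolding T_def by (rule order_trans[OF norm_sum]) (auto simp: f_def norm_mult)
  also have "... <= real n" by (auto simp: J_def)
  finally show ?thesis using n by simp
 qed
 have "(\<Sum>h\<in>{-int W<..<int W}. norm (T h)) <= (\<Sum>h\<in>{-int W<..<int W}. real W * of_bool (h \<in> G) + \<eta>\<^sup>2 * real W / 4)"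
  by (rule sum_mono) (use Tle in "auto simp: G_def of_bool_def intro!: add_increasing2")
 also have "... = real W * real (card G) + real (2 * W - 1) * (\<eta>\<^sup>2 * real W / 4)"
 proof -
  have c: "nat (2 * int W - 1) = 2 * W - Suc 0" using W1 by linarith
  have "{-int W<..<int W} \<inter> {h. h \<in> G} = G" by (auto simp: G_def)
  then show ?thesis unfolding sum.distrib sum_distrib_left[symmetric]
   by (simp add: c of_bool_def sum.If_cases)
 qed
 also have "... <= real W * real (card G) + (2 * real W) * (\<eta>\<^sup>2 * real W / 4)"
  using W1 by (intro add_left_mono mult_right_mono) auto
 finally have "(\<eta> * real W)\<^sup>2 <= real W * real (card G) + (2 * real W) * (\<eta>\<^sup>2 * real W / 4)"
  using sumT by linarith
 then have "real W * (\<eta>\<^sup>2 * real W / 2) <= real W * real (card G)" by (simp add: power2_eq_square algebra_simps)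
 then have cG: "\<eta>\<^sup>2 * real W / 2 <= real (card G)" using W0 by (simp only: mult_le_cancel_left_pos)
 define N where "N = 2 * W - 1"
 have N: "real W <= real N" "real N <= 2 * real W" using W1 by (auto simp: N_def)
 have e4: "(\<eta>\<^sup>2 / 4)\<^sup>2 = \<eta> ^ 4 / 16" by (simp add: power2_eq_square eval_nat_numeral)
 have e41: "\<eta> ^ 4 <= 1" using eta by (simp add: power_le_one)
 have "\<exists>r::nat. 1 <= r \<and> real r <= 9 / (\<eta>\<^sup>2 / 4) \<and> dn (real r * (2 * A)) <= 144 * (4 / (\<eta>\<^sup>2 * real W)) / ((\<eta>\<^sup>2 / 4)\<^sup>2 * real N)"
 proof (rule vinogradov[where G = G and a = "- int W + 1" and c = 0])
  show "G \<subseteq> {- int W + 1..<- int W + 1 + int N}" using W1 by (auto simp: G_def N_def)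
  show "\<eta>\<^sup>2 / 4 * real N <= real (card G)"
  proof -
   have "\<eta>\<^sup>2 / 4 * real N <= \<eta>\<^sup>2 / 4 * (2 * real W)" using N by (intro mult_left_mono) auto
   also have "... = \<eta>\<^sup>2 * real W / 2" by simp
   finally show ?thesis using cG by linarith
  qed
  show "0 < \<eta>\<^sup>2 / 4" using eta by simp
  show "\<eta>\<^sup>2 / 4 <= 1" using power_le_one[of \<eta> 2] eta by simp
  show "0 <= 4 / (\<eta>\<^sup>2 * real W)" by simp
  have W4: "1152 <= \<eta> ^ 4 * real W" using W eta by (simp add: field_simps)
  show "4 / (\<eta>\<^sup>2 * real W) <= \<eta>\<^sup>2 / 4 / 16"
  proof -
   have "256 <= \<eta>\<^sup>2 * (\<eta>\<^sup>2 * real W)" using W4 by (simp add: power2_eq_square eval_nat_numeral mult.assoc)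
   then show ?thesis using eta W0 by (simp add: field_simps)
  qed
  show "72 / (\<eta>\<^sup>2 / 4)\<^sup>2 <= real N" unfolding e4 using W N eta by simp
  fix h assume h: "h \<in> G"
  have "T h = (\<Sum>w\<in>J h. ee (2 * A * of_int h * of_int w + (A * (of_int h)\<^sup>2 + B * of_int h)))"
   unfolding T_def f_def
   by (rule sum.cong[OF refl], simp only: cnj_ee flip: ee_add) (rule arg_cong[where f = ee], simp add: algebra_simps power2_eq_square)
  then have "dn (2 * A * of_int h) <= 1 / (\<eta>\<^sup>2 * real W / 4)"
   unfolding J_def using h eta W0 by (intro dn_of_sum) (auto simp: G_def J_def)
  then show "dn (of_int h * (2 * A) + 0) <= 4 / (\<eta>\<^sup>2 * real W)" by (simp add: mult_ac)
 qed
 then obtain r :: nat where r: "1 <= r" "real r <= 9 / (\<eta>\<^sup>2 / 4)"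
  "dn (real r * (2 * A)) <= 144 * (4 / (\<eta>\<^sup>2 * real W)) / ((\<eta>\<^sup>2 / 4)\<^sup>2 * real N)" by blast
 have "144 * (4 / (\<eta>\<^sup>2 * real W)) / ((\<eta>\<^sup>2 / 4)\<^sup>2 * real N) = 9216 / (\<eta> ^ 6 * (real W * real N))"
  unfolding e4 by (simp add: eval_nat_numeral field_simps)
 also have "... <= 9216 / (\<eta> ^ 6 * (real W * real W))"
  using N eta W0 by (intro divide_left_mono mult_left_mono mult_pos_pos) auto
 finally have "dn (real r * (2 * A)) <= 9216 / (\<eta> ^ 6 * (real W)\<^sup>2)" using r by (simp add: power2_eq_square)
 \<comment> \<open>Doubling r absorbs the 2 of the frequency 2 A; hence 72 rather than 36.\<close>
 then show ?thesis using r by (intro exI[of _ "2 * r"]) (auto simp: mult_ac)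
qed

lemma nat_floor_half: "2 <= y ==> y / 2 <= real (nat \<lfloor>y\<rfloor>)"
 by linarith

text \<open>Once A is controlled, the quadratic part is almost constant along progressions of step r
  and length \<open>W'\<close>, so some short progression carries a large linear exponential sum of
  frequency r B. One and the same r serves both coefficients, on which the elimination in
  \<open>phase_major\<close> relies.\<close>

lemma weyl_quadratic:
 fixes A B \<eta> :: real and n W :: nat and a :: int
 assumes S: "\<eta> * real W <= norm (\<Sum>w\<in>{a..<a + int n}. ee (A * (of_int w)\<^sup>2 + B * of_int w))"
  and n: "n <= W" and a: "\<bar>a\<bar> <= int W" and eta: "0 < \<eta>" "\<eta> <= 1" and W: "2 ^ 22 / \<eta> ^ 7 <= real W"
 shows "\<exists>r::nat. 1 <= r \<and> real r <= 72 / \<eta>\<^sup>2 \<and> dn (real r * A) <= 9216 / (\<eta> ^ 6 * (real W)\<^sup>2)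
  \<and> dn (real r * B) <= 2 ^ 24 / (\<eta> ^ 8 * real W)"
proof -
 let ?I = "{a..<a + int n}"
 define f where "f w = ee (A * (of_int w)\<^sup>2 + B * of_int w)" for w :: int
 have W0: "0 < real W" by (rule less_le_trans[OF _ W]) (use eta in simp)
 have "1152 / \<eta> ^ 4 <= 2 ^ 22 / \<eta> ^ 7"
 proof -
  have "\<eta> ^ 7 <= \<eta> ^ 4" using eta by (intro power_decreasing) auto
  then have "1152 / \<eta> ^ 4 <= 1152 / \<eta> ^ 7" using eta by (intro divide_left_mono) auto
  also have "... <= 2 ^ 22 / \<eta> ^ 7" using eta by (intro divide_right_mono) auto
  finally show ?thesis .
 qed
 from weyl_quadratic_A[OF S n eta order_trans[OF this W]]
 obtain r :: nat where r: "1 <= r" "real r <= 72 / \<eta>\<^sup>2" "dn (real r * A) <= 9216 / (\<eta> ^ 6 * (real W)\<^sup>2)"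
  by blast
 define \<rho> where "\<rho> = 9216 / (\<eta> ^ 6 * (real W)\<^sup>2)"
 have rho0: "0 <= \<rho>" by (simp add: \<rho>_def)
 \<comment> \<open>The length \<eta>^7 W / 2^21 keeps the phase error X below a small multiple of
   \<eta>; rounding down costs at most a factor 2.\<close>
 define W' where "W' = nat \<lfloor>\<eta> ^ 7 * real W / 2 ^ 21\<rfloor>"
 have x1: "2 <= \<eta> ^ 7 * real W / 2 ^ 21" using W eta by (simp add: field_simps)
 have W'u: "real W' <= \<eta> ^ 7 * real W / 2 ^ 21" unfolding W'_def using x1 by linarith
 have "\<eta> ^ 7 * real W / 2 ^ 22 = (\<eta> ^ 7 * real W / 2 ^ 21) / 2" by simp
 also have "... <= real W'" unfolding W'_def using x1 by (rule nat_floor_half)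
 finally have W'l: "\<eta> ^ 7 * real W / 2 ^ 22 <= real W'" .
 have W'1: "1 <= real W'" unfolding W'_def using x1 by linarith
 have e76: "\<eta> ^ 7 = \<eta> ^ 6 * \<eta>" "\<eta> ^ 7 = \<eta>\<^sup>2 * \<eta> ^ 5" by (simp_all flip: power_add power_Suc2)
 have e51: "\<eta> ^ 5 <= \<eta>" using power_decreasing[of 1 5 \<eta>] eta by simp
 have rW: "real r * real W' <= \<eta> * real W / 8"
 proof -
  have "real r * real W' <= (72 / \<eta>\<^sup>2) * (\<eta> ^ 7 * real W / 2 ^ 21)" using r W'u by (intro mult_mono) auto
  also have "... = 72 / 2 ^ 21 * ((\<eta> ^ 7 / \<eta>\<^sup>2) * real W)" by simp
  also have "\<eta> ^ 7 / \<eta>\<^sup>2 = \<eta> ^ 5" using power_diff[of \<eta> 2 7] eta by simp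
  also have "72 / 2 ^ 21 * (\<eta> ^ 5 * real W) <= 72 / 2 ^ 21 * (\<eta> * real W)" using e51 by (intro mult_left_mono mult_right_mono) auto
  also have "... <= 1/8 * (\<eta> * real W)" using eta by (intro mult_right_mono) auto
  finally show ?thesis by simp
 qed
 have nrm: "norm (f w) <= 1" for w by (simp add: f_def)
 let ?V = "{0..<int W'}"
 have Vne: "finite ?V" "?V ~= {}" using W'1 by auto
 define D where "D v = (\<Sum>w\<in>?I. f (w + int r * v))" for v
 have "norm (av ?V D - sum f ?I) <= \<eta> * real W / 4"
 proof -
  have "av ?V D - sum f ?I = av ?V (%v. D v - sum f ?I)" unfolding av_diff by (simp add: av_const[OF Vne])
  also have "norm ... <= \<eta> * real W / 4"
  proof (rule norm_av_bound)
   fix v assume v: "v \<in> ?V"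
   have "norm (D v - sum f ?I) <= 2 * \<bar>real_of_int (int r * v)\<bar>"
    unfolding D_def by (rule sum_interval_shift_bound[OF nrm])
   also have "... <= 2 * (real r * real W')" using v by (auto simp: abs_mult intro!: mult_left_mono)
   also have "... <= \<eta> * real W / 4" using rW by simp
   finally show "norm (D v - sum f ?I) <= \<eta> * real W / 4" .
  qed (use eta in simp)
  finally show ?thesis .
 qed
 moreover have "av ?V D = (\<Sum>w\<in>?I. av ?V (%v. f (w + int r * v)))"
  unfolding D_def av_def scaleR_sum_right by (rule sum.swap)
 moreover have "\<eta> * real W <= norm (sum f ?I)" using S by (simp add: f_def)
 ultimately have big: "3/4 * (\<eta> * real W) <= norm (\<Sum>w\<in>?I. av ?V (%v. f (w + int r * v)))"
  using norm_triangle_ineq3[of "av ?V D" "sum f ?I"] by simp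
 have "\<exists>w\<in>?I. 3/4 * \<eta> <= norm (av ?V (%v. f (w + int r * v)))"
 proof (rule ccontr)
  assume "\<not> ?thesis"
  then have lt: "norm (av ?V (%v. f (w + int r * v))) < 3/4 * \<eta>" if "w \<in> ?I" for w using that by force
  have "?I ~= {}"
  proof
   assume "?I = {}"
   then have "3/4 * (\<eta> * real W) <= 0" using big by simp
   then show False using mult_pos_pos[OF eta(1) W0] by simp
  qed
  then have "(\<Sum>w\<in>?I. norm (av ?V (%v. f (w + int r * v)))) < (\<Sum>w\<in>?I. 3/4 * \<eta>)"
   by (intro sum_strict_mono lt) auto
  also have "... = real n * (3/4 * \<eta>)" by simp
  also have "... <= real W * (3/4 * \<eta>)" using n eta by (intro mult_right_mono) auto
  finally show False using big norm_sum[of "%w. av ?V (%v. f (w + int r * v))" ?I] by (simp add: mult_ac)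
 qed
 then obtain w where w: "w \<in> ?I" "3/4 * \<eta> <= norm (av ?V (%v. f (w + int r * v)))" by blast
 have "\<bar>w\<bar> <= 2 * int W" using w(1) a n by auto
 then have w2: "\<bar>real_of_int w\<bar> <= 2 * real W" by linarith
 have close: "norm (f (w + int r * v) - f w * ee (real r * B * of_int v)) <= \<eta> / 2" if v: "v \<in> ?V" for v
 proof -
  have v': "0 <= v" "real_of_int v <= real W'" using v by auto
  \<comment> \<open>The deviation of the phase at w + r v from its linear approximation; both terms
    are integer multiples of r A, which is within \<rho> of an integer.\<close>
  define X where "X = of_int (2 * w * v) * (real r * A) + of_int (int r * v * v) * (real r * A)"
  have eq: "A * (of_int (w + int r * v))\<^sup>2 + B * of_int (w + int r * v) - ((A * (of_int w)\<^sup>2 + B * of_int w) + real r * B * of_int v) = X"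
   by (simp add: X_def power2_eq_square algebra_simps)
  have "dn X <= \<bar>real_of_int (2 * w * v)\<bar> * dn (real r * A) + \<bar>real_of_int (int r * v * v)\<bar> * dn (real r * A)"
   unfolding X_def by (rule order_trans[OF dn_add]) (intro add_mono dn_mult)
  also have "... <= (2 * (2 * real W) * real W') * \<rho> + (real r * real W' * real W') * \<rho>"
  proof -
   have "\<bar>real_of_int w\<bar> * real_of_int v <= (2 * real W) * real W'" using w2 v' by (intro mult_mono) auto
   then have 1: "\<bar>real_of_int (2 * w * v)\<bar> <= 2 * (2 * real W) * real W'" using v' by (simp add: abs_mult mult_ac)
   have "real_of_int v * real_of_int v <= real W' * real W'" using v' by (intro mult_mono) auto
   then have "real r * (real_of_int v * real_of_int v) <= real r * (real W' * real W')" by (rule mult_left_mono) simp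
   then have 2: "\<bar>real_of_int (int r * v * v)\<bar> <= real r * real W' * real W'" using v' by (simp add: abs_mult mult.assoc)
   have 3: "dn (real r * A) <= \<rho>" using r(3) by (simp add: \<rho>_def)
   show ?thesis by (intro add_mono mult_mono 1 2 3) simp_all
  qed
  also have "... <= (2 * (2 * real W) * real W') * \<rho> + (real W * real W') * \<rho>"
  proof -
   have "real r * real W' <= real W" using rW mult_right_mono[OF eta(2), of "real W"] eta W0 by linarith
   then show ?thesis using rho0 by (intro add_left_mono mult_right_mono) auto
  qed
  also have "... = 5 * real W * real W' * \<rho>" by simp
  also have "... <= 5 * real W * (\<eta> ^ 7 * real W / 2 ^ 21) * \<rho>" using W'u rho0 by (intro mult_right_mono mult_left_mono) auto
  also have "... = 5 * 9216 / 2 ^ 21 * \<eta>" unfolding \<rho>_def e76(1) using eta W0 by (simp add: power2_eq_square)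
  finally have dX: "dn X <= 5 * 9216 / 2 ^ 21 * \<eta>" .
  have "norm (f (w + int r * v) - f w * ee (real r * B * of_int v)) =
   norm (ee (A * (of_int (w + int r * v))\<^sup>2 + B * of_int (w + int r * v)) - ee ((A * (of_int w)\<^sup>2 + B * of_int w) + real r * B * of_int v))"
   unfolding f_def ee_add[of "A * (of_int w)\<^sup>2 + B * of_int w"] ..
  also have "... <= 2 * pi * dn X" using ee_near eq by metis
  also have "... <= 2 * 4 * (5 * 9216 / 2 ^ 21 * \<eta>)" using pi_less_4 dX by (intro mult_mono) auto
  also have "... <= \<eta> / 2" using eta by simp
  finally show ?thesis .
 qed
 have "norm (av ?V (%v. f (w + int r * v)) - av ?V (%v. f w * ee (real r * B * of_int v))) <= \<eta> / 2"
  unfolding av_diff[symmetric] by (rule norm_av_bound) (use close eta in auto)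
 moreover have "norm (av ?V (%v. f w * ee (real r * B * of_int v))) = norm (av ?V (%v. ee (real r * B * of_int v)))"
  unfolding av_mult_left by (simp add: norm_mult f_def)
 ultimately have "\<eta> / 4 <= norm (av ?V (%v. ee (real r * B * of_int v)))"
  using w(2) norm_triangle_ineq2[of "av ?V (%v. f (w + int r * v))" "av ?V (%v. f w * ee (real r * B * of_int v))"] by linarith
 then have "\<eta> / 4 * real W' <= norm (\<Sum>v\<in>?V. ee (real r * B * of_int v + 0))"
  using W'1 by (simp add: av_def field_simps)
 then have "dn (real r * B) <= 1 / (\<eta> / 4 * real W')" by (rule dn_of_sum) (use eta W'1 in auto)
 also have "... <= 1 / (\<eta> / 4 * (\<eta> ^ 7 * real W / 2 ^ 22))"
  using W'l W'1 eta W0 by (intro divide_left_mono mult_left_mono mult_pos_pos) auto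
 also have "\<eta> / 4 * (\<eta> ^ 7 * real W / 2 ^ 22) = \<eta> ^ 8 * real W / 2 ^ 24"
  using power_Suc[of \<eta> 7] by simp
 also have "1 / (\<eta> ^ 8 * real W / 2 ^ 24) = 2 ^ 24 / (\<eta> ^ 8 * real W)" by simp
 finally show ?thesis using r by blast
qed

section \<open>Fourier analysis on the integers mod P\<close>

lemma av_sum: "av S (%x. \<Sum>k\<in>A. f x k) = (\<Sum>k\<in>A. av S (%x. f x k))"
 unfolding av_def scaleR_sum_right by (rule sum.swap)

lemma av_ee_orth:
 assumes P: "P > 0"
 shows "av (zp P) (%x. ee (of_int (j * x) / real P)) = of_bool (int P dvd j)"
proof (cases "int P dvd j")
 case True
 then obtain k where k: "j = int P * k" by auto
 have "ee (of_int (j * x) / real P) = 1" for x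
 proof -
  have "of_int (j * x) / real P = of_int (k * x)" using P by (simp add: k)
  then show ?thesis by (simp only: ee_of_int)
 qed
 then show ?thesis using True P by (simp add: av_const)
next
 case False
 define S where "S = av (zp P) (%x. ee (of_int (j * x) / real P))"
 have pr: "per P (%x. ee (of_int (j * x) / real P))"
  unfolding per_def
 proof
  fix x
  have "of_int (j * (x + int P)) / real P = of_int (j * x) / real P + of_int j"
   using P by (simp add: field_simps)
  then show "ee (of_int (j * (x + int P)) / real P) = ee (of_int (j * x) / real P)" by (simp only: ee_add_int)
 qed
 have "av (zp P) (%x. ee (of_int (j * (x + 1)) / real P)) = S"
  using av_shift[OF P pr, of 1] by (simp add: S_def)
 moreover have "av (zp P) (%x. ee (of_int (j * (x + 1)) / real P)) = ee (of_int j / real P) * S"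
  unfolding S_def av_mult_left[symmetric] by (intro av_cong) (auto simp: field_simps simp flip: ee_add)
 ultimately have "(ee (of_int j / real P) - 1) * S = 0" by (simp add: algebra_simps)
 moreover have "ee (of_int j / real P) ~= 1"
 proof
  assume "ee (of_int j / real P) = 1"
  then have "2 * dn (of_int j / real P) <= 0" using ee_far[of "of_int j / real P"] by simp
  then have "dn (of_int j / real P) = 0" using dn_nonneg[of "of_int j / real P"] by linarith
  then have "of_int j / real P = of_int (round (of_int j / real P))" by (simp add: dn_def)
  then have "real_of_int j = of_int (int P * round (of_int j / real P))" using P by (simp add: field_simps)
  then have "j = int P * round (of_int j / real P)" by (simp only: of_int_eq_iff)
  then show False using False by (metis dvd_triv_left)
 qed
 ultimately have "S = 0" by simp
 then show ?thesis using False by (simp add: S_def)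
qed

definition fc :: "nat => (int => complex) => int => complex" where
 "fc P G k = av (zp P) (%x. G x * ee (- (of_int (k * x) / real P)))"

lemma fc_inversion:
 assumes P: "P > 0" and G: "per P G"
 shows "(\<Sum>k\<in>zp P. fc P G k * ee (of_int (k * x) / real P)) = G x"
proof -
 have "(\<Sum>k\<in>zp P. fc P G k * ee (of_int (k * x) / real P)) =
  real P *\<^sub>R av (zp P) (%k. fc P G k * ee (of_int (k * x) / real P))"
  using P by (simp add: av_def)
 also have "av (zp P) (%k. fc P G k * ee (of_int (k * x) / real P)) =
  av (zp P) (%y. G y * av (zp P) (%k. ee (of_int ((x - y) * k) / real P)))"
  unfolding fc_def av_mult_right[symmetric] av_mult_left[symmetric]
  by (subst av_swap) (intro av_cong refl, simp add: mult.assoc diff_divide_distrib algebra_simps flip: ee_add)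
 also have "... = av (zp P) (%y. G y * of_bool (int P dvd (x - y)))"
  by (simp only: av_ee_orth[OF P])
 also have "... = (1 / real P) *\<^sub>R (\<Sum>y\<in>zp P. if y = x mod int P then G y else 0)"
 proof -
  have "G y * of_bool (int P dvd (x - y)) = (if y = x mod int P then G y else 0)" if "y \<in> zp P" for y
  proof -
   have "int P dvd (x - y) \<longleftrightarrow> x mod int P = y mod int P" by (simp add: mod_eq_dvd_iff)
   also have "y mod int P = y" using that by simp
   finally show ?thesis by auto
  qed
  then have "(\<Sum>y\<in>zp P. G y * of_bool (int P dvd (x - y))) = (\<Sum>y\<in>zp P. if y = x mod int P then G y else 0)"
   by (rule sum.cong[OF refl])
  then show ?thesis unfolding av_def by simp
 qed
 also have "... = (1 / real P) *\<^sub>R G x"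
  using P per_mod[OF G, of x] by (simp add: sum.delta')
 finally show ?thesis using P by simp
qed

lemma parseval_sum:
 assumes P: "P > 0"
 shows "av (zp P) (%x. (norm (\<Sum>k\<in>zp P. c k * ee (of_int (k * x) / real P)))\<^sup>2) = (\<Sum>k\<in>zp P. (norm (c k))\<^sup>2)"
proof -
 let ?f = "%x. \<Sum>k\<in>zp P. c k * ee (of_int (k * x) / real P)"
 have "complex_of_real (av (zp P) (%x. (norm (?f x))\<^sup>2)) = av (zp P) (%x. \<Sum>k\<in>zp P. \<Sum>l\<in>zp P. c k * cnj (c l) * ee (of_int ((k - l) * x) / real P))"
  unfolding of_real_av
 proof (intro av_cong refl)
  fix x
  have "complex_of_real ((norm (?f x))\<^sup>2) = (\<Sum>k\<in>zp P. \<Sum>l\<in>zp P. (c k * ee (of_int (k * x) / real P)) * cnj (c l * ee (of_int (l * x) / real P)))"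
   by (simp only: complex_norm_square cnj_sum sum_product)
  also have "... = (\<Sum>k\<in>zp P. \<Sum>l\<in>zp P. c k * cnj (c l) * ee (of_int ((k - l) * x) / real P))"
  proof (intro sum.cong refl)
   fix k l
   have "ee (of_int ((k - l) * x) / real P) = ee (of_int (k * x) / real P) * cnj (ee (of_int (l * x) / real P))"
    unfolding ee_diff[symmetric] by (simp add: left_diff_distrib diff_divide_distrib)
   then show "(c k * ee (of_int (k * x) / real P)) * cnj (c l * ee (of_int (l * x) / real P)) =
    c k * cnj (c l) * ee (of_int ((k - l) * x) / real P)" by simp
  qed
  finally show "complex_of_real ((norm (?f x))\<^sup>2) = (\<Sum>k\<in>zp P. \<Sum>l\<in>zp P. c k * cnj (c l) * ee (of_int ((k - l) * x) / real P))" .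
 qed
 also have "... = (\<Sum>k\<in>zp P. \<Sum>l\<in>zp P. c k * cnj (c l) * av (zp P) (%x. ee (of_int ((k - l) * x) / real P)))"
  unfolding av_sum av_mult_left ..
 also have "... = (\<Sum>k\<in>zp P. \<Sum>l\<in>zp P. if l = k then c k * cnj (c k) else 0)"
 proof (intro sum.cong refl)
  fix k l assume kl: "k \<in> zp P" "l \<in> zp P"
  have "int P dvd (k - l) \<longleftrightarrow> k mod int P = l mod int P" by (simp add: mod_eq_dvd_iff)
  then have "int P dvd (k - l) \<longleftrightarrow> k = l" using kl by simp
  then show "c k * cnj (c l) * av (zp P) (%x. ee (of_int ((k - l) * x) / real P)) = (if l = k then c k * cnj (c k) else 0)"
   by (simp only: av_ee_orth[OF P]) auto
 qed
 also have "... = complex_of_real (\<Sum>k\<in>zp P. (norm (c k))\<^sup>2)"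
  by (simp add: complex_norm_square del: of_real_power)
 finally show ?thesis by (simp only: of_real_eq_iff)
qed

lemma parseval: "P > 0 ==> per P G ==> (\<Sum>k\<in>zp P. (norm (fc P G k))\<^sup>2) = av (zp P) (%x. (norm (G x))\<^sup>2)"
 using parseval_sum[of P "fc P G"] fc_inversion[of P G] by simp

text \<open>Averaging translates acts as a Fourier multiplier, so its mean square is a weighted sum
  of squared coefficients.\<close>

lemma parseval_shifts:
 assumes P: "P > 0" and G: "per P G"
 shows "av (zp P) (%x. (norm (av S (%i. a i * G (x + v i))))\<^sup>2) =
  (\<Sum>k\<in>zp P. (norm (fc P G k))\<^sup>2 * (norm (av S (%i. a i * ee (of_int (v i) * (of_int k / real P)))))\<^sup>2)"
proof -
 have "av S (%i. a i * G (x + v i)) = (\<Sum>k\<in>zp P. (fc P G k * av S (%i. a i * ee (of_int (v i) * (of_int k / real P)))) * ee (of_int (k * x) / real P))" for x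
 proof -
  have "av S (%i. a i * G (x + v i)) = av S (%i. \<Sum>k\<in>zp P. a i * (fc P G k * ee (of_int (k * (x + v i)) / real P)))"
   by (simp only: sum_distrib_left[symmetric] fc_inversion[OF P G])
  also have "... = (\<Sum>k\<in>zp P. av S (%i. a i * (fc P G k * ee (of_int (k * (x + v i)) / real P))))"
   unfolding av_def scaleR_sum_right by (rule sum.swap)
  also have "... = (\<Sum>k\<in>zp P. (fc P G k * av S (%i. a i * ee (of_int (v i) * (of_int k / real P)))) * ee (of_int (k * x) / real P))"
   unfolding av_mult_left[symmetric] av_mult_right[symmetric]
  proof (intro sum.cong av_cong refl)
   fix k i
   have "ee (of_int (k * (x + v i)) / real P) = ee (of_int (v i) * (of_int k / real P)) * ee (of_int (k * x) / real P)"
    by (simp add: algebra_simps add_divide_distrib flip: ee_add)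
   then show "a i * (fc P G k * ee (of_int (k * (x + v i)) / real P)) = fc P G k * (a i * ee (of_int (v i) * (of_int k / real P))) * ee (of_int (k * x) / real P)"
    by (simp only: mult_ac)
  qed
  finally show ?thesis .
 qed
 then show ?thesis using parseval_sum[OF P] by (simp add: norm_mult power_mult_distrib)
qed

text \<open>Both mean squares integrate |fc|^2 against multipliers. Frequencies whose first
  multiplier is below \<epsilon> / 2 carry at most half of \<epsilon>; at all others the hypothesis
  on exponential sums makes the second multiplier at least 1/4. Thus a large average over one family
  of shifts is converted into one over another family by arithmetic on single frequencies, whatever
  \<open>G\<close> is.\<close>

lemma spectral_transfer:
 fixes G :: "int => complex"
 assumes P: "P > 0" and G: "per P G" "!!x. norm (G x) <= 1"
  and O: "finite \<Omega>" "\<Omega> ~= {}"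
  and big: "\<epsilon> <= av \<Omega> (%\<omega>. av (zp P) (%x. (norm (av S (%i. G (x + v \<omega> i))))\<^sup>2))"
  and tr: "!!\<phi>::real. \<epsilon> / 2 <= av \<Omega> (%\<omega>. (norm (av S (%i. ee (of_int (v \<omega> i) * \<phi>))))\<^sup>2) ==>
    1 / 4 <= (norm (av T (%j. ee (of_int (u j) * \<phi>))))\<^sup>2"
 shows "\<epsilon> / 8 <= av (zp P) (%x. (norm (av T (%j. G (x + u j))))\<^sup>2)"
proof -
 define w where "w k = av \<Omega> (%\<omega>. (norm (av S (%i. ee (of_int (v \<omega> i) * (of_int k / real P)))))\<^sup>2)" for k
 define w' where "w' k = (norm (av T (%j. ee (of_int (u j) * (of_int k / real P)))))\<^sup>2" for k
 define g where "g k = (norm (fc P G k))\<^sup>2" for k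
 have w1: "w k <= 1" for k
  unfolding w_def by (intro av_le power_le_one norm_av_bound) auto
 have w'0: "0 <= w' k" for k by (simp add: w'_def)
 have g0: "0 <= g k" for k by (simp add: g_def)
 have g1: "(\<Sum>k\<in>zp P. g k) <= 1"
  unfolding g_def parseval[OF P G(1)] by (intro av_le power_le_one) (use G in auto)
 have "\<epsilon> <= av \<Omega> (%\<omega>. \<Sum>k\<in>zp P. g k * (norm (av S (%i. ee (of_int (v \<omega> i) * (of_int k / real P)))))\<^sup>2)"
  using big parseval_shifts[OF P G(1), of S "%_. 1"] by (simp add: g_def)
 also have "... = (\<Sum>k\<in>zp P. g k * w k)"
  unfolding w_def av_mult_left[symmetric] unfolding av_sum ..
 also have "... <= (\<Sum>k\<in>zp P. g k * (\<epsilon> / 2) + 4 * (g k * w' k))" if "\<epsilon> \<ge> 0"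
 proof (rule sum_mono)
  fix k
  show "g k * w k <= g k * (\<epsilon> / 2) + 4 * (g k * w' k)"
  proof (cases "\<epsilon> / 2 <= w k")
   case True
   then have "1/4 <= w' k" using tr[of "of_int k / real P"] by (simp add: w_def w'_def)
   then have "w k <= \<epsilon> / 2 + 4 * w' k" using w1[of k] that by linarith
   then have "g k * w k <= g k * (\<epsilon> / 2 + 4 * w' k)" using g0 by (intro mult_left_mono)
   then show ?thesis by (simp add: algebra_simps)
  next
   case False
   then have "g k * w k <= g k * (\<epsilon> / 2)" using g0 by (intro mult_left_mono) auto
   moreover have "0 <= g k * w' k" using g0 w'0 by simp
   ultimately show ?thesis by linarith
  qed
 qed
 also have "(\<Sum>k\<in>zp P. g k * (\<epsilon> / 2) + 4 * (g k * w' k)) = (\<Sum>k\<in>zp P. g k) * (\<epsilon> / 2) + 4 * (\<Sum>k\<in>zp P. g k * w' k)"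
  by (simp add: sum.distrib sum_distrib_left sum_distrib_right)
 also have "(\<Sum>k\<in>zp P. g k * w' k) = av (zp P) (%x. (norm (av T (%j. G (x + u j))))\<^sup>2)"
  using parseval_shifts[OF P G(1), of T "%_. 1" u] by (simp add: g_def w'_def)
 finally have *: "\<epsilon> \<ge> 0 ==> \<epsilon> <= (\<Sum>k\<in>zp P. g k) * (\<epsilon> / 2) + 4 * av (zp P) (%x. (norm (av T (%j. G (x + u j))))\<^sup>2)" .
 show ?thesis
 proof (cases "\<epsilon> \<ge> 0")
  case True
  have "(\<Sum>k\<in>zp P. g k) * (\<epsilon> / 2) <= 1 * (\<epsilon> / 2)" using g1 True by (intro mult_right_mono) auto
  then show ?thesis using *[OF True] by linarith
 next
  case False
  have "0 <= av (zp P) (%x. (norm (av T (%j. G (x + u j))))\<^sup>2)" by (rule av_nonneg) simp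
  then show ?thesis using False by linarith
 qed
qed

text \<open>\<open>b\<close> is placed on a circle of length R + T, long enough to avoid
  wrap-around, and Parseval bounds the mean over translates by the largest multiplier. The circle is
  at most twice as long as the window of s, whence the factor 2.\<close>

lemma local_fourier:
 fixes a b :: "int => complex"
 assumes T: "T > 0" "T <= R" and ab: "!!t. norm (b t) <= 1"
  and big: "\<epsilon> <= av {c..<c + int R} (%s. (norm (av (zp T) (%t. a t * b (t + s))))\<^sup>2)"
 shows "\<exists>\<alpha>::real. \<epsilon> / 2 <= (norm (av (zp T) (%t. a t * ee (\<alpha> * of_int t))))\<^sup>2"
proof -
 define D where "D = R + T"
 have D: "D > 0" using T by (simp add: D_def)
 define B where "B x = b (c + x mod int D)" for x
 have B: "per D B" "!!x. norm (B x) <= 1" using ab by (auto simp: per_def B_def)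
 define A where "A k = (norm (av (zp T) (%t. a t * ee (of_int k / real D * of_int t))))\<^sup>2" for k :: int
 define m where "m = Max (A ` zp D)"
 have fin: "finite (A ` zp D)" "A ` zp D ~= {}" using D by auto
 have "m \<in> A ` zp D" unfolding m_def using fin by (rule Max_in)
 then obtain k0 where k0: "m = A k0" by auto
 have Am: "A k <= m" if "k \<in> zp D" for k unfolding m_def using fin that by simp
 have m0: "0 <= m" using k0 by (simp add: A_def)
 have "av {c..<c + int R} (%s. (norm (av (zp T) (%t. a t * b (t + s))))\<^sup>2) =
  (\<Sum>s\<in>{c..<c + int R}. (norm (av (zp T) (%t. a t * b (t + s))))\<^sup>2) / real R"
  by (simp add: av_def)
 also have "(\<Sum>s\<in>{c..<c + int R}. (norm (av (zp T) (%t. a t * b (t + s))))\<^sup>2) =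
  (\<Sum>x\<in>{0..<int R}. (norm (av (zp T) (%t. a t * B (x + t))))\<^sup>2)"
 proof (rule sum.reindex_bij_witness[of _ "%x. x + c" "%s. s - c"])
  fix s assume s: "s \<in> {c..<c + int R}"
  have "av (zp T) (%t. a t * B (s - c + t)) = av (zp T) (%t. a t * b (t + s))"
   by (intro av_cong refl) (use s in "auto simp: B_def D_def algebra_simps")
  then show "(norm (av (zp T) (%t. a t * B (s - c + t))))\<^sup>2 = (norm (av (zp T) (%t. a t * b (t + s))))\<^sup>2" by simp
 qed auto
 also have "... <= (\<Sum>x\<in>zp D. (norm (av (zp T) (%t. a t * B (x + t))))\<^sup>2)"
  by (rule sum_mono2) (auto simp: D_def)
 also have "... = real D * av (zp D) (%x. (norm (av (zp T) (%t. a t * B (x + t))))\<^sup>2)"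
  using D by (simp add: av_def)
 also have "av (zp D) (%x. (norm (av (zp T) (%t. a t * B (x + t))))\<^sup>2) = (\<Sum>k\<in>zp D. (norm (fc D B k))\<^sup>2 * A k)"
  unfolding parseval_shifts[OF D B(1)] A_def by (simp only: mult.commute)
 also have "... <= (\<Sum>k\<in>zp D. (norm (fc D B k))\<^sup>2 * m)" by (intro sum_mono mult_left_mono Am) auto
 also have "... = av (zp D) (%x. (norm (B x))\<^sup>2) * m" by (simp only: sum_distrib_right[symmetric] parseval[OF D B(1)])
 also have "... <= 1 * m" using m0 by (intro mult_right_mono av_le power_le_one) (use B in auto)
 finally have "av {c..<c + int R} (%s. (norm (av (zp T) (%t. a t * b (t + s))))\<^sup>2) <= real D * m / real R"
  using T by (simp add: divide_right_mono mult_left_mono)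
 also have "... <= (2 * real R) * m / real R"
  using T m0 by (intro divide_right_mono mult_right_mono) (auto simp: D_def)
 also have "... = 2 * m" using T by simp
 finally have "\<epsilon> / 2 <= m" using big by linarith
 then show ?thesis using k0 unfolding A_def by (intro exI[of _ "of_int k0 / real D"]) simp
qed

section \<open>Box norms along families of directions\<close>

type_synonym direction = "(int \<times> int) set \<times> (int \<times> int => int)"

text \<open>A Gowers box norm raised to the power 2^n, n being the number of directions. A direction
  is a parameter set with a map into the shifts; parameters are pairs because concatenation produces
  shifts \<alpha> s + \<beta> s'.\<close>

fun bv :: "nat => direction list => (int => complex) => complex" where
 "bv P [] T = av (zp P) T"
| "bv P ((S, \<delta>) # ds) T = av S (%s. av S (%s'. bv P ds (%x. T (x + \<delta> s) * cnj (T (x + \<delta> s')))))"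

definition bdd :: "('a => complex) => bool" where "bdd f \<longleftrightarrow> (\<forall>x. norm (f x) <= 1)"

lemma bddD: "bdd f ==> norm (f x) <= 1" by (simp add: bdd_def)

lemma mult_le_1: "norm a <= 1 ==> norm b <= 1 ==> norm (a * b :: complex) <= 1"
 by (simp add: norm_mult mult_le_one)

lemma bdd_mult: "bdd f ==> bdd g ==> bdd (%x. f x * g x)"
 by (simp add: bdd_def mult_le_1)

lemma bdd_cnj: "bdd f ==> bdd (%x. cnj (f x))" by (simp add: bdd_def)

lemma bdd_comp: "bdd f ==> bdd (%x. f (g x))" by (simp add: bdd_def)

lemma norm_prod_list_le: "(!!B. B \<in> set Bs ==> norm (f B) <= 1) ==> norm (prod_list (map f Bs) :: complex) <= 1"
 by (induction Bs) (auto intro: mult_le_1)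

lemma av_cong1: "(!!x. x \<in> S ==> f x = g x) ==> av S f = av S g"
 by (rule av_cong[OF refl])

lemma av_rot3: "av A (%a. av B (%b. av C (%c. f a b c))) = av B (%b. av C (%c. av A (%a. f a b c)))"
 unfolding av_swap[of A B] unfolding av_swap[of A C] ..

lemma av_rot4: "av A (%a. av B (%b. av C (%c. av D (%d. f a b c d)))) = av B (%b. av C (%c. av D (%d. av A (%a. f a b c d))))"
 by (subst av_rot3) (intro av_cong refl, rule av_swap)

lemma norm_av_le_1: "(!!x. x \<in> S ==> norm (f x) <= 1) ==> norm (av S f) <= 1"
 by (rule norm_av_bound) auto

text \<open>Moving x and the parameter p along the joint translations that fix \<open>B\<close>
  changes the mean by at most \<open>e\<close> and puts the average over s on \<open>R\<close>
  alone; Cauchy-Schwarz then removes \<open>B\<close>.\<close>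

lemma gcs_step:
 fixes B R :: "int => 'p::ab_group_add => complex"
 assumes P: "P > 0" and X: "finite X" "X ~= {}" and S: "finite S" "S ~= {}"
  and B: "!!x p. norm (B x p) <= 1" "!!p. per P (%x. B x p)"
  and R: "!!x p. norm (R x p) <= 1" "!!p. per P (%x. R x p)"
  and inv: "!!s x p. s \<in> S ==> B (x + \<delta> s) (p + v s) = B x p"
  and e: "!!s. s \<in> S ==> shiftok X (v s) e"
 shows "(norm (av (zp P) (%x. av X (%p. B x p * R x p))))\<^sup>2 <=
  Re (av S (%s. av S (%s'. av (zp P) (%x. av X (%p. R (x + \<delta> s) (p + v s) * cnj (R (x + \<delta> s') (p + v s'))))))) + 2 * e"
proof -
 define A where "A = av (zp P) (%x. av X (%p. B x p * R x p))"
 define A' where "A' = av (zp P) (%x. av X (%p. B x p * av S (%s. R (x + \<delta> s) (p + v s))))"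
 have e0: "0 <= e" using e S shiftok_nonneg by blast
 have eq: "av (zp P) (%x. av X (%p. B x p * R (x + \<delta> s) (p + v s))) =
  av (zp P) (%x. av X (%p. B x (p + v s) * R x (p + v s)))" if s: "s \<in> S" for s
 proof -
  have "av (zp P) (%x. av X (%p. B x p * R (x + \<delta> s) (p + v s))) =
   av (zp P) (%x. av X (%p. B (x + \<delta> s) (p + v s) * R (x + \<delta> s) (p + v s)))"
   by (simp only: inv[OF s])
  also have "... = av (zp P) (%x. av X (%p. B x (p + v s) * R x (p + v s)))"
   by (rule av_shift[OF P, of "%x. av X (%p. B x (p + v s) * R x (p + v s))"])
     (intro per_av per_times B R)
  finally show ?thesis .
 qed
 have "A' = av S (%s. av (zp P) (%x. av X (%p. B x p * R (x + \<delta> s) (p + v s))))"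
  unfolding A'_def av_mult_left[symmetric]
  by (subst av_swap[of S], intro av_cong refl) (rule av_swap)
 also have "... = av S (%s. av (zp P) (%x. av X (%p. B x (p + v s) * R x (p + v s))))"
  by (intro av_cong refl eq)
 finally have "A' - A = av S (%s. av (zp P) (%x. av X (%p. B x (p + v s) * R x (p + v s)) - av X (%p. B x p * R x p)))"
  unfolding A_def av_diff by (simp add: av_const[OF S])
 also have "norm ... <= e"
 proof (intro norm_av_bound e0)
  fix s x assume "s \<in> S"
  show "norm (av X (%p. B x (p + v s) * R x (p + v s)) - av X (%p. B x p * R x p)) <= e"
   by (rule shiftokD[OF e[OF \<open>s \<in> S\<close>]]) (intro mult_le_1 B R)
 qed
 finally have AA: "norm A <= norm A' + e"
  using norm_triangle_ineq3[of A A'] norm_minus_commute[of A A'] by simp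
 have A1: "norm A <= 1" unfolding A_def by (intro norm_av_le_1 mult_le_1 B R)
 have A'1: "norm A' <= 1" unfolding A'_def by (intro norm_av_le_1 mult_le_1 B R)
 have "(norm A)\<^sup>2 <= (norm A')\<^sup>2 + 2 * e"
  using abs_power_diff_le[of "norm A" "norm A'" e 2] AA A1 A'1 e0 by simp
 moreover have "(norm A')\<^sup>2 <= av (zp P \<times> X) (%z. (norm (av S (%s. R (fst z + \<delta> s) (snd z + v s))))\<^sup>2)"
 proof -
  have "A' = av (zp P \<times> X) (%z. B (fst z) (snd z) * av S (%s. R (fst z + \<delta> s) (snd z + v s)))"
   unfolding A'_def av_Times by simp
  then show ?thesis by (simp only:) (rule av_kill, rule B)
 qed
 moreover have "av (zp P \<times> X) (%z. (norm (av S (%s. R (fst z + \<delta> s) (snd z + v s))))\<^sup>2) =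
  Re (av S (%s. av S (%s'. av (zp P) (%x. av X (%p. R (x + \<delta> s) (p + v s) * cnj (R (x + \<delta> s') (p + v s')))))))"
 proof -
  have "complex_of_real (av (zp P \<times> X) (%z. (norm (av S (%s. R (fst z + \<delta> s) (snd z + v s))))\<^sup>2)) =
   av (zp P \<times> X) (%z. av S (%s. av S (%s'. R (fst z + \<delta> s) (snd z + v s) * cnj (R (fst z + \<delta> s') (snd z + v s')))))"
   unfolding of_real_av av_norm_square ..
  also have "... = av S (%s. av S (%s'. av (zp P \<times> X) (%z. R (fst z + \<delta> s) (snd z + v s) * cnj (R (fst z + \<delta> s') (snd z + v s')))))"
   by (subst av_swap, intro av_cong refl) (rule av_swap)
  finally show ?thesis unfolding av_Times fst_conv snd_conv by (metis Re_complex_of_real)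
 qed
 ultimately show ?thesis unfolding A_def by linarith
qed

lemma prod_list_map_mult_cnj:
 "prod_list (map (%B. f B * cnj (g B)) Bs) = prod_list (map f Bs) * cnj (prod_list (map g Bs))"
 for f g :: "'b => complex"
 by (induction Bs) auto

definition gdir :: "nat => 'p::ab_group_add set => real => direction => (int \<times> int => 'p) => (int => 'p => complex) => bool" where
 "gdir P X e D v B \<longleftrightarrow> finite (fst D) \<and> fst D ~= {} \<and> (\<forall>s\<in>fst D. shiftok X (v s) e) \<and>
  (\<forall>x p. norm (B x p) <= 1) \<and> (\<forall>p. per P (%x. B x p)) \<and>
  (\<forall>s\<in>fst D. \<forall>x p. B (x + snd D s) (p + v s) = B x p)"

text \<open>Gowers--Cauchy--Schwarz elimination: every factor invariant under its own family of translations is removed at the price of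
 differencing the target along that family.\<close>

lemma gowers_cauchy_schwarz:
 fixes X :: "'p::ab_group_add set" and vs :: "(int \<times> int => 'p) list"
 assumes P: "P > 0" and X: "finite X" "X ~= {}"
 shows "length ds = length vs ==> length Bs = length vs ==> vs ~= [] ==>
  (!!i. i < length vs ==> gdir P X e (ds ! i) (vs ! i) (Bs ! i)) ==> bdd T ==> per P T ==>
  (norm (av (zp P) (%x. av X (%p. T x * prod_list (map (%B. B x p) Bs))))) ^ (2 ^ length vs) <= Re (bv P ds T) + 2 ^ Suc (length vs) * e"
proof (induction vs arbitrary: ds Bs T)
 case (Cons v vs)
 obtain D ds' where ds: "ds = D # ds'" using Cons.prems by (cases ds) auto
 obtain B Bs' where Bs: "Bs = B # Bs'" using Cons.prems by (cases Bs) auto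
 obtain S \<delta> where D: "D = (S, \<delta>)" by force
 have g: "gdir P X e D v B" using Cons.prems(4)[of 0] by (simp add: ds Bs)
 have g': "gdir P X e (ds' ! i) (vs ! i) (Bs' ! i)" if "i < length vs" for i
  using Cons.prems(4)[of "Suc i"] that by (simp add: ds Bs)
 have len: "length ds' = length vs" "length Bs' = length vs" using Cons.prems by (auto simp: ds Bs)
 have S: "finite S" "S ~= {}" using g by (auto simp: gdir_def D)
 have e: "!!s. s \<in> S ==> shiftok X (v s) e" using g by (auto simp: gdir_def D)
 then have e0: "0 <= e" using S shiftok_nonneg by blast
 have B1: "norm (B x p) <= 1" for x p using g by (auto simp: gdir_def)
 have B2: "per P (%x. B x p)" for p using g by (auto simp: gdir_def)
 have inv: "!!s x p. s \<in> S ==> B (x + \<delta> s) (p + v s) = B x p" using g by (auto simp: gdir_def D)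
 have Bi: "norm (C x p) <= 1" "per P (%x. C x p)" if "C \<in> set Bs'" for C x p
  using that g' len by (auto simp: gdir_def in_set_conv_nth)
 define R where "R x p = T x * prod_list (map (%B. B x p) Bs')" for x p
 have R1: "norm (R x p) <= 1" for x p unfolding R_def
  by (intro mult_le_1 norm_prod_list_le bddD Bi Cons.prems)
 have R2: "per P (%x. R x p)" for p
 proof -
  have "prod_list (map (%B. B (x + int P) p) Bs') = prod_list (map (%B. B x p) Bs')" for x
   by (rule arg_cong[where f = prod_list], rule map_cong[OF refl]) (use Bi in "auto simp: per_def")
  then show ?thesis using Cons.prems(6) unfolding R_def per_def by simp
 qed
 define Tn where "Tn s s' x = T (x + \<delta> s) * cnj (T (x + \<delta> s'))" for s s' x
 define Bn where "Bn s s' = (%(C :: int => 'p => complex) x p. C (x + \<delta> s) (p + v s) * cnj (C (x + \<delta> s') (p + v s')))" for s s'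
 define Z where "Z s s' = av (zp P) (%x. av X (%p. Tn s s' x * prod_list (map (%B. B x p) (map (Bn s s') Bs'))))" for s s'
 have Tn: "bdd (Tn s s')" "per P (Tn s s')" for s s'
  using Cons.prems(5,6) unfolding Tn_def[abs_def]
  by (auto intro!: bdd_mult bdd_cnj per_times per_cnj per_shift bdd_comp[of T])
 have RR: "R (x + \<delta> s) (p + v s) * cnj (R (x + \<delta> s') (p + v s')) = Tn s s' x * prod_list (map (%B. B x p) (map (Bn s s') Bs'))" for s s' x p
 proof -
  have "prod_list (map (%B. B x p) (map (Bn s s') Bs')) =
   prod_list (map (%B. B (x + \<delta> s) (p + v s)) Bs') * cnj (prod_list (map (%B. B (x + \<delta> s') (p + v s')) Bs'))"
   unfolding prod_list_map_mult_cnj[symmetric] map_map o_def Bn_def ..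
  then show ?thesis unfolding R_def Tn_def by simp
 qed
 let ?N = "norm (av (zp P) (%x. av X (%p. T x * prod_list (map (%B. B x p) Bs))))"
 have "?N = norm (av (zp P) (%x. av X (%p. B x p * R x p)))"
  by (simp add: Bs R_def mult.left_commute)
 then have 1: "?N\<^sup>2 <= Re (av S (%s. av S (%s'. Z s s'))) + 2 * e"
  using gcs_step[where B = B and R = R and \<delta> = \<delta> and v = v and e = e, OF P X S B1 B2 R1 R2 inv e] by (simp only: RR Z_def)
 show ?case
 proof (cases "vs = []")
  case True
  \<comment> \<open>No factor depends on the parameter any more, so the average over X
    disappears.\<close>
  then have "Z s s' = av (zp P) (Tn s s')" for s s' using len by (simp add: Z_def av_const[OF X])
  then show ?thesis using 1 True len e0 by (simp add: ds D Tn_def[abs_def])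
 next
  case False
  let ?n = "length vs"
  let ?A = "av S (%s. av S (%s'. norm (Z s s')))"
  have Z1: "norm (Z s s') <= 1" for s s'
   unfolding Z_def RR[symmetric] by (intro norm_av_le_1 mult_le_1) (auto simp: R1)
  have A1: "?A <= 1" by (intro av_le) (auto simp: Z1)
  have A0: "0 <= ?A" by (intro av_nonneg) auto
  have "Re (av S (%s. av S (%s'. Z s s'))) <= ?A"
   by (rule order_trans[OF complex_Re_le_cmod], rule order_trans[OF norm_av_le], rule av_mono, rule norm_av_le)
  then have 2: "?N\<^sup>2 <= ?A + 2 * e" using 1 by linarith
  have N1: "?N\<^sup>2 <= 1"
   by (intro power_le_one norm_av_le_1 norm_ge_zero mult_le_1 norm_prod_list_le)
     (use Bi B1 Cons.prems in "auto simp: Bs bdd_def")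
  have IH: "norm (Z s s') ^ (2 ^ ?n) <= Re (bv P ds' (Tn s s')) + 2 ^ Suc ?n * e" if ss: "s \<in> S" "s' \<in> S" for s s'
   unfolding Z_def
  proof (rule Cons.IH)
   fix i assume i: "i < length vs"
   have gi: "gdir P X e (ds' ! i) (vs ! i) (Bs' ! i)" by (rule g'[OF i])
   have "(map (Bn s s') Bs') ! i = Bn s s' (Bs' ! i)" using i len by simp
   moreover have "gdir P X e (ds' ! i) (vs ! i) (Bn s s' (Bs' ! i))"
   proof -
    let ?C = "Bs' ! i"
    have c: "!!x p. norm (?C x p) <= 1" "!!p. per P (%x. ?C x p)"
     "!!s x p. s \<in> fst (ds' ! i) ==> ?C (x + snd (ds' ! i) s) (p + (vs ! i) s) = ?C x p"
     using gi by (auto simp: gdir_def)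
    have "Bn s s' ?C (x + snd (ds' ! i) r) (p + (vs ! i) r) = Bn s s' ?C x p" if "r \<in> fst (ds' ! i)" for r x p
     using c(3)[OF that, of "x + \<delta> s" "p + v s"] c(3)[OF that, of "x + \<delta> s'" "p + v s'"]
     unfolding Bn_def by (simp add: ac_simps)
    moreover have "norm (Bn s s' ?C x p) <= 1" for x p unfolding Bn_def by (intro mult_le_1) (auto simp: c)
    moreover have "per P (%x. Bn s s' ?C x p)" for p
     unfolding Bn_def by (intro per_times per_cnj per_shift[of P "%x. ?C x (p + v s)"] per_shift[of P "%x. ?C x (p + v s')"] c)
    ultimately show ?thesis using gi by (simp add: gdir_def)
   qed
   ultimately show "gdir P X e (ds' ! i) (vs ! i) ((map (Bn s s') Bs') ! i)" by simp
  qed (use len False Tn in auto)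
  have "?N ^ (2 ^ length (v # vs)) = (?N\<^sup>2) ^ (2 ^ ?n)" by (simp add: power_mult[symmetric] mult.commute)
  \<comment> \<open>The error doubles with every direction: 2^n * 2 e from raising to the power, and
    as much again from the induction hypothesis.\<close>
  also have "... <= ?A ^ (2 ^ ?n) + real (2 ^ ?n) * (2 * e)"
   by (rule abs_power_diff_le) (use 2 N1 A0 A1 e0 in auto)
  also have "?A ^ (2 ^ ?n) <= av S (%s. av S (%s'. norm (Z s s')) ^ (2 ^ ?n))"
   by (rule av_power_le, rule av_nonneg) auto
  also have "... <= av S (%s. av S (%s'. norm (Z s s') ^ (2 ^ ?n)))"
   by (rule av_mono, rule av_power_le) auto
  also have "... <= av S (%s. av S (%s'. Re (bv P ds' (Tn s s')) + 2 ^ Suc ?n * e))"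
   by (intro av_mono IH)
  also have "... = Re (bv P ds T) + 2 ^ Suc ?n * e"
   unfolding av_add by (simp add: av_const[OF S] ds D Re_av Tn_def[abs_def])
  finally show ?thesis by (simp add: mult_ac)
 qed
qed simp

section \<open>Reducing the count to box expectations of one function\<close>

definition Lam :: "nat => nat => int => int => (int => complex) => (int => complex) => (int => complex) => complex" where
 "Lam P M q1 q2 f0 f1 f2 = av (zp P) (%x. av (zp M) (%d. f0 x * f1 (x + q1 * d) * f2 (x + q2 * d\<^sup>2)))"

definition good :: "nat => (int => complex) => bool" where "good P f \<longleftrightarrow> per P f \<and> bdd f"

lemma good_mult: "good P f ==> good P g ==> good P (%x. f x * g x)"
 by (simp add: good_def bdd_mult per_times)

lemma good_cnj: "good P f ==> good P (%x. cnj (f x))"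
 by (simp add: good_def bdd_cnj per_cnj)

lemma good_shift: "good P f ==> good P (%x. f (x + a))"
 by (auto simp: good_def bdd_def intro: per_shift)

lemma good_shift2: "good P f ==> good P (%x. f (x - a))"
 using good_shift[of P f "-a"] by simp

lemma good_le: "good P f ==> norm (f x) <= 1" by (simp add: good_def bdd_def)

lemma good_av: "(!!s. s \<in> S ==> good P (%x. f x s)) ==> good P (%x. av S (f x))"
 unfolding good_def bdd_def by (auto intro!: per_av norm_av_le_1)

text \<open>What two van der Corput steps leave behind: only the third function, at the four
  combinations of h or h' with k or k'.\<close>

definition pet4 :: "nat => nat => int => int => (int => complex) => int => int => int => int => complex" where
 "pet4 P M q1 q2 F h h' k k' = av (zp P) (%x. av (zp M) (%d.
   F (x - q1 * h + q2 * (d + k + h)\<^sup>2) * cnj (F (x - q1 * h' + q2 * (d + k + h')\<^sup>2)) *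
   cnj (F (x - q1 * h + q2 * (d + k' + h)\<^sup>2) * cnj (F (x - q1 * h' + q2 * (d + k' + h')\<^sup>2)))))"

text \<open>The substitution y = x + q1 d makes f1 independent of d, so Cauchy-Schwarz removes it;
  after differencing in d the opposite substitution makes f0 independent of d, and a second round
  removes it too. With e = 2 H / M the error is 2 e from the first round, doubled by the squaring,
  plus 2 e from the second.\<close>

lemma pet:
 assumes P: "P > 0" and M: "M > 0" and H: "H > 0" and f: "good P f0" "good P f1" "good P F"
  and big: "\<eta> <= norm (Lam P M q1 q2 f0 f1 F)" "0 <= \<eta>"
 shows "\<eta> ^ 4 <= av (zp H) (%h. av (zp H) (%h'. av (zp H) (%k. av (zp H) (%k'. norm (pet4 P M q1 q2 F h h' k k'))))) + 12 * real H / real M"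
proof -
 note fle = good_le[OF f(1)] good_le[OF f(2)] good_le[OF f(3)]
 define e where "e = 2 * real H / real M"
 have e0: "0 <= e" by (simp add: e_def)
 have sh: "shiftok {0..<0 + int M} s e" if "s \<in> zp H" for s
  by (rule shiftok_mono[OF shiftok_int[OF M]]) (use that M in "auto simp: e_def intro!: divide_right_mono")
 have HH: "finite (zp H)" "zp H ~= {}" using H by auto
 \<comment> \<open>The two factors that still depend on d once x + q1 d is the base point.\<close>
 define v where "v y d = f0 (y - q1 * d) * F (y - q1 * d + q2 * d\<^sup>2)" for y d
 have v1: "norm (v y d) <= 1" for y d unfolding v_def by (intro mult_le_1 fle)
 have vp: "per P (%y. v (y + a) d)" for a d
 proof -
  have "(%y. v (y + a) d) = (%y. f0 (y + (a - q1 * d)) * F (y + (a - q1 * d + q2 * d\<^sup>2)))"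
   unfolding v_def by (simp add: algebra_simps)
  then show ?thesis using f by (auto simp: good_def intro!: per_times per_shift[of P f0] per_shift[of P F])
 qed
 have L: "Lam P M q1 q2 f0 f1 F = av (zp P) (%y. f1 y * av (zp M) (v y))"
 proof -
  have "Lam P M q1 q2 f0 f1 F = av (zp M) (%d. av (zp P) (%x. f1 (x + q1 * d) * v (x + q1 * d) d))"
   unfolding Lam_def v_def by (subst av_swap) (simp add: mult_ac)
  also have "... = av (zp M) (%d. av (zp P) (%y. f1 y * v y d))"
   using av_shift[OF P, of "%y. f1 y * v y d" for d] f vp[of 0] by (simp add: per_times good_def)
  also have "... = av (zp P) (%y. f1 y * av (zp M) (v y))"
   by (subst av_swap) (simp only: av_mult_left)
  finally show ?thesis .
 qed
 define E1 where "E1 = av (zp P) (%y. av (zp M) (%d. (norm (av (zp H) (%h. v y (d + h))))\<^sup>2))"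
 have "\<eta>\<^sup>2 <= (norm (Lam P M q1 q2 f0 f1 F))\<^sup>2" using big by (intro power_mono) auto
 also have "... <= av (zp P) (%y. (norm (av (zp M) (v y)))\<^sup>2)"
  unfolding L by (rule av_kill) (rule fle)
 also have "... <= av (zp P) (%y. av (zp M) (%d. (norm (av (zp H) (%h. v y (d + h))))\<^sup>2) + 2 * e)"
 proof (rule av_mono)
  fix y
  show "(norm (av (zp M) (v y)))\<^sup>2 <= av (zp M) (%d. (norm (av (zp H) (%h. v y (d + h))))\<^sup>2) + 2 * e"
   using vdC[where v = "v y" and h = "%s. s" and a = 0, OF v1 M HH sh] by simp
 qed
 finally have 1: "\<eta>\<^sup>2 <= E1 + 2 * e" unfolding av_add E1_def using P by (simp add: av_const)
 have E1b: "0 <= E1" "E1 <= 1"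
  unfolding E1_def by (auto intro!: av_nonneg av_le power_le_one norm_av_le_1 v1)
 define w where "w h h' x d = F (x - q1 * h + q2 * (d + h)\<^sup>2) * cnj (F (x - q1 * h' + q2 * (d + h')\<^sup>2))" for h h' x d
 have w1: "norm (w h h' x d) <= 1" for h h' x d unfolding w_def by (intro mult_le_1) (auto simp: fle)
 \<comment> \<open>With the base point back at y - q1 d, the two copies of f0 no longer see
   d.\<close>
 define c where "c h h' x = f0 (x - q1 * h) * cnj (f0 (x - q1 * h'))" for h h' x
 have c1: "norm (c h h' x) <= 1" for h h' x unfolding c_def by (intro mult_le_1) (auto simp: fle)
 have "complex_of_real E1 = av (zp P) (%y. av (zp M) (%d. av (zp H) (%h. av (zp H) (%h'. v y (d + h) * cnj (v y (d + h'))))))"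
  unfolding E1_def of_real_av av_norm_square ..
 also have "... = av (zp M) (%d. av (zp H) (%h. av (zp H) (%h'. av (zp P) (%y. v y (d + h) * cnj (v y (d + h'))))))"
  by (rule av_rot4)
 also have "... = av (zp M) (%d. av (zp H) (%h. av (zp H) (%h'. av (zp P) (%x. c h h' x * w h h' x d))))"
 proof (rule av_cong1, rule av_cong1, rule av_cong1)
  fix d h h'
  have "av (zp P) (%y. v y (d + h) * cnj (v y (d + h'))) = av (zp P) (%x. v (x + q1 * d) (d + h) * cnj (v (x + q1 * d) (d + h')))"
   using av_shift[OF P, of "%y. v y (d + h) * cnj (v y (d + h'))" "q1 * d"] vp[of 0] by (simp add: per_times per_cnj)
  also have "... = av (zp P) (%x. c h h' x * w h h' x d)"
   unfolding v_def c_def w_def by (intro av_cong refl) (simp add: algebra_simps)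
  finally show "av (zp P) (%y. v y (d + h) * cnj (v y (d + h'))) = av (zp P) (%x. c h h' x * w h h' x d)" .
 qed
 also have "... = av (zp H) (%h. av (zp H) (%h'. av (zp P) (%x. c h h' x * av (zp M) (w h h' x))))"
  unfolding av_mult_left[symmetric]
  by (rule av_rot4)
 also have "... = av (zp H \<times> zp H \<times> zp P) (%z. c (fst z) (fst (snd z)) (snd (snd z)) * av (zp M) (w (fst z) (fst (snd z)) (snd (snd z))))"
  unfolding av_Times by simp
 finally have E1c: "E1 = norm (av (zp H \<times> zp H \<times> zp P) (%z. c (fst z) (fst (snd z)) (snd (snd z)) * av (zp M) (w (fst z) (fst (snd z)) (snd (snd z)))))"
  using E1b by (metis abs_of_nonneg norm_of_real)
 define E2 where "E2 = av (zp H) (%h. av (zp H) (%h'. av (zp P) (%x. av (zp M) (%d. (norm (av (zp H) (%k. w h h' x (d + k))))\<^sup>2))))"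
 have "E1\<^sup>2 <= av (zp H \<times> zp H \<times> zp P) (%z. (norm (av (zp M) (w (fst z) (fst (snd z)) (snd (snd z)))))\<^sup>2)"
  unfolding E1c by (rule av_kill) (rule c1)
 also have "... = av (zp H) (%h. av (zp H) (%h'. av (zp P) (%x. (norm (av (zp M) (w h h' x)))\<^sup>2)))"
  unfolding av_Times by simp
 also have "... <= av (zp H) (%h. av (zp H) (%h'. av (zp P) (%x. av (zp M) (%d. (norm (av (zp H) (%k. w h h' x (d + k))))\<^sup>2) + 2 * e)))"
 proof (intro av_mono)
  fix h h' x
  show "(norm (av (zp M) (w h h' x)))\<^sup>2 <= av (zp M) (%d. (norm (av (zp H) (%k. w h h' x (d + k))))\<^sup>2) + 2 * e"
   using vdC[where v = "w h h' x" and h = "%s. s" and a = 0, OF w1 M HH sh] by simp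
 qed
 finally have 2: "E1\<^sup>2 <= E2 + 2 * e" unfolding av_add E2_def using P HH by (simp add: av_const)
 have "complex_of_real E2 = av (zp H) (%h. av (zp H) (%h'. av (zp P) (%x. av (zp M) (%d. av (zp H) (%k. av (zp H) (%k'. w h h' x (d + k) * cnj (w h h' x (d + k'))))))))"
  unfolding E2_def of_real_av av_norm_square ..
 also have "... = av (zp H) (%h. av (zp H) (%h'. av (zp H) (%k. av (zp H) (%k'. av (zp P) (%x. av (zp M) (%d. w h h' x (d + k) * cnj (w h h' x (d + k'))))))))"
 proof (rule av_cong1, rule av_cong1)
  fix h h'
  have "av (zp P) (%x. av (zp M) (%d. av (zp H) (%k. av (zp H) (%k'. w h h' x (d + k) * cnj (w h h' x (d + k')))))) =
   av (zp P) (%x. av (zp H) (%k. av (zp M) (%d. av (zp H) (%k'. w h h' x (d + k) * cnj (w h h' x (d + k'))))))"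
   by (rule av_cong1, rule av_swap)
  also have "... = av (zp P) (%x. av (zp H) (%k. av (zp H) (%k'. av (zp M) (%d. w h h' x (d + k) * cnj (w h h' x (d + k'))))))"
   by (rule av_cong1, rule av_cong1, rule av_swap)
  also have "... = av (zp H) (%k. av (zp P) (%x. av (zp H) (%k'. av (zp M) (%d. w h h' x (d + k) * cnj (w h h' x (d + k'))))))"
   by (rule av_swap)
  also have "... = av (zp H) (%k. av (zp H) (%k'. av (zp P) (%x. av (zp M) (%d. w h h' x (d + k) * cnj (w h h' x (d + k'))))))"
   by (rule av_cong1, rule av_swap)
  finally show "av (zp P) (%x. av (zp M) (%d. av (zp H) (%k. av (zp H) (%k'. w h h' x (d + k) * cnj (w h h' x (d + k')))))) =
   av (zp H) (%k. av (zp H) (%k'. av (zp P) (%x. av (zp M) (%d. w h h' x (d + k) * cnj (w h h' x (d + k'))))))" .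
 qed
 also have "... = av (zp H) (%h. av (zp H) (%h'. av (zp H) (%k. av (zp H) (%k'. pet4 P M q1 q2 F h h' k k'))))"
  unfolding w_def pet4_def by (simp only: ac_simps)
 finally have "E2 <= norm (av (zp H) (%h. av (zp H) (%h'. av (zp H) (%k. av (zp H) (%k'. pet4 P M q1 q2 F h h' k k')))))"
  by (metis abs_ge_self norm_of_real)
 also have "... <= av (zp H) (%h. av (zp H) (%h'. av (zp H) (%k. av (zp H) (%k'. norm (pet4 P M q1 q2 F h h' k k')))))"
  by (rule order_trans[OF norm_av_le], rule av_mono, rule order_trans[OF norm_av_le], rule av_mono,
    rule order_trans[OF norm_av_le], rule av_mono, rule norm_av_le)
 finally have 3: "E2 <= av (zp H) (%h. av (zp H) (%h'. av (zp H) (%k. av (zp H) (%k'. norm (pet4 P M q1 q2 F h h' k k')))))" .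
 have "\<eta>\<^sup>2 <= 1"
 proof -
  have "norm (Lam P M q1 q2 f0 f1 F) <= 1" unfolding Lam_def by (intro norm_av_le_1 mult_le_1 fle)
  then show ?thesis using big by (intro power_le_one) auto
 qed
 then have "(\<eta>\<^sup>2) ^ 2 <= E1 ^ 2 + real 2 * (2 * e)"
  by (intro abs_power_diff_le) (use 1 E1b e0 in auto)
 then have "\<eta> ^ 4 <= E1\<^sup>2 + 4 * e" by (simp add: power_mult[symmetric])
 then show ?thesis using 2 3 by (simp add: e_def)
qed

text \<open>The second parameter is frozen at 0 to fit a one-dimensional family into the type of
  directions.\<close>

definition dir1 :: "nat => int => direction" where
 "dir1 L c = (zp L \<times> {0}, %s. c * fst s)"

text \<open>Measured from the first of the four points the squares of d cancel, and the other three
  factors move linearly in d with coefficients 2 q2 times h - h', k - k' and their sum. A shift of d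
  is thus compensated by a shift of X, the invariance required by Gowers-Cauchy-Schwarz; three
  factors give 2^3 = 8.\<close>

lemma pet_box:
 assumes P: "P > 0" and M: "M > 0" and L: "L > 0" and F: "good P F"
 shows "norm (pet4 P M q1 q2 F h h' k k') ^ 8 <=
  Re (bv P [dir1 L (2 * q2 * (k - k')), dir1 L (2 * q2 * (h - h')), dir1 L (2 * q2 * ((h - h') + (k - k')))] F) + 32 * real L / real M"
proof -
 have Fp: "per P F" "!!x. norm (F x) <= 1" using F by (auto simp: good_def bdd_def)
 define e where "e = 2 * real L / real M"
 let ?v = "%s :: int \<times> int. fst s"
 let ?c = "%h k. q2 * (k + h)\<^sup>2 - q1 * h"
 define B1 where "B1 X d = cnj (F (X + (?c h' k - ?c h k) - 2 * q2 * (h - h') * d))" for X d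
 define B2 where "B2 X d = cnj (F (X + (?c h k' - ?c h k) - 2 * q2 * (k - k') * d))" for X d
 define B3 where "B3 X d = F (X + (?c h' k' - ?c h k) - 2 * q2 * ((h - h') + (k - k')) * d)" for X d
 have Fs: "per P (%x. F (x + b - c))" for b c
  using per_shift[OF Fp(1), of "b - c"] by (simp add: add_diff_eq)
 have Bp: "per P (%X. B1 X d)" "per P (%X. B2 X d)" "per P (%X. B3 X d)" for d
  unfolding B1_def B2_def B3_def by (intro per_cnj Fs)+
 have "pet4 P M q1 q2 F h h' k k' = av (zp M) (%d. av (zp P) (%x.
   F (x - q1 * h + q2 * (d + k + h)\<^sup>2) * cnj (F (x - q1 * h' + q2 * (d + k + h')\<^sup>2)) *
   cnj (F (x - q1 * h + q2 * (d + k' + h)\<^sup>2) * cnj (F (x - q1 * h' + q2 * (d + k' + h')\<^sup>2)))))"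
  unfolding pet4_def by (rule av_swap)
 also have "... = av (zp M) (%d. av (zp P) (%X. F X * (B2 X d * (B1 X d * B3 X d))))"
 proof (rule av_cong1)
  fix d
  let ?a = "q2 * (d + k + h)\<^sup>2 - q1 * h"
  have "av (zp P) (%X. F X * (B2 X d * (B1 X d * B3 X d))) = av (zp P) (%x. F (x + ?a) * (B2 (x + ?a) d * (B1 (x + ?a) d * B3 (x + ?a) d)))"
   by (rule av_shift[OF P, of "%X. F X * (B2 X d * (B1 X d * B3 X d))", symmetric])
     (intro per_times Bp Fp)
  also have "... = av (zp P) (%x.
   F (x - q1 * h + q2 * (d + k + h)\<^sup>2) * cnj (F (x - q1 * h' + q2 * (d + k + h')\<^sup>2)) *
   cnj (F (x - q1 * h + q2 * (d + k' + h)\<^sup>2) * cnj (F (x - q1 * h' + q2 * (d + k' + h')\<^sup>2))))"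
  proof (intro av_cong refl)
   fix x
   have F1: "F (x + ?a + (?c h' k - ?c h k) - 2 * q2 * (h - h') * d) = F (x - q1 * h' + q2 * (d + k + h')\<^sup>2)"
    by (rule arg_cong[where f = F]) (simp add: algebra_simps power2_eq_square)
   have F2: "F (x + ?a + (?c h k' - ?c h k) - 2 * q2 * (k - k') * d) = F (x - q1 * h + q2 * (d + k' + h)\<^sup>2)"
    by (rule arg_cong[where f = F]) (simp add: algebra_simps power2_eq_square)
   have F3: "F (x + ?a + (?c h' k' - ?c h k) - 2 * q2 * ((h - h') + (k - k')) * d) = F (x - q1 * h' + q2 * (d + k' + h')\<^sup>2)"
    by (rule arg_cong[where f = F]) (simp add: algebra_simps power2_eq_square)
   have F0: "F (x + ?a) = F (x - q1 * h + q2 * (d + k + h)\<^sup>2)"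
    by (rule arg_cong[where f = F]) simp
   show "F (x + ?a) * (B2 (x + ?a) d * (B1 (x + ?a) d * B3 (x + ?a) d)) =
    F (x - q1 * h + q2 * (d + k + h)\<^sup>2) * cnj (F (x - q1 * h' + q2 * (d + k + h')\<^sup>2)) *
    cnj (F (x - q1 * h + q2 * (d + k' + h)\<^sup>2) * cnj (F (x - q1 * h' + q2 * (d + k' + h')\<^sup>2)))"
    unfolding B1_def B2_def B3_def F1 F2 F3 F0 by (simp add: mult_ac)
  qed
  finally show "av (zp P) (%x.
   F (x - q1 * h + q2 * (d + k + h)\<^sup>2) * cnj (F (x - q1 * h' + q2 * (d + k + h')\<^sup>2)) *
   cnj (F (x - q1 * h + q2 * (d + k' + h)\<^sup>2) * cnj (F (x - q1 * h' + q2 * (d + k' + h')\<^sup>2)))) =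
   av (zp P) (%X. F X * (B2 X d * (B1 X d * B3 X d)))" ..
 qed
 also have "... = av (zp P) (%x. av (zp M) (%d. F x * prod_list (map (%B. B x d) [B2, B1, B3])))"
  by (subst av_swap) simp
 finally have pe: "pet4 P M q1 q2 F h h' k k' = av (zp P) (%x. av (zp M) (%d. F x * prod_list (map (%B. B x d) [B2, B1, B3])))" .
 have gd: "gdir P (zp M) e (dir1 L (2 * q2 * a)) ?v (%X d. c (F (X + b - 2 * q2 * a * d)))"
  if "c = cnj \<or> c = id" for a b c
  unfolding gdir_def dir1_def
 proof (intro conjI ballI allI)
  fix s :: "int \<times> int" assume s: "s \<in> fst (zp L \<times> {0::int}, %s :: int \<times> int. 2 * q2 * a * fst s)"
  have "shiftok {0..<0 + int M} (fst s) e"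
   by (rule shiftok_mono[OF shiftok_int[OF M]]) (use s M in "auto simp: e_def intro!: divide_right_mono")
  then show "shiftok (zp M) (fst s) e" by simp
 next
  fix p show "per P (%x. c (F (x + b - 2 * q2 * a * p)))"
   using that Fs per_cnj[OF Fs] by auto
 qed (use L Fp that in "auto simp: algebra_simps")
 have "(norm (pet4 P M q1 q2 F h h' k k')) ^ (2 ^ length [?v, ?v, ?v]) <=
  Re (bv P [dir1 L (2 * q2 * (k - k')), dir1 L (2 * q2 * (h - h')), dir1 L (2 * q2 * ((h - h') + (k - k')))] F) + 2 ^ Suc (length [?v, ?v, ?v]) * e"
  unfolding pe
 proof (rule gowers_cauchy_schwarz[OF P])
  fix i assume "i < length [?v, ?v, ?v]"
  then have i: "i = 0 \<or> i = 1 \<or> i = 2" by auto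
  show "gdir P (zp M) e ([dir1 L (2 * q2 * (k - k')), dir1 L (2 * q2 * (h - h')), dir1 L (2 * q2 * ((h - h') + (k - k')))] ! i) ([?v, ?v, ?v] ! i) ([B2, B1, B3] ! i)"
   using i gd[of cnj "k - k'" "?c h k' - ?c h k"] gd[of cnj "h - h'" "?c h' k - ?c h k"] gd[of id "(h - h') + (k - k')" "?c h' k' - ?c h k"]
   unfolding B1_def[abs_def] B2_def[abs_def] B3_def[abs_def] by (elim disjE) (simp_all add: id_def)
 qed (use M Fp F in "auto simp: good_def")
 then show ?thesis by (simp add: e_def)
qed

section \<open>Concatenation: special directions become generic two-dimensional ones\<close>

text \<open>A box expectation in two directions, averaged over \<tau> with the same four functions
  throughout. That the functions do not vary with \<tau> is what concatenation exploits.\<close>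

definition quad :: "nat => 't set => ('t => int) => ('t => int) => (int => complex) => (int => complex) => (int => complex) => (int => complex) => complex" where
 "quad P \<T> A B f0 f1 f2 f3 = av \<T> (%\<tau>. av (zp P) (%x. f0 x * f1 (x + A \<tau>) * f2 (x + B \<tau>) * f3 (x + A \<tau> + B \<tau>)))"

text \<open>The form is linear in f0; by Cauchy-Schwarz its square is at most its value at the
  conjugate of the function that f0 is paired with.\<close>

lemma quad_step:
 assumes P: "P > 0" and T: "finite \<T>" "\<T> ~= {}" and f: "good P f0" "good P f1" "good P f2" "good P f3"
 shows "\<exists>D. good P D \<and> (norm (quad P \<T> A B f0 f1 f2 f3))\<^sup>2 <= norm (quad P \<T> A B D f1 f2 f3)"
proof -
 define X where "X x = av \<T> (%\<tau>. f1 (x + A \<tau>) * f2 (x + B \<tau>) * f3 (x + A \<tau> + B \<tau>))" for x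
 have q: "quad P \<T> A B D f1 f2 f3 = av (zp P) (%x. D x * X x)" for D
  unfolding quad_def X_def av_mult_left[symmetric] by (subst av_swap) (simp add: mult.assoc)
 have gX: "good P X" unfolding X_def
  unfolding add.assoc by (intro good_av good_mult good_shift f)
 have "(norm (quad P \<T> A B f0 f1 f2 f3))\<^sup>2 <= av (zp P) (%x. (norm (X x))\<^sup>2)"
  unfolding q by (rule av_kill) (rule good_le[OF f(1)])
 also have "... = norm (complex_of_real (av (zp P) (%x. (norm (X x))\<^sup>2)))"
  using av_nonneg[of "zp P" "%x. (norm (X x))\<^sup>2"] by simp
 also have "complex_of_real (av (zp P) (%x. (norm (X x))\<^sup>2)) = quad P \<T> A B (%x. cnj (X x)) f1 f2 f3"
  unfolding q of_real_av by (rule av_cong1) (simp add: complex_norm_square mult.commute del: of_real_power)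
 finally show ?thesis using good_cnj[OF gX] by blast
qed

lemma quad_flip1:
 assumes P: "P > 0" and f: "good P f0" "good P f1" "good P f2" "good P f3"
 shows "quad P \<T> A B f0 f1 f2 f3 = quad P \<T> (%\<tau>. - A \<tau>) B f1 f0 f3 f2"
 unfolding quad_def
proof (rule av_cong1)
 fix \<tau>
 have "av (zp P) (%x. f1 x * f0 (x + - A \<tau>) * f3 (x + B \<tau>) * f2 (x + - A \<tau> + B \<tau>)) =
  av (zp P) (%x. f1 (x + A \<tau>) * f0 (x + A \<tau> + - A \<tau>) * f3 (x + A \<tau> + B \<tau>) * f2 (x + A \<tau> + - A \<tau> + B \<tau>))"
 proof (rule av_shift[OF P, symmetric])
  have "good P (%x. f1 x * f0 (x + - A \<tau>) * f3 (x + B \<tau>) * f2 (x + (- A \<tau> + B \<tau>)))"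
   by (intro good_mult good_shift f)
  then show "per P (%x. f1 x * f0 (x + - A \<tau>) * f3 (x + B \<tau>) * f2 (x + - A \<tau> + B \<tau>))"
   unfolding good_def add.assoc by simp
 qed
 also have "... = av (zp P) (%x. f0 x * f1 (x + A \<tau>) * f2 (x + B \<tau>) * f3 (x + A \<tau> + B \<tau>))"
  by (rule av_cong1) (simp add: algebra_simps)
 finally show "av (zp P) (%x. f0 x * f1 (x + A \<tau>) * f2 (x + B \<tau>) * f3 (x + A \<tau> + B \<tau>)) =
  av (zp P) (%x. f1 x * f0 (x + - A \<tau>) * f3 (x + B \<tau>) * f2 (x + - A \<tau> + B \<tau>))" ..
qed

lemma quad_flip2:
 assumes P: "P > 0" and f: "good P f0" "good P f1" "good P f2" "good P f3"
 shows "quad P \<T> A B f0 f1 f2 f3 = quad P \<T> A (%\<tau>. - B \<tau>) f2 f3 f0 f1"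
 unfolding quad_def
proof (rule av_cong1)
 fix \<tau>
 have "av (zp P) (%x. f2 x * f3 (x + A \<tau>) * f0 (x + - B \<tau>) * f1 (x + A \<tau> + - B \<tau>)) =
  av (zp P) (%x. f2 (x + B \<tau>) * f3 (x + B \<tau> + A \<tau>) * f0 (x + B \<tau> + - B \<tau>) * f1 (x + B \<tau> + A \<tau> + - B \<tau>))"
 proof (rule av_shift[OF P, symmetric])
  have "good P (%x. f2 x * f3 (x + A \<tau>) * f0 (x + - B \<tau>) * f1 (x + (A \<tau> + - B \<tau>)))"
   by (intro good_mult good_shift f)
  then show "per P (%x. f2 x * f3 (x + A \<tau>) * f0 (x + - B \<tau>) * f1 (x + A \<tau> + - B \<tau>))"
   unfolding good_def add.assoc by simp
 qed
 also have "... = av (zp P) (%x. f0 x * f1 (x + A \<tau>) * f2 (x + B \<tau>) * f3 (x + A \<tau> + B \<tau>))"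
  by (rule av_cong1) (simp add: algebra_simps)
 finally show "av (zp P) (%x. f0 x * f1 (x + A \<tau>) * f2 (x + B \<tau>) * f3 (x + A \<tau> + B \<tau>)) =
  av (zp P) (%x. f2 x * f3 (x + A \<tau>) * f0 (x + - B \<tau>) * f1 (x + A \<tau> + - B \<tau>))" ..
qed

lemma power_le_trans: "a ^ n <= b ==> b ^ m <= c ==> 0 <= a ==> a ^ (n * m) <= (c::real)"
 by (metis order_trans power_mono power_mult zero_le_power)

text \<open>The two reflections of the parallelogram bring f1 and f2 to the place of f0, so
  \<open>quad_step\<close> acts on each; three squarings give the exponent 8.\<close>

lemma quad_duals:
 assumes P: "P > 0" and T: "finite \<T>" "\<T> ~= {}" and f: "good P f0" "good P f1" "good P f2" "good P f3"
 shows "\<exists>D0 D1 D2. good P D0 \<and> good P D1 \<and> good P D2 \<and> (norm (quad P \<T> A B f0 f1 f2 f3)) ^ 8 <= norm (quad P \<T> A B D0 D1 D2 f3)"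
proof -
 obtain D0 where D0: "good P D0" "(norm (quad P \<T> A B f0 f1 f2 f3))\<^sup>2 <= norm (quad P \<T> A B D0 f1 f2 f3)"
  using quad_step[OF P T f] by blast
 obtain D1 where D1: "good P D1" "(norm (quad P \<T> A B D0 f1 f2 f3))\<^sup>2 <= norm (quad P \<T> A B D0 D1 f2 f3)"
  using quad_step[OF P T f(2) D0(1) f(4) f(3), where A = "%\<tau>. - A \<tau>" and B = B]
   quad_flip1[OF P D0(1) f(2-4), of \<T> A B] quad_flip1[OF P D0(1) _ f(3-4), of _ \<T> A B] by metis
 obtain D2 where D2: "good P D2" "(norm (quad P \<T> A B D0 D1 f2 f3))\<^sup>2 <= norm (quad P \<T> A B D0 D1 D2 f3)"
  using quad_step[OF P T f(3) f(4) D0(1) D1(1), where A = A and B = "%\<tau>. - B \<tau>"]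
   quad_flip2[OF P D0(1) D1(1) f(3-4), of \<T> A B] quad_flip2[OF P D0(1) D1(1) _ f(4), of _ \<T> A B] by metis
 have "norm (quad P \<T> A B f0 f1 f2 f3) ^ (2 * 2) <= norm (quad P \<T> A B D0 D1 f2 f3)"
  by (rule power_le_trans[OF D0(2) D1(2)]) simp
 from power_le_trans[OF this D2(2)] show ?thesis using D0(1) D1(1) D2(1) by auto
qed

text \<open>With y = x + B \<tau> as base point, \<open>Yf\<close> is the part that varies with
  \<tau> beside D2. \<open>Rf\<close> is what accompanies D1 after the base point has been moved
  once more to make D1 free of \<tau>.\<close>

definition Yf where "Yf D0 D1 g A B (\<tau>::'t) y = D0 (y - B \<tau>) * D1 (y + A \<tau> - B \<tau>) * g (y + A \<tau>)"
 for D0 D1 g :: "int => complex" and A B :: "'t => int" and y :: int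

definition Rf where "Rf D0 D1 g A B (\<tau>::'t) \<tau>' z = D0 (z - A \<tau>) * g (z + B \<tau>) * cnj (Yf D0 D1 g A B \<tau>' (z + B \<tau> - A \<tau>))"
 for D0 D1 g :: "int => complex" and A B :: "'t => int" and z :: int

lemma good_shift3: "good P f ==> good P (%x. f (x + a - b))"
 using good_shift[of P f "a - b"] by (simp add: add_diff_eq)

lemma good_Yf: "good P D0 ==> good P D1 ==> good P g ==> good P (Yf D0 D1 g A B \<tau>)"
 unfolding Yf_def[abs_def] by (intro good_mult good_shift good_shift2 good_shift3)

lemma good_Rf: "good P D0 ==> good P D1 ==> good P g ==> good P (Rf D0 D1 g A B \<tau> \<tau>')"
 unfolding Rf_def[abs_def] by (intro good_mult good_cnj good_shift good_shift2 good_shift3[of P "Yf D0 D1 g A B \<tau>'"] good_Yf)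

text \<open>Two applications of Cauchy-Schwarz, removing D2 and then one copy of D1, duplicate
  \<tau> twice. Ten factors remain, four of them copies of g.\<close>

lemma quad_dup:
 assumes P: "P > 0" and T: "finite \<T>" "\<T> ~= {}" and f: "good P D0" "good P D1" "good P D2" "good P g"
 shows "(norm (quad P \<T> A B D0 D1 D2 g)) ^ 4 <= norm (av \<T> (%\<tau>. av \<T> (%\<tau>'. av \<T> (%\<rho>. av \<T> (%\<rho>'.
   av (zp P) (%z. Rf D0 D1 g A B \<tau> \<tau>' z * cnj (Rf D0 D1 g A B \<rho> \<rho>' z)))))))"
proof -
 let ?Y = "Yf D0 D1 g A B" and ?R = "Rf D0 D1 g A B"
 have gY: "good P (?Y \<tau>)" for \<tau> by (intro good_Yf f)
 have "quad P \<T> A B D0 D1 D2 g = av \<T> (%\<tau>. av (zp P) (%y. D2 y * ?Y \<tau> y))"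
  unfolding quad_def
 proof (rule av_cong1)
  fix \<tau>
  have "av (zp P) (%y. D2 y * ?Y \<tau> y) = av (zp P) (%y. D2 (y + B \<tau>) * ?Y \<tau> (y + B \<tau>))"
   by (rule av_shift[OF P, symmetric]) (use good_mult[OF f(3) gY] in "simp add: good_def")
  then show "av (zp P) (%x. D0 x * D1 (x + A \<tau>) * D2 (x + B \<tau>) * g (x + A \<tau> + B \<tau>)) = av (zp P) (%y. D2 y * ?Y \<tau> y)"
   by (simp add: Yf_def ac_simps)
 qed
 also have "... = av (zp P) (%y. D2 y * av \<T> (%\<tau>. ?Y \<tau> y))"
  by (subst av_swap) (simp only: av_mult_left)
 finally have "(norm (quad P \<T> A B D0 D1 D2 g))\<^sup>2 <= av (zp P) (%y. (norm (av \<T> (%\<tau>. ?Y \<tau> y)))\<^sup>2)"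
  by (simp only:) (rule av_kill, rule good_le[OF f(3)])
 also have "... = norm (complex_of_real (av (zp P) (%y. (norm (av \<T> (%\<tau>. ?Y \<tau> y)))\<^sup>2)))"
  using av_nonneg[of "zp P" "%y. (norm (av \<T> (%\<tau>. ?Y \<tau> y)))\<^sup>2"] by simp
 also have "complex_of_real (av (zp P) (%y. (norm (av \<T> (%\<tau>. ?Y \<tau> y)))\<^sup>2)) =
   av (zp P) (%y. av \<T> (%\<tau>. av \<T> (%\<tau>'. ?Y \<tau> y * cnj (?Y \<tau>' y))))"
  unfolding of_real_av av_norm_square ..
 also have "... = av \<T> (%\<tau>. av \<T> (%\<tau>'. av (zp P) (%y. ?Y \<tau> y * cnj (?Y \<tau>' y))))" by (rule av_rot3)
 also have "... = av \<T> (%\<tau>. av \<T> (%\<tau>'. av (zp P) (%z. D1 z * ?R \<tau> \<tau>' z)))"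
 proof (rule av_cong1, rule av_cong1)
  fix \<tau> \<tau>'
  have "av (zp P) (%y. ?Y \<tau> y * cnj (?Y \<tau>' y)) =
   av (zp P) (%z. ?Y \<tau> (z + (B \<tau> - A \<tau>)) * cnj (?Y \<tau>' (z + (B \<tau> - A \<tau>))))"
   by (rule av_shift[OF P, symmetric, of "%y. ?Y \<tau> y * cnj (?Y \<tau>' y)"])
     (use good_mult[OF gY good_cnj[OF gY]] in "simp add: good_def")
  also have "... = av (zp P) (%z. D1 z * ?R \<tau> \<tau>' z)"
   by (rule av_cong1) (simp add: Yf_def Rf_def algebra_simps)
  finally show "av (zp P) (%y. ?Y \<tau> y * cnj (?Y \<tau>' y)) = av (zp P) (%z. D1 z * ?R \<tau> \<tau>' z)" .
 qed
 also have "... = av (zp P) (%z. av \<T> (%\<tau>. av \<T> (%\<tau>'. D1 z * ?R \<tau> \<tau>' z)))" by (rule av_rot3[symmetric])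
 also have "... = av (zp P) (%z. D1 z * av (\<T> \<times> \<T>) (%\<omega>. ?R (fst \<omega>) (snd \<omega>) z))"
  unfolding av_Times by (simp add: av_mult_left)
 finally have 1: "(norm (quad P \<T> A B D0 D1 D2 g))\<^sup>2 <= norm (av (zp P) (%z. D1 z * av (\<T> \<times> \<T>) (%\<omega>. ?R (fst \<omega>) (snd \<omega>) z)))" .
 have "(norm (av (zp P) (%z. D1 z * av (\<T> \<times> \<T>) (%\<omega>. ?R (fst \<omega>) (snd \<omega>) z))))\<^sup>2 <=
  av (zp P) (%z. (norm (av (\<T> \<times> \<T>) (%\<omega>. ?R (fst \<omega>) (snd \<omega>) z)))\<^sup>2)"
  by (rule av_kill) (rule good_le[OF f(2)])
 also have "... = norm (complex_of_real (av (zp P) (%z. (norm (av (\<T> \<times> \<T>) (%\<omega>. ?R (fst \<omega>) (snd \<omega>) z)))\<^sup>2)))"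
  using av_nonneg[of "zp P" "%z. (norm (av (\<T> \<times> \<T>) (%\<omega>. ?R (fst \<omega>) (snd \<omega>) z)))\<^sup>2"] by simp
 also have "complex_of_real (av (zp P) (%z. (norm (av (\<T> \<times> \<T>) (%\<omega>. ?R (fst \<omega>) (snd \<omega>) z)))\<^sup>2)) =
   av (zp P) (%z. av (\<T> \<times> \<T>) (%\<omega>. av (\<T> \<times> \<T>) (%\<omega>'. ?R (fst \<omega>) (snd \<omega>) z * cnj (?R (fst \<omega>') (snd \<omega>') z))))"
  unfolding of_real_av av_norm_square ..
 also have "... = av (\<T> \<times> \<T>) (%\<omega>. av (\<T> \<times> \<T>) (%\<omega>'. av (zp P) (%z. ?R (fst \<omega>) (snd \<omega>) z * cnj (?R (fst \<omega>') (snd \<omega>') z))))"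
  by (rule av_rot3)
 finally have 2: "(norm (av (zp P) (%z. D1 z * av (\<T> \<times> \<T>) (%\<omega>. ?R (fst \<omega>) (snd \<omega>) z))))\<^sup>2 <= norm (av \<T> (%\<tau>. av \<T> (%\<tau>'. av \<T> (%\<rho>. av \<T> (%\<rho>'.
   av (zp P) (%z. ?R \<tau> \<tau>' z * cnj (?R \<rho> \<rho>' z)))))))"
  unfolding av_Times by simp
 from power_le_trans[OF 1 2] show ?thesis by simp
qed

text \<open>The pairs (l, p) belonging to \<tau>, \<tau>', \<rho>, \<rho>', nested in the way in
  which the averages produce them.\<close>

type_synonym par = "((int \<times> int) \<times> (int \<times> int)) \<times> ((int \<times> int) \<times> (int \<times> int))"

definition ip :: "par => par => int" where
 "ip c v = (case c of (((c1, c2), (c3, c4)), ((c5, c6), (c7, c8))) => case v of (((v1, v2), (v3, v4)), ((v5, v6), (v7, v8))) =>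
   c1 * v1 + c2 * v2 + c3 * v3 + c4 * v4 + c5 * v5 + c6 * v6 + c7 * v7 + c8 * v8)"

lemma ip_add: "ip c (v + w) = ip c v + ip c w"
proof -
 obtain c1 c2 c3 c4 c5 c6 c7 c8 where c: "c = (((c1, c2), (c3, c4)), ((c5, c6), (c7, c8)))" by (metis surj_pair)
 obtain v1 v2 v3 v4 v5 v6 v7 v8 where v: "v = (((v1, v2), (v3, v4)), ((v5, v6), (v7, v8)))" by (metis surj_pair)
 obtain w1 w2 w3 w4 w5 w6 w7 w8 where w: "w = (((w1, w2), (w3, w4)), ((w5, w6), (w7, w8)))" by (metis surj_pair)
 show ?thesis unfolding c v w ip_def by (simp add: algebra_simps)
qed

definition dir2 :: "nat => int => int => int => direction" where
 "dir2 S q \<alpha> \<beta> = (zp S \<times> zp S, %s. q * (\<alpha> * fst s + \<beta> * snd s))"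

abbreviation bx8 :: "int set => int set => par set" where
 "bx8 J1 J2 \<equiv> ((J1 \<times> J2) \<times> (J1 \<times> J2)) \<times> ((J1 \<times> J2) \<times> (J1 \<times> J2))"

lemma shiftok_bx8:
 assumes L: "L > 0"
 shows "shiftok (bx8 {j1..<j1 + int L} {j2..<j2 + int L}) (((s1, s2), (s3, s4)), ((s5, s6), (s7, s8)))
  (2 * (\<bar>s1\<bar> + \<bar>s2\<bar> + \<bar>s3\<bar> + \<bar>s4\<bar> + \<bar>s5\<bar> + \<bar>s6\<bar> + \<bar>s7\<bar> + \<bar>s8\<bar>) / real L)"
proof -
 let ?J1 = "{j1..<j1 + int L}" and ?J2 = "{j2..<j2 + int L}"
 have J: "finite ?J1" "?J1 ~= {}" "finite ?J2" "?J2 ~= {}" using L by auto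
 have 1: "shiftok (?J1 \<times> ?J2) (s, t) (2 * real_of_int \<bar>s\<bar> / real L + 2 * real_of_int \<bar>t\<bar> / real L)" for s t
  using shiftok_Times[OF shiftok_int[OF L] shiftok_int[OF L] J] by simp
 have 2: "shiftok ((?J1 \<times> ?J2) \<times> (?J1 \<times> ?J2)) ((s, t), (s', t')) ((2 * real_of_int \<bar>s\<bar> / real L + 2 * real_of_int \<bar>t\<bar> / real L) + (2 * real_of_int \<bar>s'\<bar> / real L + 2 * real_of_int \<bar>t'\<bar> / real L))" for s t s' t'
  by (rule shiftok_Times[OF 1 1]) (use J in auto)
 have "shiftok (bx8 ?J1 ?J2) (((s1, s2), (s3, s4)), ((s5, s6), (s7, s8)))
  (((2 * real_of_int \<bar>s1\<bar> / real L + 2 * real_of_int \<bar>s2\<bar> / real L) + (2 * real_of_int \<bar>s3\<bar> / real L + 2 * real_of_int \<bar>s4\<bar> / real L)) +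
   ((2 * real_of_int \<bar>s5\<bar> / real L + 2 * real_of_int \<bar>s6\<bar> / real L) + (2 * real_of_int \<bar>s7\<bar> / real L + 2 * real_of_int \<bar>s8\<bar> / real L)))"
  by (rule shiftok_Times[OF 2 2]) (use J in auto)
 then show ?thesis by (rule shiftok_mono) (simp add: add_divide_distrib algebra_simps)
qed

lemma gdir_dir2:
 assumes L: "L > 0" and S: "S > 0" and h: "good P h"
  and ip: "!!s. ip c (v s) = - (\<alpha> * fst s + \<beta> * snd s)"
  and v: "!!s. s \<in> zp S \<times> zp S ==> shiftok (bx8 {j1..<j1 + int L} {j2..<j2 + int L}) (v s) e"
 shows "gdir P (bx8 {j1..<j1 + int L} {j2..<j2 + int L}) e (dir2 S q \<alpha> \<beta>) v (%X \<pi>. h (X + q * ip c \<pi>))"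
 unfolding gdir_def dir2_def
proof (intro conjI ballI allI)
 fix s :: "int \<times> int" and x p
 have "x + q * (\<alpha> * fst s + \<beta> * snd s) + q * ip c (p + v s) = x + q * ip c p"
  unfolding ip_add ip by (simp add: algebra_simps)
 then have "h (x + q * (\<alpha> * fst s + \<beta> * snd s) + q * ip c (p + v s)) = h (x + q * ip c p)" by (rule arg_cong)
 then show "h (x + snd (zp S \<times> zp S, %s. q * (\<alpha> * fst s + \<beta> * snd s)) s + q * ip c (p + v s)) = h (x + q * ip c p)"
  by simp
next
 fix p show "per P (%x. h (x + q * ip c p))" using good_shift[OF h] by (simp add: good_def)
qed (use S v good_le[OF h] in auto)

text \<open>Entry i belongs to the i-th of the nine factors eliminated in \<open>conc_fixed\<close>:
  moving two suitable parameters by s displaces the argument of that factor by -q (\<alpha> s1 +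
  \<beta> s2). Repeated entries come from different factors with the same two coefficients.\<close>

definition conc_dirs :: "nat => int => int => int => int => int => (int \<times> int) list" where
 "conc_dirs S b a a' c c' = [(a, a + b), (a, a' + b), (a, a' + b), (a, - a'), (a + b, c), (a + b, - (c + b)), (a + b, c), (a + b, c), (a + b, c)]"

text \<open>With a, a', c, c' frozen all arguments are linear in the eight remaining parameters.
  Relative to one copy of g, each of the nine other factors is invariant under a two-parameter
  family of parameter changes compensated by a shift of X. Nine Gowers-Cauchy-Schwarz steps give the
  exponent 2^9 = 512 and the error 2^10 e.\<close>

lemma conc_fixed:
 fixes q b a a' c c' j1 j2 :: int
 assumes P: "P > 0" and L: "L > 0" and S: "S > 0" and f: "good P D0" "good P D1" "good P g"
 defines "A \<equiv> %\<tau>::int \<times> int \<times> int. q * (fst \<tau> * fst (snd \<tau>))" and "B \<equiv> %\<tau>::int \<times> int \<times> int. q * ((fst \<tau> + b) * snd (snd \<tau>))"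
 shows "(norm (av (bx8 {j1..<j1 + int L} {j2..<j2 + int L}) (%\<pi>. av (zp P) (%z.
   Rf D0 D1 g A B (a, fst (fst \<pi>)) (a', snd (fst \<pi>)) z * cnj (Rf D0 D1 g A B (c, fst (snd \<pi>)) (c', snd (snd \<pi>)) z))))) ^ 512
  <= Re (bv P (map (%(\<alpha>, \<beta>). dir2 S q \<alpha> \<beta>) (conc_dirs S b a a' c c')) g) + 4096 * real S / real L"
proof -
 let ?X = "bx8 {j1..<j1 + int L} {j2..<j2 + int L}"
 define e where "e = 4 * real S / real L"
 let ?z = "((0,0),(0,0)) :: (int \<times> int) \<times> (int \<times> int)"
 \<comment> \<open>\<open>c1\<close> to \<open>c9\<close> are the coefficient vectors of the nine
   arguments after z + q (a + b) p has become the base point X.\<close>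
 define c1 :: par where "c1 = (((-a, -(a+b)), (0,0)), ?z)"
 define c2 :: par where "c2 = (((-a, 0), (0, -(a'+b))), ?z)"
 define c3 :: par where "c3 = (((-a, 0), (a', -(a'+b))), ?z)"
 define c4 :: par where "c4 = (((-a, 0), (a', 0)), ?z)"
 define c5 :: par where "c5 = (((0, -(a+b)), (0, 0)), ((-c, 0), (0, 0)))"
 define c6 :: par where "c6 = (((0, -(a+b)), (0, 0)), ((0, c+b), (0, 0)))"
 define c7 :: par where "c7 = (((0, -(a+b)), (0, 0)), ((-c, c+b), (0, -(c'+b))))"
 define c8 :: par where "c8 = (((0, -(a+b)), (0, 0)), ((-c, c+b), (c', -(c'+b))))"
 define c9 :: par where "c9 = (((0, -(a+b)), (0, 0)), ((-c, c+b), (c', 0)))"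
 \<comment> \<open>Each \<open>v\<close> moves two parameters that enter the corresponding argument
   and fixes the other six.\<close>
 define v1 :: "int \<times> int => par" where "v1 = (%s. (((fst s, snd s), (0,0)), ?z))"
 define v2 :: "int \<times> int => par" where "v2 = (%s. (((fst s, 0), (0,snd s)), ?z))"
 define v4 :: "int \<times> int => par" where "v4 = (%s. (((fst s, 0), (snd s, 0)), ?z))"
 define v5 :: "int \<times> int => par" where "v5 = (%s. (((0, fst s), (0,0)), ((snd s, 0), (0,0))))"
 define v6 :: "int \<times> int => par" where "v6 = (%s. (((0, fst s), (0,0)), ((0, snd s), (0,0))))"
 note vdefs = v1_def v2_def v4_def v5_def v6_def and cdefs = c1_def c2_def c3_def c4_def c5_def c6_def c7_def c8_def c9_def
 define Bs where "Bs = [%X \<pi>. D0 (X + q * ip c1 \<pi>), %X \<pi>. cnj (D0 (X + q * ip c2 \<pi>)), %X \<pi>. cnj (D1 (X + q * ip c3 \<pi>)),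
  %X \<pi>. cnj (g (X + q * ip c4 \<pi>)), %X \<pi>. cnj (D0 (X + q * ip c5 \<pi>)), %X \<pi>. cnj (g (X + q * ip c6 \<pi>)),
  %X \<pi>. D0 (X + q * ip c7 \<pi>), %X \<pi>. D1 (X + q * ip c8 \<pi>), %X \<pi>. g (X + q * ip c9 \<pi>)]"
 define vs where "vs = [v1, v2, v2, v4, v5, v6, v5, v5, v5]"
 let ?ds = "map (%(\<alpha>, \<beta>). dir2 S q \<alpha> \<beta>) (conc_dirs S b a a' c c')"
 have vok: "shiftok ?X (v s) e" if "s \<in> zp S \<times> zp S" "v \<in> {v1, v2, v4, v5, v6}" for s v
 proof -
  have "2 * (real_of_int (fst s) + real_of_int (snd s)) / real L <= e"
   unfolding e_def by (rule divide_right_mono) (use that(1) in auto)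
  then show ?thesis using that
   by (auto simp: vdefs intro!: shiftok_mono[OF shiftok_bx8[OF L]])
 qed
 have gd: "gdir P ?X e (?ds ! i) (vs ! i) (Bs ! i)" if i: "i < 9" for i
 proof -
  note G = gdir_dir2[OF L S _ _ vok, where q = q]
  have h: "good P D0" "good P (%x. cnj (D0 x))" "good P D1" "good P (%x. cnj (D1 x))" "good P g" "good P (%x. cnj (g x))"
   by (intro good_cnj f)+
  have "i = 0 \<or> i = 1 \<or> i = 2 \<or> i = 3 \<or> i = 4 \<or> i = 5 \<or> i = 6 \<or> i = 7 \<or> i = 8" using i by auto
  then show ?thesis
   apply (elim disjE)
       apply (simp_all add: vs_def Bs_def conc_dirs_def)
       apply (rule G[OF h(1)]; simp add: vdefs cdefs ip_def split_beta algebra_simps)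
       apply (rule G[OF h(2)]; simp add: vdefs cdefs ip_def split_beta algebra_simps)
      apply (rule G[OF h(4)]; simp add: vdefs cdefs ip_def split_beta algebra_simps)
      apply (rule G[OF h(6)]; simp add: vdefs cdefs ip_def split_beta algebra_simps)
     apply (rule G[OF h(2)]; simp add: vdefs cdefs ip_def split_beta algebra_simps)
     apply (rule G[OF h(6)]; simp add: vdefs cdefs ip_def split_beta algebra_simps)
    apply (rule G[OF h(1)]; simp add: vdefs cdefs ip_def split_beta algebra_simps)
    apply (rule G[OF h(3)]; simp add: vdefs cdefs ip_def split_beta algebra_simps)
   apply (rule G[OF h(5)]; simp add: vdefs cdefs ip_def split_beta algebra_simps)
   done
 qed
 have "av ?X (%\<pi>. av (zp P) (%z. Rf D0 D1 g A B (a, fst (fst \<pi>)) (a', snd (fst \<pi>)) z * cnj (Rf D0 D1 g A B (c, fst (snd \<pi>)) (c', snd (snd \<pi>)) z))) =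
  av ?X (%\<pi>. av (zp P) (%X. g X * prod_list (map (%B. B X \<pi>) Bs)))"
 proof (rule av_cong1)
  fix \<pi> :: par
  obtain l p l' p' l2 p2 l3 p3 where pi: "\<pi> = (((l, p), (l', p')), ((l2, p2), (l3, p3)))" by (metis surj_pair)
  let ?Z = "%z. Rf D0 D1 g A B (a, fst (fst \<pi>)) (a', snd (fst \<pi>)) z * cnj (Rf D0 D1 g A B (c, fst (snd \<pi>)) (c', snd (snd \<pi>)) z)"
  have "av (zp P) ?Z = av (zp P) (%X. ?Z (X + - (q * ((a + b) * p))))"
   by (rule av_shift[OF P, symmetric]) (rule good_mult[OF good_Rf[OF f] good_cnj[OF good_Rf[OF f]], unfolded good_def, THEN conjunct1])
  also have "... = av (zp P) (%X. g X * prod_list (map (%B. B X \<pi>) Bs))"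
  proof (rule av_cong1)
   fix X
   let ?z = "X + - (q * ((a + b) * p))"
   have F: "D0 (?z - q * (a * l)) = D0 (X + q * ip c1 \<pi>)"
    "g (?z + q * ((a + b) * p)) = g X"
    "D0 (?z + q * ((a + b) * p) - q * (a * l) - q * ((a' + b) * p')) = D0 (X + q * ip c2 \<pi>)"
    "D1 (?z + q * ((a + b) * p) - q * (a * l) + q * (a' * l') - q * ((a' + b) * p')) = D1 (X + q * ip c3 \<pi>)"
    "g (?z + q * ((a + b) * p) - q * (a * l) + q * (a' * l')) = g (X + q * ip c4 \<pi>)"
    "D0 (?z - q * (c * l2)) = D0 (X + q * ip c5 \<pi>)"
    "g (?z + q * ((c + b) * p2)) = g (X + q * ip c6 \<pi>)"
    "D0 (?z + q * ((c + b) * p2) - q * (c * l2) - q * ((c' + b) * p3)) = D0 (X + q * ip c7 \<pi>)"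
    "D1 (?z + q * ((c + b) * p2) - q * (c * l2) + q * (c' * l3) - q * ((c' + b) * p3)) = D1 (X + q * ip c8 \<pi>)"
    "g (?z + q * ((c + b) * p2) - q * (c * l2) + q * (c' * l3)) = g (X + q * ip c9 \<pi>)"
    unfolding pi cdefs ip_def
    by (rule arg_cong[where f = D0] arg_cong[where f = D1] arg_cong[where f = g], simp add: algebra_simps)+
   show "?Z ?z = g X * prod_list (map (%B. B X \<pi>) Bs)"
    unfolding Bs_def Rf_def Yf_def A_def B_def pi fst_conv snd_conv
    unfolding F[unfolded pi] by (simp add: mult_ac)
  qed
  finally show "av (zp P) ?Z = av (zp P) (%X. g X * prod_list (map (%B. B X \<pi>) Bs))" .
 qed
 also have "... = av (zp P) (%X. av ?X (%\<pi>. g X * prod_list (map (%B. B X \<pi>) Bs)))" by (rule av_swap)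
 finally have eq: "av ?X (%\<pi>. av (zp P) (%z. Rf D0 D1 g A B (a, fst (fst \<pi>)) (a', snd (fst \<pi>)) z * cnj (Rf D0 D1 g A B (c, fst (snd \<pi>)) (c', snd (snd \<pi>)) z))) =
  av (zp P) (%X. av ?X (%\<pi>. g X * prod_list (map (%B. B X \<pi>) Bs)))" .
 have "(norm (av (zp P) (%X. av ?X (%\<pi>. g X * prod_list (map (%B. B X \<pi>) Bs))))) ^ (2 ^ length vs) <= Re (bv P ?ds g) + 2 ^ Suc (length vs) * e"
  by (rule gowers_cauchy_schwarz[OF P])
    (use L f gd in "auto simp: vs_def Bs_def conc_dirs_def good_def")
 then show ?thesis unfolding eq by (simp add: vs_def e_def)
qed

lemma av_pairs: "av (I \<times> J) (%\<tau>. av (I \<times> J) (%\<tau>'. h \<tau> \<tau>')) = av (I \<times> I) (%\<alpha>. av (J \<times> J) (%\<pi>. h (fst \<alpha>, fst \<pi>) (snd \<alpha>, snd \<pi>)))"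
 unfolding av_Times fst_conv snd_conv by (rule av_cong1) (rule av_swap)

text \<open>The exponent is 8 * 4 * 512, from \<open>quad_duals\<close>, \<open>quad_dup\<close> and
  \<open>conc_fixed\<close>. The windows start anywhere because they stem from differences l - l'
  and p - p' with the second member frozen.\<close>

lemma double_concatenation:
 fixes b q j1 j2 :: int
 assumes P: "P > 0" and L: "L > 0" and S: "S > 0" and g: "good P g" and I: "finite I" "I ~= {}"
 defines "A \<equiv> %\<tau>::int \<times> int \<times> int. q * (fst \<tau> * fst (snd \<tau>))" and "B \<equiv> %\<tau>::int \<times> int \<times> int. q * ((fst \<tau> + b) * snd (snd \<tau>))"
 assumes big: "\<epsilon> <= norm (quad P (I \<times> {j1..<j1 + int L} \<times> {j2..<j2 + int L}) A B g (%x. cnj (g x)) (%x. cnj (g x)) g)" and e0: "0 <= \<epsilon>"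
 shows "\<epsilon> ^ 16384 <= av ((I \<times> I) \<times> (I \<times> I)) (%\<alpha>. Re (bv P (map (%(\<alpha>, \<beta>). dir2 S q \<alpha> \<beta>)
   (conc_dirs S b (fst (fst \<alpha>)) (snd (fst \<alpha>)) (fst (snd \<alpha>)) (snd (snd \<alpha>)))) g)) + 4096 * real S / real L"
proof -
 let ?J = "{j1..<j1 + int L} \<times> {j2..<j2 + int L}"
 let ?T = "I \<times> ?J"
 have T: "finite ?T" "?T ~= {}" using I L by auto
 obtain D0 D1 D2 where D: "good P D0" "good P D1" "good P D2"
  and 1: "(norm (quad P ?T A B g (%x. cnj (g x)) (%x. cnj (g x)) g)) ^ 8 <= norm (quad P ?T A B D0 D1 D2 g)"
  using quad_duals[OF P T g good_cnj[OF g] good_cnj[OF g] g, of A B] by blast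
 let ?h = "%\<tau> \<tau>' \<rho> \<rho>'. av (zp P) (%z. Rf D0 D1 g A B \<tau> \<tau>' z * cnj (Rf D0 D1 g A B \<rho> \<rho>' z))"
 define Z where "Z \<alpha> = av (bx8 {j1..<j1 + int L} {j2..<j2 + int L}) (%\<pi>.
   ?h (fst (fst \<alpha>), fst (fst \<pi>)) (snd (fst \<alpha>), snd (fst \<pi>)) (fst (snd \<alpha>), fst (snd \<pi>)) (snd (snd \<alpha>), snd (snd \<pi>)))" for \<alpha> :: "(int \<times> int) \<times> (int \<times> int)"
 have "av ?T (%\<tau>. av ?T (%\<tau>'. av ?T (%\<rho>. av ?T (%\<rho>'. ?h \<tau> \<tau>' \<rho> \<rho>')))) = av ((I \<times> I) \<times> (I \<times> I)) Z"
 proof -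
  have "av ?T (%\<tau>. av ?T (%\<tau>'. av ?T (%\<rho>. av ?T (%\<rho>'. ?h \<tau> \<tau>' \<rho> \<rho>')))) =
   av (I \<times> I) (%\<alpha>. av (?J \<times> ?J) (%\<pi>. av (I \<times> I) (%\<beta>. av (?J \<times> ?J) (%\<psi>. ?h (fst \<alpha>, fst \<pi>) (snd \<alpha>, snd \<pi>) (fst \<beta>, fst \<psi>) (snd \<beta>, snd \<psi>)))))"
   unfolding av_pairs ..
  also have "... = av (I \<times> I) (%\<alpha>. av (I \<times> I) (%\<beta>. av (?J \<times> ?J) (%\<pi>. av (?J \<times> ?J) (%\<psi>. ?h (fst \<alpha>, fst \<pi>) (snd \<alpha>, snd \<pi>) (fst \<beta>, fst \<psi>) (snd \<beta>, snd \<psi>)))))"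
   by (rule av_cong1) (rule av_swap)
  also have "... = av ((I \<times> I) \<times> (I \<times> I)) Z"
   unfolding av_Times[of "I \<times> I" "I \<times> I"] Z_def av_Times[of "?J \<times> ?J" "?J \<times> ?J"] by simp
  finally show ?thesis .
 qed
 then have 2: "(norm (quad P ?T A B D0 D1 D2 g)) ^ 4 <= norm (av ((I \<times> I) \<times> (I \<times> I)) Z)"
  using quad_dup[OF P T D g, of A B] by simp
 have 3: "(norm (av ((I \<times> I) \<times> (I \<times> I)) Z)) ^ 512 <= av ((I \<times> I) \<times> (I \<times> I)) (%\<alpha>. norm (Z \<alpha>) ^ 512)"
 proof -
  have "(norm (av ((I \<times> I) \<times> (I \<times> I)) Z)) ^ 512 <= (av ((I \<times> I) \<times> (I \<times> I)) (%\<alpha>. norm (Z \<alpha>))) ^ 512"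
   by (rule power_mono[OF norm_av_le]) simp
  also have "... <= av ((I \<times> I) \<times> (I \<times> I)) (%\<alpha>. norm (Z \<alpha>) ^ 512)"
   using av_power_le[of "(I \<times> I) \<times> (I \<times> I)" "%\<alpha>. norm (Z \<alpha>)" 9] by simp
  finally show ?thesis .
 qed
 have "\<epsilon> ^ 8 <= norm (quad P ?T A B D0 D1 D2 g)"
  by (rule order_trans[OF power_mono[OF big e0] 1])
 from power_le_trans[OF this 2] have "\<epsilon> ^ 32 <= norm (av ((I \<times> I) \<times> (I \<times> I)) Z)" using e0 by simp
 from power_le_trans[OF this 3] have "\<epsilon> ^ 16384 <= av ((I \<times> I) \<times> (I \<times> I)) (%\<alpha>. norm (Z \<alpha>) ^ 512)" using e0 by simp
 also have "... <= av ((I \<times> I) \<times> (I \<times> I)) (%\<alpha>. Re (bv P (map (%(\<alpha>, \<beta>). dir2 S q \<alpha> \<beta>)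
   (conc_dirs S b (fst (fst \<alpha>)) (snd (fst \<alpha>)) (fst (snd \<alpha>)) (snd (snd \<alpha>)))) g) + 4096 * real S / real L)"
  unfolding Z_def A_def B_def by (rule av_mono) (rule conc_fixed[OF P L S D(1,2) g])
 also have "... = av ((I \<times> I) \<times> (I \<times> I)) (%\<alpha>. Re (bv P (map (%(\<alpha>, \<beta>). dir2 S q \<alpha> \<beta>)
   (conc_dirs S b (fst (fst \<alpha>)) (snd (fst \<alpha>)) (fst (snd \<alpha>)) (snd (snd \<alpha>)))) g)) + 4096 * real S / real L"
  unfolding av_add using I by (simp add: av_const)
 finally show ?thesis .
qed

section \<open>Equidistribution of generic linear forms\<close>

lemma card_residue_class:
 fixes m :: int
 assumes m: "m > 0"
 shows "real (card {x \<in> {a..<a + int n}. m dvd x - c}) <= real n / real_of_int m + 1"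
proof (cases "{x \<in> {a..<a + int n}. m dvd x - c} = {}")
 case False
 let ?A = "{x \<in> {a..<a + int n}. m dvd x - c}"
 have inj: "inj_on (%x. (x - c) div m) ?A"
  by (rule inj_onI) (use m in "auto simp: dvd_def")
 have "real (card ((%x. (x - c) div m) ` ?A)) <= real_of_int (a + int n - c) / m - real_of_int (a - c) / m + 1"
 proof (rule card_int_interval)
  fix y assume "y \<in> (%x. (x - c) div m) ` ?A"
  then obtain x where x: "a <= x" "x < a + int n" "m dvd x - c" and y: "y = (x - c) div m" by auto
  have "real_of_int y = real_of_int (x - c) / real_of_int m" using x(3) y by (simp add: real_of_int_div)
  then show "real_of_int (a - c) / m <= of_int y \<and> of_int y <= real_of_int (a + int n - c) / m"
   using x m by (auto intro!: divide_right_mono)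
 next
  show "finite ((%x. (x - c) div m) ` ?A)" by (rule finite_imageI, rule finite_subset[of _ "{a..<a + int n}"]) auto
 qed (use False in auto)
 also have "... = real n / real_of_int m + 1" by (simp add: diff_divide_distrib[symmetric])
 finally show ?thesis unfolding card_image[OF inj] .
next
 case True
 then show ?thesis unfolding True using m by simp
qed

text \<open>The first coordinate determines the second, and the first coordinates of two solutions
  differ by a multiple of |\<beta>| / gcd.\<close>

lemma card_linear_fibre:
 fixes \<alpha> \<beta> u :: int
 assumes b: "\<beta> ~= 0"
 shows "real (card {s \<in> zp S \<times> zp S. \<alpha> * fst s + \<beta> * snd s = u}) <= real S * real_of_int (gcd \<alpha> \<beta>) / \<bar>real_of_int \<beta>\<bar> + 1"
proof (cases "{s \<in> zp S \<times> zp S. \<alpha> * fst s + \<beta> * snd s = u} = {}")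
 case False
 let ?E = "{s \<in> zp S \<times> zp S. \<alpha> * fst s + \<beta> * snd s = u}"
 obtain s0 where s0: "s0 \<in> ?E" using False by blast
 define g where "g = gcd \<alpha> \<beta>"
 define m where "m = \<bar>\<beta>\<bar> div g"
 have g: "g > 0" "g dvd \<beta>" "g dvd \<alpha>" using b by (auto simp: g_def)
 have m: "m > 0" unfolding m_def using g b by (simp add: pos_imp_zdiv_pos_iff zdvd_imp_le)
 have mg: "\<bar>\<beta>\<bar> = m * g" unfolding m_def using g by simp
 have inj: "inj_on fst ?E"
  by (rule inj_onI) (use b in "auto simp: prod_eq_iff")
 have "fst ` ?E \<subseteq> {x \<in> {0..<0 + int S}. m dvd x - fst s0}"
 proof
  fix x assume "x \<in> fst ` ?E"
  then obtain s where s: "s \<in> ?E" "x = fst s" by auto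
  have "\<alpha> * (x - fst s0) = \<beta> * (snd s0 - snd s)" using s s0 by (auto simp: algebra_simps)
  then have "\<beta> dvd \<alpha> * (x - fst s0)" by simp
  then have "m * g dvd \<alpha> * (x - fst s0)" using mg by (metis abs_dvd_iff)
  moreover have "\<alpha> * (x - fst s0) = (\<alpha> div g) * (x - fst s0) * g" using g(3) by (metis dvd_mult_div_cancel mult.assoc mult.commute)
  ultimately have "m * g dvd (\<alpha> div g) * (x - fst s0) * g" by simp
  then have "m dvd (\<alpha> div g) * (x - fst s0)" using g(1) by (subst (asm) dvd_mult_cancel_right) simp
  moreover have "coprime m (\<alpha> div g)"
  proof -
   have "coprime (\<alpha> div g) (\<beta> div g)" unfolding g_def by (rule div_gcd_coprime) (use b in auto)
   moreover have "m = \<bar>\<beta> div g\<bar>" unfolding m_def using g by (auto elim!: dvdE simp: abs_mult)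
   ultimately show ?thesis by (simp add: coprime_commute)
  qed
  ultimately have "m dvd x - fst s0" by (simp add: coprime_dvd_mult_right_iff)
  then show "x \<in> {x \<in> {0..<0 + int S}. m dvd x - fst s0}" using s by auto
 qed
 then have "card (fst ` ?E) <= card {x \<in> {0..<0 + int S}. m dvd x - fst s0}"
  by (rule card_mono[rotated]) (rule finite_subset[of _ "{0..<0 + int S}"], auto)
 then have "real (card ?E) <= real S / real_of_int m + 1"
  using card_residue_class[OF m, of 0 S "fst s0"] unfolding card_image[OF inj] by linarith
 also have "real_of_int m = \<bar>real_of_int \<beta>\<bar> / real_of_int g"
 proof -
  have "\<bar>real_of_int \<beta>\<bar> = real_of_int m * real_of_int g" using mg by (metis of_int_abs of_int_mult)
  then show ?thesis using g by simp
 qed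
 finally show ?thesis by (simp add: g_def)
next
 case True
 then show ?thesis unfolding True using b by simp
qed

text \<open>Non-degeneracy of a pair of coefficients: \<beta> of nearly maximal size and a small gcd
  keep every fibre of \<alpha> s + \<beta> s' short.\<close>

definition spread :: "nat => real => int \<times> int => bool" where
 "spread H K p \<longleftrightarrow> \<bar>fst p\<bar> <= 2 * int H \<and> \<bar>snd p\<bar> <= 2 * int H \<and> real H <= K * \<bar>real_of_int (snd p)\<bar> \<and> real_of_int (gcd (fst p) (snd p)) <= K"

text \<open>Each value is taken at most 2 S K^2 / H times among S^2 pairs, and the interval has 16 H
  S + 1 \<le> 17 H S points; hence 34 K^2. As \<phi> is nonnegative, the distribution of the form
  may be replaced by a uniform one in which \<alpha>, \<beta> and w no longer occur.\<close>

lemma av_linear_majorise: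
 fixes \<phi> :: "int => real"
 assumes sp: "spread H K (\<alpha>, \<beta>)" and K: "1 <= K" and H: "0 < H" "H <= S" and w: "\<bar>w\<bar> <= 4 * int H * int S" and phi: "!!u. 0 <= \<phi> u"
 shows "av (zp S \<times> zp S) (%s. \<phi> (\<alpha> * fst s + \<beta> * snd s + w)) <= 34 * K\<^sup>2 * av {- (8 * int H * int S)..8 * int H * int S} \<phi>"
proof -
 let ?V = "{- (8 * int H * int S)..8 * int H * int S}"
 let ?h = "%s :: int \<times> int. \<alpha> * fst s + \<beta> * snd s + w"
 have S: "S > 0" using H by simp
 have b: "\<beta> ~= 0" using sp H K by (auto simp: spread_def)
 have rng: "?h ` (zp S \<times> zp S) \<subseteq> ?V"
 proof
  fix y assume "y \<in> ?h ` (zp S \<times> zp S)"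
  then obtain s where s: "s \<in> zp S \<times> zp S" "y = ?h s" by auto
  have "\<bar>\<alpha> * fst s\<bar> <= 2 * int H * int S" "\<bar>\<beta> * snd s\<bar> <= 2 * int H * int S"
   unfolding abs_mult using sp s by (auto simp: spread_def intro!: mult_mono)
  then show "y \<in> ?V" using w s(2) by auto
 qed
 define N where "N u = real (card {s \<in> zp S \<times> zp S. ?h s = u})" for u
 have N: "N u <= 2 * real S * K\<^sup>2 / real H" for u
 proof -
  have "N u = real (card {s \<in> zp S \<times> zp S. \<alpha> * fst s + \<beta> * snd s = u - w})"
   unfolding N_def by (rule arg_cong[where f = "%X. real (card X)"]) auto
  also have "... <= real S * real_of_int (gcd \<alpha> \<beta>) / \<bar>real_of_int \<beta>\<bar> + 1" by (rule card_linear_fibre[OF b])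
  also have "real S * real_of_int (gcd \<alpha> \<beta>) / \<bar>real_of_int \<beta>\<bar> <= real S * K / (real H / K)"
  proof (rule frac_le)
   show "real H / K <= \<bar>real_of_int \<beta>\<bar>" using sp K by (simp add: spread_def field_simps)
   show "real S * real_of_int (gcd \<alpha> \<beta>) <= real S * K" using sp by (intro mult_left_mono) (auto simp: spread_def)
  qed (use K H in auto)
  also have "1 <= real S * K\<^sup>2 / real H"
  proof -
   have "real H * 1 <= real S * K\<^sup>2" using H K by (intro mult_mono) auto
   then show ?thesis using H by simp
  qed
  finally show ?thesis using H by (simp add: power2_eq_square mult_ac)
 qed
 have "(\<Sum>s\<in>zp S \<times> zp S. \<phi> (?h s)) = (\<Sum>u\<in>?h ` (zp S \<times> zp S). \<Sum>s\<in>{s \<in> zp S \<times> zp S. ?h s = u}. \<phi> (?h s))"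
  by (rule sum.image_gen) simp
 also have "... = (\<Sum>u\<in>?h ` (zp S \<times> zp S). N u * \<phi> u)"
  by (rule sum.cong) (auto simp: N_def)
 also have "... <= (\<Sum>u\<in>?V. N u * \<phi> u)"
  by (rule sum_mono2) (use rng phi in "auto simp: N_def")
 also have "... <= (\<Sum>u\<in>?V. 2 * real S * K\<^sup>2 / real H * \<phi> u)"
  by (intro sum_mono mult_right_mono N phi)
 also have "... = 2 * real S * K\<^sup>2 / real H * sum \<phi> ?V" by (simp add: sum_distrib_left)
 finally have 1: "(\<Sum>s\<in>zp S \<times> zp S. \<phi> (?h s)) <= 2 * real S * K\<^sup>2 / real H * sum \<phi> ?V" .
 have cV: "real (card ?V) = 16 * (real H * real S) + 1" by simp
 have s0: "0 <= sum \<phi> ?V" by (intro sum_nonneg phi)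
 have hs: "1 <= real H * real S" using mult_mono[of 1 "real H" 1 "real S"] H S by simp
 have "av (zp S \<times> zp S) (%s. \<phi> (?h s)) = (\<Sum>s\<in>zp S \<times> zp S. \<phi> (?h s)) / (real S * real S)"
  by (simp add: av_def card_cartesian_product)
 also have "... <= (2 * real S * K\<^sup>2 / real H * sum \<phi> ?V) / (real S * real S)"
  by (intro divide_right_mono 1) auto
 also have "... = 2 * K\<^sup>2 * sum \<phi> ?V / (real H * real S)" using S by (simp add: field_simps)
 also have "... <= 2 * K\<^sup>2 * sum \<phi> ?V * (17 / (16 * (real H * real S) + 1))"
 proof -
  have "1 / (real H * real S) <= 17 / (16 * (real H * real S) + 1)"
   using hs by (simp add: divide_simps)
  from mult_left_mono[OF this, of "2 * K\<^sup>2 * sum \<phi> ?V"] s0 show ?thesis by simp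
 qed
 also have "... = 34 * K\<^sup>2 * av ?V \<phi>" unfolding av_def cV by simp
 finally show ?thesis .
qed

text \<open>Iterated multiplicative derivatives with all steps from one fixed set; the final mean is
  replaced by a functional \<Phi> so that the innermost part can be analysed on its own.\<close>

fun ua :: "int => int set => nat => ((int => complex) => real) => (int => complex) => real" where
 "ua q U 0 \<Phi> T = \<Phi> T"
| "ua q U (Suc n) \<Phi> T = av U (%h. ua q U n \<Phi> (%x. T (x + q * h) * cnj (T x)))"

lemma good_diff: "good P T ==> good P (%x. T (x + a) * cnj (T x))"
 by (intro good_mult good_cnj good_shift)

lemma ua_nonneg: "(!!T. 0 <= \<Phi> T) ==> 0 <= ua q U n \<Phi> T"
 by (induction n arbitrary: T) (auto intro!: av_nonneg)

lemma bv_shift: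
 assumes P: "P > 0" shows "per P T ==> bv P ds (%x. T (x + c)) = bv P ds T"
proof (induction ds arbitrary: T)
 case Nil then show ?case using av_shift[OF P] by simp
next
 case (Cons d ds)
 obtain S \<delta> where d: "d = (S, \<delta>)" by force
 have "bv P ds (%x. T (x + \<delta> s + c) * cnj (T (x + \<delta> s' + c))) = bv P ds (%x. T (x + \<delta> s) * cnj (T (x + \<delta> s')))" for s s'
  using Cons.IH[of "%x. T (x + \<delta> s) * cnj (T (x + \<delta> s'))"] Cons.prems
  by (simp add: per_times per_cnj per_shift add_ac)
 then show ?case by (simp add: d)
qed

text \<open>Translation invariance turns the two shifts into one step \<open>?l s - ?l s'\<close>;
  with s' frozen its distribution is majorised by the uniform one, at a factor 34 K^2 per
  direction.\<close>

lemma bv_le_ua: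
 assumes P: "P > 0" and K: "1 <= K" and H: "0 < H" "H <= S"
 shows "(!!p. p \<in> set l ==> spread H K p) ==> good P T ==>
  norm (bv P (map (%(\<alpha>, \<beta>). dir2 S q \<alpha> \<beta>) l) T) <= (34 * K\<^sup>2) ^ length l * ua q {- (8 * int H * int S)..8 * int H * int S} (length l) (%T. norm (av (zp P) T)) T"
proof (induction l arbitrary: T)
 case (Cons p l)
 obtain \<alpha> \<beta> where p: "p = (\<alpha>, \<beta>)" by force
 let ?ds = "map (%(\<alpha>, \<beta>). dir2 S q \<alpha> \<beta>) l" and ?V = "{- (8 * int H * int S)..8 * int H * int S}"
 let ?C = "(34 * K\<^sup>2) ^ length l"
 let ?l = "%s::int \<times> int. \<alpha> * fst s + \<beta> * snd s"
 define \<phi> where "\<phi> h = ua q ?V (length l) (%T. norm (av (zp P) T)) (%x. T (x + q * h) * cnj (T x))" for h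
 have phi: "0 <= \<phi> h" for h unfolding \<phi>_def by (rule ua_nonneg) simp
 have sp: "spread H K (\<alpha>, \<beta>)" using Cons.prems(1) p by auto
 have T: "per P T" using Cons.prems(2) by (simp add: good_def)
 have IH: "norm (bv P ?ds (%x. T (x + q * ?l s) * cnj (T (x + q * ?l s')))) <= ?C * \<phi> (?l s + - ?l s')" for s s'
 proof -
  have "per P (%x. T (x + q * (?l s + - ?l s')) * cnj (T x))" by (intro per_times per_cnj per_shift T)
  from bv_shift[OF P this, of ?ds "q * ?l s'"]
  have "bv P ?ds (%x. T (x + q * ?l s) * cnj (T (x + q * ?l s'))) =
   bv P ?ds (%x. T (x + q * (?l s + - ?l s')) * cnj (T x))"
   by (simp add: algebra_simps)
  then show ?thesis unfolding \<phi>_def using Cons by (simp add: good_diff)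
 qed
 have w: "\<bar>- ?l s\<bar> <= 4 * int H * int S" if "s \<in> zp S \<times> zp S" for s
 proof -
  have "\<bar>\<alpha> * fst s\<bar> <= 2 * int H * int S" "\<bar>\<beta> * snd s\<bar> <= 2 * int H * int S"
   unfolding abs_mult using sp that by (auto simp: spread_def intro!: mult_mono)
  then show ?thesis by linarith
 qed
 have "norm (bv P (map (%(\<alpha>, \<beta>). dir2 S q \<alpha> \<beta>) (p # l)) T) <=
  av (zp S \<times> zp S) (%s. av (zp S \<times> zp S) (%s'. norm (bv P ?ds (%x. T (x + q * ?l s) * cnj (T (x + q * ?l s'))))))"
  by (simp add: p dir2_def) (rule order_trans[OF norm_av_le], rule av_mono, rule norm_av_le)
 also have "... <= av (zp S \<times> zp S) (%s. av (zp S \<times> zp S) (%s'. ?C * \<phi> (?l s + - ?l s')))"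
  by (intro av_mono IH)
 also have "... = av (zp S \<times> zp S) (%s'. av (zp S \<times> zp S) (%s. ?C * \<phi> (?l s + - ?l s')))" by (rule av_swap)
 also have "... <= av (zp S \<times> zp S) (%s'. ?C * (34 * K\<^sup>2 * av ?V \<phi>))"
  unfolding av_mult_left[where c = ?C] by (intro av_mono mult_left_mono av_linear_majorise[OF sp K H w phi]) auto
 also have "... = (34 * K\<^sup>2) ^ Suc (length l) * av ?V \<phi>" using H by (simp add: av_const zp_ne)
 finally show ?case unfolding \<phi>_def[abs_def] by simp
qed simp

lemma av_small:
 assumes H: "0 < H" and K: "1 <= K" "K <= real H"
 shows "av {a..<a + int H} (%y. of_bool (K * \<bar>real_of_int (y + c)\<bar> < real H)) <= 3 / K"
proof -
 let ?E = "{y \<in> {a..<a + int H}. K * \<bar>real_of_int (y + c)\<bar> < real H}"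
 have "real (card ?E) <= 3 * real H / K"
 proof (cases "?E = {}")
  case False
  have "real (card ?E) <= (real H / K - c) - (- (real H / K) - c) + 1"
  proof (rule card_int_interval)
   fix x assume "x \<in> ?E"
   then have "\<bar>real_of_int (x + c)\<bar> < real H / K" using K by (simp add: field_simps)
   then show "- (real H / K) - c <= of_int x \<and> of_int x <= real H / K - c" by auto
  next
   show "finite ?E" by (rule finite_subset[of _ "{a..<a + int H}"]) auto
  qed (use False in auto)
  moreover have "1 <= real H / K" using K by simp
  ultimately show ?thesis by linarith
 next
  case True
  then show ?thesis unfolding True using K by simp
 qed
 then show ?thesis using H by (simp add: av_of_bool divide_le_eq)
qed

lemma sum_inverse_squares_tail: "1 <= k ==> (\<Sum>g\<in>{k<..n}. 1 / (real g)\<^sup>2) <= 1 / real k"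
proof -
 assume k: "1 <= k"
 have "(\<Sum>g\<in>{k<..n}. 1 / (real g)\<^sup>2) <= 1 / real k - 1 / real n" if "k <= n"
  using that
 proof (induction n rule: dec_induct)
  case (step n)
  have "{k<..Suc n} = insert (Suc n) {k<..n}" using step by auto
  moreover have "1 / (real (Suc n))\<^sup>2 <= 1 / real n - 1 / real (Suc n)"
  proof -
   have "1 / (real (Suc n))\<^sup>2 <= 1 / (real n * real (Suc n))"
    unfolding power2_eq_square by (rule divide_left_mono) (use step k in "auto intro!: mult_right_mono mult_pos_pos")
   also have "... = 1 / real n - 1 / real (Suc n)" using step k by (simp add: field_simps)
   finally show ?thesis .
  qed
  ultimately show ?case using step by simp
 qed simp
 then show ?thesis by (cases "k <= n") (auto intro: order_trans)
qed

text \<open>A large gcd is a common divisor g beyond the floor of K, and g divides both coordinates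
  for at most (3 H / g)^2 pairs; summing over g gives a tail of inverse squares. The condition x
  \<noteq> 0 keeps g below 2 H, where the count 3 H / g is valid.\<close>

lemma av_gcd_large:
 assumes H: "0 < H" and K: "1 <= K" and I: "{a..<a + int H} \<subseteq> {- (2 * int H)..2 * int H}"
 shows "av {a..<a + int H} (%x. av {b..<b + int H} (%y. of_bool (K < real_of_int (gcd x y) \<and> x ~= 0))) <= 18 / K"
proof -
 let ?I = "{a..<a + int H}" and ?J = "{b..<b + int H}"
 define k where "k = nat \<lfloor>K\<rfloor>"
 have k1: "1 <= k" using K by (simp add: k_def le_nat_floor)
 have rk: "real k = of_int \<lfloor>K\<rfloor>" unfolding k_def using K by simp
 have "K < real k + 1" unfolding rk by linarith
 moreover have "1 <= real k" using k1 by simp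
 ultimately have "K <= 2 * real k" by linarith
 moreover have "real k <= K" unfolding rk by linarith
 ultimately have k: "1 <= k" "real k <= K" "K <= 2 * real k" using k1 by auto
 define M where "M A g = {x \<in> A. int g dvd x}" for A and g :: nat
 have fM: "finite (M {c..<d} g)" for c d g unfolding M_def by (rule finite_subset[of _ "{c..<d}"]) auto
 have cM: "real (card (M {c..<c + int H} g)) <= 3 * real H / real g" if g: "g \<in> {k<..2 * H}" for c g
 proof -
  have "real (card (M {c..<c + int H} g)) <= real H / real g + 1"
   using card_residue_class[of "int g" c H 0] g unfolding M_def by simp
  also have "1 <= 2 * real H / real g" using g by simp
  finally show ?thesis by (simp add: field_simps)
 qed
 let ?B = "{p \<in> ?I \<times> ?J. K < real_of_int (gcd (fst p) (snd p)) \<and> fst p ~= 0}"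
 have "?B \<subseteq> (\<Union>g\<in>{k<..2 * H}. M ?I g \<times> M ?J g)"
 proof
  fix p assume p: "p \<in> ?B"
  define g where "g = nat (gcd (fst p) (snd p))"
  have ig: "int g = gcd (fst p) (snd p)" by (simp add: g_def)
  then have "real k < real g" using p k by (metis (no_types, lifting) le_less_trans mem_Collect_eq of_int_of_nat_eq)
  moreover have "int g <= \<bar>fst p\<bar>" unfolding ig using p by (simp add: gcd_le1_int zdvd_imp_le)
  moreover have "\<bar>fst p\<bar> <= 2 * int H"
  proof -
   have "fst p \<in> {- (2 * int H)..2 * int H}" using p I by (auto simp: subset_iff)
   then show ?thesis by auto
  qed
  ultimately have "g \<in> {k<..2 * H}" by auto
  moreover have "p \<in> M ?I g \<times> M ?J g" using p by (auto simp: M_def ig mem_Times_iff)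
  ultimately show "p \<in> (\<Union>g\<in>{k<..2 * H}. M ?I g \<times> M ?J g)" by blast
 qed
 then have "card ?B <= card (\<Union>g\<in>{k<..2 * H}. M ?I g \<times> M ?J g)"
  by (rule card_mono[rotated]) (auto intro!: fM)
 also have "... <= (\<Sum>g\<in>{k<..2 * H}. card (M ?I g \<times> M ?J g))" by (rule card_UN_le) simp
 finally have "real (card ?B) <= (\<Sum>g\<in>{k<..2 * H}. real (card (M ?I g)) * real (card (M ?J g)))"
  by (simp add: card_cartesian_product flip: of_nat_mult of_nat_sum)
 also have "... <= (\<Sum>g\<in>{k<..2 * H}. (3 * real H / real g) * (3 * real H / real g))"
  by (intro sum_mono mult_mono cM) auto
 also have "... = 9 * (real H)\<^sup>2 * (\<Sum>g\<in>{k<..2 * H}. 1 / (real g)\<^sup>2)"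
  by (simp add: sum_distrib_left power2_eq_square)
 also have "... <= 9 * (real H)\<^sup>2 * (1 / real k)"
  by (intro mult_left_mono sum_inverse_squares_tail k) simp
 also have "... <= 9 * (real H)\<^sup>2 * (2 / K)"
  using k by (intro mult_left_mono) (auto simp: field_simps)
 finally have 1: "real (card ?B) <= 18 * (real H)\<^sup>2 / K" by simp
 have "av ?I (%x. av ?J (%y. of_bool (K < real_of_int (gcd x y) \<and> x ~= 0))) =
  av (?I \<times> ?J) (%p. of_bool (K < real_of_int (gcd (fst p) (snd p)) \<and> fst p ~= 0))"
  by (simp add: av_Times)
 also have "... = real (card ?B) / (real H)\<^sup>2"
  by (simp add: av_of_bool card_cartesian_product power2_eq_square)
 also have "... <= (18 * (real H)\<^sup>2 / K) / (real H)\<^sup>2" by (intro divide_right_mono 1) simp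
 finally show ?thesis using H by simp
qed

lemma av_shift_interval: "av {a..<b::int} (%x. f (x + c)) = av {a + c..<b + c} f"
proof -
 have "bij_betw (%x. x + c) {a..<b} {a + c..<b + c}"
  by (rule bij_betw_byWitness[where f' = "%x. x - c"]) auto
 from av_reindex[OF this, of f] show ?thesis by simp
qed

text \<open>The case x = 0, left out of the gcd term, is covered by the first indicator since H >
  0.\<close>

lemma not_spread_le:
 assumes "\<bar>x\<bar> <= 2 * int H" "\<bar>y\<bar> <= 2 * int H" "0 < H"
 shows "of_bool (\<not> spread H K (x, y)) <= (of_bool (K * \<bar>real_of_int x\<bar> < real H) + of_bool (K * \<bar>real_of_int y\<bar> < real H) + of_bool (K < real_of_int (gcd x y) \<and> x ~= 0) :: real)"
proof (cases "spread H K (x, y)")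
 case False
 then have "K * \<bar>real_of_int y\<bar> < real H \<or> K < real_of_int (gcd x y)"
  using assms by (auto simp: spread_def)
 then show ?thesis using assms(3) by (cases "x = 0") auto
qed simp

lemma av_not_spread:
 assumes H: "0 < H" and K: "1 <= K" "K <= real H"
  and I: "{a..<a + int H} \<subseteq> {- (2 * int H)..2 * int H}" "{b..<b + int H} \<subseteq> {- (2 * int H)..2 * int H}"
 shows "av {a..<a + int H} (%x. av {b..<b + int H} (%y. of_bool (\<not> spread H K (x, y)))) <= 24 / K"
proof -
 let ?I = "{a..<a + int H}" and ?J = "{b..<b + int H}"
 have ne: "?I ~= {}" "?J ~= {}" using H by auto
 have "av ?I (%x. av ?J (%y. of_bool (\<not> spread H K (x, y)))) <=
  av ?I (%x. av ?J (%y. of_bool (K * \<bar>real_of_int x\<bar> < real H) + of_bool (K * \<bar>real_of_int y\<bar> < real H) + of_bool (K < real_of_int (gcd x y) \<and> x ~= 0) :: real))"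
  by (intro av_mono not_spread_le H) (use I in "auto simp: subset_iff abs_le_iff")
 also have "... = av ?I (%x. of_bool (K * \<bar>real_of_int x\<bar> < real H)) + av ?J (%y. of_bool (K * \<bar>real_of_int y\<bar> < real H))
   + av ?I (%x. av ?J (%y. of_bool (K < real_of_int (gcd x y) \<and> x ~= 0)))"
  unfolding av_add using ne by (simp add: av_const)
 also have "... <= 3 / K + 3 / K + 18 / K"
  using av_small[OF H K, of a 0] av_small[OF H K, of b 0] av_gcd_large[OF H K(1) I(1), of b] by (intro add_mono) auto
 finally show ?thesis by (simp add: add_divide_distrib[symmetric])
qed

text \<open>Because gcd (x, x + y) = gcd (x, y), the last term involves independent coordinates; in
  the middle term x + y is a translate of x for frozen y.\<close>

lemma av_not_spread_sum:
 assumes H: "0 < H" and K: "1 <= K" "K <= real H"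
  and I: "{a..<a + int H} \<subseteq> {- int H..int H}" "{b..<b + int H} \<subseteq> {- int H..int H}"
 shows "av {b..<b + int H} (%y. av {a..<a + int H} (%x. of_bool (\<not> spread H K (x, x + y)))) <= 24 / K"
proof -
 let ?I = "{a..<a + int H}" and ?J = "{b..<b + int H}"
 have ne: "?I ~= {}" "?J ~= {}" using H by auto
 have I2: "?I \<subseteq> {- (2 * int H)..2 * int H}" using I(1) by (auto simp: subset_iff)
 have bd: "\<bar>x\<bar> <= 2 * int H" "\<bar>x + y\<bar> <= 2 * int H" if "x \<in> ?I" "y \<in> ?J" for x y
 proof -
  have "x \<in> {- int H..int H}" "y \<in> {- int H..int H}" using that I by blast+
  then show "\<bar>x\<bar> <= 2 * int H" "\<bar>x + y\<bar> <= 2 * int H" by auto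
 qed
 have "av ?J (%y. av ?I (%x. of_bool (\<not> spread H K (x, x + y)))) <=
  av ?J (%y. av ?I (%x. of_bool (K * \<bar>real_of_int x\<bar> < real H) + of_bool (K * \<bar>real_of_int (x + y)\<bar> < real H) + of_bool (K < real_of_int (gcd x (x + y)) \<and> x ~= 0) :: real))"
  by (intro av_mono not_spread_le H bd)
 also have "... = av ?I (%x. of_bool (K * \<bar>real_of_int x\<bar> < real H)) + av ?J (%y. av ?I (%x. of_bool (K * \<bar>real_of_int (x + y)\<bar> < real H)))
   + av ?I (%x. av ?J (%y. of_bool (K < real_of_int (gcd x y) \<and> x ~= 0)))"
  unfolding av_add using ne av_swap[of ?J ?I "%y x. of_bool (K < real_of_int (gcd x y) \<and> x ~= 0) :: real"] by (simp add: av_const)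
 also have "... <= 3 / K + 3 / K + 18 / K"
 proof (intro add_mono av_gcd_large[OF H K(1) I2])
  show "av ?I (%x. of_bool (K * \<bar>real_of_int x\<bar> < real H)) <= 3 / K" using av_small[OF H K, of a 0] by simp
  show "av ?J (%y. av ?I (%x. of_bool (K * \<bar>real_of_int (x + y)\<bar> < real H))) <= 3 / K"
   by (intro av_le av_small[OF H K]) (use K in simp)
 qed
 finally show ?thesis by (simp add: add_divide_distrib[symmetric])
qed

lemma spread_minus [simp]: "spread H K (x, - y) = spread H K (x, y)" "spread H K (x, - y - z) = spread H K (x, y + z)"
 by (auto simp: spread_def gcd_diff1) (metis gcd_neg2 minus_add_distrib uminus_add_conv_diff add.commute abs_minus_cancel)+

lemma norm_bv_le_1: "good P T ==> norm (bv P ds T) <= 1"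
proof (induction ds arbitrary: T)
 case Nil then show ?case by (auto intro!: norm_av_le_1 simp: good_le)
next
 case (Cons d ds)
 then show ?case by (cases d) (auto intro!: norm_av_le_1 Cons.IH good_mult good_cnj good_shift)
qed

text \<open>Up to sign and repetition \<open>conc_dirs\<close> has five entries, each degenerate for
  a proportion of at most 24 / K of the parameters. There the box expectation is bounded by 1, which
  gives 120 / K; everywhere else all nine directions are replaced by the same uniform
  interval.\<close>

lemma uniform_majorant:
 assumes P: "P > 0" and K: "1 <= K" "K <= real H" and H: "0 < H" "H <= S" and g: "!!b. good P (g b)"
  and I: "{i..<i + int H} \<subseteq> {- int H..int H}" "{j..<j + int H} \<subseteq> {- int H..int H}"
 shows "av {j..<j + int H} (%b. av (({i..<i + int H} \<times> {i..<i + int H}) \<times> ({i..<i + int H} \<times> {i..<i + int H})) (%\<alpha>.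
   Re (bv P (map (%(\<alpha>, \<beta>). dir2 S q \<alpha> \<beta>) (conc_dirs S b (fst (fst \<alpha>)) (snd (fst \<alpha>)) (fst (snd \<alpha>)) (snd (snd \<alpha>)))) (g b))))
  <= 120 / K + (34 * K\<^sup>2) ^ 9 * av {j..<j + int H} (%b. ua q {- (8 * int H * int S)..8 * int H * int S} 9 (%T. norm (av (zp P) T)) (g b))"
proof -
 let ?I = "{i..<i + int H}" and ?J = "{j..<j + int H}"
 let ?u = "%b. ua q {- (8 * int H * int S)..8 * int H * int S} 9 (%T. norm (av (zp P) T)) (g b)"
 let ?B = "%x y. of_bool (\<not> spread H K (x, y)) :: real"
 have ne: "?I ~= {}" "?J ~= {}" using H by auto
 have I2: "?I \<subseteq> {- (2 * int H)..2 * int H}" using I(1) by (auto simp: subset_iff)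
 have I3: "{i + b..<i + b + int H} \<subseteq> {- (2 * int H)..2 * int H}" if "b \<in> ?J" for b
 proof -
  have "b \<in> {- int H..int H}" using that I by blast
  moreover have "i \<in> {- int H..int H}" "i + int H - 1 \<in> {- int H..int H}" using I(1) H by (auto simp: subset_iff)
  ultimately show ?thesis by auto
 qed
 have cI: "av ?I (%_. c) = c" and cJ: "av ?J (%_. c) = c" for c :: real using ne by (simp_all add: av_const)
 have sh: "av ?I (%x. f (x + b)) = av {i + b..<i + b + int H} f" for f :: "int => real" and b
  using av_shift_interval[of i "i + int H" f b] by (simp add: add_ac)
 have pt: "Re (bv P (map (%(\<alpha>, \<beta>). dir2 S q \<alpha> \<beta>) (conc_dirs S b a a' c c')) (g b)) <=
   (?B a (a + b) + ?B a (a' + b) + ?B a a' + ?B (a + b) c + ?B (a + b) (c + b)) + (34 * K\<^sup>2) ^ 9 * ?u b" for b a a' c c'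
 proof (cases "\<forall>p\<in>set (conc_dirs S b a a' c c'). spread H K p")
  case True
  have "length (conc_dirs S b a a' c c') = 9" by (simp add: conc_dirs_def)
  then have "norm (bv P (map (%(\<alpha>, \<beta>). dir2 S q \<alpha> \<beta>) (conc_dirs S b a a' c c')) (g b)) <= (34 * K\<^sup>2) ^ 9 * ?u b"
   using bv_le_ua[OF P K(1) H, of "conc_dirs S b a a' c c'" "g b" q] True g by auto
  from order_trans[OF complex_Re_le_cmod this] show ?thesis by (rule order_trans) simp
 next
  case False
  then have "1 <= ?B a (a + b) + ?B a (a' + b) + ?B a a' + ?B (a + b) c + ?B (a + b) (c + b)"
   by (auto simp: conc_dirs_def)
  moreover have "Re (bv P (map (%(\<alpha>, \<beta>). dir2 S q \<alpha> \<beta>) (conc_dirs S b a a' c c')) (g b)) <= 1"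
   by (rule order_trans[OF complex_Re_le_cmod norm_bv_le_1[OF g]])
  moreover have "0 <= (34 * K\<^sup>2) ^ 9 * ?u b" using K by (intro mult_nonneg_nonneg ua_nonneg) auto
  ultimately show ?thesis by linarith
 qed
 have "av ?J (%b. av ((?I \<times> ?I) \<times> (?I \<times> ?I)) (%\<alpha>.
   Re (bv P (map (%(\<alpha>, \<beta>). dir2 S q \<alpha> \<beta>) (conc_dirs S b (fst (fst \<alpha>)) (snd (fst \<alpha>)) (fst (snd \<alpha>)) (snd (snd \<alpha>)))) (g b))))
  = av ?J (%b. av ?I (%a. av ?I (%a'. av ?I (%c. av ?I (%c'.
   Re (bv P (map (%(\<alpha>, \<beta>). dir2 S q \<alpha> \<beta>) (conc_dirs S b a a' c c')) (g b)))))))"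
  unfolding av_Times by simp
 also have "... <= av ?J (%b. av ?I (%a. av ?I (%a'. av ?I (%c. av ?I (%c'.
   (?B a (a + b) + ?B a (a' + b) + ?B a a' + ?B (a + b) c + ?B (a + b) (c + b)) + (34 * K\<^sup>2) ^ 9 * ?u b)))))"
  by (intro av_mono pt)
 also have "... = (av ?J (%b. av ?I (%a. ?B a (a + b))) + av ?J (%b. av ?I (%a. av ?I (%a'. ?B a (a' + b)))) + av ?I (%a. av ?I (%a'. ?B a a'))
   + av ?J (%b. av ?I (%a. av ?I (%c. ?B (a + b) c))) + av ?J (%b. av ?I (%a. av ?I (%c. ?B (a + b) (c + b))))) + (34 * K\<^sup>2) ^ 9 * av ?J ?u"
  unfolding av_add av_mult_left cI cJ ..
 also have "av ?J (%b. av ?I (%a. ?B a (a + b))) <= 24 / K" by (rule av_not_spread_sum[OF H(1) K I])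
 also have "av ?J (%b. av ?I (%a. av ?I (%a'. ?B a (a' + b)))) <= 24 / K"
 proof (rule av_le)
  fix b assume b: "b \<in> ?J"
  have "av ?I (%a. av ?I (%a'. ?B a (a' + b))) = av ?I (%a. av {i + b..<i + b + int H} (%a'. ?B a a'))"
   by (rule av_cong1) (rule sh)
  then show "av ?I (%a. av ?I (%a'. ?B a (a' + b))) <= 24 / K"
   using av_not_spread[OF H(1) K I2 I3[OF b]] by simp
 qed (use K in simp)
 also have "av ?I (%a. av ?I (%a'. ?B a a')) <= 24 / K" by (rule av_not_spread[OF H(1) K I2 I2])
 also have "av ?J (%b. av ?I (%a. av ?I (%c. ?B (a + b) c))) <= 24 / K"
 proof (rule av_le)
  fix b assume b: "b \<in> ?J"
  have "av ?I (%a. av ?I (%c. ?B (a + b) c)) = av {i + b..<i + b + int H} (%a. av ?I (%c. ?B a c))"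
   using sh[of "%a. av ?I (%c. ?B a c)" b] .
  then show "av ?I (%a. av ?I (%c. ?B (a + b) c)) <= 24 / K"
   using av_not_spread[OF H(1) K I3[OF b] I2] by simp
 qed (use K in simp)
 also have "av ?J (%b. av ?I (%a. av ?I (%c. ?B (a + b) (c + b)))) <= 24 / K"
 proof (rule av_le)
  fix b assume b: "b \<in> ?J"
  have "av ?I (%a. av ?I (%c. ?B (a + b) (c + b))) = av ?I (%a. av {i + b..<i + b + int H} (%c. ?B (a + b) c))"
   by (rule av_cong1) (rule sh)
  also have "... = av {i + b..<i + b + int H} (%a. av {i + b..<i + b + int H} (%c. ?B a c))"
   using sh[of "%a. av {i + b..<i + b + int H} (%c. ?B a c)" b] .
  finally show "av ?I (%a. av ?I (%c. ?B (a + b) (c + b))) <= 24 / K"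
   using av_not_spread[OF H(1) K I3[OF b] I3[OF b]] by simp
 qed (use K in simp)
 finally show ?thesis by (simp add: add_divide_distrib[symmetric])
qed

section \<open>From the count to uniform differences\<close>

lemma norm_av_power: "norm (av S f) ^ (2 ^ n) <= av S (%x. norm (f x) ^ (2 ^ n))"
 by (rule order_trans[OF power_mono[OF norm_av_le] av_power_le]) auto

lemma av_times_single: "av (A \<times> {c}) f = av A (%x. f (x, c))"
 unfolding av_Times by (simp add: av_def[of "{c}"])

text \<open>Only l and p are kept as variables of the quad; the second copies l', p' are averaged
  outside, where they merely displace the windows.\<close>

lemma bv_dir1_quad:
 assumes P: "P > 0" and g: "good P g"
 shows "av I (%a. bv P [dir1 L (q * a), dir1 L (q * (a + b))] g) =
  av (zp L) (%l'. av (zp L) (%p'. quad P (I \<times> {- l'..<- l' + int L} \<times> {- p'..<- p' + int L})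
   (%\<tau>. q * (fst \<tau> * fst (snd \<tau>))) (%\<tau>. q * ((fst \<tau> + b) * snd (snd \<tau>))) g (%x. cnj (g x)) (%x. cnj (g x)) g))"
proof -
 define Q where "Q a l p = av (zp P) (%x. g x * cnj (g (x + q * (a * l))) * cnj (g (x + q * ((a + b) * p))) * g (x + q * (a * l) + q * ((a + b) * p)))" for a l p
 have bv: "bv P [dir1 L (q * a), dir1 L (q * (a + b))] g =
  av (zp L) (%l. av (zp L) (%l'. av (zp L) (%p. av (zp L) (%p'. Q a (l + - l') (p + - p')))))" for a
 proof -
  have "av (zp P) (%x. g (x + q * (a + b) * p + q * a * l) * cnj (g (x + q * (a + b) * p + q * a * l')) *
    cnj (g (x + q * (a + b) * p' + q * a * l) * cnj (g (x + q * (a + b) * p' + q * a * l')))) = Q a (l + - l') (p + - p')" for l l' p p'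
  proof -
   let ?Z = "%x. g x * cnj (g (x + q * (a * (l + - l')))) * cnj (g (x + q * ((a + b) * (p + - p')))) * g (x + (q * (a * (l + - l')) + q * ((a + b) * (p + - p'))))"
   have "good P ?Z" by (intro good_mult good_cnj good_shift g)
   then have "av (zp P) (%x. ?Z (x + (q * (a + b) * p' + q * a * l'))) = av (zp P) ?Z"
    by (intro av_shift P) (simp add: good_def)
   then show ?thesis unfolding Q_def by (simp add: algebra_simps)
  qed
  then show ?thesis by (simp add: dir1_def av_times_single)
 qed
 have "av I (%a. bv P [dir1 L (q * a), dir1 L (q * (a + b))] g) =
  av I (%a. av (zp L) (%l'. av (zp L) (%p'. av (zp L) (%l. av (zp L) (%p. Q a (l + - l') (p + - p'))))))"
 proof (rule av_cong1)
  fix a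
  have "bv P [dir1 L (q * a), dir1 L (q * (a + b))] g = av (zp L) (%l'. av (zp L) (%l. av (zp L) (%p. av (zp L) (%p'. Q a (l + - l') (p + - p')))))"
   unfolding bv by (rule av_swap)
  also have "... = av (zp L) (%l'. av (zp L) (%l. av (zp L) (%p'. av (zp L) (%p. Q a (l + - l') (p + - p')))))"
   by (rule av_cong1, rule av_cong1, rule av_swap)
  also have "... = av (zp L) (%l'. av (zp L) (%p'. av (zp L) (%l. av (zp L) (%p. Q a (l + - l') (p + - p')))))"
   by (rule av_cong1, rule av_swap)
  finally show "bv P [dir1 L (q * a), dir1 L (q * (a + b))] g = av (zp L) (%l'. av (zp L) (%p'. av (zp L) (%l. av (zp L) (%p. Q a (l + - l') (p + - p')))))" .
 qed
 also have "... = av (zp L) (%l'. av (zp L) (%p'. av I (%a. av (zp L) (%l. av (zp L) (%p. Q a (l + - l') (p + - p'))))))"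
  by (rule av_rot3)
 also have "... = av (zp L) (%l'. av (zp L) (%p'. av I (%a. av {- l'..<- l' + int L} (%l. av {- p'..<- p' + int L} (%p. Q a l p)))))"
 proof (rule av_cong1, rule av_cong1, rule av_cong1)
  fix l' p' a
  have "av (zp L) (%l. av (zp L) (%p. Q a (l + - l') (p + - p'))) = av (zp L) (%l. av {- p'..<- p' + int L} (%p. Q a (l + - l') p))"
   by (rule av_cong1) (use av_shift_interval[of 0 "int L" _ "- p'"] in \<open>simp add: add.commute\<close>)
  also have "... = av {- l'..<- l' + int L} (%l. av {- p'..<- p' + int L} (%p. Q a l p))"
   using av_shift_interval[of 0 "int L" "%l. av {- p'..<- p' + int L} (%p. Q a l p)" "- l'"] by (simp add: add.commute)
  finally show "av (zp L) (%l. av (zp L) (%p. Q a (l + - l') (p + - p'))) = av {- l'..<- l' + int L} (%l. av {- p'..<- p' + int L} (%p. Q a l p))" .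
 qed
 finally show ?thesis unfolding quad_def Q_def av_Times fst_conv snd_conv .
qed

text \<open>Absorbing an error raises the exponent by one, because \<eta> \<le> 1/2 makes \<eta>^n
  at least twice \<eta>^(n+1).\<close>

lemma half_power_le: "0 < \<eta> ==> \<eta> <= 1/2 ==> \<eta> ^ n <= X + e ==> e <= \<eta> ^ Suc n ==> \<eta> ^ Suc n <= (X::real)"
proof -
 assume *: "0 < \<eta>" "\<eta> <= 1/2" "\<eta> ^ n <= X + e" "e <= \<eta> ^ Suc n"
 have "2 * \<eta> ^ Suc n <= \<eta> ^ n" using * mult_right_mono[of "2 * \<eta>" 1 "\<eta> ^ n"] by simp
 then show "\<eta> ^ Suc n <= X" using * by linarith
qed

lemma av_power_chain: "0 <= \<eta> ==> \<eta> ^ a <= X ==> X ^ b <= Y ==> \<eta> ^ (a * b) <= (Y::real)"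
 by (rule power_le_trans) auto

text \<open>The exponents are 4 + 1 = 5, then 5 * 8 + 1 = 41, then 41 * 16384 + 1 = 671745 = E, each
  + 1 being an absorbed error, and finally 19 E + 190. Of the three directions of
  \<open>pet_box\<close>, those with coefficients a and a + b are concatenated; b stays visible in
  the products b m and b m', which \<open>bilinear\<close> needs.\<close>

lemma pet_concatenation:
 assumes P: "P > 0" and M: "M > 0" and L: "L > 0" and H: "0 < H" "H <= S" and f: "good P f0" "good P f1" "good P F"
  and eta: "0 < \<eta>" "\<eta> <= 1/2" and big: "\<eta> <= norm (Lam P M q1 q2 f0 f1 F)"
  and sizes: "12 * real H / real M <= \<eta> ^ 5" "32 * real L / real M <= \<eta> ^ 41" "4096 * real S / real L <= \<eta> ^ 671745" "240 / \<eta> ^ 671745 <= real H"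
 shows "\<exists>j. - int H < j \<and> j <= 0 \<and> \<eta> ^ 12763345 <= av {j..<j + int H} (%b. av (zp L) (%m. av (zp L) (%m'.
   ua (2 * q2) {- (8 * int H * int S)..8 * int H * int S} 9 (%T. norm (av (zp P) T))
    (%x. F (x + 2 * q2 * b * m) * cnj (F (x + 2 * q2 * b * m'))))))"
proof -
 have S: "S > 0" using H by simp
 define E where "E = (671745::nat)"
 have M0: "real M > 0" using M by simp
 define q where "q = 2 * q2"
 define f where "f h h' k k' = Re (bv P [dir1 L (2 * q2 * (k - k')), dir1 L (2 * q2 * (h - h')), dir1 L (2 * q2 * ((h - h') + (k - k')))] F)" for h h' k k'
 have e0: "0 <= \<eta>" using eta by simp
 have hz: "finite (zp H)" "zp H ~= {}" using H by auto
 note av4_const = av_const[OF hz]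
 define X where "X = av (zp H) (%h. av (zp H) (%h'. av (zp H) (%k. av (zp H) (%k'. norm (pet4 P M q1 q2 F h h' k k')))))"
 have "\<eta> ^ 4 <= X + 12 * real H / real M"
  unfolding X_def by (rule pet[OF P M H(1) f big e0])
 from half_power_le[OF eta this] sizes(1) have X: "\<eta> ^ 5 <= X" by simp
 have "X ^ 8 <= av (zp H) (%h. av (zp H) (%h'. av (zp H) (%k. av (zp H) (%k'. norm (pet4 P M q1 q2 F h h' k k') ^ 8))))"
 proof -
  have "X ^ (2 ^ 3) <= av (zp H) (%h. av (zp H) (%h'. av (zp H) (%k. av (zp H) (%k'. norm (pet4 P M q1 q2 F h h' k k') ^ (2 ^ 3)))))"
   unfolding X_def
   by (rule order_trans[OF av_power_le], intro av_nonneg norm_ge_zero, rule av_mono)+ simp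
  then show ?thesis by simp
 qed
 also have "... <= av (zp H) (%h. av (zp H) (%h'. av (zp H) (%k. av (zp H) (%k'. f h h' k k' + 32 * real L / real M))))"
  unfolding f_def by (intro av_mono pet_box P M L f)
 also have "... = av (zp H) (%h. av (zp H) (%h'. av (zp H) (%k. av (zp H) (%k'. f h h' k k')))) + 32 * real L / real M"
  unfolding av_add by (simp add: av4_const)
 finally have "X ^ 8 <= av (zp H) (%h. av (zp H) (%h'. av (zp H) (%k. av (zp H) (%k'. f h h' k k')))) + 32 * real L / real M" .
 from av_power_chain[OF e0 X this] have "\<eta> ^ 40 <= av (zp H) (%h. av (zp H) (%h'. av (zp H) (%k. av (zp H) (%k'. f h h' k k')))) + 32 * real L / real M" by simp
 from half_power_le[OF eta this] sizes(2) have "\<eta> ^ 41 <= av (zp H) (%h. av (zp H) (%h'. av (zp H) (%k. av (zp H) (%k'. f h h' k k'))))" by simp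
 also have "... = av (zp H) (%h'. av (zp H) (%h. av (zp H) (%k. av (zp H) (%k'. f h h' k k'))))" by (rule av_swap)
 also have "... = av (zp H) (%h'. av (zp H) (%k. av (zp H) (%k'. av (zp H) (%h. f h h' k k'))))" by (rule av_cong1) (rule av_rot3)
 also have "... = av (zp H) (%h'. av (zp H) (%k'. av (zp H) (%k. av (zp H) (%h. f h h' k k'))))" by (rule av_cong1) (rule av_swap)
 \<comment> \<open>Freezing h' and k' lets the differences a = h - h' and b = k - k' run over
   intervals of length H.\<close>
 finally obtain h' where h': "h' \<in> zp H" "\<eta> ^ 41 <= av (zp H) (%k'. av (zp H) (%k. av (zp H) (%h. f h h' k k')))"
  using av_pigeonhole[OF hz] by blast
 then obtain k' where k': "k' \<in> zp H" "\<eta> ^ 41 <= av (zp H) (%k. av (zp H) (%h. f h h' k k'))"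
  using av_pigeonhole[OF hz] by blast
 define I where "I = {- h'..<- h' + int H}"
 define J where "J = {- k'..<- k' + int H}"
 have IJ: "finite I" "I ~= {}" "finite J" "J ~= {}" using H by (auto simp: I_def J_def)
 have HI: "{- h'..<- h' + int H} \<subseteq> {- int H..int H}" "{- k'..<- k' + int H} \<subseteq> {- int H..int H}" using h' k' by auto
 have lz: "finite (zp L)" "zp L ~= {}" using L by auto
 define g where "g b m m' = (%x. F (x + q * b * m) * cnj (F (x + q * b * m')))" for b m m'
 have g: "good P (g b m m')" for b m m' unfolding g_def by (intro good_mult good_cnj good_shift f)
 define A where "A = (%\<tau>::int \<times> int \<times> int. q * (fst \<tau> * fst (snd \<tau>)))"
 define B where "B b = (%\<tau>::int \<times> int \<times> int. q * ((fst \<tau> + b) * snd (snd \<tau>)))" for b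
 define Qd where "Qd b m m' l p = quad P (I \<times> {- l..<- l + int L} \<times> {- p..<- p + int L}) A (B b) (g b m m') (%x. cnj (g b m m' x)) (%x. cnj (g b m m' x)) (g b m m')" for b m m' l p
 have "av (zp H) (%k. av (zp H) (%h. f h h' k k')) = av J (%b. av I (%a. Re (bv P [dir1 L (q * b), dir1 L (q * a), dir1 L (q * (a + b))] F)))"
 proof -
  let ?G = "%a b. Re (bv P [dir1 L (q * b), dir1 L (q * a), dir1 L (q * (a + b))] F)"
  have "av (zp H) (%k. av (zp H) (%h. f h h' k k')) = av (zp H) (%k. av (zp H) (%h. ?G (h + - h') (k + - k')))"
   unfolding f_def q_def by simp
  also have "... = av (zp H) (%k. av I (%a. ?G a (k + - k')))"
  proof (rule av_cong1)
   fix k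
   have "av (zp H) (%h. ?G (h + - h') (k + - k')) = av {0 + - h'..<int H + - h'} (%a. ?G a (k + - k'))"
    by (rule av_shift_interval)
   then show "av (zp H) (%h. ?G (h + - h') (k + - k')) = av I (%a. ?G a (k + - k'))" unfolding I_def by (simp only: add_0_left add.commute[of "int H"])
  qed
  also have "... = av J (%b. av I (%a. ?G a b))"
   unfolding J_def using av_shift_interval[of 0 "int H" "%b. av I (%a. ?G a b)" "- k'"] by (simp add: add.commute)
  finally show ?thesis .
 qed
 also have "... = Re (av J (%b. av I (%a. bv P [dir1 L (q * b), dir1 L (q * a), dir1 L (q * (a + b))] F)))"
  by (simp only: Re_av)
 also have "av J (%b. av I (%a. bv P [dir1 L (q * b), dir1 L (q * a), dir1 L (q * (a + b))] F)) =
  av J (%b. av I (%a. av (zp L) (%m. av (zp L) (%m'. bv P [dir1 L (q * a), dir1 L (q * (a + b))] (g b m m')))))"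
  by (rule av_cong1, rule av_cong1) (simp add: dir1_def av_times_single g_def)
 also have "... = av J (%b. av (zp L) (%m. av (zp L) (%m'. av I (%a. bv P [dir1 L (q * a), dir1 L (q * (a + b))] (g b m m')))))"
  by (rule av_cong1) (rule av_rot3)
 also have "... = av J (%b. av (zp L) (%m. av (zp L) (%m'. av (zp L) (%l. av (zp L) (%p. Qd b m m' l p)))))"
  unfolding bv_dir1_quad[OF P g] Qd_def A_def B_def ..
 finally have eq: "av (zp H) (%k. av (zp H) (%h. f h h' k k')) = Re (av J (%b. av (zp L) (%m. av (zp L) (%m'. av (zp L) (%l. av (zp L) (%p. Qd b m m' l p))))))" .
 have 1: "\<eta> ^ 41 <= norm (av J (%b. av (zp L) (%m. av (zp L) (%m'. av (zp L) (%l. av (zp L) (%p. Qd b m m' l p))))))"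
  using k'(2) unfolding eq by (rule order_trans[OF _ complex_Re_le_cmod])
 have "norm (av J (%b. av (zp L) (%m. av (zp L) (%m'. av (zp L) (%l. av (zp L) (%p. Qd b m m' l p)))))) ^ (2 ^ 14) <=
  av J (%b. av (zp L) (%m. av (zp L) (%m'. av (zp L) (%l. av (zp L) (%p. norm (Qd b m m' l p) ^ (2 ^ 14))))))"
  by (rule order_trans[OF norm_av_power], rule av_mono, rule order_trans[OF norm_av_power], rule av_mono,
    rule order_trans[OF norm_av_power], rule av_mono, rule order_trans[OF norm_av_power], rule av_mono, rule norm_av_power)
 then have "norm (av J (%b. av (zp L) (%m. av (zp L) (%m'. av (zp L) (%l. av (zp L) (%p. Qd b m m' l p)))))) ^ 16384 <=
  av J (%b. av (zp L) (%m. av (zp L) (%m'. av (zp L) (%l. av (zp L) (%p. norm (Qd b m m' l p) ^ 16384)))))" by simp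
 also define Z where "Z b m m' = av ((I \<times> I) \<times> (I \<times> I)) (%\<alpha>. Re (bv P (map (%(\<alpha>, \<beta>). dir2 S q \<alpha> \<beta>)
   (conc_dirs S b (fst (fst \<alpha>)) (snd (fst \<alpha>)) (fst (snd \<alpha>)) (snd (snd \<alpha>)))) (g b m m')))" for b m m'
 have "av J (%b. av (zp L) (%m. av (zp L) (%m'. av (zp L) (%l. av (zp L) (%p. norm (Qd b m m' l p) ^ 16384))))) <=
  av J (%b. av (zp L) (%m. av (zp L) (%m'. av (zp L) (%l. av (zp L) (%p. Z b m m' + 4096 * real S / real L)))))"
  unfolding Z_def Qd_def A_def B_def
  by (rule av_mono)+ (rule double_concatenation[OF P L S g IJ(1,2) order_refl norm_ge_zero])
 also have "... = av J (%b. av (zp L) (%m. av (zp L) (%m'. Z b m m'))) + 4096 * real S / real L"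
  unfolding av_add by (simp add: av_const[OF lz] av_const[OF IJ(3,4)])
 finally have "norm (av J (%b. av (zp L) (%m. av (zp L) (%m'. av (zp L) (%l. av (zp L) (%p. Qd b m m' l p)))))) ^ 16384 <=
  av J (%b. av (zp L) (%m. av (zp L) (%m'. Z b m m'))) + 4096 * real S / real L" .
 from av_power_chain[OF e0 1 this] have "\<eta> ^ 671744 <= av J (%b. av (zp L) (%m. av (zp L) (%m'. Z b m m'))) + 4096 * real S / real L" by simp
 from half_power_le[OF eta this] sizes(3) have 2: "\<eta> ^ E <= av J (%b. av (zp L) (%m. av (zp L) (%m'. Z b m m')))"
  by (simp add: E_def)
 \<comment> \<open>Makes the exceptional contribution 120 / K exactly half of \<eta>^E. The factor
   (34 K^2)^9 then costs \<eta>^(-18 E) and a constant which, doubled, is below 2^190.\<close>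
 define K where "K = 240 / \<eta> ^ E"
 have eE: "0 < \<eta> ^ E" "\<eta> ^ E <= 1" using eta by (auto intro: power_le_one)
 have K: "1 <= K" "K <= real H" using sizes(4) eE unfolding K_def E_def by (auto simp: field_simps)
 let ?u = "%b m m'. ua q {- (8 * int H * int S)..8 * int H * int S} 9 (%T. norm (av (zp P) T)) (g b m m')"
 define R where "R = av J (%b. av (zp L) (%m. av (zp L) (%m'. ?u b m m')))"
 have R0: "0 <= R" unfolding R_def by (intro av_nonneg ua_nonneg) auto
 have "av J (%b. av (zp L) (%m. av (zp L) (%m'. Z b m m'))) = av (zp L) (%m. av (zp L) (%m'. av J (%b. Z b m m')))"
  by (rule av_rot3)
 also have "... <= av (zp L) (%m. av (zp L) (%m'. 120 / K + (34 * K\<^sup>2) ^ 9 * av J (%b. ?u b m m')))"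
  unfolding Z_def I_def J_def by (intro av_mono uniform_majorant[OF P K H g HI])
 also have "... = 120 / K + (34 * K\<^sup>2) ^ 9 * av (zp L) (%m. av (zp L) (%m'. av J (%b. ?u b m m')))"
  unfolding av_add av_mult_left by (simp add: av_const[OF lz])
 also have "av (zp L) (%m. av (zp L) (%m'. av J (%b. ?u b m m'))) = R"
  unfolding R_def by (rule av_rot3[symmetric])
 finally have "\<eta> ^ E <= 120 / K + (34 * K\<^sup>2) ^ 9 * R" using 2 by simp
 moreover have "120 / K = \<eta> ^ E / 2" using eE by (simp add: K_def)
 ultimately have "\<eta> ^ E / 2 <= (34 * K\<^sup>2) ^ 9 * R" by simp
 also have "... = (34 * 240\<^sup>2) ^ 9 * R / \<eta> ^ (18 * E)"
  by (simp add: K_def power_divide power_mult[symmetric] power_mult_distrib[symmetric] mult.commute)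
 finally have "\<eta> ^ E * \<eta> ^ (18 * E) <= 2 * (34 * 240\<^sup>2) ^ 9 * R"
  using eta by (simp add: field_simps)
 also have "... <= 2 ^ 190 * R" using R0 by (intro mult_right_mono) simp
 finally have "\<eta> ^ (E + 18 * E) <= 2 ^ 190 * R" by (simp only: power_add)
 then have "(1/2) ^ 190 * \<eta> ^ (E + 18 * E) <= R" by (simp add: field_simps)
 moreover have "\<eta> ^ 190 * \<eta> ^ (E + 18 * E) <= (1/2) ^ 190 * \<eta> ^ (E + 18 * E)"
  using eta by (intro mult_right_mono power_mono) auto
 ultimately have "\<eta> ^ (190 + (E + 18 * E)) <= R" by (simp only: power_add)
 then have "\<eta> ^ 12763345 <= R" by (simp add: E_def)
 then show ?thesis
  using k'(1) unfolding R_def g_def J_def q_def by (intro exI[of _ "- k'"]) auto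
qed

section \<open>Bilinear exponential sums and local linear phases\<close>

lemma av_ee_major:
 assumes T: "T > 0" and d: "16 * real T * dn \<theta> <= 1"
 shows "1 / 4 <= (norm (av (zp T) (%t. ee (of_int t * \<theta>))))\<^sup>2"
proof -
 have ne: "finite (zp T)" "zp T ~= {}" using T by auto
 have "av (zp T) (%t. ee (of_int t * \<theta>)) - 1 = av (zp T) (%t. ee (of_int t * \<theta>) - ee 0)"
  unfolding av_diff av_const[OF ne] by simp
 also have "norm ... <= 1 / 2"
 proof (rule norm_av_bound)
  fix t assume t: "t \<in> zp T"
  have "norm (ee (of_int t * \<theta>) - ee 0) <= 2 * pi * dn (of_int t * \<theta> - 0)" by (rule ee_near)
  also have "... <= 8 * dn (of_int t * \<theta>)" using pi_less_4 unfolding diff_0_right by (intro mult_right_mono) auto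
  also have "... <= 8 * (real T * dn \<theta>)"
   using t by (intro mult_left_mono order_trans[OF dn_mult] mult_right_mono) auto
  finally show "norm (ee (of_int t * \<theta>) - ee 0) <= 1 / 2" using d by simp
 qed simp
 finally have "1 / 2 <= norm (av (zp T) (%t. ee (of_int t * \<theta>)))"
  using norm_triangle_ineq3[of "av (zp T) (%t. ee (of_int t * \<theta>))" 1] by simp
 from power_mono[OF this, of 2] show ?thesis by (simp add: power2_eq_square)
qed

text \<open>Points with f < c account for at most half of the lower bound 2 c; at all others f \<le>
  1 \<le> X / d.\<close>

lemma av_threshold:
 assumes S: "finite S" "S ~= {}" and big: "2 * c <= av S f" and f: "!!x. x \<in> S ==> f x <= 1" and X: "!!x. x \<in> S ==> 0 <= X x"
  and cd: "0 < c" "0 < d" and imp: "!!x. x \<in> S ==> c <= f x ==> d <= X x"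
 shows "c * d <= av S (X :: _ => real)"
proof -
 have "2 * c <= av S (%x. c + X x / d)"
 proof (rule order_trans[OF big], rule av_mono)
  fix x assume x: "x \<in> S"
  show "f x <= c + X x / d"
  proof (cases "c <= f x")
   case True
   then have "1 <= X x / d" using imp[OF x] cd by simp
   then show ?thesis using f[OF x] cd by linarith
  next
   case False
   moreover have "0 <= X x / d" using X[OF x] cd by simp
   ultimately show ?thesis by linarith
  qed
 qed
 then have "c <= av S X / d" unfolding av_add av_divide av_const[OF S] by simp
 then show ?thesis using cd by (simp add: field_simps)
qed

text \<open>A large sum over n forces b \<theta> to lie within 2 / (\<delta> L) of an integer. This
  happens for a positive proportion of b, so \<open>vinogradov\<close> in b gains the further factor
  H. The denominator divides Q, and Q \<theta> is so near an integer that the phase hardly turns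
  over T steps.\<close>

lemma bilinear_major:
 fixes \<theta> \<delta> :: real
 assumes d: "0 < \<delta>" "\<delta> <= 1" and H: "0 < H" and L: "0 < L" and T: "0 < T"
  and big: "\<delta> <= av {j..<j + int H} (%b. (norm (av {i..<i + int L} (%n. ee (of_int (b * n) * \<theta>))))\<^sup>2)"
  and dvd: "!!r::nat. 1 <= r ==> real r <= 18 / \<delta> ==> r dvd Q"
  and sizes: "64 <= \<delta>\<^sup>2 * real L" "288 <= \<delta>\<^sup>2 * real H" "18432 * real T * real Q <= \<delta> ^ 3 * real L * real H"
 shows "1 / 4 <= (norm (av (zp T) (%t. ee (of_int (int Q * t) * \<theta>))))\<^sup>2"
proof -
 let ?J = "{j..<j + int H}" and ?N = "{i..<i + int L}"
 let ?f = "%b. (norm (av ?N (%n. ee (of_int (b * n) * \<theta>))))\<^sup>2"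
 define G where "G = {b \<in> ?J. \<delta> / 2 <= ?f b}"
 have "\<delta> / 2 <= 1 * av ?J (%b. of_bool (\<delta> / 2 <= ?f b))"
  by (rule av_markov) (use H d big in "auto intro!: power_le_one norm_av_le_1")
 then have cG: "\<delta> / 2 * real H <= real (card G)" using H by (simp add: av_of_bool G_def field_simps)
 have near: "dn (of_int b * \<theta> + 0) <= 2 / (\<delta> * real L)" if b: "b \<in> G" for b
 proof -
  let ?n = "norm (av ?N (%n. ee (of_int (b * n) * \<theta>)))"
  have n1: "?n <= 1" by (intro norm_av_le_1) simp
  have "\<delta> / 2 <= ?n\<^sup>2" using b by (simp add: G_def)
  also have "... <= ?n" using n1 by (simp add: power2_eq_square mult_left_le)
  also have "... = norm (\<Sum>n\<in>?N. ee (of_int b * \<theta> * of_int n + 0)) / real L"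
   by (simp add: av_def mult_ac)
  finally have "\<delta> / 2 * real L <= norm (\<Sum>n\<in>?N. ee (of_int b * \<theta> * of_int n + 0))"
   using L by (simp add: field_simps)
  from dn_of_sum[OF this] show ?thesis using d L by simp
 qed
 have "\<exists>r::nat. 1 <= r \<and> real r <= 9 / (\<delta> / 2) \<and> dn (real r * \<theta>) <= 144 * (2 / (\<delta> * real L)) / ((\<delta> / 2)\<^sup>2 * real H)"
 proof (rule vinogradov[where G = G and c = 0])
  show "2 / (\<delta> * real L) <= \<delta> / 2 / 16" using d L sizes(1) by (simp add: field_simps power2_eq_square)
  show "72 / (\<delta> / 2)\<^sup>2 <= real H" using d sizes(2) by (simp add: field_simps power2_eq_square)
 qed (use d L cG near in "auto simp: G_def")
 then obtain r :: nat where r: "1 <= r" "real r <= 18 / \<delta>" "dn (real r * \<theta>) <= 1152 / (\<delta> ^ 3 * real L * real H)"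
  by (auto simp: power2_eq_square power3_eq_cube field_simps)
 have "dn (of_int (int Q) * \<theta>) <= \<bar>of_int (int Q)\<bar> * (1152 / (\<delta> ^ 3 * real L * real H))"
  by (rule dn_dvd[OF _ _ r(3)]) (use dvd[OF r(1,2)] r(1) in auto)
 then have "16 * real T * dn (of_int (int Q) * \<theta>) <= 16 * real T * (real Q * (1152 / (\<delta> ^ 3 * real L * real H)))"
  by (intro mult_left_mono) auto
 also have "... = 18432 * real T * real Q / (\<delta> ^ 3 * real L * real H)" by simp
 also have "... <= 1" using sizes(3) d L H by simp
 finally have "16 * real T * dn (of_int (int Q) * \<theta>) <= 1" .
 from av_ee_major[OF T this] show ?thesis by (simp add: mult_ac)
qed

text \<open>The squared correlation of W with its shift by v is an average over \<nu> of
  correlations of \<open>G \<nu>\<close> with its own shift by v. This is linear in the shifted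
  copy, so Cauchy-Schwarz puts the averages over b and n inside, and
  \<open>spectral_transfer\<close> with \<open>bilinear_major\<close> replaces the products b n by
  multiples of Q. Shifting \<nu> along the same progression supplies the translates for
  \<open>local_fourier\<close>. The constant 1/64 is paid with \<eta>-type factors: \<epsilon>^8 /
  64 \<ge> \<epsilon>^14.\<close>

lemma bilinear:
 fixes W :: "int => complex"
 assumes P: "P > 0" and W: "good P W" and e: "0 < \<epsilon>" "\<epsilon> <= 1/2" and H: "0 < H" and L: "0 < L" and T: "0 < T"
  and big: "\<epsilon> <= av {j..<j + int H} (%b. av (zp L) (%m. av (zp L) (%m'. norm (av (zp P) (%x. W (x + q * b * m) * cnj (W (x + q * b * m')))))))"
  and dvd: "!!r::nat. 1 <= r ==> real r <= 72 / \<epsilon> ^ 4 ==> r dvd Q"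
  and sizes: "1024 <= \<epsilon> ^ 8 * real L" "4608 <= \<epsilon> ^ 8 * real H" "2 ^ 21 * real T * real Q <= \<epsilon> ^ 12 * real L * real H"
 shows "\<exists>\<alpha>::int => real. \<epsilon> ^ 14 <= av (zp P) (%y. norm (av (zp T) (%t. W (y + q * int Q * t) * ee (\<alpha> y * of_int t))))"
proof -
 let ?J = "{j..<j + int H}"
 let ?z = "zp P"
 have pz: "finite ?z" "?z ~= {}" using P by auto
 have lz: "finite (zp L)" "zp L ~= {}" using L by auto
 have jz: "finite ?J" "?J ~= {}" using H by auto
 define C where "C v = norm (av ?z (%x. W x * cnj (W (x + v))))" for v
 have shift: "norm (av ?z (%x. W (x + q * b * m) * cnj (W (x + q * b * m')))) = C (q * b * (m' + - m))" for b m m'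
 proof -
  have "good P (%x. W x * cnj (W (x + q * b * (m' + - m))))" by (intro good_mult good_cnj good_shift W)
  then have "av ?z (%x. W (x + q * b * m) * cnj (W (x + q * b * m + q * b * (m' + - m)))) = av ?z (%x. W x * cnj (W (x + q * b * (m' + - m))))"
   by (intro av_shift[OF P, of "%x. W x * cnj (W (x + q * b * (m' + - m)))"]) (simp add: good_def)
  then show ?thesis unfolding C_def by (simp add: algebra_simps)
 qed
 have "\<epsilon> <= av (zp L) (%m. av ?J (%b. av (zp L) (%m'. C (q * b * (m' + - m)))))"
  using big unfolding shift by (subst av_swap)
 then obtain m where m: "m \<in> zp L" "\<epsilon> <= av ?J (%b. av (zp L) (%m'. C (q * b * (m' + - m))))"
  using av_pigeonhole[OF lz] by blast
 define N where "N = {- m..<- m + int L}"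
 have Nz: "finite N" "N ~= {}" using L by (auto simp: N_def)
 have "av (zp L) (%m'. C (q * b * (m' + - m))) = av N (%n. C (q * b * n))" for b
  unfolding N_def using av_shift_interval[of 0 "int L" "%n. C (q * b * n)" "- m"] by (simp only: add_0_left add.commute[of "int L"])
 with m have "\<epsilon> <= av ?J (%b. av N (%n. C (q * b * n)))" by simp
 then have "\<epsilon>\<^sup>2 <= (av ?J (%b. av N (%n. C (q * b * n))))\<^sup>2" using e by (intro power_mono) auto
 also have "... <= av ?J (%b. av N (%n. (C (q * b * n))\<^sup>2))"
  by (rule order_trans[OF av_square_le], rule av_mono, rule av_square_le)
 finally have 1: "\<epsilon>\<^sup>2 <= av ?J (%b. av N (%n. (C (q * b * n))\<^sup>2))" .
 define G where "G \<nu> x = W x * cnj (W (x + \<nu>))" for \<nu> x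
 have G: "good P (G \<nu>)" for \<nu> unfolding G_def by (intro good_mult good_cnj good_shift W)
 \<comment> \<open>With x' = x + \<nu> the four factors regroup, and the shift v separates two
   copies of the same function \<open>G \<nu>\<close>.\<close>
 have Csq: "complex_of_real ((C v)\<^sup>2) = av ?z (%\<nu>. av ?z (%x. G \<nu> x * cnj (G \<nu> (x + v))))" for v
 proof -
  let ?a = "%x. W x * cnj (W (x + v))"
  have a: "good P ?a" by (intro good_mult good_cnj good_shift W)
  have "complex_of_real ((C v)\<^sup>2) = av ?z (%x. av ?z (%x'. ?a x * cnj (?a x')))"
   unfolding C_def av_norm_square ..
  also have "... = av ?z (%x. av ?z (%\<nu>. ?a x * cnj (?a (\<nu> + x))))"
  proof (rule av_cong1)
   fix x
   have "good P (%x'. cnj (?a x'))" by (rule good_cnj[OF a])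
   then have "av ?z (%x'. cnj (?a x')) = av ?z (%\<nu>. cnj (?a (\<nu> + x)))"
    by (intro av_shift[OF P, of "%x'. cnj (?a x')", symmetric]) (simp add: good_def)
   then show "av ?z (%x'. ?a x * cnj (?a x')) = av ?z (%\<nu>. ?a x * cnj (?a (\<nu> + x)))"
    unfolding av_mult_left by simp
  qed
  also have "... = av ?z (%\<nu>. av ?z (%x. ?a x * cnj (?a (\<nu> + x))))" by (rule av_swap)
  also have "... = av ?z (%\<nu>. av ?z (%x. G \<nu> x * cnj (G \<nu> (x + v))))"
   unfolding G_def by (simp add: algebra_simps)
  finally show ?thesis .
 qed
 define M where "M \<nu> x = av ?J (%b. av N (%n. G \<nu> (x + q * b * n)))" for \<nu> x
 have "complex_of_real (av ?J (%b. av N (%n. (C (q * b * n))\<^sup>2))) =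
  av ?J (%b. av N (%n. av ?z (%\<nu>. av ?z (%x. G \<nu> x * cnj (G \<nu> (x + q * b * n))))))"
  unfolding of_real_av Csq ..
 also have "... = av ?J (%b. av ?z (%\<nu>. av ?z (%x. av N (%n. G \<nu> x * cnj (G \<nu> (x + q * b * n))))))"
  by (rule av_cong1) (rule av_rot3)
 also have "... = av ?z (%\<nu>. av ?z (%x. av ?J (%b. av N (%n. G \<nu> x * cnj (G \<nu> (x + q * b * n))))))"
  by (rule av_rot3)
 also have "... = av (?z \<times> ?z) (%p. G (fst p) (snd p) * cnj (M (fst p) (snd p)))"
  unfolding av_Times M_def av_mult_left by (simp add: cnj_av)
 finally have "Re (complex_of_real (av ?J (%b. av N (%n. (C (q * b * n))\<^sup>2)))) = Re (av (?z \<times> ?z) (%p. G (fst p) (snd p) * cnj (M (fst p) (snd p))))"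
  by (rule arg_cong)
 then have "av ?J (%b. av N (%n. (C (q * b * n))\<^sup>2)) = Re (av (?z \<times> ?z) (%p. G (fst p) (snd p) * cnj (M (fst p) (snd p))))"
  unfolding Re_complex_of_real .
 also have "... <= norm (av (?z \<times> ?z) (%p. G (fst p) (snd p) * cnj (M (fst p) (snd p))))" by (rule complex_Re_le_cmod)
 finally have "\<epsilon>\<^sup>2 <= norm (av (?z \<times> ?z) (%p. G (fst p) (snd p) * cnj (M (fst p) (snd p))))" using 1 by simp
 then have "(\<epsilon>\<^sup>2)\<^sup>2 <= (norm (av (?z \<times> ?z) (%p. G (fst p) (snd p) * cnj (M (fst p) (snd p)))))\<^sup>2"
  by (intro power_mono) auto
 also have "... <= av (?z \<times> ?z) (%p. (norm (cnj (M (fst p) (snd p))))\<^sup>2)"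
  by (rule av_kill) (rule good_le[OF G])
 also have "... = av ?z (%\<nu>. av ?z (%x. (norm (M \<nu> x))\<^sup>2))" unfolding av_Times by simp
 also define E where "E \<nu> = av ?J (%b. av ?z (%x. (norm (av N (%n. G \<nu> (x + q * b * n))))\<^sup>2))" for \<nu>
 have "av ?z (%\<nu>. av ?z (%x. (norm (M \<nu> x))\<^sup>2)) <= av ?z E"
 proof (rule av_mono)
  fix \<nu>
  have "av ?z (%x. (norm (M \<nu> x))\<^sup>2) <= av ?z (%x. av ?J (%b. (norm (av N (%n. G \<nu> (x + q * b * n))))\<^sup>2))"
   unfolding M_def by (rule av_mono) (rule norm_av_square_le)
  also have "... = E \<nu>" unfolding E_def by (rule av_swap)
  finally show "av ?z (%x. (norm (M \<nu> x))\<^sup>2) <= E \<nu>" .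
 qed
 finally have E: "\<epsilon> ^ 4 <= av ?z E" by (simp add: power_mult[symmetric])
 define X where "X \<nu> = av ?z (%x. (norm (av (zp T) (%t. G \<nu> (x + q * int Q * t))))\<^sup>2)" for \<nu>
 have big2: "\<epsilon> ^ 4 / 2 * (\<epsilon> ^ 4 / 16) <= av ?z X"
 proof (rule av_threshold[OF pz])
  show "2 * (\<epsilon> ^ 4 / 2) <= av ?z E" using E by simp
  show "E \<nu> <= 1" for \<nu> unfolding E_def by (intro av_le power_le_one norm_av_le_1 norm_ge_zero good_le[OF G]) auto
  show "0 <= X \<nu>" for \<nu> unfolding X_def by (intro av_nonneg) simp
  show "\<epsilon> ^ 4 / 16 <= X \<nu>" if "\<epsilon> ^ 4 / 2 <= E \<nu>" for \<nu>
  proof -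
   have "\<epsilon> ^ 4 / 2 / 8 <= X \<nu>" unfolding X_def
   proof (rule spectral_transfer[OF P _ _ jz, where S = N and v = "%b n. q * b * n"])
    show "\<epsilon> ^ 4 / 2 <= av ?J (%b. av ?z (%x. (norm (av N (%n. G \<nu> (x + q * b * n))))\<^sup>2))" using that by (simp add: E_def)
    fix \<phi> :: real
    assume *: "\<epsilon> ^ 4 / 2 / 2 <= av ?J (%b. (norm (av N (%n. ee (of_int (q * b * n) * \<phi>))))\<^sup>2)"
    define \<delta> where "\<delta> = \<epsilon> ^ 4 / 4"
    have ep: "\<epsilon> ^ 4 > 0" "\<epsilon> ^ 4 <= 1" using e by (auto intro: power_le_one)
    have "1 / 4 <= (norm (av (zp T) (%t. ee (of_int (int Q * t) * (of_int q * \<phi>)))))\<^sup>2"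
    proof (rule bilinear_major[where \<delta> = \<delta> and j = j and H = H and i = "- m" and L = L])
     show "\<delta> <= av ?J (%b. (norm (av {- m..<- m + int L} (%n. ee (of_int (b * n) * (of_int q * \<phi>)))))\<^sup>2)"
      using * unfolding N_def \<delta>_def by (simp add: mult_ac)
     show "r dvd Q" if "1 <= r" "real r <= 18 / \<delta>" for r using dvd[OF that(1)] that(2) by (simp add: \<delta>_def)
     show "64 <= \<delta>\<^sup>2 * real L" using sizes(1) by (simp add: \<delta>_def power_divide power_mult[symmetric])
     show "288 <= \<delta>\<^sup>2 * real H" using sizes(2) by (simp add: \<delta>_def power_divide power_mult[symmetric])
     have "18432 * 64 * (real T * real Q) <= 2 ^ 21 * (real T * real Q)" by (intro mult_right_mono) auto
     also have "... <= \<epsilon> ^ 12 * real L * real H" using sizes(3) by (simp only: mult.assoc)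
     finally show "18432 * real T * real Q <= \<delta> ^ 3 * real L * real H"
      by (simp add: \<delta>_def power_divide power_mult[symmetric])
    qed (use ep H L T in \<open>auto simp: \<delta>_def\<close>)
    then show "1 / 4 <= (norm (av (zp T) (%t. ee (of_int (q * int Q * t) * \<phi>))))\<^sup>2" by (simp add: mult_ac)
   qed (use G in "auto simp: good_def bdd_def")
   then show ?thesis by simp
  qed
 qed (use e in auto)
 \<comment> \<open>\<open>X\<close> is periodic, so \<nu> may be shifted by q Q s without changing
   the mean; the inner average becomes the correlation of W on one progression with the translates
   of another.\<close>
 have eq: "av ?z X = av ?z (%\<nu>. av ?z (%x. av (zp T) (%s. (norm (av (zp T) (%t. W (x + q * int Q * t) * cnj (W (x + \<nu> + q * int Q * (t + s))))))\<^sup>2)))"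
 proof -
  have per: "per P X"
  proof -
   have "per P W" using W by (simp add: good_def)
   then show ?thesis unfolding X_def G_def per_def by (simp add: add.assoc[symmetric])
  qed
  have "av ?z X = av (zp T) (%s. av ?z (%\<nu>. X (\<nu> + q * int Q * s)))"
   using av_shift[OF P per] T by (simp add: av_const)
  also have "... = av ?z (%\<nu>. av (zp T) (%s. X (\<nu> + q * int Q * s)))" by (rule av_swap)
  also have "... = av ?z (%\<nu>. av (zp T) (%s. av ?z (%x. (norm (av (zp T) (%t. W (x + q * int Q * t) * cnj (W (x + \<nu> + q * int Q * (t + s))))))\<^sup>2)))"
   unfolding X_def G_def by (simp add: algebra_simps)
  also have "... = av ?z (%\<nu>. av ?z (%x. av (zp T) (%s. (norm (av (zp T) (%t. W (x + q * int Q * t) * cnj (W (x + \<nu> + q * int Q * (t + s))))))\<^sup>2)))"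
   by (rule av_cong1) (rule av_swap)
  finally show ?thesis .
 qed
 obtain \<nu> where nu: "\<epsilon> ^ 4 / 2 * (\<epsilon> ^ 4 / 16) <= av ?z (%x. av (zp T) (%s. (norm (av (zp T) (%t. W (x + q * int Q * t) * cnj (W (x + \<nu> + q * int Q * (t + s))))))\<^sup>2))"
  using av_pigeonhole[OF pz big2[unfolded eq]] by blast
 define D where "D x = av (zp T) (%s. (norm (av (zp T) (%t. W (x + q * int Q * t) * cnj (W (x + \<nu> + q * int Q * (t + s))))))\<^sup>2)" for x
 have "\<exists>\<alpha>::real. D x / 2 <= (norm (av (zp T) (%t. W (x + q * int Q * t) * ee (\<alpha> * of_int t))))\<^sup>2" for x
  by (rule local_fourier[where b = "%t. cnj (W (x + \<nu> + q * int Q * t))" and R = T and c = 0, OF T])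
    (use good_le[OF W] in "auto simp: D_def")
 then obtain \<alpha> :: "int => real" where al: "!!x. D x / 2 <= (norm (av (zp T) (%t. W (x + q * int Q * t) * ee (\<alpha> x * of_int t))))\<^sup>2"
  by metis
 have "\<epsilon> ^ 14 = \<epsilon> ^ 6 * \<epsilon> ^ 8" by (simp flip: power_add)
 also have "... <= (1 / 2) ^ 6 * \<epsilon> ^ 8" using e by (intro mult_right_mono power_mono) auto
 also have "... = \<epsilon> ^ 4 / 2 * (\<epsilon> ^ 4 / 16) / 2" by (simp add: power_add[symmetric] power_one_over)
 also have "... <= av ?z D / 2" using nu unfolding D_def by (intro divide_right_mono) auto
 also have "... = av ?z (%x. D x / 2)" by (rule av_divide[symmetric])
 also have "... <= av ?z (%x. norm (av (zp T) (%t. W (x + q * int Q * t) * ee (\<alpha> x * of_int t))))"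
 proof (rule av_mono)
  fix x
  let ?n = "norm (av (zp T) (%t. W (x + q * int Q * t) * ee (\<alpha> x * of_int t)))"
  have "?n <= 1" by (intro norm_av_le_1 mult_le_1 good_le[OF W]) simp
  then have "?n\<^sup>2 <= ?n" by (simp add: power2_eq_square mult_left_le)
  with al[of x] show "D x / 2 <= ?n" by linarith
 qed
 finally show ?thesis by blast
qed

section \<open>Cubes of differences and structured weights\<close>

text \<open>Lists model U^n, so that the number of difference variables can be the subject of an
  induction.\<close>

definition lists_of :: "'a set => nat => 'a list set" where
 "lists_of U n = {xs. set xs \<subseteq> U \<and> length xs = n}"

lemma lists_of_0 [simp]: "lists_of U 0 = {[]}" by (auto simp: lists_of_def)

lemma lists_of_Suc: "lists_of U (Suc n) = (%p. fst p # snd p) ` (U \<times> lists_of U n)"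
 by (auto simp: lists_of_def length_Suc_conv image_iff)

lemma finite_lists_of: "finite U ==> finite (lists_of U n)"
 unfolding lists_of_def by (rule finite_lists_length_eq)

lemma lists_of_ne: "U ~= {} ==> lists_of U n ~= {}"
 by (induction n) (auto simp: lists_of_Suc)

lemma av_lists_0: "av (lists_of U 0) f = f []" by (simp add: av_def)

lemma av_lists_Suc: "av (lists_of U (Suc n)) f = av U (%u. av (lists_of U n) (%r. f (u # r)))"
proof -
 have "bij_betw (%p. fst p # snd p) (U \<times> lists_of U n) (lists_of U (Suc n))"
  unfolding lists_of_Suc by (rule inj_on_imp_bij_betw) (auto intro: inj_onI)
 from av_reindex[OF this, of f] show ?thesis by (simp add: av_Times)
qed

text \<open>The product of G over the 2^n vertices of the box spanned by two points, conjugated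
  according to parity. For lists of equal length the second equation is reached only when both are
  empty.\<close>

fun dx :: "'a list => 'a list => ('a list => complex) => complex" where
 "dx (u # us) (u' # us') G = dx us us' (%r. G (u # r) * cnj (G (u' # r)))"
| "dx us us' G = G []"

text \<open>The cube product without the vertex \<open>us\<close>. Every other vertex misses at
  least one entry of \<open>us\<close>, which makes this a structured weight
  (\<open>struct_kx\<close>).\<close>

fun kx :: "'a list => 'a list => ('a list => complex) => complex" where
 "kx (u # us) (u' # us') G = cnj (G (u' # us)) * kx us us' (%r. G (u # r) * cnj (G (u' # r)))"
| "kx us us' G = 1"

lemma dx_eq_kx: "length us = length us' ==> dx us us' G = G us * kx us us' G"
 by (induction us us' arbitrary: G rule: list_induct2) auto

lemma good_dx: "(!!v. good P (%x. G x v)) ==> good P (%x. dx us us' (G x))"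
proof (induction us arbitrary: us' G)
 case Nil then show ?case by simp
next
 case (Cons u us)
 show ?case
 proof (cases us')
  case Nil then show ?thesis using Cons.prems by simp
 next
  case (Cons a list)
  then show ?thesis using Cons.prems by (auto intro!: Cons.IH good_mult good_cnj)
 qed
qed

text \<open>A product of n bounded factors, the i-th of which does not depend on the i-th list
  entry: the weights that n applications of Cauchy-Schwarz remove. The bound is required of each
  factor because they are discarded one by one.\<close>

fun struct :: "nat => ('a list => 'z => complex) => bool" where
 "struct 0 \<beta> \<longleftrightarrow> (\<forall>z. \<beta> [] z = 1)"
| "struct (Suc n) \<beta> \<longleftrightarrow> (\<exists>b \<gamma>. (\<forall>u r z. \<beta> (u # r) z = b r z * \<gamma> u r z) \<and> (\<forall>r z. norm (b r z) <= 1) \<and> (\<forall>u. struct n (\<gamma> u)))"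

lemma struct_kx: "(!!z v. norm (G z v) <= 1) ==> length us' = n ==> struct n (%us z. kx us us' (G z))"
proof (induction n arbitrary: us' G)
 case (Suc n)
 then obtain u' us'' where us': "us' = u' # us''" by (cases us') auto
 have st: "struct n (%us z. kx us us'' (%r. G z (u # r) * cnj (G z (u' # r))))" for u
  by (rule Suc.IH[where G = "%z r. G z (u # r) * cnj (G z (u' # r))"]) (use Suc.prems us' in "auto intro!: mult_le_1")
 show ?case unfolding struct.simps us'
  by (rule exI[of _ "%r z. cnj (G z (u' # r))"], rule exI[of _ "%u r z. kx r us'' (%r. G z (u # r) * cnj (G z (u' # r)))"])
    (use Suc.prems st in auto)
qed simp

text \<open>The invariant of degree lowering. The frequency \<alpha> may depend on u and y in an
  arbitrary way; the weight may depend on everything, but only through factors that each miss an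
  entry of u.\<close>

definition locstruct :: "nat => int => int set => int => nat => nat => (int => complex) => real => bool" where
 "locstruct P q U \<sigma> T n F \<eta> \<longleftrightarrow> (\<exists>\<alpha> \<beta>. struct n \<beta> \<and> \<eta> <= av (lists_of U n) (%u. av (zp P) (%y.
   norm (av (zp T) (%t. F (y + \<sigma> * t + q * sum_list u) * \<beta> u (y, t) * ee (\<alpha> u y * of_int t))))))"

text \<open>One-sided differences are cubes whose opposite corner is the zero list.\<close>

lemma ua_dx: "ua q U n \<Phi> F = av (lists_of U n) (%us. \<Phi> (%x. dx us (replicate n 0) (%v. F (x + q * sum_list v))))"
proof (induction n arbitrary: F)
 case 0 then show ?case by (simp add: av_lists_0 del: lists_of_0)
next
 case (Suc n)
 show ?case unfolding av_lists_Suc ua.simps Suc by (simp add: algebra_simps)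
qed

text \<open>Multiplicative derivatives respect products, conjugates and translates, so the pair of
  shifts may be formed after differencing instead of before.\<close>

lemma ua_av_pairs: "av S (%i. ua q U n \<Phi> (%x. F (x + c i) * cnj (F (x + d i)))) =
 ua q U n (%W. av S (%i. \<Phi> (%x. W (x + c i) * cnj (W (x + d i))))) F"
proof (induction n arbitrary: F)
 case (Suc n)
 have "av S (%i. ua q U (Suc n) \<Phi> (%x. F (x + c i) * cnj (F (x + d i)))) =
  av U (%h. av S (%i. ua q U n \<Phi> (%x. F (x + q * h + c i) * cnj (F (x + q * h + d i)) * cnj (F (x + c i) * cnj (F (x + d i))))))"
  unfolding ua.simps by (rule av_swap)
 also have "... = av U (%h. av S (%i. ua q U n \<Phi> (%x. (%x. F (x + q * h) * cnj (F x)) (x + c i) * cnj ((%x. F (x + q * h) * cnj (F x)) (x + d i)))))"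
  by (simp add: algebra_simps)
 also have "... = ua q U (Suc n) (%W. av S (%i. \<Phi> (%x. W (x + c i) * cnj (W (x + d i))))) F"
  unfolding ua.simps by (rule av_cong1) (rule Suc)
 finally show ?case .
qed simp

text \<open>For each u the n-fold derivative of F is a function to which \<open>bilinear\<close>
  applies. On the resulting progressions the vertex u of the cube supplies F itself, and the
  remaining vertices are the structured weight. The exponent is 1 + 14.\<close>

lemma locstruct_of_concatenation:
 assumes P: "P > 0" and F: "good P F" and e: "0 < \<epsilon>" "\<epsilon> <= 1/2" and H: "0 < H" and L: "0 < L" and T: "0 < T" and U: "finite U" "U ~= {}"
  and big: "2 * \<epsilon> <= av {j..<j + int H} (%b. av (zp L) (%m. av (zp L) (%m'.
   ua q U n (%T. norm (av (zp P) T)) (%x. F (x + q * b * m) * cnj (F (x + q * b * m'))))))"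
  and dvd: "!!r::nat. 1 <= r ==> real r <= 72 / \<epsilon> ^ 4 ==> r dvd Q"
  and sizes: "1024 <= \<epsilon> ^ 8 * real L" "4608 <= \<epsilon> ^ 8 * real H" "2 ^ 21 * real T * real Q <= \<epsilon> ^ 12 * real L * real H"
 shows "locstruct P q U (q * int Q) T n F (\<epsilon> ^ 15)"
proof -
 define \<psi> where "\<psi> W = av {j..<j + int H} (%b. av (zp L) (%m. av (zp L) (%m'.
  norm (av (zp P) (%x. W (x + q * b * m) * cnj (W (x + q * b * m')))))))" for W
 define W where "W us x = dx us (replicate n 0) (%v. F (x + q * sum_list v))" for us x
 have W: "good P (W us)" for us unfolding W_def by (intro good_dx good_shift F)
 have "av {j..<j + int H} (%b. av (zp L) (%m. av (zp L) (%m'.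
   ua q U n (%T. norm (av (zp P) T)) (%x. F (x + q * b * m) * cnj (F (x + q * b * m')))))) =
  av ({j..<j + int H} \<times> zp L \<times> zp L) (%i. ua q U n (%T. norm (av (zp P) T)) (%x. F (x + q * fst i * fst (snd i)) * cnj (F (x + q * fst i * snd (snd i)))))"
  unfolding av_Times by simp
 also have "... = ua q U n \<psi> F"
 proof -
  have "\<psi> = (%W. av ({j..<j + int H} \<times> zp L \<times> zp L) (%i. norm (av (zp P) (%x. W (x + q * fst i * fst (snd i)) * cnj (W (x + q * fst i * snd (snd i)))))))"
   unfolding \<psi>_def[abs_def] av_Times by simp
  then show ?thesis
   using ua_av_pairs[of "{j..<j + int H} \<times> zp L \<times> zp L" q U n "%T. norm (av (zp P) T)" F "%i. q * fst i * fst (snd i)" "%i. q * fst i * snd (snd i)"]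
   by simp
 qed
 also have "... = av (lists_of U n) (%us. \<psi> (W us))" unfolding ua_dx W_def ..
 finally have 1: "2 * \<epsilon> <= av (lists_of U n) (%us. \<psi> (W us))" using big by simp
 have "\<exists>\<alpha>::int => real. \<epsilon> <= \<psi> (W us) --> \<epsilon> ^ 14 <= av (zp P) (%y. norm (av (zp T) (%t. W us (y + q * int Q * t) * ee (\<alpha> y * of_int t))))" for us
 proof (cases "\<epsilon> <= \<psi> (W us)")
  case True
  from bilinear[OF P W e H L T True[unfolded \<psi>_def] dvd sizes] show ?thesis by blast
 qed simp
 then obtain \<alpha> :: "int list => int => real" where al: "!!us. \<epsilon> <= \<psi> (W us) ==> \<epsilon> ^ 14 <= av (zp P) (%y. norm (av (zp T) (%t. W us (y + q * int Q * t) * ee (\<alpha> us y * of_int t))))"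
  using choice[of "%us \<alpha>. \<epsilon> <= \<psi> (W us) --> \<epsilon> ^ 14 <= av (zp P) (%y. norm (av (zp T) (%t. W us (y + q * int Q * t) * ee (\<alpha> y * of_int t))))"]
  by blast
 have "\<epsilon> * \<epsilon> ^ 14 <= av (lists_of U n) (%us. av (zp P) (%y. norm (av (zp T) (%t. W us (y + q * int Q * t) * ee (\<alpha> us y * of_int t)))))"
 proof (rule av_threshold[OF finite_lists_of[OF U(1)] lists_of_ne[OF U(2)] 1])
  show "\<psi> (W us) <= 1" for us unfolding \<psi>_def by (intro av_le norm_av_le_1 mult_le_1 good_le[OF W] good_le[OF good_cnj[OF W]]) auto
 qed (use e al in "auto intro!: av_nonneg")
 also have "... = av (lists_of U n) (%u. av (zp P) (%y. norm (av (zp T) (%t.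
   F (y + q * int Q * t + q * sum_list u) * kx u (replicate n 0) (%v. F (y + q * int Q * t + q * sum_list v)) * ee (\<alpha> u y * of_int t)))))"
 proof (rule av_cong1)
  fix us :: "int list" assume "us \<in> lists_of U n"
  then have "length us = length (replicate n (0::int))" by (simp add: lists_of_def)
  then show "av (zp P) (%y. norm (av (zp T) (%t. W us (y + q * int Q * t) * ee (\<alpha> us y * of_int t)))) =
   av (zp P) (%y. norm (av (zp T) (%t. F (y + q * int Q * t + q * sum_list us) * kx us (replicate n 0) (%v. F (y + q * int Q * t + q * sum_list v)) * ee (\<alpha> us y * of_int t))))"
   unfolding W_def by (simp only: dx_eq_kx)
 qed
 finally have "\<epsilon> ^ 15 <= av (lists_of U n) (%u. av (zp P) (%y. norm (av (zp T) (%t.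
   F (y + q * int Q * t + q * sum_list u) * kx u (replicate n 0) (%v. F (y + q * int Q * t + q * sum_list v)) * ee (\<alpha> u y * of_int t)))))"
  by (simp flip: power_Suc)
 then show ?thesis unfolding locstruct_def
  by (intro exI[of _ \<alpha>] exI[of _ "%u z. kx u (replicate n 0) (%v. F (fst z + q * int Q * snd z + q * sum_list v))"] conjI struct_kx)
    (auto simp: good_le[OF F])
qed

lemma struct_mult: "struct n \<beta> ==> struct n \<beta>' ==> struct n (%u z. \<beta> u z * \<beta>' u z)"
proof (induction n arbitrary: \<beta> \<beta>')
 case (Suc n)
 obtain b \<gamma> where 1: "!!u r z. \<beta> (u # r) z = b r z * \<gamma> u r z" "!!r z. norm (b r z) <= 1" "!!u. struct n (\<gamma> u)"
  using Suc.prems(1) by auto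
 obtain b' \<gamma>' where 2: "!!u r z. \<beta>' (u # r) z = b' r z * \<gamma>' u r z" "!!r z. norm (b' r z) <= 1" "!!u. struct n (\<gamma>' u)"
  using Suc.prems(2) by auto
 show ?case unfolding struct.simps
  by (rule exI[of _ "%r z. b r z * b' r z"], rule exI[of _ "%u r z. \<gamma> u r z * \<gamma>' u r z"])
    (auto simp: 1(1) 2(1) intro!: mult_le_1 1(2) 2(2) Suc.IH 1(3) 2(3))
qed simp

lemma struct_cnj: "struct n \<beta> ==> struct n (%u z. cnj (\<beta> u z))"
proof (induction n arbitrary: \<beta>)
 case (Suc n)
 obtain b \<gamma> where 1: "!!u r z. \<beta> (u # r) z = b r z * \<gamma> u r z" "!!r z. norm (b r z) <= 1" "!!u. struct n (\<gamma> u)"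
  using Suc.prems(1) by auto
 show ?case unfolding struct.simps
  by (rule exI[of _ "%r z. cnj (b r z)"], rule exI[of _ "%u r z. cnj (\<gamma> u r z)"])
    (auto simp: 1 intro!: Suc.IH)
qed simp

lemma struct_comp: "struct n \<beta> ==> struct n (%u z. \<beta> u (h z))"
proof (induction n arbitrary: \<beta>)
 case (Suc n)
 obtain b \<gamma> where 1: "!!u r z. \<beta> (u # r) z = b r z * \<gamma> u r z" "!!r z. norm (b r z) <= 1" "!!u. struct n (\<gamma> u)"
  using Suc.prems(1) by auto
 show ?case unfolding struct.simps
  by (rule exI[of _ "%r z. b r (h z)"], rule exI[of _ "%u r z. \<gamma> u r (h z)"])
    (auto simp: 1 intro!: Suc.IH)
qed simp

lemma struct_bound: "struct n \<beta> ==> length u = n ==> norm (\<beta> u z) <= 1"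
proof (induction n arbitrary: \<beta> u)
 case (Suc n)
 obtain b \<gamma> where 1: "!!u r z. \<beta> (u # r) z = b r z * \<gamma> u r z" "!!r z. norm (b r z) <= 1" "!!u. struct n (\<gamma> u)"
  using Suc.prems(1) by auto
 obtain x r where u: "u = x # r" using Suc.prems(2) by (cases u) auto
 show ?case unfolding u 1(1) using Suc.prems(2) by (intro mult_le_1 1(2) Suc.IH 1(3)) (simp add: u)
qed simp

lemma dx_mult: "dx us us' (%v. f v * g v) = dx us us' f * dx us us' g"
proof (induction us us' f arbitrary: g rule: dx.induct)
 case (1 u us u' us' G)
 show ?case using 1[of "%r. g (u # r) * cnj (g (u' # r))"] by (simp add: mult_ac)
qed auto

fun px :: "'a list => 'a list => ('a list => real) => real" where
 "px (u # us) (u' # us') f = px us us' (%r. f (u # r) - f (u' # r))"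
| "px us us' f = f []"

lemma dx_ee: "dx us us' (%v. ee (f v * t)) = ee (px us us' f * t)"
proof (induction us us' f rule: px.induct)
 case (1 u us u' us' f)
 then show ?case by (simp add: left_diff_distrib ee_diff)
qed auto

lemma norm_dx_le: "(!!v. norm (G v) <= 1) ==> norm (dx us us' G) <= 1"
proof (induction us us' G rule: dx.induct)
 case (1 u us u' us' G)
 have "norm (G (u # v) * cnj (G (u' # v))) <= 1" for v by (intro mult_le_1) (simp_all add: 1(2))
 from 1(1)[OF this] show ?case by simp
qed auto

lemma norm_kx_ee: "norm (kx us us' (%v. ee (f v * t))) = 1"
proof (induction us us' f rule: px.induct)
 case (1 u us u' us' f)
 have "(%r. ee (f (u # r) * t) * cnj (ee (f (u' # r) * t))) = (%v. ee ((f (u # v) - f (u' # v)) * t))"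
  by (simp add: left_diff_distrib ee_diff)
 then show ?case using 1 by (simp add: norm_mult)
qed auto

text \<open>Each step discards the factor that is free of the leading entry and doubles that entry;
  the product of \<open>\<gamma> u\<close> with the conjugate of \<open>\<gamma> u'\<close> is again
  structured, with one factor fewer.\<close>

lemma box_cauchy_schwarz:
 "struct n \<beta> ==> norm (av Z (%z. av (lists_of U n) (%u. G z u * \<beta> u z))) ^ (2 ^ n) <=
  av (lists_of U n) (%us. av (lists_of U n) (%us'. norm (av Z (%z. dx us us' (G z)))))"
proof (induction n arbitrary: \<beta> G)
 case 0
 then show ?case by (simp add: av_lists_0 del: lists_of_0)
next
 case (Suc n)
 let ?l = "lists_of U n"
 obtain b \<gamma> where 1: "!!u r z. \<beta> (u # r) z = b r z * \<gamma> u r z" "!!r z. norm (b r z) <= 1" "!!u. struct n (\<gamma> u)"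
  using Suc.prems by auto
 define Y where "Y u u' = norm (av Z (%z. av ?l (%r. (G z (u # r) * cnj (G z (u' # r))) * (\<gamma> u r z * cnj (\<gamma> u' r z)))))" for u u'
 let ?X = "norm (av Z (%z. av (lists_of U (Suc n)) (%u. G z u * \<beta> u z)))"
 have "av Z (%z. av (lists_of U (Suc n)) (%u. G z u * \<beta> u z)) = av Z (%z. av ?l (%r. av U (%u. b r z * (G z (u # r) * \<gamma> u r z))))"
  unfolding av_lists_Suc 1(1) by (rule av_cong1) (subst av_swap, simp add: mult_ac)
 also have "... = av (Z \<times> ?l) (%p. b (snd p) (fst p) * av U (%u. G (fst p) (u # snd p) * \<gamma> u (snd p) (fst p)))"
  unfolding av_Times av_mult_left by simp
 finally have "?X\<^sup>2 <= av (Z \<times> ?l) (%p. (norm (av U (%u. G (fst p) (u # snd p) * \<gamma> u (snd p) (fst p))))\<^sup>2)"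
  by (simp only:) (rule av_kill, rule 1(2))
 also have "... = norm (complex_of_real (av (Z \<times> ?l) (%p. (norm (av U (%u. G (fst p) (u # snd p) * \<gamma> u (snd p) (fst p))))\<^sup>2)))"
  using av_nonneg[of "Z \<times> ?l" "%p. (norm (av U (%u. G (fst p) (u # snd p) * \<gamma> u (snd p) (fst p))))\<^sup>2"] by simp
 also have "complex_of_real (av (Z \<times> ?l) (%p. (norm (av U (%u. G (fst p) (u # snd p) * \<gamma> u (snd p) (fst p))))\<^sup>2)) =
  av (Z \<times> ?l) (%p. av U (%u. av U (%u'. G (fst p) (u # snd p) * \<gamma> u (snd p) (fst p) * cnj (G (fst p) (u' # snd p) * \<gamma> u' (snd p) (fst p)))))"
  unfolding of_real_av av_norm_square ..
 also have "... = av U (%u. av U (%u'. av (Z \<times> ?l) (%p. G (fst p) (u # snd p) * \<gamma> u (snd p) (fst p) * cnj (G (fst p) (u' # snd p) * \<gamma> u' (snd p) (fst p)))))"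
  by (rule av_rot3)
 also have "norm ... <= av U (%u. av U (%u'. Y u u'))"
  unfolding Y_def av_Times
  by (rule order_trans[OF norm_av_le], rule av_mono, rule order_trans[OF norm_av_le], rule av_mono) (simp add: mult_ac)
 finally have X: "?X\<^sup>2 <= av U (%u. av U (%u'. Y u u'))" .
 have Y0: "0 <= Y u u'" for u u' by (simp add: Y_def)
 have "?X ^ (2 ^ Suc n) = (?X\<^sup>2) ^ (2 ^ n)" by (simp add: power_mult[symmetric])
 also have "... <= (av U (%u. av U (%u'. Y u u'))) ^ (2 ^ n)" by (intro power_mono X) simp
 also have "... <= av U (%u. av U (%u'. Y u u' ^ (2 ^ n)))"
  by (rule order_trans[OF av_power_le], intro av_nonneg Y0, rule av_mono, rule av_power_le, rule Y0)
 also have "... <= av U (%u. av U (%u'. av ?l (%us. av ?l (%us'. norm (av Z (%z. dx (u # us) (u' # us') (G z)))))))"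
 proof (rule av_mono, rule av_mono)
  fix u u'
  have "struct n (%r z. \<gamma> u r z * cnj (\<gamma> u' r z))" by (intro struct_mult struct_cnj 1(3))
  from Suc.IH[OF this, of "%z r. G z (u # r) * cnj (G z (u' # r))"]
  show "Y u u' ^ (2 ^ n) <= av ?l (%us. av ?l (%us'. norm (av Z (%z. dx (u # us) (u' # us') (G z)))))"
   by (simp add: Y_def)
 qed
 also have "... = av U (%u. av ?l (%us. av U (%u'. av ?l (%us'. norm (av Z (%z. dx (u # us) (u' # us') (G z)))))))"
  by (rule av_cong1) (rule av_swap)
 finally show ?case unfolding av_lists_Suc .
qed

section \<open>Phases met by dual functions lie on major arcs\<close>

text \<open>Replacing d by d + 2 Q' w and t by t + 2 d w + 2 Q' w^2 leaves the argument of G0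
  unchanged and moves that of G1 by 2 q1 Q' w. After averaging over w, G0 drops out and the phase
  has become a quadratic polynomial in w whose coefficients are multiples of \<Psi> y. The two error
  terms are the boundary costs of the shifts in d and in t.\<close>

lemma dual_window:
 fixes c :: "int => complex" and \<Psi> :: "int => real"
 assumes P: "P > 0" and M: "M > 0" and T: "T > 0" and W: "W > 0" and g: "good P G0" "good P G1" and c: "!!y. norm (c y) <= 1"
  and big: "\<eta> <= norm (av (zp P) (%y. av (zp T) (%t. av (zp M) (%d. c y * (ee (\<Psi> y * of_int t) *
   (G0 (y + 2 * q2 * int Q' * t - q2 * d\<^sup>2) * G1 (y + 2 * q2 * int Q' * t - q2 * d\<^sup>2 + q1 * d)))))))"
 shows "\<exists>d\<in>zp M. \<exists>s. \<eta> - (4 * real Q' * real W / real M + 4 * (real M * real W + real Q' * (real W)\<^sup>2) / real T) <=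
  av (zp P) (%y. norm (c y) * norm (av (zp W) (%w. G1 (y + s + 2 * q1 * int Q' * w) * ee (\<Psi> y * of_int (2 * d * w + 2 * int Q' * w\<^sup>2)))))"
proof -
 define e1 where "e1 = 4 * real Q' * real W / real M"
 define e2 where "e2 = 4 * (real M * real W + real Q' * (real W)\<^sup>2) / real T"
 have e0: "0 <= e1" "0 <= e2" by (auto simp: e1_def e2_def)
 have Wz: "finite (zp W)" "zp W ~= {}" and Tz: "finite (zp T)" "zp T ~= {}" and Mz: "finite (zp M)" "zp M ~= {}" using W T M by auto
 define f where "f y t d = ee (\<Psi> y * of_int t) * (G0 (y + 2 * q2 * int Q' * t - q2 * d\<^sup>2) * G1 (y + 2 * q2 * int Q' * t - q2 * d\<^sup>2 + q1 * d))" for y t d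
 have f1: "norm (f y t d) <= 1" for y t d unfolding f_def by (intro mult_le_1 good_le[OF g(1)] good_le[OF g(2)]) simp
 have win: "norm (av (zp T) (%t. av (zp M) (%d. f y t d)) - av (zp T) (%t. av (zp M) (%d. f y (t + (2 * d * w + 2 * int Q' * w\<^sup>2)) (d + 2 * int Q' * w)))) <= e1 + e2"
  if w: "w \<in> zp W" for y w
 proof -
  have w': "0 <= real_of_int w" "real_of_int w <= real W" using w by auto
  have sM: "shiftok (zp M) (2 * int Q' * w) e1"
   by (rule shiftok_int') (use M w in "auto simp: e1_def abs_mult intro!: divide_right_mono mult_left_mono")
  have sT: "shiftok (zp T) (2 * d * w + 2 * int Q' * w\<^sup>2) e2" if d: "d \<in> zp M" for d
  proof (rule shiftok_int'[OF T])
   have "real_of_int d * w <= real M * real W" using d w by (intro mult_mono) auto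
   moreover have "real Q' * (real_of_int w)\<^sup>2 <= real Q' * (real W)\<^sup>2" using w by (intro mult_left_mono power_mono) auto
   moreover have "0 <= real_of_int d * w" "0 <= real Q' * (real_of_int w)\<^sup>2" using d w' by auto
   ultimately have "2 * \<bar>real_of_int (2 * d * w + 2 * int Q' * w\<^sup>2)\<bar> <= 4 * (real M * real W + real Q' * (real W)\<^sup>2)" by simp
   then show "2 * \<bar>real_of_int (2 * d * w + 2 * int Q' * w\<^sup>2)\<bar> / real T <= e2" unfolding e2_def by (rule divide_right_mono) simp
  qed simp
  have a: "norm (av (zp T) (%t. av (zp M) (%d. f y t (d + 2 * int Q' * w))) - av (zp T) (%t. av (zp M) (%d. f y t d))) <= e1"
   unfolding av_diff[symmetric] by (rule norm_av_bound[OF _ e0(1)]) (simp only: av_diff, rule shiftokD[OF sM f1])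
  have b: "norm (av (zp M) (%d. av (zp T) (%t. f y (t + (2 * d * w + 2 * int Q' * w\<^sup>2)) (d + 2 * int Q' * w))) - av (zp M) (%d. av (zp T) (%t. f y t (d + 2 * int Q' * w)))) <= e2"
   unfolding av_diff[symmetric]
  proof (rule norm_av_bound[OF _ e0(2)])
   fix d assume "d \<in> zp M"
   from shiftokD[OF sT[OF this], of "%t. f y t (d + 2 * int Q' * w)"] f1
   show "norm (av (zp T) (%t. f y (t + (2 * d * w + 2 * int Q' * w\<^sup>2)) (d + 2 * int Q' * w) - f y t (d + 2 * int Q' * w))) <= e2"
    unfolding av_diff by simp
  qed
  show ?thesis
   using norm_triangle_ineq[of "av (zp T) (%t. av (zp M) (%d. f y t d)) - av (zp T) (%t. av (zp M) (%d. f y t (d + 2 * int Q' * w)))"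
     "av (zp T) (%t. av (zp M) (%d. f y t (d + 2 * int Q' * w))) - av (zp T) (%t. av (zp M) (%d. f y (t + (2 * d * w + 2 * int Q' * w\<^sup>2)) (d + 2 * int Q' * w)))"]
    a b unfolding av_swap[of "zp M" "zp T"] by (simp add: norm_minus_commute)
 qed
 define A where "A = av (zp P) (%y. c y * av (zp T) (%t. av (zp M) (%d. f y t d)))"
 define A' where "A' = av (zp P) (%y. c y * av (zp W) (%w. av (zp T) (%t. av (zp M) (%d. f y (t + (2 * d * w + 2 * int Q' * w\<^sup>2)) (d + 2 * int Q' * w)))))"
 have "norm (A - A') <= e1 + e2"
  unfolding A_def A'_def av_diff[symmetric]
 proof (rule norm_av_bound)
  fix y
  have "av (zp T) (%t. av (zp M) (%d. f y t d)) - av (zp W) (%w. av (zp T) (%t. av (zp M) (%d. f y (t + (2 * d * w + 2 * int Q' * w\<^sup>2)) (d + 2 * int Q' * w)))) =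
   av (zp W) (%w. av (zp T) (%t. av (zp M) (%d. f y t d)) - av (zp T) (%t. av (zp M) (%d. f y (t + (2 * d * w + 2 * int Q' * w\<^sup>2)) (d + 2 * int Q' * w))))"
   unfolding av_diff[of "zp W"] av_const[OF Wz] ..
  also have "norm ... <= e1 + e2" by (rule norm_av_bound[OF win]) (use e0 in auto)
  finally have *: "norm (av (zp T) (%t. av (zp M) (%d. f y t d)) - av (zp W) (%w. av (zp T) (%t. av (zp M) (%d. f y (t + (2 * d * w + 2 * int Q' * w\<^sup>2)) (d + 2 * int Q' * w))))) <= e1 + e2" .
  show "norm (c y * av (zp T) (%t. av (zp M) (%d. f y t d)) - c y * av (zp W) (%w. av (zp T) (%t. av (zp M) (%d. f y (t + (2 * d * w + 2 * int Q' * w\<^sup>2)) (d + 2 * int Q' * w))))) <= e1 + e2"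
   unfolding right_diff_distrib[symmetric] norm_mult
   by (rule order_trans[OF mult_right_mono[OF c] ]) (use * in auto)
 qed (use e0 in simp)
 moreover have "\<eta> <= norm A" using big unfolding A_def f_def av_mult_left .
 ultimately have A': "\<eta> - (e1 + e2) <= norm A'" using norm_triangle_ineq2[of A A'] by simp
 define K where "K t d y = norm (c y) * norm (av (zp W) (%w. G1 (y + (2 * q2 * int Q' * t - q2 * d\<^sup>2 + q1 * d) + 2 * q1 * int Q' * w) * ee (\<Psi> y * of_int (2 * d * w + 2 * int Q' * w\<^sup>2))))" for t d y
 have "A' = av (zp P) (%y. av (zp T) (%t. av (zp M) (%d. c y * av (zp W) (%w. f y (t + (2 * d * w + 2 * int Q' * w\<^sup>2)) (d + 2 * int Q' * w)))))"
  unfolding A'_def av_mult_left by (rule av_cong1) (subst av_rot3, rule refl)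
 also have "... = av (zp T) (%t. av (zp M) (%d. av (zp P) (%y. c y * av (zp W) (%w. f y (t + (2 * d * w + 2 * int Q' * w\<^sup>2)) (d + 2 * int Q' * w)))))"
  by (rule av_rot3)
 finally have A'eq: "A' = av (zp T) (%t. av (zp M) (%d. av (zp P) (%y. c y * av (zp W) (%w. f y (t + (2 * d * w + 2 * int Q' * w\<^sup>2)) (d + 2 * int Q' * w)))))" .
 have A'le: "norm A' <= av (zp T) (%t. av (zp M) (%d. av (zp P) (K t d)))"
  unfolding A'eq
 proof (rule order_trans[OF norm_av_le], rule av_mono, rule order_trans[OF norm_av_le], rule av_mono, rule order_trans[OF norm_av_le], rule av_mono)
  fix t d y
  have "f y (t + (2 * d * w + 2 * int Q' * w\<^sup>2)) (d + 2 * int Q' * w) = ee (\<Psi> y * of_int t) * G0 (y + 2 * q2 * int Q' * t - q2 * d\<^sup>2) *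
   (G1 (y + (2 * q2 * int Q' * t - q2 * d\<^sup>2 + q1 * d) + 2 * q1 * int Q' * w) * ee (\<Psi> y * of_int (2 * d * w + 2 * int Q' * w\<^sup>2)))" for w
  proof -
   have "y + 2 * q2 * int Q' * (t + (2 * d * w + 2 * int Q' * w\<^sup>2)) - q2 * (d + 2 * int Q' * w)\<^sup>2 = y + 2 * q2 * int Q' * t - q2 * d\<^sup>2"
    by (simp add: algebra_simps power2_eq_square)
   moreover have "y + 2 * q2 * int Q' * t - q2 * d\<^sup>2 + q1 * (d + 2 * int Q' * w) = y + (2 * q2 * int Q' * t - q2 * d\<^sup>2 + q1 * d) + 2 * q1 * int Q' * w"
    by (simp add: algebra_simps)
   ultimately show ?thesis unfolding f_def of_int_add[of t] distrib_left[of "\<Psi> y"] ee_add by (simp only: mult_ac)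
  qed
  then have "norm (c y * av (zp W) (%w. f y (t + (2 * d * w + 2 * int Q' * w\<^sup>2)) (d + 2 * int Q' * w))) =
   K t d y * norm (G0 (y + 2 * q2 * int Q' * t - q2 * d\<^sup>2))"
   unfolding K_def by (simp only: av_mult_left norm_mult norm_ee) simp
  also have "... <= K t d y * 1" by (intro mult_left_mono good_le[OF g(1)]) (simp add: K_def)
  finally show "norm (c y * av (zp W) (%w. f y (t + (2 * d * w + 2 * int Q' * w\<^sup>2)) (d + 2 * int Q' * w))) <= K t d y" by simp
 qed
 from av_pigeonhole[OF Tz order_trans[OF A' A'le]] obtain t where t: "\<eta> - (e1 + e2) <= av (zp M) (%d. av (zp P) (K t d))" by blast
 from av_pigeonhole[OF Mz this] obtain d where d: "d \<in> zp M" "\<eta> - (e1 + e2) <= av (zp P) (K t d)" by blast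
 show ?thesis
  by (rule bexI[OF _ d(1)], rule exI[of _ "2 * q2 * int Q' * t - q2 * d\<^sup>2 + q1 * d"]) (rule d(2)[unfolded e1_def e2_def K_def])
qed

lemma sum_square_by_difference:
 "(\<Sum>w\<in>zp W. \<Sum>w'\<in>zp W. f w w') = (\<Sum>k\<in>{- int W..<int W}. \<Sum>w\<in>{max 0 (- k)..<max 0 (- k) + int (nat (int W - \<bar>k\<bar>))}. f w (w + k))"
proof -
 have "(\<Sum>w\<in>zp W. \<Sum>w'\<in>zp W. f w w') = (\<Sum>p\<in>zp W \<times> zp W. f (fst p) (snd p))"
  unfolding sum.cartesian_product by (simp add: case_prod_unfold)
 also have "... = (\<Sum>p\<in>(SIGMA k:{- int W..<int W}. {max 0 (- k)..<max 0 (- k) + int (nat (int W - \<bar>k\<bar>))}). f (snd p) (snd p + fst p))"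
  by (rule sum.reindex_bij_witness[where i = "%p. (snd p, snd p + fst p)" and j = "%p. (snd p - fst p, fst p)"])
    (auto simp: max_def split: if_splits)
 also have "... = (\<Sum>k\<in>{- int W..<int W}. \<Sum>w\<in>{max 0 (- k)..<max 0 (- k) + int (nat (int W - \<bar>k\<bar>))}. f w (w + k))"
  by (subst sum.Sigma) (auto simp: case_prod_unfold)
 finally show ?thesis .
qed

lemma cnj_sgn_mult: "cnj (sgn z) * z = complex_of_real (norm z)"
proof (cases "z = 0")
 case False
 have "cnj (sgn z) * z = (z * cnj z) / complex_of_real (norm z)"
  by (simp add: sgn_div_norm scaleR_conv_of_real divide_inverse)
 also have "... = complex_of_real (norm z)"
  unfolding complex_norm_square[symmetric] using False by (simp add: power2_eq_square)
 finally show ?thesis .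
qed simp

text \<open>Removing G by Cauchy-Schwarz compares \<Psi> at y and at y + q' k through a quadratic
  sum in w. Weyl's inequality controls both coefficients A and B with a common r, and d (r A) - Q'
  (r B) = 4 r Q'^2 k \<Psi> y no longer contains the unknown value at y + q' k. So k \<theta> is
  near an integer for many k, and \<open>vinogradov\<close> in k places \<Psi> y near a rational
  with denominator dividing R^3 Q'^2.\<close>

lemma phase_major:
 fixes c :: "int => complex" and \<Psi> :: "int => real"
 assumes P: "P > 0" and W: "W > 0" and G: "good P G" and c: "!!y. norm (c y) <= 1" "per P c" and psi: "per P \<Psi>"
  and e: "0 < \<epsilon>" "\<epsilon> <= 1" and d: "d \<in> zp M"
  and big: "\<epsilon> <= av (zp P) (%y. norm (c y) * norm (av (zp W) (%w. G (y + s + 2 * q1 * int Q' * w) * ee (\<Psi> y * of_int (2 * d * w + 2 * int Q' * w\<^sup>2)))))"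
  and dvd: "!!r::nat. 1 <= r ==> real r <= 1152 / \<epsilon> ^ 4 ==> r dvd R" "4 dvd R" and R: "R > 0"
  and sizes: "2 ^ 36 / \<epsilon> ^ 14 <= real W" "real R * (real Q' * 2 ^ 40 / (\<epsilon> ^ 16 * real W) + real M * 2 ^ 26 / (\<epsilon> ^ 12 * (real W)\<^sup>2)) <= \<tau>" "\<tau> <= \<epsilon>\<^sup>2 / 128"
 shows "\<epsilon>\<^sup>2 / 8 <= av (zp P) (%y. of_bool (c y ~= 0 \<and> dn (of_int (int (R ^ 3 * Q'\<^sup>2)) * \<Psi> y) <= 4608 * (real R)\<^sup>2 * \<tau> / (\<epsilon> ^ 4 * real W)))"
proof -
 let ?z = "zp P"
 have pz: "finite ?z" "?z ~= {}" using P by auto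
 define q' where "q' = 2 * q1 * int Q'"
 define p where "p w = 2 * d * w + 2 * int Q' * w\<^sup>2" for w
 define Z where "Z y = av (zp W) (%w. G (y + s + q' * w) * ee (\<Psi> y * of_int (p w)))" for y
 \<comment> \<open>The conjugate sign linearises the modulus; the factor |c| makes b y \<noteq> 0
   imply c y \<noteq> 0.\<close>
 define b where "b y = complex_of_real (norm (c y)) * cnj (sgn (Z y))" for y
 have Gp: "per P G" using G by (simp add: good_def)
 have Zp: "per P Z"
 proof -
  have "G (y + int P + s + q' * w) = G (y + s + q' * w)" for y w
   using Gp[unfolded per_def, rule_format, of "y + s + q' * w"] by (simp add: add_ac)
  then show ?thesis using psi unfolding Z_def per_def by simp
 qed
 have bp: "per P b" using Zp c(2) unfolding b_def per_def by simp
 have b1: "norm (b y) <= 1" for y unfolding b_def by (intro mult_le_1) (simp_all add: c norm_sgn)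
 have bz: "b y * Z y = complex_of_real (norm (c y) * norm (Z y))" for y
  unfolding b_def mult.assoc cnj_sgn_mult by simp
 define \<Phi> where "\<Phi> w y = b y * ee (\<Psi> y * of_int (p w))" for w y
 have Phip: "per P (\<Phi> w)" for w using bp psi unfolding \<Phi>_def per_def by simp
 define h where "h k y w = b y * cnj (b (y - q' * k)) * ee (\<Psi> y * of_int (p w) - \<Psi> (y - q' * k) * of_int (p (w + k)))" for k y w
 have "complex_of_real (av ?z (%y. norm (c y) * norm (Z y))) = av ?z (%y. b y * Z y)"
  unfolding of_real_av bz ..
 also have "... = av ?z (%y. av (zp W) (%w. G (y + s + q' * w) * \<Phi> w y))"
  unfolding Z_def \<Phi>_def av_mult_left[symmetric] by (simp only: mult_ac)
 also have "... = av (zp W) (%w. av ?z (%y. G (y + s + q' * w) * \<Phi> w y))" by (rule av_swap)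
 also have "... = av (zp W) (%w. av ?z (%Y. G Y * \<Phi> w (Y - (s + q' * w))))"
 proof (rule av_cong1)
  fix w
  have "per P (%Y. G Y * \<Phi> w (Y - (s + q' * w)))" by (intro per_times Gp per_shift2 Phip)
  from av_shift[OF P this, of "s + q' * w"]
  show "av ?z (%y. G (y + s + q' * w) * \<Phi> w y) = av ?z (%Y. G Y * \<Phi> w (Y - (s + q' * w)))" by (simp add: add.assoc)
 qed
 also have "... = av ?z (%Y. G Y * av (zp W) (%w. \<Phi> w (Y - (s + q' * w))))"
  by (subst av_swap) (simp only: av_mult_left)
 finally have 1: "complex_of_real (av ?z (%y. norm (c y) * norm (Z y))) = av ?z (%Y. G Y * av (zp W) (%w. \<Phi> w (Y - (s + q' * w))))" .
 have "\<epsilon> <= norm (av ?z (%Y. G Y * av (zp W) (%w. \<Phi> w (Y - (s + q' * w)))))"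
  unfolding 1[symmetric] using big unfolding Z_def p_def q'_def by (simp only: norm_of_real)
 then have "\<epsilon>\<^sup>2 <= (norm (av ?z (%Y. G Y * av (zp W) (%w. \<Phi> w (Y - (s + q' * w))))))\<^sup>2"
  using e by (intro power_mono) auto
 also have "... <= av ?z (%Y. (norm (av (zp W) (%w. \<Phi> w (Y - (s + q' * w)))))\<^sup>2)" by (rule av_kill) (rule good_le[OF G])
 also have "... = norm (complex_of_real (av ?z (%Y. (norm (av (zp W) (%w. \<Phi> w (Y - (s + q' * w)))))\<^sup>2)))"
  using av_nonneg[of ?z "%Y. (norm (av (zp W) (%w. \<Phi> w (Y - (s + q' * w)))))\<^sup>2"] by simp
 also have "complex_of_real (av ?z (%Y. (norm (av (zp W) (%w. \<Phi> w (Y - (s + q' * w)))))\<^sup>2)) =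
   av ?z (%Y. av (zp W) (%w. av (zp W) (%w'. \<Phi> w (Y - (s + q' * w)) * cnj (\<Phi> w' (Y - (s + q' * w'))))))"
  unfolding of_real_av av_norm_square ..
 also have "... = av (zp W) (%w. av (zp W) (%w'. av ?z (%Y. \<Phi> w (Y - (s + q' * w)) * cnj (\<Phi> w' (Y - (s + q' * w'))))))"
  by (rule av_rot3)
 also have "... = av (zp W) (%w. av (zp W) (%w'. av ?z (%y. h (w' - w) y w)))"
 proof (rule av_cong1, rule av_cong1)
  fix w w'
  have "per P (%Y. \<Phi> w (Y - (s + q' * w)) * cnj (\<Phi> w' (Y - (s + q' * w'))))" by (intro per_times per_cnj per_shift2 Phip)
  from av_shift[OF P this, of "s + q' * w"]
  have "av ?z (%Y. \<Phi> w (Y - (s + q' * w)) * cnj (\<Phi> w' (Y - (s + q' * w')))) = av ?z (%y. \<Phi> w y * cnj (\<Phi> w' (y - q' * (w' - w))))"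
   by (simp add: algebra_simps)
  then show "av ?z (%Y. \<Phi> w (Y - (s + q' * w)) * cnj (\<Phi> w' (Y - (s + q' * w')))) = av ?z (%y. h (w' - w) y w)"
   unfolding \<Phi>_def h_def ee_diff by (simp add: mult_ac)
 qed
 also have "... = (\<Sum>w\<in>zp W. \<Sum>w'\<in>zp W. av ?z (%y. h (w' - w) y w)) / (of_nat W)\<^sup>2"
  unfolding av_def[of "zp W"] by (simp add: scaleR_conv_of_real sum_divide_distrib power2_eq_square)
 finally have "\<epsilon>\<^sup>2 * (real W)\<^sup>2 <= norm (\<Sum>w\<in>zp W. \<Sum>w'\<in>zp W. av ?z (%y. h (w' - w) y w))"
  using W by (simp add: norm_divide norm_power divide_simps)
 also define I where "I k = {max 0 (- k)..<max 0 (- k) + int (nat (int W - \<bar>k\<bar>))}" for k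
 define Ks where "Ks = {- int W..<int W}"
 have "(\<Sum>w\<in>zp W. \<Sum>w'\<in>zp W. av ?z (%y. h (w' - w) y w)) = (\<Sum>k\<in>Ks. \<Sum>w\<in>I k. av ?z (%y. h k y w))"
  unfolding sum_square_by_difference[of "%w w'. av ?z (%y. h (w' - w) y w)"] I_def Ks_def by simp
 also define S where "S k y = norm (\<Sum>w\<in>I k. ee (\<Psi> (y + q' * k) * of_int (p w) - \<Psi> y * of_int (p (w + k))))" for k y
 have "norm (\<Sum>k\<in>Ks. \<Sum>w\<in>I k. av ?z (%y. h k y w)) <= (\<Sum>k\<in>Ks. av ?z (%y. norm (b y) * S k y))"
 proof (rule order_trans[OF norm_sum], rule sum_mono)
  fix k
  have "norm (\<Sum>w\<in>I k. av ?z (%y. h k y w)) <= av ?z (%y. norm (\<Sum>w\<in>I k. h k y w))"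
   unfolding av_sum[symmetric] by (rule norm_av_le)
  also have "... = av ?z (%y. norm (\<Sum>w\<in>I k. h k (y + q' * k) w))"
  proof -
   have "per P (%y. norm (\<Sum>w\<in>I k. h k y w))"
   proof -
    have "b (y + int P - q' * k) = b (y - q' * k)" "\<Psi> (y + int P - q' * k) = \<Psi> (y - q' * k)" for y
     using per_shift2[OF bp, of "q' * k"] per_shift2[OF psi, of "q' * k"] unfolding per_def by auto
    then show ?thesis using bp psi unfolding h_def per_def by simp
   qed
   from av_shift[OF P this, of "q' * k"] show ?thesis by simp
  qed
  also have "... <= av ?z (%y. norm (b y) * S k y)"
  proof (rule av_mono)
   fix y
   have "norm (\<Sum>w\<in>I k. h k (y + q' * k) w) = norm (b (y + q' * k)) * (norm (b y) * S k y)"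
    unfolding h_def S_def by (simp add: sum_distrib_left[symmetric] norm_mult)
   also have "... <= 1 * (norm (b y) * S k y)" by (intro mult_right_mono b1) (simp add: S_def)
   finally show "norm (\<Sum>w\<in>I k. h k (y + q' * k) w) <= norm (b y) * S k y" by simp
  qed
  finally show "norm (\<Sum>w\<in>I k. av ?z (%y. h k y w)) <= av ?z (%y. norm (b y) * S k y)" .
 qed
 \<comment> \<open>As there are 2 W values of k, pairs below this threshold contribute at most half
   of \<epsilon>^2 W^2.\<close>
 also define gd where "gd k y \<longleftrightarrow> b y ~= 0 \<and> \<epsilon>\<^sup>2 / 4 * real W <= S k y" for k y
 have SW: "S k y <= real W" for k y
 proof -
  have "S k y <= real (card (I k))" unfolding S_def by (rule order_trans[OF norm_sum]) simp
  also have "card (I k) <= W" using nat_mono[of "int W - \<bar>k\<bar>" "int W"] by (simp add: I_def)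
  finally show ?thesis by simp
 qed
 have "(\<Sum>k\<in>Ks. av ?z (%y. norm (b y) * S k y)) <= (\<Sum>k\<in>Ks. av ?z (%y. \<epsilon>\<^sup>2 / 4 * real W + real W * of_bool (gd k y)))"
 proof (intro sum_mono av_mono)
  fix k y
  have S0: "0 <= S k y" by (simp add: S_def)
  have bS: "norm (b y) * S k y <= S k y" using mult_right_mono[OF b1 S0, of y] by simp
  have e4: "0 <= \<epsilon>\<^sup>2 / 4 * real W" by simp
  show "norm (b y) * S k y <= \<epsilon>\<^sup>2 / 4 * real W + real W * of_bool (gd k y)"
  proof (cases "gd k y")
   case True
   then have "of_bool (gd k y) = (1::real)" by simp
   then show ?thesis using bS SW[of k y] e4 by (simp only: mult_1_right)
  next
   case False then show ?thesis using bS e4 by (auto simp: gd_def)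
  qed
 qed
 also have "... = \<epsilon>\<^sup>2 / 2 * (real W)\<^sup>2 + real W * av ?z (%y. \<Sum>k\<in>Ks. of_bool (gd k y))"
  unfolding av_add av_mult_left av_sum sum.distrib av_const[OF pz]
  by (simp add: Ks_def sum_distrib_left power2_eq_square)
 finally have "\<epsilon>\<^sup>2 / 2 * (real W)\<^sup>2 <= real W * av ?z (%y. \<Sum>k\<in>Ks. of_bool (gd k y))" by simp
 then have "\<epsilon>\<^sup>2 / 2 * real W <= av ?z (%y. \<Sum>k\<in>Ks. of_bool (gd k y))"
  using W by (simp add: power2_eq_square)
 then have "\<epsilon>\<^sup>2 / 8 + \<epsilon>\<^sup>2 / 8 <= av ?z (%y. (\<Sum>k\<in>Ks. of_bool (gd k y)) / (2 * real W))"
  unfolding av_divide using W by (simp add: field_simps)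
 then have "\<epsilon>\<^sup>2 / 8 <= 1 * av ?z (%y. of_bool (\<epsilon>\<^sup>2 / 8 <= (\<Sum>k\<in>Ks. of_bool (gd k y)) / (2 * real W)))"
 proof (rule av_markov[rotated 3])
  fix y
  have "(\<Sum>k\<in>Ks. of_bool (gd k y)) <= (\<Sum>k\<in>Ks. 1::real)" by (rule sum_mono) simp
  also have "... = 2 * real W" by (simp add: Ks_def)
  finally show "(\<Sum>k\<in>Ks. of_bool (gd k y)) / (2 * real W) <= 1" using W by simp
 qed (use pz in auto)
 also have "... <= 1 * av ?z (%y. of_bool (c y ~= 0 \<and> dn (of_int (int (R ^ 3 * Q'\<^sup>2)) * \<Psi> y) <= 4608 * (real R)\<^sup>2 * \<tau> / (\<epsilon> ^ 4 * real W)))"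
  unfolding mult_1
 proof (rule av_mono)
  fix y
  have "c y ~= 0 \<and> dn (of_int (int (R ^ 3 * Q'\<^sup>2)) * \<Psi> y) <= 4608 * (real R)\<^sup>2 * \<tau> / (\<epsilon> ^ 4 * real W)"
   if *: "\<epsilon>\<^sup>2 / 8 <= (\<Sum>k\<in>Ks. of_bool (gd k y)) / (2 * real W)"
  proof -
   define Gk where "Gk = {k \<in> {- int W..<- int W + int (2 * W)}. gd k y}"
   have "(\<Sum>k\<in>Ks. of_bool (gd k y)) = real (card Gk)"
    unfolding Gk_def Ks_def by (simp add: of_bool_def sum.If_cases Int_def)
   then have cG: "\<epsilon>\<^sup>2 / 8 * real (2 * W) <= real (card Gk)" using * W by (simp add: field_simps)
   moreover have "0 < \<epsilon>\<^sup>2 / 8 * real (2 * W)" using e W by simp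
   ultimately have "Gk ~= {}" by (metis card.empty of_nat_0 not_less)
   then have cy: "c y ~= 0" by (auto simp: Gk_def gd_def b_def)
   define \<theta> where "\<theta> = of_int (int (4 * R * Q'\<^sup>2)) * \<Psi> y"
   have near: "dn (of_int k * \<theta> + 0) <= \<tau>" if k: "k \<in> Gk" for k
   proof -
    define y' where "y' = y + q' * k"
    define A where "A = 2 * real Q' * (\<Psi> y' - \<Psi> y)"
    define B where "B = 2 * of_int d * (\<Psi> y' - \<Psi> y) - 4 * real Q' * of_int k * \<Psi> y"
    define C where "C = - \<Psi> y * of_int (2 * d * k + 2 * int Q' * k\<^sup>2)"
    have kW: "- int W <= k" "k < int W" using k by (auto simp: Gk_def)
    have ph: "\<Psi> (y + q' * k) * of_int (p w) - \<Psi> y * of_int (p (w + k)) = A * (of_int w)\<^sup>2 + B * of_int w + C" for w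
     unfolding A_def B_def C_def p_def y'_def by (simp add: algebra_simps power2_eq_square)
    have "S k y = norm ((\<Sum>w\<in>I k. ee (A * (of_int w)\<^sup>2 + B * of_int w)) * ee C)"
     unfolding S_def ph ee_add sum_distrib_right ..
    then have "\<epsilon>\<^sup>2 / 4 * real W <= norm (\<Sum>w\<in>I k. ee (A * (of_int w)\<^sup>2 + B * of_int w))"
     using k by (simp add: Gk_def gd_def norm_mult)
    then have "\<exists>r::nat. 1 <= r \<and> real r <= 72 / (\<epsilon>\<^sup>2 / 4)\<^sup>2 \<and> dn (real r * A) <= 9216 / ((\<epsilon>\<^sup>2 / 4) ^ 6 * (real W)\<^sup>2)
     \<and> dn (real r * B) <= 2 ^ 24 / ((\<epsilon>\<^sup>2 / 4) ^ 8 * real W)"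
     unfolding I_def
    proof (rule weyl_quadratic)
     show "2 ^ 22 / (\<epsilon>\<^sup>2 / 4) ^ 7 <= real W" using sizes(1) by (simp add: power_divide power_mult[symmetric])
     show "\<epsilon>\<^sup>2 / 4 <= 1" using e power_le_one[of \<epsilon> 2] by simp
    qed (use e kW in auto)
    then obtain r :: nat where r: "1 <= r" "real r <= 1152 / \<epsilon> ^ 4" "dn (real r * A) <= 9216 * 4 ^ 6 / (\<epsilon> ^ 12 * (real W)\<^sup>2)"
     "dn (real r * B) <= 2 ^ 40 / (\<epsilon> ^ 16 * real W)"
     by (auto simp: power_divide power_mult[symmetric])
    obtain r2 where r2: "R = r * r2" using dvd(1)[OF r(1,2)] by (auto elim: dvdE)
    have "r2 <= R" using r2 r(1) by simp
    then have r2R: "real r2 <= real R" by (simp only: of_nat_le_iff)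
    have "of_int k * \<theta> = of_int (int r2) * (of_int d * (real r * A) - of_int (int Q') * (real r * B))"
     unfolding \<theta>_def A_def B_def r2 by (simp add: algebra_simps power2_eq_square)
    then have "dn (of_int k * \<theta> + 0) = dn (of_int (int r2) * (of_int d * (real r * A) - of_int (int Q') * (real r * B)))" by simp
    also have "... <= \<bar>of_int (int r2)\<bar> * dn (of_int d * (real r * A) - of_int (int Q') * (real r * B))" by (rule dn_mult)
    also have "... <= real r2 * (\<bar>of_int d\<bar> * dn (real r * A) + \<bar>of_int (int Q')\<bar> * dn (real r * B))"
     unfolding of_int_of_nat_eq[of r2] abs_of_nat
     by (rule mult_left_mono[OF order_trans[OF dn_diff]]) (intro add_mono dn_mult, simp)
    also have "... <= real R * (real M * (2 ^ 26 / (\<epsilon> ^ 12 * (real W)\<^sup>2)) + real Q' * (2 ^ 40 / (\<epsilon> ^ 16 * real W)))"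
    proof (intro mult_mono add_mono r2R)
     show "dn (real r * A) <= 2 ^ 26 / (\<epsilon> ^ 12 * (real W)\<^sup>2)"
      by (rule order_trans[OF r(3)], rule divide_right_mono) (use e in auto)
    qed (use d r(4) e in auto)
    also have "... <= \<tau>" using sizes(2) by (simp add: algebra_simps)
    finally show ?thesis .
   qed
   have tau0: "0 <= \<tau>" using sizes(2) e by (elim order_trans[rotated]) (intro mult_nonneg_nonneg add_nonneg_nonneg divide_nonneg_nonneg, auto)
   have "\<exists>r::nat. 1 <= r \<and> real r <= 9 / (\<epsilon>\<^sup>2 / 8) \<and> dn (real r * \<theta>) <= 144 * \<tau> / ((\<epsilon>\<^sup>2 / 8)\<^sup>2 * real (2 * W))"
   proof (rule vinogradov[where G = Gk and c = 0 and a = "- int W"])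
    show "72 / (\<epsilon>\<^sup>2 / 8)\<^sup>2 <= real (2 * W)"
    proof -
     have "72 / (\<epsilon>\<^sup>2 / 8)\<^sup>2 = 4608 / \<epsilon> ^ 4" by (simp add: power_divide power_mult[symmetric])
     also have "... <= 2 ^ 36 / \<epsilon> ^ 14" using e by (intro frac_le power_decreasing) auto
     finally show ?thesis using sizes(1) by simp
    qed
    show "\<epsilon>\<^sup>2 / 8 <= 1" using e power_le_one[of \<epsilon> 2] by simp
   qed (use cG near tau0 sizes(3) e in "auto simp: Gk_def")
   then obtain r :: nat where r: "1 <= r" "real r <= 72 / \<epsilon>\<^sup>2" "dn (real r * \<theta>) <= 4608 * \<tau> / (\<epsilon> ^ 4 * real W)"
    by (auto simp: power_divide power_mult[symmetric] mult.commute)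
   have "72 / \<epsilon>\<^sup>2 <= 1152 / \<epsilon> ^ 4" using e by (intro frac_le power_decreasing) auto
   then have rR: "r dvd R" using dvd(1)[OF r(1)] r(2) by linarith
   have "dn (of_int (int R) * \<theta>) <= \<bar>of_int (int R)\<bar> * (4608 * \<tau> / (\<epsilon> ^ 4 * real W))"
    by (rule dn_dvd[OF _ _ r(3)]) (use rR r(1) in auto)
   then have dR: "dn (of_int (int R) * \<theta>) <= real R * (4608 * \<tau> / (\<epsilon> ^ 4 * real W))" by simp
   obtain R4 where R4: "R = 4 * R4" using dvd(2) by (auto elim: dvdE)
   \<comment> \<open>Three powers of R: one inside \<theta>, one from \<open>vinogradov\<close>, and
     R / 4 together with the 4 inside \<theta>.\<close>
   have "of_int (int (R ^ 3 * Q'\<^sup>2)) * \<Psi> y = of_int (int R4) * (of_int (int R) * \<theta>)"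
    unfolding \<theta>_def R4 by (simp add: power2_eq_square power3_eq_cube)
   then have "dn (of_int (int (R ^ 3 * Q'\<^sup>2)) * \<Psi> y) = dn (of_int (int R4) * (of_int (int R) * \<theta>))" by simp
   also have "... <= \<bar>of_int (int R4)\<bar> * dn (of_int (int R) * \<theta>)" by (rule dn_mult)
   also have "... <= real R * (real R * (4608 * \<tau> / (\<epsilon> ^ 4 * real W)))"
    by (intro mult_mono dR) (use R4 in auto)
   finally show ?thesis using cy by (simp add: power2_eq_square mult_ac)
  qed
  then show "of_bool (\<epsilon>\<^sup>2 / 8 <= (\<Sum>k\<in>Ks. of_bool (gd k y)) / (2 * real W)) <=
   (of_bool (c y ~= 0 \<and> dn (of_int (int (R ^ 3 * Q'\<^sup>2)) * \<Psi> y) <= 4608 * (real R)\<^sup>2 * \<tau> / (\<epsilon> ^ 4 * real W)) :: real)"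
   by (simp add: of_bool_def)
 qed
 finally show ?thesis by simp
qed

text \<open>The function paired with f2 in \<open>Lam\<close> (see \<open>Lam_eq_dual2\<close>); its
  explicit form as an average over d is what \<open>dual_window\<close> acts on.\<close>

definition dual2 :: "nat => int => int => (int => complex) => (int => complex) => int => complex" where
 "dual2 M q1 q2 f0 f1 z = av (zp M) (%d. f0 (z - q2 * d\<^sup>2) * f1 (z - q2 * d\<^sup>2 + q1 * d))"

lemma good_dual2: assumes "good P f0" "good P f1" shows "good P (dual2 M q1 q2 f0 f1)"
 unfolding dual2_def[abs_def]
proof (rule good_av)
 fix d
 have "good P (%z. f0 (z + - (q2 * d\<^sup>2)) * f1 (z + (q1 * d - q2 * d\<^sup>2)))" by (intro good_mult good_shift assms)
 then show "good P (%z. f0 (z - q2 * d\<^sup>2) * f1 (z - q2 * d\<^sup>2 + q1 * d))" by (simp add: algebra_simps)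
qed

lemma per_shift_mod: "per P F ==> F (x mod int P + a) = F (x + a)"
 using per_mod[OF per_shift[of P F a], of x] by simp

text \<open>Cauchy-Schwarz over the box replaces the frequencies \<alpha> by their alternating sums
  \<Psi> over cubes, and these are major arc by \<open>phase_major\<close>. Conversely the phase
  with frequency \<alpha> u is the one with frequency \<Psi> u times phases from the other vertices;
  the latter are structured in u and join the weight, the former is almost constant along
  progressions whose step contains Qm. No linear phase is left.\<close>

lemma remove_phase:
 fixes f0 f1 :: "int => complex"
 assumes P: "P > 0" and M: "M > 0" and T: "T > 0" and W: "W > 0" and T': "T' > 0" and f: "good P f0" "good P f1" and U: "finite U" "U ~= {}"
  and loc: "locstruct P q U (2 * q2 * int Q') T n (dual2 M q1 q2 f0 f1) \<eta>" and eta: "0 < \<eta>" "\<eta> <= 1"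
  and eps: "\<epsilon> = (\<eta> / 2) ^ (2 ^ n) / 4"
  and dvd: "!!r::nat. 1 <= r ==> real r <= 1152 / \<epsilon> ^ 4 ==> r dvd R" "4 dvd R" and R: "R > 0"
  and sizes: "4 * real Q' * real W / real M + 4 * (real M * real W + real Q' * (real W)\<^sup>2) / real T <= \<epsilon>"
   "2 ^ 36 / \<epsilon> ^ 14 <= real W" "real R * (real Q' * 2 ^ 40 / (\<epsilon> ^ 16 * real W) + real M * 2 ^ 26 / (\<epsilon> ^ 12 * (real W)\<^sup>2)) <= \<tau>" "\<tau> <= \<epsilon>\<^sup>2 / 128"
  and kap: "4608 * (real R)\<^sup>2 * \<tau> / (\<epsilon> ^ 4 * real W) <= \<kappa>" and Qm: "Qm = R ^ 3 * Q'\<^sup>2"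
  and err: "2 * real Qm * real T' / real T + 8 * real T' * \<kappa> <= \<epsilon> ^ 3 * \<eta> / 16"
 shows "\<exists>\<beta>. struct n \<beta> \<and> \<epsilon> ^ 3 * \<eta> / 16 <= av (lists_of U n) (%u. av (zp P) (%y.
   norm (av (zp T') (%w. dual2 M q1 q2 f0 f1 (y + 2 * q2 * int Q' * int Qm * w + q * sum_list u) * \<beta> u (y, w)))))"
proof -
 let ?z = "zp P" and ?l = "lists_of U n"
 define F where "F = dual2 M q1 q2 f0 f1"
 define \<sigma> where "\<sigma> = 2 * q2 * int Q'"
 have F: "good P F" unfolding F_def by (rule good_dual2[OF f])
 have pz: "finite ?z" "?z ~= {}" and lz: "finite ?l" "?l ~= {}" and tz: "finite (zp T)" "zp T ~= {}" and tz': "finite (zp T')" "zp T' ~= {}"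
  using P T T' finite_lists_of[OF U(1)] lists_of_ne[OF U(2)] by auto
 have ep: "0 < \<epsilon>" "\<epsilon> <= 1" unfolding eps using eta power_le_one[of "\<eta> / 2" "2 ^ n"] by auto
 obtain \<alpha> \<beta> where st: "struct n \<beta>" and big: "\<eta> <= av ?l (%u. av ?z (%y.
   norm (av (zp T) (%t. F (y + \<sigma> * t + q * sum_list u) * \<beta> u (y, t) * ee (\<alpha> u y * of_int t)))))"
  using loc unfolding locstruct_def F_def \<sigma>_def by auto
 define N where "N u y = av (zp T) (%t. F (y + \<sigma> * t + q * sum_list u) * \<beta> u (y, t) * ee (\<alpha> u y * of_int t))" for u y
 \<comment> \<open>Zero where the inner average is small: as b u y is a factor of the cube product
   c, a nonzero c later certifies that \<open>N u y\<close> is large.\<close>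
 define b where "b u y = (if \<eta> / 2 <= norm (N u y) then cnj (sgn (N u y)) else 0)" for u y
 have b1: "norm (b u y) <= 1" for u y by (simp add: b_def norm_sgn)
 have bN: "b u y * N u y = complex_of_real (norm (N u y) * of_bool (\<eta> / 2 <= norm (N u y)))" for u y
  by (simp add: b_def cnj_sgn_mult)
 have big2: "\<eta> / 2 <= av ?l (%u. av ?z (%y. norm (N u y) * of_bool (\<eta> / 2 <= norm (N u y))))"
 proof -
  have "\<eta> <= av ?l (%u. av ?z (%y. \<eta> / 2 + norm (N u y) * of_bool (\<eta> / 2 <= norm (N u y))))"
   by (rule order_trans[OF big], fold N_def, intro av_mono) (use eta in auto)
  also have "... = \<eta> / 2 + av ?l (%u. av ?z (%y. norm (N u y) * of_bool (\<eta> / 2 <= norm (N u y))))"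
   unfolding av_add av_const[OF pz] av_const[OF lz] ..
  finally show ?thesis by simp
 qed
 define Z where "Z = ?z \<times> zp T \<times> zp M"
 define G where "G z u = b u (fst z) * (ee (\<alpha> u (fst z) * of_int (fst (snd z))) *
  (f0 (fst z + \<sigma> * fst (snd z) - q2 * (snd (snd z))\<^sup>2 + q * sum_list u) * f1 (fst z + \<sigma> * fst (snd z) - q2 * (snd (snd z))\<^sup>2 + q1 * snd (snd z) + q * sum_list u)))" for z u
 have Geq: "av ?l (%u. av ?z (%y. b u y * N u y)) = av Z (%z. av ?l (%u. G z u * \<beta> u (fst z, fst (snd z))))"
 proof -
  have "av Z (%z. av ?l (%u. G z u * \<beta> u (fst z, fst (snd z)))) = av ?l (%u. av Z (%z. G z u * \<beta> u (fst z, fst (snd z))))"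
   by (rule av_swap)
  also have "... = av ?l (%u. av ?z (%y. av (zp T) (%t. av (zp M) (%d. G (y, t, d) u * \<beta> u (y, t)))))"
   unfolding Z_def av_Times by simp
  also have "... = av ?l (%u. av ?z (%y. b u y * N u y))"
  proof (rule av_cong1, rule av_cong1)
   fix u y
   have "av (zp M) (%d. G (y, t, d) u * \<beta> u (y, t)) = b u y * (F (y + \<sigma> * t + q * sum_list u) * \<beta> u (y, t) * ee (\<alpha> u y * of_int t))" for t
   proof -
    have "av (zp M) (%d. G (y, t, d) u * \<beta> u (y, t)) = av (zp M) (%d. (b u y * \<beta> u (y, t) * ee (\<alpha> u y * of_int t)) *
     (f0 (y + \<sigma> * t + q * sum_list u - q2 * d\<^sup>2) * f1 (y + \<sigma> * t + q * sum_list u - q2 * d\<^sup>2 + q1 * d)))"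
     unfolding G_def by (simp add: algebra_simps)
    then show ?thesis unfolding av_mult_left F_def dual2_def by (simp only: mult_ac)
   qed
   then show "av (zp T) (%t. av (zp M) (%d. G (y, t, d) u * \<beta> u (y, t))) = b u y * N u y"
    unfolding N_def av_mult_left[symmetric] by simp
  qed
  finally show ?thesis ..
 qed
 have "\<eta> / 2 <= norm (av Z (%z. av ?l (%u. G z u * \<beta> u (fst z, fst (snd z)))))"
  unfolding Geq[symmetric] bN of_real_av[symmetric] norm_of_real using big2 by linarith
 then have "(\<eta> / 2) ^ (2 ^ n) <= norm (av Z (%z. av ?l (%u. G z u * \<beta> u (fst z, fst (snd z))))) ^ (2 ^ n)"
  using eta by (intro power_mono) auto
 also have "... <= av ?l (%us. av ?l (%us'. norm (av Z (%z. dx us us' (G z)))))"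
  by (rule box_cauchy_schwarz[of n "%u z. \<beta> u (fst z, fst (snd z))"]) (rule struct_comp[OF st])
 also have "... = av ?l (%us'. av ?l (%us. norm (av Z (%z. dx us us' (G z)))))" by (rule av_swap)
 finally have "4 * \<epsilon> <= av ?l (%us'. av ?l (%us. norm (av Z (%z. dx us us' (G z)))))" by (simp add: eps)
 then obtain us' where us': "us' \<in> ?l" and 4: "2 * (2 * \<epsilon>) <= av ?l (%us. norm (av Z (%z. dx us us' (G z))))"
  using av_pigeonhole[OF lz] by fastforce
 define X where "X us = norm (av Z (%z. dx us us' (G z)))" for us
 define \<Psi> where "\<Psi> us y = px us us' (%v. \<alpha> v y)" for us y
 define c where "c us y = dx us us' (%v. b v y)" for us y
 define maj where "maj us y \<longleftrightarrow> c us y ~= 0 \<and> dn (of_int (int Qm) * \<Psi> us y) <= \<kappa>" for us y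
 have c1: "norm (c us y) <= 1" for us y unfolding c_def by (intro norm_dx_le b1)
 have G1: "norm (G z v) <= 1" for z v unfolding G_def by (intro mult_le_1 b1 good_le[OF f(1)] good_le[OF f(2)]) simp
 have "2 * \<epsilon> * (\<epsilon>\<^sup>2 / 8) <= av ?l (%us. av ?z (%y. of_bool (maj us y)))"
 proof (rule av_threshold[OF lz])
  show "2 * (2 * \<epsilon>) <= av ?l X" using 4 unfolding X_def[abs_def] .
  show "X us <= 1" for us unfolding X_def by (intro norm_av_le_1 norm_dx_le G1)
  show "\<epsilon>\<^sup>2 / 8 <= av ?z (%y. of_bool (maj us y))" if "2 * \<epsilon> <= X us" for us
  proof -
   define G0 where "G0 x = dx us us' (%v. f0 (x + q * sum_list v))" for x
   define G1 where "G1 x = dx us us' (%v. f1 (x + q * sum_list v))" for x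
   have gG: "good P G0" "good P G1" unfolding G0_def G1_def by (intro good_dx good_shift f)+
   have dxG: "dx us us' (G (y, t, d)) = c us y * (ee (\<Psi> us y * of_int t) * (G0 (y + \<sigma> * t - q2 * d\<^sup>2) * G1 (y + \<sigma> * t - q2 * d\<^sup>2 + q1 * d)))" for y t d
    unfolding G_def fst_conv snd_conv dx_mult dx_ee c_def \<Psi>_def G0_def G1_def ..
   have "X us = norm (av ?z (%y. av (zp T) (%t. av (zp M) (%d. c us y * (ee (\<Psi> us y * of_int t) * (G0 (y + \<sigma> * t - q2 * d\<^sup>2) * G1 (y + \<sigma> * t - q2 * d\<^sup>2 + q1 * d)))))))"
    unfolding X_def Z_def av_Times dxG ..
   \<comment> \<open>The frequencies carry no periodicity; reducing y mod P provides it without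
     changing anything on the period.\<close>
   also have "... = norm (av ?z (%y. av (zp T) (%t. av (zp M) (%d. c us (y mod int P) * (ee (\<Psi> us (y mod int P) * of_int t) * (G0 (y + \<sigma> * t - q2 * d\<^sup>2) * G1 (y + \<sigma> * t - q2 * d\<^sup>2 + q1 * d)))))))"
    by (rule arg_cong[where f = norm], rule av_cong1) simp
   finally have "2 * \<epsilon> <= ..." using that by simp
   from dual_window[OF P M T W gG _ this[unfolded \<sigma>_def]] c1 obtain d s where d: "d \<in> zp M" and
    "2 * \<epsilon> - (4 * real Q' * real W / real M + 4 * (real M * real W + real Q' * (real W)\<^sup>2) / real T) <=
     av ?z (%y. norm (c us (y mod int P)) * norm (av (zp W) (%w. G1 (y + s + 2 * q1 * int Q' * w) * ee (\<Psi> us (y mod int P) * of_int (2 * d * w + 2 * int Q' * w\<^sup>2)))))"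
    by blast
   with sizes(1) have 5: "\<epsilon> <= av ?z (%y. norm (c us (y mod int P)) * norm (av (zp W) (%w. G1 (y + s + 2 * q1 * int Q' * w) * ee (\<Psi> us (y mod int P) * of_int (2 * d * w + 2 * int Q' * w\<^sup>2)))))"
    by linarith
   have "per P (%y. c us (y mod int P))" "per P (%y. \<Psi> us (y mod int P))" by (simp_all add: per_def)
   from phase_major[OF P W gG(2) c1 this ep d 5 dvd R sizes(2-4)]
   have "\<epsilon>\<^sup>2 / 8 <= av ?z (%y. of_bool (c us (y mod int P) ~= 0 \<and> dn (of_int (int (R ^ 3 * Q'\<^sup>2)) * \<Psi> us (y mod int P)) <= 4608 * (real R)\<^sup>2 * \<tau> / (\<epsilon> ^ 4 * real W)))" .
   also have "... <= av ?z (%y. of_bool (maj us y))"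
   proof (rule av_mono)
    fix y assume "y \<in> ?z"
    then have y: "y mod int P = y" by simp
    show "of_bool (c us (y mod int P) ~= 0 \<and> dn (of_int (int (R ^ 3 * Q'\<^sup>2)) * \<Psi> us (y mod int P)) <= 4608 * (real R)\<^sup>2 * \<tau> / (\<epsilon> ^ 4 * real W)) <= (of_bool (maj us y) :: real)"
     unfolding y maj_def Qm of_bool_def using kap by (auto split: if_splits)
   qed
   finally show ?thesis .
  qed
 qed (use ep in "auto intro!: av_nonneg")
 then have maj: "\<epsilon> ^ 3 / 4 <= av ?l (%us. av ?z (%y. of_bool (maj us y)))" by (simp add: power2_eq_square power3_eq_cube)
 \<comment> \<open>The conjugate phases of the other vertices; with them in the weight, \<Psi> us
   takes the place of \<alpha> us.\<close>
 define \<beta>' where "\<beta>' us z = \<beta> us z * cnj (kx us us' (%v. ee (\<alpha> v (fst z) * of_int (snd z))))" for us z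
 have len: "length us' = n" using us' by (simp add: lists_of_def)
 have st': "struct n \<beta>'" unfolding \<beta>'_def by (intro struct_mult st struct_cnj struct_kx len) simp
 define e where "e = 2 * real Qm * real T' / real T + 8 * real T' * \<kappa>"
 define K where "K us y t = norm (av (zp T') (%w. F (y + \<sigma> * t + \<sigma> * int Qm * w + q * sum_list us) * \<beta>' us (y, t + int Qm * w)))" for us y t
 have K0: "0 <= K us y t" for us y t by (simp add: K_def)
 have pt: "\<eta> / 2 * of_bool (maj us y) <= av (zp T) (K us y) + e" if us: "us \<in> ?l" for us y
 proof (cases "maj us y")
  case True
  have lus: "length us = n" using us by (simp add: lists_of_def)
  have "c us y ~= 0" using True by (simp add: maj_def)
  then have "b us y ~= 0" unfolding c_def using dx_eq_kx[of us us'] lus len by auto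
  then have Nbig: "\<eta> / 2 <= norm (N us y)" by (auto simp: b_def split: if_splits)
  define g where "g t = F (y + \<sigma> * t + q * sum_list us) * \<beta> us (y, t) * ee (\<alpha> us y * of_int t)" for t
  have g1: "norm (g t) <= 1" for t unfolding g_def by (intro mult_le_1 good_le[OF F] struct_bound[OF st lus]) simp
  have kap0: "0 <= \<kappa>" using True dn_nonneg order_trans unfolding maj_def by blast
  have gphase: "g t = ee (\<Psi> us y * of_int t) * (F (y + \<sigma> * t + q * sum_list us) * \<beta>' us (y, t))" for t
  proof -
   let ?k = "kx us us' (%v. ee (\<alpha> v y * of_int t))"
   have "ee (\<Psi> us y * of_int t) = ee (\<alpha> us y * of_int t) * ?k"
    unfolding \<Psi>_def dx_ee[symmetric] using dx_eq_kx[of us us'] lus len by simp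
   moreover have "?k * cnj ?k = 1" using complex_norm_square[of ?k] by (simp add: norm_kx_ee)
   ultimately have "ee (\<Psi> us y * of_int t) * cnj ?k = ee (\<alpha> us y * of_int t)" by (simp add: mult.assoc)
   then show ?thesis unfolding g_def \<beta>'_def by (simp add: mult_ac)
  qed
  have sh: "shiftok (zp T) (int Qm * w) (2 * real Qm * real T' / real T)" if "w \<in> zp T'" for w
   by (rule shiftok_int'[OF T]) (use that T in "auto simp: abs_mult intro!: divide_right_mono mult_left_mono")
  have "norm (av (zp T) g - av (zp T') (%w. av (zp T) (%t. g (t + int Qm * w)))) <= 2 * real Qm * real T' / real T"
  proof -
   have "av (zp T) g - av (zp T') (%w. av (zp T) (%t. g (t + int Qm * w))) = av (zp T') (%w. av (zp T) g - av (zp T) (%t. g (t + int Qm * w)))"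
    unfolding av_diff[of "zp T'"] av_const[OF tz'] ..
   also have "norm ... <= 2 * real Qm * real T' / real T"
   proof (rule norm_av_bound)
    fix w assume "w \<in> zp T'"
    from shiftokD[OF sh[OF this] g1]
    show "norm (av (zp T) g - av (zp T) (%t. g (t + int Qm * w))) <= 2 * real Qm * real T' / real T"
     by (subst norm_minus_commute)
   qed simp
   finally show ?thesis .
  qed
  then have "norm (N us y) <= norm (av (zp T') (%w. av (zp T) (%t. g (t + int Qm * w)))) + 2 * real Qm * real T' / real T"
   using norm_triangle_ineq2[of "av (zp T) g" "av (zp T') (%w. av (zp T) (%t. g (t + int Qm * w)))"] unfolding N_def g_def by linarith
  also have "norm (av (zp T') (%w. av (zp T) (%t. g (t + int Qm * w)))) <= av (zp T) (%t. norm (av (zp T') (%w. g (t + int Qm * w))))"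
   by (subst av_swap) (rule norm_av_le)
  also have "... <= av (zp T) (%t. K us y t + 8 * real T' * \<kappa>)"
  proof (rule av_mono)
   fix t
   define k where "k w = F (y + \<sigma> * (t + int Qm * w) + q * sum_list us) * \<beta>' us (y, t + int Qm * w)" for w
   have k1: "norm (k w) <= 1" for w unfolding k_def by (intro mult_le_1 good_le[OF F] struct_bound[OF st' lus])
   have "av (zp T') (%w. g (t + int Qm * w)) = ee (\<Psi> us y * of_int t) * av (zp T') k + av (zp T') (%w. (ee (\<Psi> us y * of_int (t + int Qm * w)) - ee (\<Psi> us y * of_int t)) * k w)"
    unfolding gphase k_def av_mult_left[symmetric] av_add[symmetric] by (simp add: left_diff_distrib)
   also have "norm ... <= norm (ee (\<Psi> us y * of_int t) * av (zp T') k) + norm (av (zp T') (%w. (ee (\<Psi> us y * of_int (t + int Qm * w)) - ee (\<Psi> us y * of_int t)) * k w))"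
    by (rule norm_triangle_ineq)
   also have "norm (ee (\<Psi> us y * of_int t) * av (zp T') k) = K us y t"
    unfolding norm_mult norm_ee K_def k_def by (simp add: distrib_left mult.assoc add.assoc)
   also have "norm (av (zp T') (%w. (ee (\<Psi> us y * of_int (t + int Qm * w)) - ee (\<Psi> us y * of_int t)) * k w)) <= 8 * real T' * \<kappa>"
   proof (rule norm_av_bound)
    fix w assume w: "w \<in> zp T'"
    have "norm ((ee (\<Psi> us y * of_int (t + int Qm * w)) - ee (\<Psi> us y * of_int t)) * k w) <= norm (ee (\<Psi> us y * of_int (t + int Qm * w)) - ee (\<Psi> us y * of_int t)) * 1"
     unfolding norm_mult by (intro mult_left_mono k1) simp
    also have "... <= 2 * pi * dn (\<Psi> us y * of_int (t + int Qm * w) - \<Psi> us y * of_int t)" using ee_near by simp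
    also have "\<Psi> us y * of_int (t + int Qm * w) - \<Psi> us y * of_int t = of_int w * (of_int (int Qm) * \<Psi> us y)" by (simp add: algebra_simps)
    also have "2 * pi * dn (of_int w * (of_int (int Qm) * \<Psi> us y)) <= 8 * (real T' * \<kappa>)"
    proof (intro mult_mono)
     show "dn (of_int w * (of_int (int Qm) * \<Psi> us y)) <= real T' * \<kappa>"
     proof (rule order_trans[OF dn_mult], rule mult_mono)
      show "\<bar>real_of_int w\<bar> <= real T'" using w by auto
      show "dn (of_int (int Qm) * \<Psi> us y) <= \<kappa>" using True unfolding maj_def by blast
     qed auto
    qed (use pi_less_4 pi_gt_zero in auto)
    finally show "norm ((ee (\<Psi> us y * of_int (t + int Qm * w)) - ee (\<Psi> us y * of_int t)) * k w) <= 8 * real T' * \<kappa>" by simp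
   qed (use kap0 in simp)
   finally show "norm (av (zp T') (%w. g (t + int Qm * w))) <= K us y t + 8 * real T' * \<kappa>" by simp
  qed
  also have "... = av (zp T) (K us y) + 8 * real T' * \<kappa>" unfolding av_add av_const[OF tz] ..
  finally show ?thesis using Nbig True by (simp add: e_def)
 next
  case False
  have "0 <= e"
  proof -
   have "0 <= 4608 * (real R)\<^sup>2 * \<tau> / (\<epsilon> ^ 4 * real W)"
   proof -
    have "0 <= real R * (real Q' * 2 ^ 40 / (\<epsilon> ^ 16 * real W) + real M * 2 ^ 26 / (\<epsilon> ^ 12 * (real W)\<^sup>2))" using ep by simp
    then have "0 <= \<tau>" using sizes(3) by linarith
    then show ?thesis using ep by simp
   qed
   then have "0 <= \<kappa>" using kap by linarith
   then show ?thesis by (simp add: e_def)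
  qed
  moreover have "0 <= av (zp T) (K us y)" by (intro av_nonneg K0)
  ultimately show ?thesis using False by simp
 qed
 have "\<epsilon> ^ 3 * \<eta> / 8 = \<eta> / 2 * (\<epsilon> ^ 3 / 4)" by simp
 also have "... <= \<eta> / 2 * av ?l (%us. av ?z (%y. of_bool (maj us y)))" using maj eta by (intro mult_left_mono) auto
 also have "... = av ?l (%us. av ?z (%y. \<eta> / 2 * of_bool (maj us y)))" by (simp only: av_mult_left)
 also have "... <= av ?l (%us. av ?z (%y. av (zp T) (K us y) + e))" by (intro av_mono pt)
 also have "... = av ?l (%us. av ?z (%y. av (zp T) (K us y))) + e" unfolding av_add av_const[OF pz] av_const[OF lz] ..
 finally have "\<epsilon> ^ 3 * \<eta> / 16 <= av ?l (%us. av ?z (%y. av (zp T) (K us y)))" using err by (simp add: e_def)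
 also have "... = av ?l (%us. av (zp T) (%t. av ?z (%y. K us y t)))" by (rule av_cong1) (rule av_swap)
 also have "... = av (zp T) (%t. av ?l (%us. av ?z (%y. K us y t)))" by (rule av_swap)
 finally obtain t where t: "\<epsilon> ^ 3 * \<eta> / 16 <= av ?l (%us. av ?z (%y. K us y t))"
  using av_pigeonhole[OF tz] by blast
 define \<beta>'' where "\<beta>'' us z = \<beta>' us ((fst z + - (\<sigma> * t)) mod int P, t + int Qm * snd z)" for us z
 have st'': "struct n \<beta>''" unfolding \<beta>''_def by (rule struct_comp[OF st'])
 have "av ?z (%y. K us y t) = av ?z (%y. norm (av (zp T') (%w. F (y + \<sigma> * int Qm * w + q * sum_list us) * \<beta>'' us (y, w))))" for us
 proof -
  have "av ?z (%y. K us y t) = av ?z (%y. K us ((y + - (\<sigma> * t)) mod int P) t)" by (rule av_shift_mod[OF P, symmetric])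
  also have "... = av ?z (%y. norm (av (zp T') (%w. F (y + \<sigma> * int Qm * w + q * sum_list us) * \<beta>'' us (y, w))))"
  proof (rule av_cong1)
   fix y
   have "F ((y + - (\<sigma> * t)) mod int P + \<sigma> * t + \<sigma> * int Qm * w + q * sum_list us) = F (y + \<sigma> * int Qm * w + q * sum_list us)" for w
    using per_shift_mod[of P F "y + - (\<sigma> * t)" "\<sigma> * t + \<sigma> * int Qm * w + q * sum_list us"] F by (simp add: good_def add_ac)
   then show "K us ((y + - (\<sigma> * t)) mod int P) t = norm (av (zp T') (%w. F (y + \<sigma> * int Qm * w + q * sum_list us) * \<beta>'' us (y, w)))"
    unfolding K_def \<beta>''_def by simp
  qed
  finally show ?thesis .
 qed
 with t have "\<epsilon> ^ 3 * \<eta> / 16 <= av ?l (%us. av ?z (%y. norm (av (zp T') (%w. F (y + \<sigma> * int Qm * w + q * sum_list us) * \<beta>'' us (y, w)))))" by simp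
 then show ?thesis using st'' unfolding F_def \<sigma>_def by blast
qed

section \<open>Trading one difference variable for a linear phase\<close>

lemma shiftok_real:
 assumes "shiftok B v e" "!!p. 0 <= f p" "!!p. f p <= 1"
 shows "\<bar>av B (%p. f (p + v)) - av B f\<bar> <= (e::real)"
proof -
 have "norm (av B (%p. complex_of_real (f (p + v))) - av B (%p. complex_of_real (f p))) <= e"
  by (rule shiftokD[OF assms(1)]) (use assms in simp)
 then show ?thesis unfolding of_real_av[symmetric] of_real_diff[symmetric] norm_of_real .
qed

text \<open>Squaring in w and Cauchy-Schwarz over all n + 1 entries leave, once u, r' and u' are
  frozen, the correlation of one n-fold cube g of F on two progressions at distance q (u' - u).
  Since U is a long interval, u' can first absorb the shifts Qs s; these are the translates from
  which \<open>local_fourier\<close> extracts a linear phase, now with n entries.\<close>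

lemma local_phase:
 assumes P: "P > 0" and T: "T > 0" and F: "good P F" and st: "struct (Suc n) \<beta>" and eta: "0 <= \<eta>"
  and U: "U = {- int V..int V}"
  and big: "\<eta> <= av (lists_of U (Suc n)) (%u. av (zp P) (%y. norm (av (zp T) (%w. F (y + q * int Qs * w + q * sum_list u) * \<beta> u (y, w)))))"
  and err: "2 * real Qs * real T / real (2 * V + 1) <= \<eta> ^ (2 * 2 ^ Suc n) / 2"
 shows "locstruct P q U (q * int Qs) T n F (\<eta> ^ (2 * 2 ^ Suc n) / 4)"
proof -
 let ?z = "zp P" and ?l = "lists_of U n" and ?L = "lists_of U (Suc n)"
 define \<sigma> where "\<sigma> = q * int Qs"
 have U2: "U = {- int V..<- int V + int (2 * V + 1)}" unfolding U by auto
 have Uf: "finite U" "U ~= {}" unfolding U by auto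
 have pz: "finite ?z" "?z ~= {}" and lz: "finite ?l" "?l ~= {}" and tz: "finite (zp T)" "zp T ~= {}"
  using P T finite_lists_of[OF Uf(1)] lists_of_ne[OF Uf(2)] by auto
 have Fp: "per P F" using F by (simp add: good_def)
 define Z where "Z = ?z \<times> zp T \<times> zp T"
 define G where "G z u = F (fst z + \<sigma> * fst (snd z) + q * sum_list u) * cnj (F (fst z + \<sigma> * snd (snd z) + q * sum_list u))" for z u
 define \<beta>2 where "\<beta>2 u z = \<beta> u (fst z, fst (snd z)) * cnj (\<beta> u (fst z, snd (snd z)))" for u z
 have st2: "struct (Suc n) \<beta>2" unfolding \<beta>2_def by (intro struct_mult struct_cnj struct_comp[OF st])
 have "\<eta>\<^sup>2 <= (av ?L (%u. av ?z (%y. norm (av (zp T) (%w. F (y + \<sigma> * w + q * sum_list u) * \<beta> u (y, w))))))\<^sup>2"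
  using big eta unfolding \<sigma>_def by (intro power_mono)
 also have "... <= av ?L (%u. av ?z (%y. (norm (av (zp T) (%w. F (y + \<sigma> * w + q * sum_list u) * \<beta> u (y, w))))\<^sup>2))"
  by (rule order_trans[OF av_square_le], rule av_mono, rule av_square_le)
 also have "... <= norm (complex_of_real ...)" unfolding norm_of_real by (rule abs_ge_self)
 also have "complex_of_real (av ?L (%u. av ?z (%y. (norm (av (zp T) (%w. F (y + \<sigma> * w + q * sum_list u) * \<beta> u (y, w))))\<^sup>2))) = av Z (%z. av ?L (%u. G z u * \<beta>2 u z))"
 proof -
  have "av Z (%z. av ?L (%u. G z u * \<beta>2 u z)) = av ?L (%u. av Z (%z. G z u * \<beta>2 u z))" by (rule av_swap)
  also have "... = av ?L (%u. av ?z (%y. av (zp T) (%w. av (zp T) (%w'. (F (y + \<sigma> * w + q * sum_list u) * \<beta> u (y, w)) * cnj (F (y + \<sigma> * w' + q * sum_list u) * \<beta> u (y, w'))))))"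
   unfolding Z_def av_Times G_def \<beta>2_def by (simp add: mult_ac)
  finally show ?thesis unfolding of_real_av av_norm_square[symmetric] ..
 qed
 finally have "(\<eta>\<^sup>2) ^ (2 ^ Suc n) <= norm (av Z (%z. av ?L (%u. G z u * \<beta>2 u z))) ^ (2 ^ Suc n)"
  by (rule power_mono) simp
 also have "... <= av ?L (%us. av ?L (%us'. norm (av Z (%z. dx us us' (G z)))))" by (rule box_cauchy_schwarz[OF st2])
 also define g where "g r r' x = dx r r' (%v. F (x + q * sum_list v))" for r r' x
 define H where "H r r' u u' = av ?z (%y. (norm (av (zp T) (%w. g r r' (y + \<sigma> * w + q * u) * cnj (g r r' (y + \<sigma> * w + q * u')))))\<^sup>2)" for r r' u u'
 have gg: "good P (g r r')" for r r' unfolding g_def by (intro good_dx good_shift F)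
 have "av ?L (%us. av ?L (%us'. norm (av Z (%z. dx us us' (G z))))) = av U (%u. av ?l (%r. av U (%u'. av ?l (%r'. H r r' u u'))))"
  unfolding av_lists_Suc
 proof (rule av_cong1, rule av_cong1, rule av_cong1, rule av_cong1)
  fix u r u' r'
  define D where "D y w = g r r' (y + \<sigma> * w + q * u) * cnj (g r r' (y + \<sigma> * w + q * u'))" for y w
  have dcnj: "dx a a' (%v. cnj (f v)) = cnj (dx a a' f)" for a a' :: "int list" and f
   by (induction a a' f rule: dx.induct) auto
  have D: "D y w = dx (u # r) (u' # r') (%v. F (y + \<sigma> * w + q * sum_list v))" for y w
   unfolding D_def g_def dcnj[symmetric] by (simp add: dx_mult[symmetric] distrib_left add.assoc)
  have "dx (u # r) (u' # r') (G z) = D (fst z) (fst (snd z)) * cnj (D (fst z) (snd (snd z)))" for z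
   unfolding D G_def dcnj[symmetric] by (rule dx_mult)
  then have "av Z (%z. dx (u # r) (u' # r') (G z)) = av ?z (%y. av (zp T) (%w. av (zp T) (%w'. D y w * cnj (D y w'))))"
   unfolding Z_def av_Times by simp
  also have "... = complex_of_real (H r r' u u')" unfolding H_def D_def[symmetric] of_real_av av_norm_square ..
  finally show "norm (av Z (%z. dx (u # r) (u' # r') (G z))) = H r r' u u'"
   unfolding H_def by (simp only: norm_of_real) (intro abs_of_nonneg av_nonneg, simp)
 qed
 finally have "\<eta> ^ (2 * 2 ^ Suc n) <= av U (%u. av ?l (%r. av U (%u'. av ?l (%r'. H r r' u u'))))"
  unfolding power_mult .
 then obtain u where "u \<in> U" "\<eta> ^ (2 * 2 ^ Suc n) <= av ?l (%r. av U (%u'. av ?l (%r'. H r r' u u')))"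
  using av_pigeonhole[OF Uf] by blast
 then have "\<eta> ^ (2 * 2 ^ Suc n) <= av ?l (%r'. av ?l (%r. av U (%u'. H r r' u u')))"
  using av_rot3[of ?l U ?l "%r u' r'. H r r' u u'"] av_rot3[of U ?l ?l "%u' r' r. H r r' u u'"] by (simp add: av_swap[of U ?l])
 then obtain r' where r': "r' \<in> ?l" and 1: "\<eta> ^ (2 * 2 ^ Suc n) <= av ?l (%r. av U (%u'. H r r' u u'))"
  using av_pigeonhole[OF lz] by blast
 have H01: "0 <= H r r' u u'" "H r r' u u' <= 1" for r r' u u'
 proof -
  show "0 <= H r r' u u'" unfolding H_def by (intro av_nonneg) simp
  show "H r r' u u' <= 1" unfolding H_def
   by (intro av_le power_le_one norm_av_le_1 norm_ge_zero mult_le_1) (simp_all add: good_le[OF gg])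
 qed
 define J where "J r u' y s = (norm (av (zp T) (%w. g r r' (y + \<sigma> * w) * cnj (g r r' (y + q * (u' - u) + \<sigma> * (w + s))))))\<^sup>2" for r u' y s
 have J01: "0 <= J r u' y s" "J r u' y s <= 1" for r u' y s
  unfolding J_def by (auto intro!: power_le_one norm_av_le_1 mult_le_1 simp: good_le[OF gg])
 have HJ: "H r r' u (u' + int Qs * s) = av ?z (%y. J r u' y s)" for r u' s
 proof -
  have "per P (%y. J r u' y s)"
  proof -
   have "per P (g r r')" using gg by (simp add: good_def)
   then have "g r r' (y + int P + a) = g r r' (y + a)" "g r r' (y + int P + a + b) = g r r' (y + a + b)" for y a b
    using per_shift[of P "g r r'" a] per_shift[of P "g r r'" "a + b"] unfolding per_def by (auto simp: add.assoc)
   then show ?thesis unfolding J_def per_def by simp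
  qed
  from av_shift[OF P this, of "q * u"] show ?thesis unfolding H_def J_def \<sigma>_def by (simp add: algebra_simps)
 qed
 have "\<eta> ^ (2 * 2 ^ Suc n) / 2 <= av ?l (%r. av U (%u'. av (zp T) (%s. av ?z (%y. J r u' y s))))"
 proof -
  have "av U (%u'. H r r' u u') <= av (zp T) (%s. av U (%u'. av ?z (%y. J r u' y s))) + \<eta> ^ (2 * 2 ^ Suc n) / 2" for r
  proof -
   have "av U (%u'. H r r' u u') = av (zp T) (%s. av U (%u'. H r r' u u'))" unfolding av_const[OF tz] ..
   also have "... <= av (zp T) (%s. av U (%u'. H r r' u (u' + int Qs * s)) + \<eta> ^ (2 * 2 ^ Suc n) / 2)"
   proof (rule av_mono)
    fix s assume s: "s \<in> zp T"
    have "shiftok U (int Qs * s) (2 * real Qs * real T / real (2 * V + 1))"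
     unfolding U2 by (rule shiftok_int'[where M = "2 * V + 1"]) (use s in "auto simp: abs_mult intro!: divide_right_mono mult_left_mono")
    from shiftok_real[OF this, of "%u'. H r r' u u'"]
    have "\<bar>av U (%u'. H r r' u (u' + int Qs * s)) - av U (%u'. H r r' u u')\<bar> <= 2 * real Qs * real T / real (2 * V + 1)"
     using H01 by simp
    then show "av U (%u'. H r r' u u') <= av U (%u'. H r r' u (u' + int Qs * s)) + \<eta> ^ (2 * 2 ^ Suc n) / 2" using err by linarith
   qed
   also have "... = av (zp T) (%s. av U (%u'. av ?z (%y. J r u' y s))) + \<eta> ^ (2 * 2 ^ Suc n) / 2"
    unfolding av_add av_const[OF tz] HJ ..
   finally show ?thesis .
  qed
  then have "av ?l (%r. av U (%u'. H r r' u u')) <= av ?l (%r. av (zp T) (%s. av U (%u'. av ?z (%y. J r u' y s))) + \<eta> ^ (2 * 2 ^ Suc n) / 2)"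
   by (intro av_mono)
  also have "... = av ?l (%r. av U (%u'. av (zp T) (%s. av ?z (%y. J r u' y s)))) + \<eta> ^ (2 * 2 ^ Suc n) / 2"
   unfolding av_add av_const[OF lz] av_swap[of "zp T" U] ..
  finally show ?thesis using 1 by linarith
 qed
 also have "... = av U (%u'. av ?l (%r. av (zp T) (%s. av ?z (%y. J r u' y s))))" by (rule av_swap)
 finally obtain u' where "\<eta> ^ (2 * 2 ^ Suc n) / 2 <= av ?l (%r. av (zp T) (%s. av ?z (%y. J r u' y s)))"
  using av_pigeonhole[OF Uf] by blast
 then have 2: "\<eta> ^ (2 * 2 ^ Suc n) / 2 <= av ?l (%r. av ?z (%y. av (zp T) (%s. J r u' y s)))"
  unfolding av_swap[of "zp T" ?z] .
 have "\<exists>\<alpha>::real. av (zp T) (%s. J r u' y s) / 2 <= (norm (av (zp T) (%t. g r r' (y + \<sigma> * t) * ee (\<alpha> * of_int t))))\<^sup>2" for r y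
  by (rule local_fourier[where b = "%t. cnj (g r r' (y + q * (u' - u) + \<sigma> * t))" and R = T and c = 0, OF T])
    (use good_le[OF gg] in "auto simp: J_def")
 then obtain \<alpha> :: "int list => int => real" where al: "!!r y. av (zp T) (%s. J r u' y s) / 2 <= (norm (av (zp T) (%t. g r r' (y + \<sigma> * t) * ee (\<alpha> r y * of_int t))))\<^sup>2"
  by metis
 have "\<eta> ^ (2 * 2 ^ Suc n) / 4 <= av ?l (%r. av ?z (%y. av (zp T) (%s. J r u' y s) / 2))"
  using 2 unfolding av_divide by simp
 also have "... <= av ?l (%r. av ?z (%y. norm (av (zp T) (%t. F (y + \<sigma> * t + q * sum_list r) * kx r r' (%v. F (y + \<sigma> * t + q * sum_list v)) * ee (\<alpha> r y * of_int t)))))"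
 proof (rule av_mono, rule av_mono)
  fix r y assume r: "r \<in> ?l"
  have "length r = length r'" using r r' by (simp add: lists_of_def)
  then have eq: "g r r' (y + \<sigma> * t) = F (y + \<sigma> * t + q * sum_list r) * kx r r' (%v. F (y + \<sigma> * t + q * sum_list v))" for t
   unfolding g_def by (rule dx_eq_kx)
  let ?n = "norm (av (zp T) (%t. g r r' (y + \<sigma> * t) * ee (\<alpha> r y * of_int t)))"
  have "?n <= 1" by (intro norm_av_le_1 mult_le_1 good_le[OF gg]) simp
  then have "?n\<^sup>2 <= ?n" by (simp add: power2_eq_square mult_left_le)
  with al[of r y] show "av (zp T) (%s. J r u' y s) / 2 <= norm (av (zp T) (%t. F (y + \<sigma> * t + q * sum_list r) * kx r r' (%v. F (y + \<sigma> * t + q * sum_list v)) * ee (\<alpha> r y * of_int t)))"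
   unfolding eq by linarith
 qed
 finally show ?thesis unfolding locstruct_def \<sigma>_def
  by (intro exI[of _ \<alpha>] exI[of _ "%u z. kx u r' (%v. F (fst z + q * int Qs * snd z + q * sum_list v))"] conjI struct_kx)
    (use r' in "auto simp: good_le[OF F] lists_of_def")
qed

section \<open>Bookkeeping in powers of Q\<close>

text \<open>The only properties of a factorial that are used. The condition passes to powers of
  \<eta> at the cost of dividing k (\<open>adm_power\<close>), which suits losses that are powers of
  \<eta>.\<close>

definition adm :: "nat => nat => real => bool" where
 "adm k Q \<eta> \<longleftrightarrow> 0 < Q \<and> (\<forall>r::nat. 1 <= r --> real r <= (1 / \<eta>) ^ k --> r dvd Q)"

lemma adm_le: "adm k Q \<eta> ==> j <= k ==> 0 < \<eta> ==> \<eta> <= 1/2 ==> adm j Q \<eta>"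
 unfolding adm_def using power_increasing[of j k "1 / \<eta>"] order_trans by fastforce

lemma adm_power: "adm (j * k) Q \<eta> ==> adm k Q (\<eta> ^ j)"
 unfolding adm_def by (simp only: power_mult power_one_over) blast

lemma half_powers:
 assumes "0 < \<eta>" "\<eta> <= (1/2 :: real)"
 shows "(2::real) ^ k <= (1 / \<eta>) ^ k" "\<eta> ^ k <= (1 / 2) ^ k"
proof -
 have "2 <= 1 / \<eta>" using assms by (simp add: field_simps)
 from power_mono[OF this] show "(2::real) ^ k <= (1 / \<eta>) ^ k" by simp
 show "\<eta> ^ k <= (1 / 2) ^ k" using assms by (intro power_mono) auto
qed

text \<open>The integer part of (1 / \<eta>)^(j+1) divides Q; rounding down loses at most a factor
  2, which one factor 1 / \<eta> covers.\<close>

lemma adm_ge: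
 assumes "adm k Q \<eta>" "0 < \<eta>" "\<eta> <= 1/2" "Suc j <= k"
 shows "(1 / \<eta>) ^ j <= real Q"
proof -
 let ?y = "(1 / \<eta>) ^ Suc j"
 have x: "2 <= 1 / \<eta>" using assms by (simp add: field_simps)
 have "1 <= (1 / \<eta>) ^ j" using x by (intro one_le_power) auto
 then have "2 * 1 <= 1 / \<eta> * (1 / \<eta>) ^ j" using x assms(2) by (intro mult_mono) auto
 then have y2: "2 <= ?y" by (simp only: power_Suc mult_1_right)
 have adm: "adm (Suc j) Q \<eta>" by (rule adm_le[OF assms(1,4,2,3)])
 have "nat \<lfloor>?y\<rfloor> dvd Q"
 proof -
  have "1 <= nat \<lfloor>?y\<rfloor>" using y2 by (simp add: le_nat_floor)
  moreover have "real (nat \<lfloor>?y\<rfloor>) <= ?y" using y2 by (intro of_nat_floor) linarith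
  ultimately show ?thesis using adm unfolding adm_def by blast
 qed
 then have "nat \<lfloor>?y\<rfloor> <= Q" using assms(1) by (auto simp: adm_def intro: dvd_imp_le)
 then have "real (nat \<lfloor>?y\<rfloor>) <= real Q" by simp
 moreover have "?y / 2 <= real (nat \<lfloor>?y\<rfloor>)" by (rule nat_floor_half[OF y2])
 moreover have "(1 / \<eta>) ^ j * 2 <= (1 / \<eta>) ^ j * (1 / \<eta>)" using x assms by (intro mult_left_mono) auto
 ultimately show ?thesis by simp
qed

text \<open>One factor Q pays at once for a constant up to 2^a and for a quantity z as small as
  \<eta>^b. Size conditions are met by keeping consecutive scales a factor Q apart.\<close>

lemma adm_absorb:
 assumes "adm k Q \<eta>" "0 < \<eta>" "\<eta> <= 1/2" "a + b < k" "C <= 2 ^ a" "\<eta> ^ b <= z"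
 shows "C <= real Q * z" "0 < z"
proof -
 show z: "0 < z" using assms(2,6) by (meson less_le_trans zero_less_power)
 have e: "\<eta> ^ b > 0" using assms by simp
 have "C <= (1 / \<eta>) ^ a" using half_powers(1)[OF assms(2,3), of a] assms(5) by linarith
 also have "... = (1 / \<eta>) ^ (a + b) * \<eta> ^ b" using assms(2) by (simp add: power_add power_one_over)
 also have "... <= real Q * z"
  by (intro mult_mono adm_ge[OF assms(1-3)] assms(6)) (use assms(4) e in auto)
 finally show "C <= real Q * z" .
qed

lemma scale_quotient: "1 <= (Q::real) ==> Suc a <= b ==> Q ^ a / Q ^ b <= 1 / Q"
proof -
 assume Q: "1 <= Q" and "Suc a <= b"
 then have "Q ^ Suc a <= Q ^ b" by (intro power_increasing)
 then show ?thesis using Q by (simp add: field_simps)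
qed

lemma power_diff_real: "0 < Q ==> w <= m ==> real (Q ^ (m - w)) = real Q ^ m / real Q ^ w"
proof -
 assume *: "0 < Q" "w <= m"
 then have "Q ^ m = Q ^ (m - w) * Q ^ w" by (simp add: power_add[symmetric])
 then have "real Q ^ m = real (Q ^ (m - w)) * real Q ^ w" by (metis of_nat_mult of_nat_power)
 then show ?thesis using * by simp
qed

lemma half_sum_le: "a <= c ==> b <= c ==> (a + b) / 2 <= (c::real)" by simp

lemma three_terms_le: "A = 4 * a ==> B = 4 * (b + c) ==> a <= d ==> b <= d ==> c <= d ==> 12 * d <= e ==> A + B <= (e::real)"
proof -
 assume *: "A = 4 * a" "B = 4 * (b + c)" "a <= d" "b <= d" "c <= d" "12 * d <= e"
 have "b + c <= 2 * d" using *(4,5) by simp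
 then have "B <= 8 * d" using *(2) by simp
 moreover have "A <= 4 * d" using *(1,3) by simp
 ultimately have "A + B <= 12 * d" by simp
 then show ?thesis using *(6) by simp
qed

lemma two_terms_le: "A = 2 * a ==> B = 8 * b ==> a <= d ==> b <= d ==> 10 * d <= e ==> A + B <= (e::real)"
 by linarith

text \<open>The lengths are Q^(2 m) and the steps are 1 up to powers of Q; s and c record the powers
  lost so far, so that bounds uniform in Q, m and \<eta> can be stated.\<close>

definition reduced :: "nat => int => nat => nat => nat => nat => nat => nat => (int => complex) => real => bool" where
 "reduced P q2 Q m V s c n F \<eta> \<longleftrightarrow> locstruct P (2 * q2) {- int V..int V} (2 * q2 * int (Q ^ s)) (Q ^ (2 * m - c)) n F \<eta>"

text \<open>The order of the quantifiers is the point: k depends on s, c and n alone. All that has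
  to be checked is that each error of \<open>remove_phase\<close> is a constant times 1 / Q.\<close>

lemma remove_phase_scale:
 "\<exists>k. \<forall>P q1 q2 f0 f1 Q m V \<eta>. 0 < P --> good P f0 --> good P f1 --> 0 < \<eta> --> \<eta> <= 1/2 --> adm k Q \<eta> --> k <= m -->
   reduced P q2 Q m V s c n (dual2 (Q ^ m) q1 q2 f0 f1) \<eta> -->
   (\<exists>\<beta>. struct n \<beta> \<and> \<eta> ^ k <= av (lists_of {- int V..int V} n) (%u. av (zp P) (%y.
    norm (av (zp (Q ^ (2 * m - (6 * s + 3 * c + 23)))) (%w. dual2 (Q ^ m) q1 q2 f0 f1 (y + 2 * q2 * int (Q ^ (3 * s + 3)) * w + 2 * q2 * sum_list u) * \<beta> u (y, w))))))"
proof -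
 \<comment> \<open>Ensures \<eta>^e \<le> \<epsilon> for the \<epsilon> of
   \<open>remove_phase\<close>: \<eta> / 2 \<ge> \<eta>^2 takes care of the power 2^n, and 1/4 \<ge>
   \<eta>^2 of the factor 1/4.\<close>
 define e where "e = 2 * 2 ^ n + (2::nat)"
 \<comment> \<open>The window Q^(m - w) must be shorter than Q^m by more powers of Q than s and c,
   so that both boundary errors of \<open>dual_window\<close> gain a factor Q.\<close>
 define w where "w = s + c + 1"
 \<comment> \<open>Exceeds 2 s + 3 + c and 3 w + 6, the powers of Q in the two parts of the last
   error condition.\<close>
 define c' where "c' = 6 * s + 3 * c + 23"
 define k where "k = 100 + 17 * e + 2 * w + c' + c"
 have main: "\<exists>\<beta>. struct n \<beta> \<and> \<eta> ^ k <= av (lists_of {- int V..int V} n) (%u. av (zp P) (%y.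
    norm (av (zp (Q ^ (2 * m - c'))) (%w. dual2 (Q ^ m) q1 q2 f0 f1 (y + 2 * q2 * int (Q ^ (3 * s + 3)) * w + 2 * q2 * sum_list u) * \<beta> u (y, w)))))"
  if P: "0 < P" and f: "good P f0" "good P f1" and eta: "0 < \<eta>" "\<eta> <= 1/2" and adm: "adm k Q \<eta>" and m: "k <= m"
   and red: "reduced P q2 Q m V s c n (dual2 (Q ^ m) q1 q2 f0 f1) \<eta>"
  for P q1 q2 f0 f1 Q m V \<eta>
 proof -
  define \<epsilon> where "\<epsilon> = (\<eta> / 2) ^ (2 ^ n) / 4"
  define q where "q = real Q"
  define X where "X = q ^ m"
  have Q0: "Q > 0" using adm by (simp add: adm_def)
  have q1: "1 <= q" "0 < q" using Q0 by (auto simp: q_def)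
  have X0: "0 < X" using q1 by (simp add: X_def)
  have ep0: "0 < \<epsilon>" using eta by (simp add: \<epsilon>_def)
  have ep1: "\<epsilon> <= 1" using power_le_one[of "\<eta> / 2" "2 ^ n"] eta by (simp add: \<epsilon>_def)
  have epe: "\<eta> ^ e <= \<epsilon>"
  proof -
   have "\<eta> ^ e = (\<eta>\<^sup>2) ^ (2 ^ n) * \<eta>\<^sup>2" by (simp only: e_def power_add power_mult)
   also have "... <= (\<eta> / 2) ^ (2 ^ n) * (1 / 2)\<^sup>2"
    using eta by (intro mult_mono power_mono) (auto simp: power2_eq_square)
   finally show ?thesis by (simp add: \<epsilon>_def power2_eq_square)
  qed
  have epj: "\<eta> ^ (e * j) <= \<epsilon> ^ j" for j unfolding power_mult using epe eta by (intro power_mono) auto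
  note ab = adm_absorb[OF adm eta, folded q_def]
  have W: "real (Q ^ (m - w)) = X / q ^ w" unfolding X_def q_def by (rule power_diff_real[OF Q0]) (use m in "simp add: k_def")
  have T: "real (Q ^ (2 * m - c)) = X\<^sup>2 / q ^ c" unfolding X_def q_def
   by (subst power_diff_real[OF Q0]) (use m in "auto simp: k_def power_mult[symmetric] mult.commute")
  have T': "real (Q ^ (2 * m - c')) = X\<^sup>2 / q ^ c'" unfolding X_def q_def
   by (subst power_diff_real[OF Q0]) (use m in "auto simp: k_def power_mult[symmetric] mult.commute")
  have M: "real (Q ^ m) = X" by (simp add: X_def q_def)
  have sq: "q ^ a / q ^ b <= 1 / q" if "Suc a <= b" for a b by (rule scale_quotient[OF q1(1) that])
  define \<tau> where "\<tau> = q ^ (2 * w + 3) / X"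
  define \<kappa> where "\<kappa> = q ^ (3 * w + 6) / X\<^sup>2"
  have dvd: "r dvd Q" if "1 <= r" "real r <= 1152 / \<epsilon> ^ 4" for r
  proof -
   have "1152 / \<epsilon> ^ 4 <= 2 ^ 11 / \<eta> ^ (e * 4)"
    by (rule frac_le) (use epj eta in auto)
   also have "... <= (1 / \<eta>) ^ 11 / \<eta> ^ (e * 4)" by (rule divide_right_mono[OF half_powers(1)[OF eta]]) (use eta in simp)
   also have "... = (1 / \<eta>) ^ (11 + e * 4)" by (simp add: power_add power_divide)
   also have "... <= (1 / \<eta>) ^ k" by (rule power_increasing) (use eta in "auto simp: k_def")
   finally show ?thesis using that adm unfolding adm_def by (metis order_trans)
  qed
  have dvd4: "4 dvd Q"
  proof -
   have "(2::real) ^ 2 <= (1 / \<eta>) ^ 2" by (rule half_powers(1)[OF eta])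
   also have "... <= (1 / \<eta>) ^ k" by (rule power_increasing) (use eta in "auto simp: k_def")
   finally show ?thesis using adm unfolding adm_def by (auto dest!: spec[of _ 4])
  qed
  have "\<exists>\<beta>. struct n \<beta> \<and> \<epsilon> ^ 3 * \<eta> / 16 <= av (lists_of {- int V..int V} n) (%u. av (zp P) (%y.
    norm (av (zp (Q ^ (2 * m - c'))) (%w. dual2 (Q ^ m) q1 q2 f0 f1 (y + 2 * q2 * int (Q ^ s) * int (Q ^ (2 * s + 3)) * w + 2 * q2 * sum_list u) * \<beta> u (y, w)))))"
  proof (rule remove_phase[where W = "Q ^ (m - w)" and Q' = "Q ^ s" and R = Q and \<tau> = \<tau> and \<kappa> = \<kappa> and T = "Q ^ (2 * m - c)" and \<epsilon> = \<epsilon>, OF P])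
   show "locstruct P (2 * q2) {- int V..int V} (2 * q2 * int (Q ^ s)) (Q ^ (2 * m - c)) n (dual2 (Q ^ m) q1 q2 f0 f1) \<eta>"
    using red unfolding reduced_def .
   show "4 * real (Q ^ s) * real (Q ^ (m - w)) / real (Q ^ m) + 4 * (real (Q ^ m) * real (Q ^ (m - w)) + real (Q ^ s) * (real (Q ^ (m - w)))\<^sup>2) / real (Q ^ (2 * m - c)) <= \<epsilon>"
   proof -
    have t1: "4 * real (Q ^ s) * real (Q ^ (m - w)) / real (Q ^ m) = 4 * (q ^ s / q ^ w)" unfolding W M using X0 by (simp add: q_def)
    have t2: "4 * (real (Q ^ m) * real (Q ^ (m - w)) + real (Q ^ s) * (real (Q ^ (m - w)))\<^sup>2) / real (Q ^ (2 * m - c)) = 4 * (q ^ c / q ^ w + q ^ (s + c) / q ^ (w + w))"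
     unfolding W M T using X0 q1 by (simp add: q_def field_simps power2_eq_square power_add)
    have t3: "q ^ s / q ^ w <= 1 / q" "q ^ c / q ^ w <= 1 / q" "q ^ (s + c) / q ^ (w + w) <= 1 / q" by (intro sq; simp add: w_def)+
    have "12 <= q * \<epsilon>" by (rule ab(1)[of 4 e]) (use epe in "auto simp: k_def")
    then have "12 * (1 / q) <= \<epsilon>" using q1 by (simp add: field_simps)
    from three_terms_le[OF t1 t2 t3 this] show ?thesis .
   qed
   have "2 ^ 36 <= q * \<epsilon> ^ 14" by (rule ab(1)[of 36 "e * 14"]) (use epj in "auto simp: k_def")
   then have "2 ^ 36 / \<epsilon> ^ 14 <= q ^ 1" using ep0 by (simp add: field_simps)
   also have "... <= q ^ (m - w)" by (rule power_increasing) (use q1 m in "auto simp: k_def")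
   finally show "2 ^ 36 / \<epsilon> ^ 14 <= real (Q ^ (m - w))" by (simp add: q_def)
   show "real Q * (real (Q ^ s) * 2 ^ 40 / (\<epsilon> ^ 16 * real (Q ^ (m - w))) + real (Q ^ m) * 2 ^ 26 / (\<epsilon> ^ 12 * (real (Q ^ (m - w)))\<^sup>2)) <= \<tau>"
   proof -
    have "2 ^ 41 <= q * \<epsilon> ^ 16" by (rule ab(1)[of 41 "e * 16"]) (use epj in "auto simp: k_def")
    then have a: "2 ^ 40 / \<epsilon> ^ 16 <= q / 2" using ep0 by (simp add: field_simps)
    have "2 ^ 27 <= q * \<epsilon> ^ 12" by (rule ab(1)[of 27 "e * 12"]) (use epj in "auto simp: k_def")
    then have b: "2 ^ 26 / \<epsilon> ^ 12 <= q / 2" using ep0 by (simp add: field_simps)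
    have "real Q * (real (Q ^ s) * 2 ^ 40 / (\<epsilon> ^ 16 * real (Q ^ (m - w))) + real (Q ^ m) * 2 ^ 26 / (\<epsilon> ^ 12 * (real (Q ^ (m - w)))\<^sup>2)) =
     q * q ^ (s + w) / X * (2 ^ 40 / \<epsilon> ^ 16) + q * q ^ (w + w) / X * (2 ^ 26 / \<epsilon> ^ 12)"
     unfolding W M using X0 q1 ep0 by (simp add: q_def field_simps power2_eq_square power_add)
    also have "... <= q * q ^ (s + w) / X * (q / 2) + q * q ^ (w + w) / X * (q / 2)"
     using q1 X0 by (intro add_mono mult_left_mono a b) auto
    also have "... = (q ^ (s + w + 2) + q ^ (w + w + 2)) / 2 / X" by (simp add: power_add power2_eq_square add_divide_distrib mult_ac)
    also have "... <= \<tau>" unfolding \<tau>_def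
    proof (rule divide_right_mono)
     show "(q ^ (s + w + 2) + q ^ (w + w + 2)) / 2 <= q ^ (2 * w + 3)"
      by (intro half_sum_le power_increasing q1; simp add: w_def)
    qed (use X0 in simp)
    finally show ?thesis .
   qed
   show "\<tau> <= \<epsilon>\<^sup>2 / 128"
   proof -
    have "\<tau> <= 1 / q" unfolding \<tau>_def X_def by (rule sq) (use m in "simp add: k_def")
    moreover have "128 <= q * \<epsilon> ^ 2" by (rule ab(1)[of 7 "e * 2"]) (use epj[of 2] in "auto simp: k_def")
    then have "1 / q <= \<epsilon>\<^sup>2 / 128" using q1 by (simp add: field_simps)
    ultimately show ?thesis by linarith
   qed
   show "4608 * (real Q)\<^sup>2 * \<tau> / (\<epsilon> ^ 4 * real (Q ^ (m - w))) <= \<kappa>"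
   proof -
    have "4608 <= q * \<epsilon> ^ 4" by (rule ab(1)[of 13 "e * 4"]) (use epj in "auto simp: k_def")
    then have a: "4608 / \<epsilon> ^ 4 <= q" using ep0 by (simp add: field_simps)
    have "4608 * (real Q)\<^sup>2 * \<tau> / (\<epsilon> ^ 4 * real (Q ^ (m - w))) = q ^ (3 * w + 5) / X\<^sup>2 * (4608 / \<epsilon> ^ 4)"
     unfolding W \<tau>_def using X0 q1 ep0 by (simp add: q_def[symmetric] field_simps power2_eq_square power_add power_mult power3_eq_cube eval_nat_numeral(3) numeral_eq_Suc mult_ac)
    also have "... <= q ^ (3 * w + 5) / X\<^sup>2 * q" using q1 X0 by (intro mult_left_mono a) auto
    also have "... = \<kappa>" by (simp add: \<kappa>_def power_add eval_nat_numeral)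
    finally show ?thesis .
   qed
   show "Q ^ (2 * s + 3) = Q ^ 3 * (Q ^ s)\<^sup>2" by (simp add: power_add power_mult[symmetric] mult.commute)
   show "2 * real (Q ^ (2 * s + 3)) * real (Q ^ (2 * m - c')) / real (Q ^ (2 * m - c)) + 8 * real (Q ^ (2 * m - c')) * \<kappa> <= \<epsilon> ^ 3 * \<eta> / 16"
   proof -
    have t1: "2 * real (Q ^ (2 * s + 3)) * real (Q ^ (2 * m - c')) / real (Q ^ (2 * m - c)) = 2 * (q ^ (2 * s + 3 + c) / q ^ c')"
     unfolding T T' using X0 q1 by (simp add: q_def[symmetric] field_simps power_add)
    have t2: "8 * real (Q ^ (2 * m - c')) * \<kappa> = 8 * (q ^ (3 * w + 6) / q ^ c')"
     unfolding T' \<kappa>_def using X0 by simp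
    have t3: "q ^ (2 * s + 3 + c) / q ^ c' <= 1 / q" "q ^ (3 * w + 6) / q ^ c' <= 1 / q" by (intro sq; simp add: c'_def w_def)+
    have "160 <= q * (\<epsilon> ^ 3 * \<eta>)"
    proof (rule ab(1)[of 8 "e * 3 + 1"])
     show "\<eta> ^ (e * 3 + 1) <= \<epsilon> ^ 3 * \<eta>" unfolding power_add power_one_right using epj[of 3] eta by (intro mult_right_mono) auto
    qed (auto simp: k_def)
    then have "10 * (1 / q) <= \<epsilon> ^ 3 * \<eta> / 16" using q1 by (simp add: field_simps)
    from two_terms_le[OF t1 t2 t3 this] show ?thesis .
   qed
  qed (use f eta Q0 dvd dvd4 \<epsilon>_def in auto)
  then obtain \<beta> where b: "struct n \<beta>" "\<epsilon> ^ 3 * \<eta> / 16 <= av (lists_of {- int V..int V} n) (%u. av (zp P) (%y.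
    norm (av (zp (Q ^ (2 * m - c'))) (%w. dual2 (Q ^ m) q1 q2 f0 f1 (y + 2 * q2 * int (Q ^ s) * int (Q ^ (2 * s + 3)) * w + 2 * q2 * sum_list u) * \<beta> u (y, w)))))" by blast
  have "\<eta> ^ k <= \<eta> ^ (e * 3 + (1 + 4))" by (rule power_decreasing) (use eta in "auto simp: k_def")
  also have "... = \<eta> ^ (e * 3) * (\<eta> * \<eta> ^ 4)" by (simp only: power_add power_one_right)
  also have "... <= \<epsilon> ^ 3 * (\<eta> * (1 / 2) ^ 4)"
   using eta ep0 by (intro mult_mono epj half_powers(2)) auto
  also have "... = \<epsilon> ^ 3 * \<eta> / 16" by (simp add: power_one_over)
  finally have "\<eta> ^ k <= \<epsilon> ^ 3 * \<eta> / 16" .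
  moreover have "2 * q2 * int (Q ^ s) * int (Q ^ (2 * s + 3)) = 2 * q2 * int (Q ^ (3 * s + 3))"
  proof -
   have "Q ^ (3 * s + 3) = Q ^ s * Q ^ (2 * s + 3)" by (simp add: power_add[symmetric])
   then show ?thesis by simp
  qed
  ultimately show ?thesis using b by (intro exI[of _ \<beta>]) (auto simp only: intro: order_trans)
 qed
 show ?thesis using main unfolding c'_def by blast
qed

text \<open>One round: \<open>remove_phase_scale\<close> gives up length to get rid of the phase,
  then \<open>local_phase\<close> gives up one entry and creates a new phase. The lower bound on V
  makes the interval of differences longer than the shifts that u' has to absorb.\<close>

lemma degree_lowering:
 "\<exists>k s' c'. 0 < k \<and> (\<forall>P q1 q2 f0 f1 Q m V \<eta>. 0 < P --> good P f0 --> good P f1 --> 0 < \<eta> --> \<eta> <= 1/2 --> adm k Q \<eta> --> k <= m --> Q ^ (2 * m - 5) <= V -->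
   reduced P q2 Q m V s c (Suc n) (dual2 (Q ^ m) q1 q2 f0 f1) \<eta> -->
   reduced P q2 Q m V s' c' n (dual2 (Q ^ m) q1 q2 f0 f1) (\<eta> ^ k))"
proof -
 define s' where "s' = 3 * s + 3"
 define c' where "c' = 6 * s + 3 * c + 23"
 obtain k where k: "\<forall>P q1 q2 f0 f1 Q m V \<eta>. 0 < P --> good P f0 --> good P f1 --> 0 < \<eta> --> \<eta> <= 1/2 --> adm k Q \<eta> --> k <= m -->
   reduced P q2 Q m V s c (Suc n) (dual2 (Q ^ m) q1 q2 f0 f1) \<eta> -->
   (\<exists>\<beta>. struct (Suc n) \<beta> \<and> \<eta> ^ k <= av (lists_of {- int V..int V} (Suc n)) (%u. av (zp P) (%y.
    norm (av (zp (Q ^ (2 * m - c'))) (%w. dual2 (Q ^ m) q1 q2 f0 f1 (y + 2 * q2 * int (Q ^ s') * w + 2 * q2 * sum_list u) * \<beta> u (y, w))))))"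
  using remove_phase_scale[of s c "Suc n", folded c'_def s'_def] by (elim exE) (rule that)
 note k = k[rule_format]
 define e where "e = k * (2 * 2 ^ Suc n)"
 define k' where "k' = k + e + c' + 10"
 have main: "reduced P q2 Q m V s' c' n (dual2 (Q ^ m) q1 q2 f0 f1) (\<eta> ^ k')"
  if P: "0 < P" and f: "good P f0" "good P f1" and eta: "0 < \<eta>" "\<eta> <= 1/2" and adm: "adm k' Q \<eta>" and m: "k' <= m" and V: "Q ^ (2 * m - 5) <= V"
   and red: "reduced P q2 Q m V s c (Suc n) (dual2 (Q ^ m) q1 q2 f0 f1) \<eta>"
  for P q1 q2 f0 f1 Q m V \<eta>
 proof -
  have Q0: "Q > 0" using adm by (simp add: adm_def)
  define q where "q = real Q"
  define X where "X = q ^ m"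
  have q1: "1 <= q" "0 < q" using Q0 by (auto simp: q_def)
  have X0: "0 < X" using q1 by (simp add: X_def)
  have adm': "adm k Q \<eta>" by (rule adm_le[OF adm _ eta]) (simp add: k'_def)
  have km: "k <= m" using m by (simp add: k'_def)
  obtain \<beta> where b: "struct (Suc n) \<beta>" "\<eta> ^ k <= av (lists_of {- int V..int V} (Suc n)) (%u. av (zp P) (%y.
    norm (av (zp (Q ^ (2 * m - c'))) (%w. dual2 (Q ^ m) q1 q2 f0 f1 (y + 2 * q2 * int (Q ^ s') * w + 2 * q2 * sum_list u) * \<beta> u (y, w)))))"
   using k[OF P f eta adm' km red] by blast
  have T': "real (Q ^ (2 * m - c')) = X\<^sup>2 / q ^ c'" unfolding X_def q_def
   by (subst power_diff_real[OF Q0]) (use m in "auto simp: k'_def power_mult[symmetric] mult.commute")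
  have V5: "real (Q ^ (2 * m - 5)) = X\<^sup>2 / q ^ 5" unfolding X_def q_def
   by (subst power_diff_real[OF Q0]) (use m in "auto simp: k'_def power_mult[symmetric] mult.commute")
  have eE: "(\<eta> ^ k) ^ (2 * 2 ^ Suc n) = \<eta> ^ e" by (simp only: power_mult[symmetric] e_def)
  have "locstruct P (2 * q2) {- int V..int V} (2 * q2 * int (Q ^ s')) (Q ^ (2 * m - c')) n (dual2 (Q ^ m) q1 q2 f0 f1) ((\<eta> ^ k) ^ (2 * 2 ^ Suc n) / 4)"
  proof (rule local_phase[OF P _ good_dual2[OF f] b(1) _ refl b(2)])
   have "real (Q ^ (2 * m - 5)) <= real V" using V by (simp only: of_nat_le_iff)
   then have V2: "2 * (X\<^sup>2 / q ^ 5) <= real (2 * V + 1)" unfolding V5 by simp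
   have "2 * real (Q ^ s') * real (Q ^ (2 * m - c')) / real (2 * V + 1) <= 2 * real (Q ^ s') * real (Q ^ (2 * m - c')) / (2 * (X\<^sup>2 / q ^ 5))"
    by (rule divide_left_mono[OF V2]) (use X0 q1 in auto)
   also have "... = q ^ (s' + 5) / q ^ c'" unfolding T' using X0 q1 by (simp add: q_def[symmetric] power_add)
   also have "... <= 1 / q" by (rule scale_quotient[OF q1(1)]) (simp add: s'_def c'_def)
   also have "... <= \<eta> ^ e / 2"
   proof -
    have "2 <= q * \<eta> ^ e" unfolding q_def by (rule adm_absorb(1)[OF adm eta, of 1 e]) (auto simp: k'_def)
    then show ?thesis using q1 by (simp add: field_simps)
   qed
   finally show "2 * real (Q ^ s') * real (Q ^ (2 * m - c')) / real (2 * V + 1) <= (\<eta> ^ k) ^ (2 * 2 ^ Suc n) / 2" unfolding eE .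
  qed (use Q0 eta in auto)
  moreover have "\<eta> ^ k' <= (\<eta> ^ k) ^ (2 * 2 ^ Suc n) / 4"
  proof -
   have "\<eta> ^ k' <= \<eta> ^ (e + 2)" by (rule power_decreasing) (use eta in "auto simp: k'_def")
   also have "... = \<eta> ^ e * \<eta>\<^sup>2" by (simp only: power_add)
   also have "... <= \<eta> ^ e * (1 / 2)\<^sup>2" using eta by (intro mult_left_mono half_powers(2)) auto
   finally show ?thesis unfolding eE by (simp add: power2_eq_square)
  qed
  ultimately show ?thesis unfolding reduced_def locstruct_def by (meson order_trans)
 qed
 have "0 < k'" by (simp add: k'_def)
 with main show ?thesis by blast
qed

text \<open>At n = 0 the structured weight is the constant 1, and removing the phase once more
  leaves plain averages along progressions. s and c are generalised since every round changes
  them.\<close>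

lemma reduced_to_progression:
 "\<exists>k s' c'. 0 < k \<and> (\<forall>P q1 q2 f0 f1 Q m V \<eta>. 0 < P --> good P f0 --> good P f1 --> 0 < \<eta> --> \<eta> <= 1/2 --> adm k Q \<eta> --> k <= m --> Q ^ (2 * m - 5) <= V -->
   reduced P q2 Q m V s c n (dual2 (Q ^ m) q1 q2 f0 f1) \<eta> -->
   \<eta> ^ k <= av (zp P) (%y. norm (av (zp (Q ^ (2 * m - c'))) (%w. dual2 (Q ^ m) q1 q2 f0 f1 (y + 2 * q2 * int (Q ^ s') * w)))))"
proof (induction n arbitrary: s c)
 case 0
 obtain k where k: "\<forall>P q1 q2 f0 f1 Q m V \<eta>. 0 < P --> good P f0 --> good P f1 --> 0 < \<eta> --> \<eta> <= 1/2 --> adm k Q \<eta> --> k <= m -->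
   reduced P q2 Q m V s c 0 (dual2 (Q ^ m) q1 q2 f0 f1) \<eta> -->
   (\<exists>\<beta>. struct 0 \<beta> \<and> \<eta> ^ k <= av (lists_of {- int V..int V} 0) (%u. av (zp P) (%y.
    norm (av (zp (Q ^ (2 * m - (6 * s + 3 * c + 23)))) (%w. dual2 (Q ^ m) q1 q2 f0 f1 (y + 2 * q2 * int (Q ^ (3 * s + 3)) * w + 2 * q2 * sum_list u) * \<beta> u (y, w))))))"
  using remove_phase_scale[of s c 0] by (elim exE) (rule that)
 note k = k[rule_format]
 show ?case
 proof (rule exI[of _ "Suc k"], rule exI[of _ "3 * s + 3"], rule exI[of _ "6 * s + 3 * c + 23"], intro conjI allI impI)
  fix P q1 q2 f0 f1 Q m V \<eta>
  assume *: "0 < P" "good P f0" "good P f1" "0 < \<eta>" "\<eta> <= 1/2" "adm (Suc k) Q \<eta>" "Suc k <= m"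
   "reduced P q2 Q m V s c 0 (dual2 (Q ^ m) q1 q2 f0 f1) \<eta>"
  have "adm k Q \<eta>" by (rule adm_le[OF *(6) _ *(4,5)]) simp
  with k[OF *(1-5) _ _ *(8)] *(7) have "\<eta> ^ k <= av (zp P) (%y. norm (av (zp (Q ^ (2 * m - (6 * s + 3 * c + 23)))) (%w. dual2 (Q ^ m) q1 q2 f0 f1 (y + 2 * q2 * int (Q ^ (3 * s + 3)) * w))))"
   unfolding av_lists_0 by auto
  moreover have "\<eta> ^ Suc k <= \<eta> ^ k" by (rule power_decreasing) (use * in auto)
  ultimately show "\<eta> ^ Suc k <= av (zp P) (%y. norm (av (zp (Q ^ (2 * m - (6 * s + 3 * c + 23)))) (%w. dual2 (Q ^ m) q1 q2 f0 f1 (y + 2 * q2 * int (Q ^ (3 * s + 3)) * w))))"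
   by linarith
 qed simp
next
 case (Suc n)
 obtain k1 s1 c1 where k1: "0 < k1" and 1: "\<forall>P q1 q2 f0 f1 Q m V \<eta>. 0 < P --> good P f0 --> good P f1 --> 0 < \<eta> --> \<eta> <= 1/2 --> adm k1 Q \<eta> --> k1 <= m --> Q ^ (2 * m - 5) <= V -->
   reduced P q2 Q m V s c (Suc n) (dual2 (Q ^ m) q1 q2 f0 f1) \<eta> --> reduced P q2 Q m V s1 c1 n (dual2 (Q ^ m) q1 q2 f0 f1) (\<eta> ^ k1)"
  using degree_lowering[of s c n] by (elim exE conjE) (rule that)
 note 1 = 1[rule_format]
 obtain k2 s2 c2 where k2: "0 < k2" and 2: "\<forall>P q1 q2 f0 f1 Q m V \<eta>. 0 < P --> good P f0 --> good P f1 --> 0 < \<eta> --> \<eta> <= 1/2 --> adm k2 Q \<eta> --> k2 <= m --> Q ^ (2 * m - 5) <= V -->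
   reduced P q2 Q m V s1 c1 n (dual2 (Q ^ m) q1 q2 f0 f1) \<eta> -->
   \<eta> ^ k2 <= av (zp P) (%y. norm (av (zp (Q ^ (2 * m - c2))) (%w. dual2 (Q ^ m) q1 q2 f0 f1 (y + 2 * q2 * int (Q ^ s2) * w))))"
  using Suc.IH[of s1 c1] by (elim exE conjE) (rule that)
 note 2 = 2[rule_format]
 show ?case
 proof (rule exI[of _ "k1 * k2"], rule exI[of _ s2], rule exI[of _ c2], intro conjI allI impI)
  show "0 < k1 * k2" using k1 k2 by simp
  fix P q1 q2 f0 f1 Q m V \<eta>
  assume *: "0 < P" "good P f0" "good P f1" "0 < \<eta>" "\<eta> <= 1/2" "adm (k1 * k2) Q \<eta>" "k1 * k2 <= m" "Q ^ (2 * m - 5) <= V"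
   "reduced P q2 Q m V s c (Suc n) (dual2 (Q ^ m) q1 q2 f0 f1) \<eta>"
  have kk: "k1 <= k1 * k2" "k2 <= k1 * k2" using k1 k2 by auto
  have a1: "adm k1 Q \<eta>" by (rule adm_le[OF *(6) kk(1) *(4,5)])
  have r: "reduced P q2 Q m V s1 c1 n (dual2 (Q ^ m) q1 q2 f0 f1) (\<eta> ^ k1)"
   by (rule 1[OF *(1-5) a1 _ *(8,9)]) (use kk * in linarith)
  have e1: "0 < \<eta> ^ k1" "\<eta> ^ k1 <= 1/2" using * k1 power_decreasing[of 1 k1 \<eta>] by auto
  have "(\<eta> ^ k1) ^ k2 <= av (zp P) (%y. norm (av (zp (Q ^ (2 * m - c2))) (%w. dual2 (Q ^ m) q1 q2 f0 f1 (y + 2 * q2 * int (Q ^ s2) * w))))"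
   by (rule 2[OF *(1-3) e1 adm_power[OF *(6)] _ *(8) r]) (use kk * in linarith)
  then show "\<eta> ^ (k1 * k2) <= av (zp P) (%y. norm (av (zp (Q ^ (2 * m - c2))) (%w. dual2 (Q ^ m) q1 q2 f0 f1 (y + 2 * q2 * int (Q ^ s2) * w))))"
   by (simp only: power_mult)
 qed
qed

section \<open>Inverse theorem for the linear factor\<close>

lemma cnj_dual2: "cnj (dual2 M q1 q2 f0 f1 z) = dual2 M q1 q2 (%x. cnj (f0 x)) (%x. cnj (f1 x)) z"
 by (simp add: dual2_def cnj_av)

lemma Lam_eq_dual2:
 assumes P: "P > 0" and f: "good P f0" "good P f1" "good P f2"
 shows "Lam P M q1 q2 f0 f1 f2 = av (zp P) (%z. f2 z * dual2 M q1 q2 f0 f1 z)"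
proof -
 have "Lam P M q1 q2 f0 f1 f2 = av (zp M) (%d. av (zp P) (%x. f0 x * f1 (x + q1 * d) * f2 (x + q2 * d\<^sup>2)))"
  unfolding Lam_def by (rule av_swap)
 also have "... = av (zp M) (%d. av (zp P) (%z. f2 z * (f0 (z - q2 * d\<^sup>2) * f1 (z - q2 * d\<^sup>2 + q1 * d))))"
 proof (rule av_cong1)
  fix d
  have "good P (%x. f0 x * f1 (x + q1 * d) * f2 (x + q2 * d\<^sup>2))" by (intro good_mult good_shift f)
  then have "av (zp P) (%x. f0 (x + - (q2 * d\<^sup>2)) * f1 (x + - (q2 * d\<^sup>2) + q1 * d) * f2 (x + - (q2 * d\<^sup>2) + q2 * d\<^sup>2)) =
   av (zp P) (%x. f0 x * f1 (x + q1 * d) * f2 (x + q2 * d\<^sup>2))"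
   by (intro av_shift[OF P, of "%x. f0 x * f1 (x + q1 * d) * f2 (x + q2 * d\<^sup>2)"]) (simp add: good_def)
  then show "av (zp P) (%x. f0 x * f1 (x + q1 * d) * f2 (x + q2 * d\<^sup>2)) = av (zp P) (%z. f2 z * (f0 (z - q2 * d\<^sup>2) * f1 (z - q2 * d\<^sup>2 + q1 * d)))"
   by (simp add: mult_ac)
 qed
 also have "... = av (zp P) (%z. av (zp M) (%d. f2 z * (f0 (z - q2 * d\<^sup>2) * f1 (z - q2 * d\<^sup>2 + q1 * d))))" by (rule av_swap)
 finally show ?thesis unfolding dual2_def av_mult_left .
qed

lemma av_norm_square_eq: "norm (av S (%z. cnj (D z) * D z)) = av S (%z. (norm (D z))\<^sup>2)"
proof -
 have "av S (%z. cnj (D z) * D z) = complex_of_real (av S (%z. (norm (D z))\<^sup>2))"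
  unfolding of_real_av by (rule av_cong1) (simp only: complex_norm_square mult.commute)
 then show ?thesis using av_nonneg[of S "%z. (norm (D z))\<^sup>2"] by (simp only: norm_of_real) simp
qed

text \<open>By Cauchy-Schwarz f2 may be replaced by the conjugate of the function it is paired with.
  The degree lowering above is for such dual functions.\<close>

lemma Lam_dual2_large:
 assumes P: "P > 0" and f: "good P f0" "good P f1" "good P f2" and big: "\<eta> <= norm (Lam P M q1 q2 f0 f1 f2)" "0 <= \<eta>"
 shows "\<eta>\<^sup>2 <= norm (Lam P M q1 q2 f0 f1 (dual2 M q1 q2 (%x. cnj (f0 x)) (%x. cnj (f1 x))))"
proof -
 let ?D = "dual2 M q1 q2 f0 f1"
 have "\<eta>\<^sup>2 <= (norm (av (zp P) (%z. f2 z * ?D z)))\<^sup>2"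
  using big unfolding Lam_eq_dual2[OF P f] by (intro power_mono)
 also have "... <= av (zp P) (%z. (norm (?D z))\<^sup>2)" by (rule av_kill) (rule good_le[OF f(3)])
 also have "... = norm (av (zp P) (%z. cnj (?D z) * ?D z))" by (rule av_norm_square_eq[symmetric])
 also have "av (zp P) (%z. cnj (?D z) * ?D z) = Lam P M q1 q2 f0 f1 (dual2 M q1 q2 (%x. cnj (f0 x)) (%x. cnj (f1 x)))"
  unfolding cnj_dual2 by (rule Lam_eq_dual2[symmetric, OF P f(1,2)]) (intro good_dual2 good_cnj f)
 finally show ?thesis .
qed

lemma locstruct_mono: "locstruct P q U \<sigma> T n F \<eta> ==> \<eta>' <= \<eta> ==> locstruct P q U \<sigma> T n F \<eta>'"
 unfolding locstruct_def by (meson order_trans)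

text \<open>The scales H = Q^(m-3), S = Q^(m-2), L = Q^(m-1) lie below M = Q^m with a factor Q in
  every gap. T = Q^(2 m - 6) is L H divided by Q^2, one Q for the denominators and one for the
  constants.\<close>

lemma concat_scale:
 "\<exists>k. 0 < k \<and> (\<forall>P q1 q2 f0 f1 F Q m \<eta>. 0 < P --> good P f0 --> good P f1 --> good P F --> 0 < \<eta> --> \<eta> <= 1/2 --> adm k Q \<eta> --> k <= m -->
   \<eta> <= norm (Lam P (Q ^ m) q1 q2 f0 f1 F) --> reduced P q2 Q m (8 * Q ^ (m - 3) * Q ^ (m - 2)) 1 6 9 F (\<eta> ^ k))"
proof -
 define k1 where "k1 = (12763345::nat)"
 define E where "E = (671745::nat)"
 have kE: "E <= k1" by (simp add: k1_def E_def)
 define e where "e = Suc k1"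
 define k where "k = 15 * e + 100"
 have main: "reduced P q2 Q m (8 * Q ^ (m - 3) * Q ^ (m - 2)) 1 6 9 F (\<eta> ^ k)"
  if P: "0 < P" and f: "good P f0" "good P f1" "good P F" and eta: "0 < \<eta>" "\<eta> <= 1/2" and adm: "adm k Q \<eta>" and m: "k <= m"
   and big: "\<eta> <= norm (Lam P (Q ^ m) q1 q2 f0 f1 F)"
  for P q1 q2 f0 f1 F Q m \<eta>
 proof -
  have Q0: "Q > 0" using adm by (simp add: adm_def)
  define q where "q = real Q"
  define X where "X = q ^ m"
  have q1: "1 <= q" "0 < q" using Q0 by (auto simp: q_def)
  have X0: "0 < X" using q1 by (simp add: X_def)
  note ab = adm_absorb(1)[OF adm eta, folded q_def]
  have M: "real (Q ^ m) = X" by (simp add: X_def q_def)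
  have pw: "real (Q ^ (m - j)) = X / q ^ j" if "j <= 100" for j
   unfolding X_def q_def by (rule power_diff_real[OF Q0]) (use m that in "simp add: k_def")
  have T: "real (Q ^ (2 * m - 6)) = X\<^sup>2 / q ^ 6" unfolding X_def q_def
   by (subst power_diff_real[OF Q0]) (use m in "auto simp: k_def power_mult[symmetric] mult.commute")
  have qX: "q <= real (Q ^ (m - j))" if "j <= 3" for j
  proof -
   have "q ^ 1 <= q ^ (m - j)" by (rule power_increasing) (use q1 m that in "auto simp: k_def")
   then show ?thesis by (simp add: q_def)
  qed
  have oneq: "1 / q ^ j <= 1 / q" if "1 <= j" for j using scale_quotient[OF q1(1), of 0 j] that by simp
  have small: "C * (1 / q ^ j) <= \<eta> ^ b" if "4 + 9 + b < k" "0 <= C" "C <= 2 ^ 13" "1 <= j" for C j b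
  proof -
   have "C <= q * \<eta> ^ b" by (rule ab[of 13 b]) (use that in auto)
   then have "C * (1 / q) <= \<eta> ^ b" using q1 by (simp add: field_simps)
   moreover have "C * (1 / q ^ j) <= C * (1 / q)" using oneq[OF that(4)] that(2) by (rule mult_left_mono)
   ultimately show ?thesis by linarith
  qed
  let ?U = "{- (8 * int (Q ^ (m - 3)) * int (Q ^ (m - 2)))..8 * int (Q ^ (m - 3)) * int (Q ^ (m - 2))}"
  have "\<exists>j. - int (Q ^ (m - 3)) < j \<and> j <= 0 \<and> \<eta> ^ 12763345 <= av {j..<j + int (Q ^ (m - 3))} (%b. av (zp (Q ^ (m - 1))) (%l. av (zp (Q ^ (m - 1))) (%l'.
    ua (2 * q2) ?U 9 (%T. norm (av (zp P) T)) (%x. F (x + 2 * q2 * b * l) * cnj (F (x + 2 * q2 * b * l'))))))"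
  proof (rule pet_concatenation[OF P _ _ _ _ f eta big])
   show "Q ^ (m - 3) <= Q ^ (m - 2)" by (rule power_increasing) (use Q0 in auto)
   have "12 * real (Q ^ (m - 3)) / real (Q ^ m) = 12 * (1 / q ^ 3)" using pw[of 3] M X0 by simp
   then show "12 * real (Q ^ (m - 3)) / real (Q ^ m) <= \<eta> ^ 5" using small[of 5 12 3] by (simp add: k_def)
   have "32 * real (Q ^ (m - 1)) / real (Q ^ m) = 32 * (1 / q ^ 1)" using pw[of 1] M X0 by simp
   then show "32 * real (Q ^ (m - 1)) / real (Q ^ m) <= \<eta> ^ 41" using small[of 41 32 1] kE by (simp add: k_def e_def k1_def)
   have "4096 * real (Q ^ (m - 2)) / real (Q ^ (m - 1)) = 4096 * (1 / q ^ 1)" using pw[of 2] pw[of 1] X0 q1 by (simp add: power2_eq_square)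
   also have "... <= \<eta> ^ E" by (rule small) (use kE in "auto simp: k_def e_def")
   finally show "4096 * real (Q ^ (m - 2)) / real (Q ^ (m - 1)) <= \<eta> ^ 671745" unfolding E_def .
   have "240 <= q * \<eta> ^ E" by (rule ab[of 8 E]) (use kE in "auto simp: k_def e_def")
   then have "240 / \<eta> ^ E <= q" using eta by (simp add: field_simps)
   then show "240 / \<eta> ^ 671745 <= real (Q ^ (m - 3))" unfolding E_def[symmetric] using qX[of 3] by linarith
  qed (use Q0 in auto)
  then obtain j where j: "\<eta> ^ k1 <= av {j..<j + int (Q ^ (m - 3))} (%b. av (zp (Q ^ (m - 1))) (%l. av (zp (Q ^ (m - 1))) (%l'.
    ua (2 * q2) ?U 9 (%T. norm (av (zp P) T)) (%x. F (x + 2 * q2 * b * l) * cnj (F (x + 2 * q2 * b * l'))))))"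
   unfolding k1_def by blast
  have eps: "2 * \<eta> ^ e <= \<eta> ^ k1" "0 < \<eta> ^ e" "\<eta> ^ e <= 1/2"
  proof -
   have "\<eta> * \<eta> ^ k1 <= 1/2 * \<eta> ^ k1" using eta by (intro mult_right_mono) auto
   then show "2 * \<eta> ^ e <= \<eta> ^ k1" by (simp add: e_def)
   show "0 < \<eta> ^ e" using eta by simp
   show "\<eta> ^ e <= 1/2" using power_decreasing[of 1 e \<eta>] eta by (simp add: e_def del: power_Suc)
  qed
  have epj: "(\<eta> ^ e) ^ i = \<eta> ^ (e * i)" for i by (simp only: power_mult)
  have l: "locstruct P (2 * q2) ?U (2 * q2 * int Q) (Q ^ (2 * m - 6)) 9 F ((\<eta> ^ e) ^ 15)"
  proof (rule locstruct_of_concatenation[OF P f(3) eps(2,3) _ _ _ _ _ order_trans[OF eps(1) j]])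
   show "r dvd Q" if "1 <= r" "real r <= 72 / (\<eta> ^ e) ^ 4" for r
   proof -
    have "72 / (\<eta> ^ e) ^ 4 <= (1 / \<eta>) ^ 7 / \<eta> ^ (e * 4)" unfolding epj
     using half_powers(1)[OF eta, of 7] eta by (intro divide_right_mono) auto
    also have "... = (1 / \<eta>) ^ (7 + e * 4)" by (simp add: power_add power_divide)
    also have "... <= (1 / \<eta>) ^ k" by (rule power_increasing) (use eta in "auto simp: k_def")
    finally have "real r <= (1 / \<eta>) ^ k" using that(2) by linarith
    then show ?thesis using adm that(1) unfolding adm_def by blast
   qed
   have "1024 <= q * (\<eta> ^ e) ^ 8" by (rule ab[of 10 "e * 8"]) (auto simp: k_def epj)
   also have "... <= real (Q ^ (m - 1)) * (\<eta> ^ e) ^ 8" using qX[of 1] eta by (intro mult_right_mono) auto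
   finally show "1024 <= (\<eta> ^ e) ^ 8 * real (Q ^ (m - 1))" by (simp only: mult.commute)
   have "4608 <= q * (\<eta> ^ e) ^ 8" by (rule ab[of 13 "e * 8"]) (auto simp: k_def epj)
   also have "... <= real (Q ^ (m - 3)) * (\<eta> ^ e) ^ 8" using qX[of 3] eta by (intro mult_right_mono) auto
   finally show "4608 <= (\<eta> ^ e) ^ 8 * real (Q ^ (m - 3))" by (simp only: mult.commute)
   have "2 ^ 21 <= q * (\<eta> ^ e) ^ 12" by (rule ab[of 21 "e * 12"]) (auto simp: k_def epj)
   then have "2 ^ 21 * (X\<^sup>2 / q ^ 5) <= q * (\<eta> ^ e) ^ 12 * (X\<^sup>2 / q ^ 5)" using q1 by (intro mult_right_mono) auto
   moreover have "2 ^ 21 * real (Q ^ (2 * m - 6)) * real Q = 2 ^ 21 * (X\<^sup>2 / q ^ 5)"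
    unfolding T q_def[symmetric] using q1 by (simp add: field_simps eval_nat_numeral)
   moreover have "(\<eta> ^ e) ^ 12 * real (Q ^ (m - 1)) * real (Q ^ (m - 3)) = q * (\<eta> ^ e) ^ 12 * (X\<^sup>2 / q ^ 5)"
   proof -
    have a: "real (Q ^ (m - 1)) = X / q ^ 1" and b: "real (Q ^ (m - 3)) = X / q ^ 3" by (rule pw, simp)+
    show ?thesis unfolding a b using q1 by (simp add: field_simps eval_nat_numeral)
   qed
   ultimately show "2 ^ 21 * real (Q ^ (2 * m - 6)) * real Q <= (\<eta> ^ e) ^ 12 * real (Q ^ (m - 1)) * real (Q ^ (m - 3))" by simp
  qed (use Q0 in auto)
  have le: "\<eta> ^ k <= (\<eta> ^ e) ^ 15" unfolding epj by (rule power_decreasing) (use eta in "auto simp: k_def")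
  have Ueq: "{- int (8 * Q ^ (m - 3) * Q ^ (m - 2))..int (8 * Q ^ (m - 3) * Q ^ (m - 2))} = ?U" by simp
  from locstruct_mono[OF l le] show ?thesis unfolding reduced_def Ueq power_one_right .
 qed
 have "0 < k" by (simp add: k_def)
 with main show ?thesis by blast
qed

text \<open>The nine list entries come from the nine directions of \<open>conc_dirs\<close>; degree
  lowering uses up all of them. The passage to the dual function squares \<eta>, hence the 2 in
  k.\<close>

lemma dual_progression:
 "\<exists>k s c. 0 < k \<and> (\<forall>P q1 q2 f0 f1 f2 Q m \<eta>. 0 < P --> good P f0 --> good P f1 --> good P f2 --> 0 < \<eta> --> \<eta> <= 1/2 --> adm k Q \<eta> --> k <= m -->
   \<eta> <= norm (Lam P (Q ^ m) q1 q2 f0 f1 f2) -->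
   \<eta> ^ k <= av (zp P) (%y. norm (av (zp (Q ^ (2 * m - c))) (%w. dual2 (Q ^ m) q1 q2 (%x. cnj (f0 x)) (%x. cnj (f1 x)) (y + 2 * q2 * int (Q ^ s) * w)))))"
proof -
 obtain k1 where k1: "0 < k1" and 1: "\<forall>P q1 q2 f0 f1 F Q m \<eta>. 0 < P --> good P f0 --> good P f1 --> good P F --> 0 < \<eta> --> \<eta> <= 1/2 --> adm k1 Q \<eta> --> k1 <= m -->
   \<eta> <= norm (Lam P (Q ^ m) q1 q2 f0 f1 F) --> reduced P q2 Q m (8 * Q ^ (m - 3) * Q ^ (m - 2)) 1 6 9 F (\<eta> ^ k1)"
  using concat_scale by (elim exE conjE) (rule that)
 note 1 = 1[rule_format]
 obtain k2 s c where k2: "0 < k2" and 2: "\<forall>P q1 q2 f0 f1 Q m V \<eta>. 0 < P --> good P f0 --> good P f1 --> 0 < \<eta> --> \<eta> <= 1/2 --> adm k2 Q \<eta> --> k2 <= m --> Q ^ (2 * m - 5) <= V -->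
   reduced P q2 Q m V 1 6 9 (dual2 (Q ^ m) q1 q2 f0 f1) \<eta> -->
   \<eta> ^ k2 <= av (zp P) (%y. norm (av (zp (Q ^ (2 * m - c))) (%w. dual2 (Q ^ m) q1 q2 f0 f1 (y + 2 * q2 * int (Q ^ s) * w))))"
  using reduced_to_progression[of 1 6 9] by (elim exE conjE) (rule that)
 note 2 = 2[rule_format]
 define k where "k = 2 * (k1 * k2) + 5"
 show ?thesis
 proof (rule exI[of _ k], rule exI[of _ s], rule exI[of _ c], intro conjI allI impI)
  show "0 < k" by (simp add: k_def)
  fix P :: nat and q1 q2 :: int and f0 f1 f2 :: "int => complex" and Q m :: nat and \<eta> :: real
  assume *: "0 < P" "good P f0" "good P f1" "good P f2" "0 < \<eta>" "\<eta> <= 1/2" "adm k Q \<eta>" "k <= m" "\<eta> <= norm (Lam P (Q ^ m) q1 q2 f0 f1 f2)"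
  let ?D = "dual2 (Q ^ m) q1 q2 (%x. cnj (f0 x)) (%x. cnj (f1 x))"
  have gc: "good P (%x. cnj (f0 x))" "good P (%x. cnj (f1 x))" by (intro good_cnj *)+
  have kk: "k1 <= k1 * k2" "k2 <= k1 * k2" using k1 k2 by auto
  have Q0: "Q > 0" using *(7) by (simp add: adm_def)
  have e2: "0 < \<eta>\<^sup>2" "\<eta>\<^sup>2 <= 1/2" using *(5,6) power_decreasing[of 1 2 \<eta>] by auto
  have a0: "adm (2 * (k1 * k2)) Q \<eta>" by (rule adm_le[OF *(7) _ *(5,6)]) (simp add: k_def)
  have a1: "adm (k1 * k2) Q (\<eta>\<^sup>2)" by (rule adm_power[OF a0])
  have a2: "adm k1 Q (\<eta>\<^sup>2)" by (rule adm_le[OF a1 kk(1) e2])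
  have m1: "k1 <= m" "k2 <= m" using *(8) kk unfolding k_def by linarith+
  have r: "reduced P q2 Q m (8 * Q ^ (m - 3) * Q ^ (m - 2)) 1 6 9 ?D ((\<eta>\<^sup>2) ^ k1)"
   by (rule 1[OF *(1-3) good_dual2[OF gc] e2 a2 m1(1) Lam_dual2_large[OF *(1-4,9)]]) (use *(5) in simp)
  have e3: "0 < (\<eta>\<^sup>2) ^ k1" "(\<eta>\<^sup>2) ^ k1 <= 1/2" using e2 k1 power_decreasing[of 1 k1 "\<eta>\<^sup>2"] by auto
  have V: "Q ^ (2 * m - 5) <= 8 * Q ^ (m - 3) * Q ^ (m - 2)"
  proof -
   have "Q ^ (2 * m - 5) = Q ^ (m - 3) * Q ^ (m - 2)" unfolding power_add[symmetric]
    by (rule arg_cong[where f = "%i. Q ^ i"]) (use *(8) in "simp add: k_def")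
   then show ?thesis by simp
  qed
  have "((\<eta>\<^sup>2) ^ k1) ^ k2 <= av (zp P) (%y. norm (av (zp (Q ^ (2 * m - c))) (%w. ?D (y + 2 * q2 * int (Q ^ s) * w))))"
   by (rule 2[OF *(1) gc e3 adm_power[OF a1] m1(2) V r])
  moreover have "\<eta> ^ k <= ((\<eta>\<^sup>2) ^ k1) ^ k2"
   unfolding power_mult[symmetric] by (rule power_decreasing) (use * in "auto simp: k_def")
  ultimately show "\<eta> ^ k <= av (zp P) (%y. norm (av (zp (Q ^ (2 * m - c))) (%w. ?D (y + 2 * q2 * int (Q ^ s) * w))))" by linarith
 qed
qed

text \<open>Up to boundary terms the average over t is an average of averages along subprogressions
  of step r, and their starting points disappear in the average over y.\<close>

lemma coarsen_progression:
 assumes P: "P > 0" and T: "T > 0" "T' > 0" and f: "good P f"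
 shows "av (zp P) (%y. norm (av (zp T) (%t. f (y + a * t)))) <= av (zp P) (%y. norm (av (zp T') (%w. f (y + a * int r * w)))) + 2 * real r * real T' / real T"
proof -
 have pz: "finite (zp P)" "zp P ~= {}" and tz: "finite (zp T)" "zp T ~= {}" and tz': "finite (zp T')" "zp T' ~= {}" using P T by auto
 define e where "e = 2 * real r * real T' / real T"
 have pt: "norm (av (zp T) (%t. f (y + a * t))) <= av (zp T) (%t. norm (av (zp T') (%w. f (y + a * t + a * int r * w)))) + e" for y
 proof -
  define g where "g t = f (y + a * t)" for t
  have g1: "norm (g t) <= 1" for t unfolding g_def by (rule good_le[OF f])
  have sh: "shiftok (zp T) (int r * w) e" if "w \<in> zp T'" for w
   by (rule shiftok_int'[OF T(1)]) (use that T in "auto simp: abs_mult e_def intro!: divide_right_mono mult_left_mono")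
  have eq: "av (zp T) g - av (zp T') (%w. av (zp T) (%t. g (t + int r * w))) = av (zp T') (%w. av (zp T) g - av (zp T) (%t. g (t + int r * w)))"
   unfolding av_diff[of "zp T'"] av_const[OF tz'] ..
  have "norm (av (zp T) g - av (zp T') (%w. av (zp T) (%t. g (t + int r * w)))) <= e"
   unfolding eq
  proof (rule norm_av_bound)
   fix w assume "w \<in> zp T'"
   from shiftokD[OF sh[OF this] g1]
   show "norm (av (zp T) g - av (zp T) (%t. g (t + int r * w))) <= e" by (subst norm_minus_commute)
  qed (simp add: e_def)
  moreover have "norm (av (zp T') (%w. av (zp T) (%t. g (t + int r * w)))) <= av (zp T) (%t. norm (av (zp T') (%w. g (t + int r * w))))"
   by (subst av_swap) (rule norm_av_le)
  moreover have "norm (av (zp T) g) <= norm (av (zp T') (%w. av (zp T) (%t. g (t + int r * w)))) + norm (av (zp T) g - av (zp T') (%w. av (zp T) (%t. g (t + int r * w))))"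
   by (rule norm_triangle_sub)
  ultimately have "norm (av (zp T) g) <= av (zp T) (%t. norm (av (zp T') (%w. g (t + int r * w)))) + e" by linarith
  moreover have "g (t + int r * w) = f (y + a * t + a * int r * w)" for t w unfolding g_def by (simp add: algebra_simps)
  ultimately show ?thesis unfolding g_def by simp
 qed
 have "av (zp P) (%y. norm (av (zp T) (%t. f (y + a * t)))) <= av (zp P) (%y. av (zp T) (%t. norm (av (zp T') (%w. f (y + a * t + a * int r * w)))) + e)"
  by (intro av_mono pt)
 also have "... = av (zp T) (%t. av (zp P) (%y. norm (av (zp T') (%w. f (y + a * t + a * int r * w))))) + e"
  unfolding av_add av_const[OF pz] av_swap[of "zp P" "zp T"] ..
 also have "av (zp T) (%t. av (zp P) (%y. norm (av (zp T') (%w. f (y + a * t + a * int r * w))))) = av (zp P) (%y. norm (av (zp T') (%w. f (y + a * int r * w))))"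
 proof -
  have "per P (%y. norm (av (zp T') (%w. f (y + a * int r * w))))"
  proof -
   have "f (y + int P + b) = f (y + b)" for y b using per_shift[of P f b] f by (simp add: good_def per_def)
   then show ?thesis unfolding per_def by simp
  qed
  from av_shift[OF P this] show ?thesis by (simp add: av_const[OF tz])
 qed
 finally show ?thesis unfolding e_def .
qed

lemma norm_av_cnj: "norm (av S (%x. cnj (f x))) = norm (av S f)"
 unfolding cnj_av[symmetric] by simp

text \<open>The dual function has large averages along progressions of step 2 q2 Q^s;
  \<open>dual_window\<close> with zero phase turns a shift in that direction into one of f1 by 2 q1
  Q^s. Coarsening to the step q1 Q^k removes the factor 2 and prepares the comparison with
  congruence classes modulo powers of Q.\<close>

lemma linear_factor_inverse:
 "\<exists>k. 0 < k \<and> (\<forall>P q1 q2 f0 f1 f2 Q m \<eta>. 0 < P --> good P f0 --> good P f1 --> good P f2 --> 0 < \<eta> --> \<eta> <= 1/2 --> adm k Q \<eta> --> 2 * k <= m -->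
   \<eta> <= norm (Lam P (Q ^ m) q1 q2 f0 f1 f2) -->
   \<eta> ^ k <= av (zp P) (%x. norm (av (zp (Q ^ (m - 2 * k))) (%w. f1 (x + q1 * int (Q ^ k) * w)))))"
proof -
 obtain k1 s c where k1: "0 < k1" and 1: "\<forall>P q1 q2 f0 f1 f2 Q m \<eta>. 0 < P --> good P f0 --> good P f1 --> good P f2 --> 0 < \<eta> --> \<eta> <= 1/2 --> adm k1 Q \<eta> --> k1 <= m -->
   \<eta> <= norm (Lam P (Q ^ m) q1 q2 f0 f1 f2) -->
   \<eta> ^ k1 <= av (zp P) (%y. norm (av (zp (Q ^ (2 * m - c))) (%w. dual2 (Q ^ m) q1 q2 (%x. cnj (f0 x)) (%x. cnj (f1 x)) (y + 2 * q2 * int (Q ^ s) * w))))"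
  using dual_progression by (elim exE conjE) (rule that)
 note 1 = 1[rule_format]
 define w where "w = s + c + 1"
 define k where "k = k1 + 2 * w + c + s + 20"
 show ?thesis
 proof (rule exI[of _ k], intro conjI allI impI)
  show "0 < k" by (simp add: k_def)
  fix P :: nat and q1 q2 :: int and f0 f1 f2 :: "int => complex" and Q m :: nat and \<eta> :: real
  assume *: "0 < P" "good P f0" "good P f1" "good P f2" "0 < \<eta>" "\<eta> <= 1/2" "adm k Q \<eta>" "2 * k <= m" "\<eta> <= norm (Lam P (Q ^ m) q1 q2 f0 f1 f2)"
  note P = *(1) and eta = *(5,6) and adm = *(7)
  define g0 where "g0 = (%x. cnj (f0 x))"
  define g1 where "g1 = (%x. cnj (f1 x))"
  have gc: "good P g0" "good P g1" unfolding g0_def g1_def by (intro good_cnj *)+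
  let ?D = "dual2 (Q ^ m) q1 q2 g0 g1"
  have Q0: "Q > 0" using adm by (simp add: adm_def)
  define q where "q = real Q"
  define X where "X = q ^ m"
  have q1: "1 <= q" "0 < q" using Q0 by (auto simp: q_def)
  have X0: "0 < X" using q1 by (simp add: X_def)
  have sq: "q ^ a / q ^ b <= 1 / q" if "Suc a <= b" for a b by (rule scale_quotient[OF q1(1) that])
  have M: "real (Q ^ m) = X" by (simp add: X_def q_def)
  have W: "real (Q ^ (m - w)) = X / q ^ w" unfolding X_def q_def by (rule power_diff_real[OF Q0]) (use *(8) in "simp add: k_def")
  have Wk: "real (Q ^ (m - 2 * k)) = X / q ^ (2 * k)" unfolding X_def q_def by (rule power_diff_real[OF Q0]) (use *(8) in simp)
  have T: "real (Q ^ (2 * m - c)) = X\<^sup>2 / q ^ c" unfolding X_def q_def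
   by (subst power_diff_real[OF Q0]) (use *(8) in "auto simp: k_def power_mult[symmetric] mult.commute")
  define z where "z y = av (zp (Q ^ (2 * m - c))) (%w. ?D (y + 2 * q2 * int (Q ^ s) * w))" for y
  have "adm k1 Q \<eta>" by (rule adm_le[OF adm _ eta]) (simp add: k_def)
  from 1[OF *(1-6) this _ *(9)] *(8) have big: "\<eta> ^ k1 <= av (zp P) (%y. norm (z y))" unfolding z_def g0_def g1_def by (simp add: k_def)
  also have "... = norm (complex_of_real (av (zp P) (%y. norm (z y))))"
   using av_nonneg[of "zp P" "%y. norm (z y)"] by simp
  also have "complex_of_real (av (zp P) (%y. norm (z y))) = av (zp P) (%y. av (zp (Q ^ (2 * m - c))) (%t. av (zp (Q ^ m)) (%d. cnj (sgn (z y)) * (ee (0 * of_int t) *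
   (g0 (y + 2 * q2 * int (Q ^ s) * t - q2 * d\<^sup>2) * g1 (y + 2 * q2 * int (Q ^ s) * t - q2 * d\<^sup>2 + q1 * d))))))"
   unfolding of_real_av cnj_sgn_mult[symmetric] av_mult_left by (simp add: z_def dual2_def)
  finally have b1: "\<eta> ^ k1 <= norm (av (zp P) (%y. av (zp (Q ^ (2 * m - c))) (%t. av (zp (Q ^ m)) (%d. cnj (sgn (z y)) * (ee (0 * of_int t) *
   (g0 (y + 2 * q2 * int (Q ^ s) * t - q2 * d\<^sup>2) * g1 (y + 2 * q2 * int (Q ^ s) * t - q2 * d\<^sup>2 + q1 * d)))))))" .
  have "\<exists>d\<in>zp (Q ^ m). \<exists>s0. \<eta> ^ k1 - (4 * real (Q ^ s) * real (Q ^ (m - w)) / real (Q ^ m) + 4 * (real (Q ^ m) * real (Q ^ (m - w)) + real (Q ^ s) * (real (Q ^ (m - w)))\<^sup>2) / real (Q ^ (2 * m - c))) <=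
   av (zp P) (%y. norm (cnj (sgn (z y))) * norm (av (zp (Q ^ (m - w))) (%w. g1 (y + s0 + 2 * q1 * int (Q ^ s) * w) * ee (0 * of_int (2 * d * w + 2 * int (Q ^ s) * w\<^sup>2)))))"
   by (rule dual_window[OF P _ _ _ gc _ b1]) (use Q0 in "auto simp: norm_sgn")
  then obtain d s0 where b2: "\<eta> ^ k1 - (4 * real (Q ^ s) * real (Q ^ (m - w)) / real (Q ^ m) + 4 * (real (Q ^ m) * real (Q ^ (m - w)) + real (Q ^ s) * (real (Q ^ (m - w)))\<^sup>2) / real (Q ^ (2 * m - c))) <=
   av (zp P) (%y. norm (cnj (sgn (z y))) * norm (av (zp (Q ^ (m - w))) (%w. g1 (y + s0 + 2 * q1 * int (Q ^ s) * w) * ee (0 * of_int (2 * d * w + 2 * int (Q ^ s) * w\<^sup>2)))))"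
   by blast
  define Y where "Y y = norm (av (zp (Q ^ (m - w))) (%w. g1 (y + 2 * q1 * int (Q ^ s) * w)))" for y
  have Yp: "per P Y"
  proof -
   have "g1 (y + int P + b) = g1 (y + b)" for y b using per_shift[of P g1 b] gc(2) by (simp add: good_def per_def)
   then show ?thesis unfolding per_def Y_def by simp
  qed
  have "av (zp P) (%y. norm (cnj (sgn (z y))) * norm (av (zp (Q ^ (m - w))) (%w. g1 (y + s0 + 2 * q1 * int (Q ^ s) * w) * ee (0 * of_int (2 * d * w + 2 * int (Q ^ s) * w\<^sup>2)))))
   <= av (zp P) (%y. Y (y + s0))"
  proof (rule av_mono)
   fix y
   have "norm (cnj (sgn (z y))) * Y (y + s0) <= 1 * Y (y + s0)" by (rule mult_right_mono) (auto simp: norm_sgn Y_def)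
   then show "norm (cnj (sgn (z y))) * norm (av (zp (Q ^ (m - w))) (%w. g1 (y + s0 + 2 * q1 * int (Q ^ s) * w) * ee (0 * of_int (2 * d * w + 2 * int (Q ^ s) * w\<^sup>2)))) <= Y (y + s0)"
    by (simp add: Y_def)
  qed
  also have "... = av (zp P) Y" by (rule av_shift[OF P Yp])
  also have "... <= av (zp P) (%y. norm (av (zp (Q ^ (m - 2 * k))) (%w. g1 (y + 2 * q1 * int (Q ^ s) * int (Q ^ (k - s) div 2) * w)))) + 2 * real (Q ^ (k - s) div 2) * real (Q ^ (m - 2 * k)) / real (Q ^ (m - w))"
   unfolding Y_def by (rule coarsen_progression[OF P _ _ gc(2)]) (use Q0 in auto)
  finally have b3: "av (zp P) (%y. norm (cnj (sgn (z y))) * norm (av (zp (Q ^ (m - w))) (%w. g1 (y + s0 + 2 * q1 * int (Q ^ s) * w) * ee (0 * of_int (2 * d * w + 2 * int (Q ^ s) * w\<^sup>2)))))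
   <= av (zp P) (%y. norm (av (zp (Q ^ (m - 2 * k))) (%w. g1 (y + 2 * q1 * int (Q ^ s) * int (Q ^ (k - s) div 2) * w)))) + 2 * real (Q ^ (k - s) div 2) * real (Q ^ (m - 2 * k)) / real (Q ^ (m - w))" .
  \<comment> \<open>Evenness makes Q^(k-s) div 2 an exact half, which cancels the 2 in the
    step.\<close>
  have "2 dvd Q"
  proof -
   have "(2::real) ^ 1 <= (1 / \<eta>) ^ 1" by (rule half_powers(1)[OF eta])
   also have "... <= (1 / \<eta>) ^ k" by (rule power_increasing) (use eta in "auto simp: k_def")
   finally show ?thesis using adm unfolding adm_def by (auto dest!: spec[of _ 2])
  qed
  then have ev: "2 dvd Q ^ (k - s)" by (simp add: k_def)
  then have r2: "2 * real (Q ^ (k - s) div 2) = real (Q ^ (k - s))" by (simp add: real_of_nat_div)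
  have step: "2 * q1 * int (Q ^ s) * int (Q ^ (k - s) div 2) = q1 * int (Q ^ k)" for q1
  proof -
   have "2 * (Q ^ (k - s) div 2) = Q ^ (k - s)" using ev by simp
   moreover have "k = s + (k - s)" by (simp add: k_def)
   then have "Q ^ k = Q ^ s * Q ^ (k - s)" by (metis power_add)
   ultimately have "Q ^ k = Q ^ s * (2 * (Q ^ (k - s) div 2))" by simp
   then have "int (Q ^ k) = int (Q ^ s) * (2 * int (Q ^ (k - s) div 2))" by (metis of_nat_mult of_nat_numeral)
   then show ?thesis by (simp only: mult_ac)
  qed
  have ks: "real (Q ^ (k - s)) = q ^ (k - s)" by (simp add: q_def)
  have e3: "2 * real (Q ^ (k - s) div 2) * real (Q ^ (m - 2 * k)) / real (Q ^ (m - w)) <= 1 / q"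
  proof -
   have "2 * real (Q ^ (k - s) div 2) * real (Q ^ (m - 2 * k)) / real (Q ^ (m - w)) = q ^ (k - s + w) / q ^ (2 * k)"
    unfolding r2 ks Wk W using X0 q1 by (simp add: power_add)
   also have "... <= 1 / q" by (rule sq) (simp add: k_def)
   finally show ?thesis .
  qed
  have e1: "4 * real (Q ^ s) * real (Q ^ (m - w)) / real (Q ^ m) + 4 * (real (Q ^ m) * real (Q ^ (m - w)) + real (Q ^ s) * (real (Q ^ (m - w)))\<^sup>2) / real (Q ^ (2 * m - c)) <= 12 * (1 / q)"
  proof (rule three_terms_le)
   show "4 * real (Q ^ s) * real (Q ^ (m - w)) / real (Q ^ m) = 4 * (q ^ s / q ^ w)" unfolding W M using X0 by (simp add: q_def)
   show "4 * (real (Q ^ m) * real (Q ^ (m - w)) + real (Q ^ s) * (real (Q ^ (m - w)))\<^sup>2) / real (Q ^ (2 * m - c)) = 4 * (q ^ c / q ^ w + q ^ (s + c) / q ^ (w + w))"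
    unfolding W M T using X0 q1 by (simp add: q_def field_simps power2_eq_square power_add)
   show "q ^ s / q ^ w <= 1 / q" "q ^ c / q ^ w <= 1 / q" "q ^ (s + c) / q ^ (w + w) <= 1 / q" by (intro sq; simp add: w_def)+
  qed simp
  have "26 <= q * \<eta> ^ k1" unfolding q_def by (rule adm_absorb(1)[OF adm eta, of 5 k1]) (auto simp: k_def)
  then have "13 * (1 / q) <= \<eta> ^ k1 / 2" using q1 by (simp add: field_simps)
  then have "\<eta> ^ k1 / 2 <= av (zp P) (%y. norm (av (zp (Q ^ (m - 2 * k))) (%w. g1 (y + q1 * int (Q ^ k) * w))))"
   using b2 b3 e1 e3 unfolding step by linarith
  moreover have "\<eta> ^ k <= \<eta> ^ k1 / 2"
  proof -
   have "\<eta> ^ k <= \<eta> ^ (k1 + 1)" by (rule power_decreasing) (use eta in "auto simp: k_def")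
   also have "... <= \<eta> ^ k1 * (1 / 2)" unfolding power_add power_one_right using eta by (intro mult_left_mono) auto
   finally show ?thesis by simp
  qed
  ultimately show "\<eta> ^ k <= av (zp P) (%x. norm (av (zp (Q ^ (m - 2 * k))) (%w. f1 (x + q1 * int (Q ^ k) * w))))"
   unfolding g1_def norm_av_cnj by linarith
 qed
qed

section \<open>Inverse theorem for the quadratic factor\<close>

definition dual1 :: "nat => int => int => (int => complex) => (int => complex) => int => complex" where
 "dual1 M q1 q2 f0 f2 z = av (zp M) (%d. f0 (z - q1 * d) * f2 (z - q1 * d + q2 * d\<^sup>2))"

lemma good_dual1: assumes "good P f0" "good P f2" shows "good P (dual1 M q1 q2 f0 f2)"
 unfolding dual1_def[abs_def]
proof (rule good_av)
 fix d
 have "good P (%z. f0 (z + - (q1 * d)) * f2 (z + (q2 * d\<^sup>2 - q1 * d)))" by (intro good_mult good_shift assms)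
 then show "good P (%z. f0 (z - q1 * d) * f2 (z - q1 * d + q2 * d\<^sup>2))" by (simp add: algebra_simps)
qed

lemma cnj_dual1: "cnj (dual1 M q1 q2 f0 f2 z) = dual1 M q1 q2 (%x. cnj (f0 x)) (%x. cnj (f2 x)) z"
 by (simp add: dual1_def cnj_av)

lemma Lam_eq_dual1:
 assumes P: "P > 0" and f: "good P f0" "good P f1" "good P f2"
 shows "Lam P M q1 q2 f0 f1 f2 = av (zp P) (%z. f1 z * dual1 M q1 q2 f0 f2 z)"
proof -
 have "Lam P M q1 q2 f0 f1 f2 = av (zp M) (%d. av (zp P) (%x. f0 x * f1 (x + q1 * d) * f2 (x + q2 * d\<^sup>2)))"
  unfolding Lam_def by (rule av_swap)
 also have "... = av (zp M) (%d. av (zp P) (%z. f1 z * (f0 (z - q1 * d) * f2 (z - q1 * d + q2 * d\<^sup>2))))"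
 proof (rule av_cong1)
  fix d
  have "good P (%x. f0 x * f1 (x + q1 * d) * f2 (x + q2 * d\<^sup>2))" by (intro good_mult good_shift f)
  then have "av (zp P) (%x. f0 (x + - (q1 * d)) * f1 (x + - (q1 * d) + q1 * d) * f2 (x + - (q1 * d) + q2 * d\<^sup>2)) =
   av (zp P) (%x. f0 x * f1 (x + q1 * d) * f2 (x + q2 * d\<^sup>2))"
   by (intro av_shift[OF P, of "%x. f0 x * f1 (x + q1 * d) * f2 (x + q2 * d\<^sup>2)"]) (simp add: good_def)
  then show "av (zp P) (%x. f0 x * f1 (x + q1 * d) * f2 (x + q2 * d\<^sup>2)) = av (zp P) (%z. f1 z * (f0 (z - q1 * d) * f2 (z - q1 * d + q2 * d\<^sup>2)))"
   by (simp add: mult_ac)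
 qed
 also have "... = av (zp P) (%z. av (zp M) (%d. f1 z * (f0 (z - q1 * d) * f2 (z - q1 * d + q2 * d\<^sup>2))))" by (rule av_swap)
 finally show ?thesis unfolding dual1_def av_mult_left .
qed

lemma Lam_dual1_large:
 assumes P: "P > 0" and f: "good P f0" "good P f1" "good P f2" and big: "\<eta> <= norm (Lam P M q1 q2 f0 f1 f2)" "0 <= \<eta>"
 shows "\<eta>\<^sup>2 <= norm (Lam P M q1 q2 f0 (dual1 M q1 q2 (%x. cnj (f0 x)) (%x. cnj (f2 x))) f2)"
proof -
 let ?D = "dual1 M q1 q2 f0 f2"
 have "\<eta>\<^sup>2 <= (norm (av (zp P) (%z. f1 z * ?D z)))\<^sup>2"
  using big unfolding Lam_eq_dual1[OF P f] by (intro power_mono)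
 also have "... <= av (zp P) (%z. (norm (?D z))\<^sup>2)" by (rule av_kill) (rule good_le[OF f(2)])
 also have "... = norm (av (zp P) (%z. cnj (?D z) * ?D z))" by (rule av_norm_square_eq[symmetric])
 also have "av (zp P) (%z. cnj (?D z) * ?D z) = Lam P M q1 q2 f0 (dual1 M q1 q2 (%x. cnj (f0 x)) (%x. cnj (f2 x))) f2"
  unfolding cnj_dual1 by (rule Lam_eq_dual1[symmetric, OF P f(1) _ f(3)]) (intro good_dual1 good_cnj f)
 finally show ?thesis .
qed

text \<open>Shifting d by K w undoes the shift of x by q1 K w in the argument of g0, which becomes
  free of w; g2 is then averaged along x + q2 (d + K w)^2.\<close>

lemma dual1_window:
 assumes P: "P > 0" and M: "M > 0" and W: "W > 0" and g: "good P g0" "good P g2"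
 shows "\<exists>d\<in>zp M. av (zp P) (%x. norm (av (zp W) (%w. dual1 M q1 q2 g0 g2 (x + q1 * int K * w)))) - 2 * real K * real W / real M <=
  av (zp P) (%x. norm (av (zp W) (%w. g2 (x + q2 * (d + int K * w)\<^sup>2))))"
proof -
 define e where "e = 2 * real K * real W / real M"
 have pz: "finite (zp P)" "zp P ~= {}" and mz: "finite (zp M)" "zp M ~= {}" and wz: "finite (zp W)" "zp W ~= {}" using P M W by auto
 define Y where "Y d x = norm (av (zp W) (%w. g2 (x + q2 * (d + int K * w)\<^sup>2)))" for d x
 have pt: "norm (av (zp W) (%w. dual1 M q1 q2 g0 g2 (x + q1 * int K * w))) <= av (zp M) (%d. Y d (x + - (q1 * d))) + e" for x
 proof -
  define H where "H w d = g0 (x + q1 * int K * w - q1 * d) * g2 (x + q1 * int K * w - q1 * d + q2 * d\<^sup>2)" for w d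
  have H1: "norm (H w d) <= 1" for w d unfolding H_def by (intro mult_le_1 good_le[OF g(1)] good_le[OF g(2)])
  have sh: "shiftok (zp M) (int K * w) e" if "w \<in> zp W" for w
   by (rule shiftok_int'[OF M]) (use that M in "auto simp: abs_mult e_def intro!: divide_right_mono mult_left_mono")
  have "norm (av (zp W) (%w. av (zp M) (%d. H w (d + int K * w)) - av (zp M) (H w))) <= e"
  proof (rule norm_av_bound)
   fix w assume "w \<in> zp W"
   from shiftokD[OF sh[OF this], of "H w"] H1
   show "norm (av (zp M) (%d. H w (d + int K * w)) - av (zp M) (H w)) <= e" by simp
  qed (simp add: e_def)
  then have "norm (av (zp W) (%w. av (zp M) (H w))) <= norm (av (zp W) (%w. av (zp M) (%d. H w (d + int K * w)))) + e"
   unfolding av_diff using norm_triangle_sub[of "av (zp W) (%w. av (zp M) (H w))" "av (zp W) (%w. av (zp M) (%d. H w (d + int K * w)))"]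
   by (simp only: norm_minus_commute)
  moreover have "norm (av (zp W) (%w. av (zp M) (%d. H w (d + int K * w)))) <= av (zp M) (%d. Y d (x + - (q1 * d)))"
  proof -
   have "H w (d + int K * w) = g0 (x - q1 * d) * g2 (x + - (q1 * d) + q2 * (d + int K * w)\<^sup>2)" for w d
    unfolding H_def by (simp add: algebra_simps)
   then have "av (zp W) (%w. av (zp M) (%d. H w (d + int K * w))) = av (zp M) (%d. g0 (x - q1 * d) * av (zp W) (%w. g2 (x + - (q1 * d) + q2 * (d + int K * w)\<^sup>2)))"
    by (subst av_swap) (simp only: av_mult_left)
   then have "norm (av (zp W) (%w. av (zp M) (%d. H w (d + int K * w)))) <= av (zp M) (%d. norm (g0 (x - q1 * d)) * Y d (x + - (q1 * d)))"
    using norm_av_le[of "zp M" "%d. g0 (x - q1 * d) * av (zp W) (%w. g2 (x + - (q1 * d) + q2 * (d + int K * w)\<^sup>2))"] by (simp add: norm_mult Y_def)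
   also have "... <= av (zp M) (%d. 1 * Y d (x + - (q1 * d)))"
    by (intro av_mono mult_right_mono good_le[OF g(1)]) (simp add: Y_def)
   finally show ?thesis by simp
  qed
  moreover have "dual1 M q1 q2 g0 g2 (x + q1 * int K * w) = av (zp M) (H w)" for w unfolding dual1_def H_def ..
  ultimately show ?thesis by simp
 qed
 have Yp: "per P (Y d)" for d
 proof -
  have "g2 (y + int P + b) = g2 (y + b)" for y b using per_shift[of P g2 b] g(2) by (simp add: good_def per_def)
  then show ?thesis unfolding per_def Y_def by simp
 qed
 have "av (zp P) (%x. norm (av (zp W) (%w. dual1 M q1 q2 g0 g2 (x + q1 * int K * w)))) <= av (zp P) (%x. av (zp M) (%d. Y d (x + - (q1 * d))) + e)"
  by (intro av_mono pt)
 also have "... = av (zp M) (%d. av (zp P) (%x. Y d (x + - (q1 * d)))) + e"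
  unfolding av_add av_const[OF pz] av_swap[of "zp P" "zp M"] ..
 also have "... = av (zp M) (%d. av (zp P) (Y d)) + e" unfolding av_shift[OF P Yp] ..
 finally have "av (zp P) (%x. norm (av (zp W) (%w. dual1 M q1 q2 g0 g2 (x + q1 * int K * w)))) - e <= av (zp M) (%d. av (zp P) (Y d))" by simp
 from av_pigeonhole[OF mz this] show ?thesis unfolding e_def Y_def by blast
qed

text \<open>A frequency \<phi> with a large Weyl sum along q2 (d + K w)^2 has q2 K^2 \<phi> near a
  rational with denominator dividing Q, so it is also seen by the progression of step q2 K^2 Q.
  \<open>spectral_transfer\<close>, with a one-point outer average, carries this over to g.\<close>

lemma quadratic_progression_transfer:
 fixes g :: "int => complex"
 assumes P: "P > 0" and g: "good P g" and W: "W > 0" and T: "T > 0" and z: "0 < z" "z <= 1"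
  and big: "z <= av (zp P) (%x. (norm (av (zp W) (%w. g (x + q2 * (d + int K * w)\<^sup>2))))\<^sup>2)"
  and dvd: "!!r::nat. 1 <= r ==> real r <= 288 / z\<^sup>2 ==> r dvd Q"
  and sizes: "2 ^ 29 / z ^ 7 <= real W" "2 ^ 24 * real T * real Q <= z ^ 6 * (real W)\<^sup>2"
 shows "z / 8 <= av (zp P) (%x. norm (av (zp T) (%j. g (x + q2 * int (K\<^sup>2 * Q) * j))))"
proof -
 have gp: "per P g" "!!x. norm (g x) <= 1" using g by (auto simp: good_def bdd_def)
 have "z / 8 <= av (zp P) (%x. (norm (av (zp T) (%j. g (x + q2 * int (K\<^sup>2 * Q) * j))))\<^sup>2)"
 proof (rule spectral_transfer[OF P gp, where \<Omega> = "{()}" and S = "zp W" and v = "%_ w. q2 * (d + int K * w)\<^sup>2"])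
  show "z <= av {()} (%\<omega>. av (zp P) (%x. (norm (av (zp W) (%w. g (x + q2 * (d + int K * w)\<^sup>2))))\<^sup>2))" using big by (simp add: av_def[of "{()}"])
  fix \<phi> :: real
  let ?n = "norm (av (zp W) (%w. ee (of_int (q2 * (d + int K * w)\<^sup>2) * \<phi>)))"
  assume "z / 2 <= av {()} (%\<omega>. ?n\<^sup>2)"
  then have "z / 2 <= ?n\<^sup>2" by (simp add: av_def[of "{()}"])
  also have "... <= ?n"
  proof -
   have "?n <= 1" by (intro norm_av_le_1) simp
   then show ?thesis by (simp add: power2_eq_square mult_left_le)
  qed
  finally have n: "z / 2 <= ?n" .
  define A where "A = of_int (q2 * int (K\<^sup>2)) * \<phi>"
  define B where "B = of_int (2 * d * int K * q2) * \<phi>"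
  define C where "C = of_int (q2 * d\<^sup>2) * \<phi>"
  have ph: "of_int (q2 * (d + int K * w)\<^sup>2) * \<phi> = A * (of_int w)\<^sup>2 + B * of_int w + C" for w
   unfolding A_def B_def C_def by (simp add: algebra_simps power2_eq_square)
  have "(\<Sum>w\<in>zp W. ee (of_int (q2 * (d + int K * w)\<^sup>2) * \<phi>)) = (\<Sum>w\<in>zp W. ee (A * (of_int w)\<^sup>2 + B * of_int w)) * ee C"
   unfolding ph ee_add sum_distrib_right ..
  then have neq: "?n = norm (\<Sum>w\<in>zp W. ee (A * (of_int w)\<^sup>2 + B * of_int w)) / real W"
   unfolding av_def by (simp add: norm_mult)
  have "z / 2 <= norm (\<Sum>w\<in>zp W. ee (A * (of_int w)\<^sup>2 + B * of_int w)) / real W" using n unfolding neq .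
  then have "z / 2 * real W <= norm (\<Sum>w\<in>{0..<0 + int W}. ee (A * (of_int w)\<^sup>2 + B * of_int w))" using W by (simp add: pos_le_divide_eq)
  then have "\<exists>r::nat. 1 <= r \<and> real r <= 72 / (z / 2)\<^sup>2 \<and> dn (real r * A) <= 9216 / ((z / 2) ^ 6 * (real W)\<^sup>2)
   \<and> dn (real r * B) <= 2 ^ 24 / ((z / 2) ^ 8 * real W)"
  proof (rule weyl_quadratic)
   show "2 ^ 22 / (z / 2) ^ 7 <= real W" using sizes(1) by (simp add: power_divide)
  qed (use z in auto)
  then obtain r :: nat where r: "1 <= r" "real r <= 288 / z\<^sup>2" "dn (real r * A) <= 589824 / (z ^ 6 * (real W)\<^sup>2)"
   by (auto simp: power_divide)
  have "dn (of_int (int Q) * A) <= \<bar>of_int (int Q)\<bar> * (589824 / (z ^ 6 * (real W)\<^sup>2))"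
   by (rule dn_dvd[OF _ _ r(3)]) (use dvd[OF r(1,2)] r(1) in auto)
  then have "16 * real T * dn (of_int (int Q) * A) <= 16 * real T * (real Q * (589824 / (z ^ 6 * (real W)\<^sup>2)))"
   by (intro mult_left_mono) auto
  also have "... = 9437184 * real T * real Q / (z ^ 6 * (real W)\<^sup>2)" by simp
  also have "... <= 2 ^ 24 * real T * real Q / (z ^ 6 * (real W)\<^sup>2)" by (intro divide_right_mono mult_right_mono) auto
  also have "... <= 1" using sizes(2) z W by simp
  finally have "16 * real T * dn (of_int (int Q) * A) <= 1" .
  from av_ee_major[OF T this] show "1 / 4 <= (norm (av (zp T) (%j. ee (of_int (q2 * int (K\<^sup>2 * Q) * j) * \<phi>))))\<^sup>2"
   unfolding A_def by (simp add: mult_ac)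
 qed auto
 also have "... <= av (zp P) (%x. norm (av (zp T) (%j. g (x + q2 * int (K\<^sup>2 * Q) * j))))"
 proof (rule av_mono)
  fix x
  let ?n = "norm (av (zp T) (%j. g (x + q2 * int (K\<^sup>2 * Q) * j)))"
  have "?n <= 1" by (intro norm_av_le_1 gp)
  then show "?n\<^sup>2 <= ?n" by (simp add: power2_eq_square mult_left_le)
 qed
 finally show ?thesis .
qed

text \<open>Now f1 is replaced by a dual function, to which the linear inverse theorem applies. Its
  averages along progressions become averages of f2 along quadratics by \<open>dual1_window\<close>,
  and these become averages along progressions of length about Q^(2 m).\<close>

lemma quadratic_factor_inverse:
 "\<exists>k. 0 < k \<and> (\<forall>P q1 q2 f0 f1 f2 Q m \<eta>. 0 < P --> good P f0 --> good P f1 --> good P f2 --> 0 < \<eta> --> \<eta> <= 1/2 --> adm k Q \<eta> --> 2 * k <= m -->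
   \<eta> <= norm (Lam P (Q ^ m) q1 q2 f0 f1 f2) -->
   \<eta> ^ k <= av (zp P) (%x. norm (av (zp (Q ^ (2 * m - 2 * k))) (%w. f2 (x + q2 * int (Q ^ k) * w)))))"
proof -
 obtain k1 where k1: "0 < k1" and 1: "\<forall>P q1 q2 f0 f1 f2 Q m \<eta>. 0 < P --> good P f0 --> good P f1 --> good P f2 --> 0 < \<eta> --> \<eta> <= 1/2 --> adm k1 Q \<eta> --> 2 * k1 <= m -->
   \<eta> <= norm (Lam P (Q ^ m) q1 q2 f0 f1 f2) -->
   \<eta> ^ k1 <= av (zp P) (%x. norm (av (zp (Q ^ (m - 2 * k1))) (%w. f1 (x + q1 * int (Q ^ k1) * w))))"
  using linear_factor_inverse by (elim exE conjE) (rule that)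
 note 1 = 1[rule_format]
 \<comment> \<open>\<eta>^b bounds z = \<zeta>^2 from below, because \<zeta> \<ge> \<eta>^(2 k1 +
   1).\<close>
 define b where "b = 4 * k1 + 2"
 define k where "k = 40 + 8 * b"
 show ?thesis
 proof (rule exI[of _ k], intro conjI allI impI)
  show "0 < k" by (simp add: k_def)
  fix P :: nat and q1 q2 :: int and f0 f1 f2 :: "int => complex" and Q m :: nat and \<eta> :: real
  assume *: "0 < P" "good P f0" "good P f1" "good P f2" "0 < \<eta>" "\<eta> <= 1/2" "adm k Q \<eta>" "2 * k <= m" "\<eta> <= norm (Lam P (Q ^ m) q1 q2 f0 f1 f2)"
  note P = *(1) and eta = *(5,6) and adm = *(7)
  define g0 where "g0 = (%x. cnj (f0 x))"
  define g2 where "g2 = (%x. cnj (f2 x))"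
  have gc: "good P g0" "good P g2" unfolding g0_def g2_def by (intro good_cnj *)+
  have Q0: "Q > 0" using adm by (simp add: adm_def)
  define q where "q = real Q"
  define X where "X = q ^ m"
  have q1: "1 <= q" "0 < q" using Q0 by (auto simp: q_def)
  have X0: "0 < X" using q1 by (simp add: X_def)
  have sq: "q ^ a / q ^ b <= 1 / q" if "Suc a <= b" for a b by (rule scale_quotient[OF q1(1) that])
  note ab = adm_absorb(1)[OF adm eta, folded q_def]
  have M: "real (Q ^ m) = X" by (simp add: X_def q_def)
  have W: "real (Q ^ (m - 2 * k1)) = X / q ^ (2 * k1)" unfolding X_def q_def by (rule power_diff_real[OF Q0]) (use *(8) in "simp add: k_def b_def")
  have T: "real (Q ^ (2 * m - b)) = X\<^sup>2 / q ^ b" unfolding X_def q_def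
   by (subst power_diff_real[OF Q0]) (use *(8) in "auto simp: k_def power_mult[symmetric] mult.commute")
  have Tk: "real (Q ^ (2 * m - 2 * k)) = X\<^sup>2 / q ^ (2 * k)" unfolding X_def q_def
   by (subst power_diff_real[OF Q0]) (use *(8) in "auto simp: power_mult[symmetric] mult.commute")
  have e2: "0 < \<eta>\<^sup>2" "\<eta>\<^sup>2 <= 1/2" using eta power_decreasing[of 1 2 \<eta>] by auto
  have "adm (2 * k1) Q \<eta>" by (rule adm_le[OF adm _ eta]) (simp add: k_def b_def)
  then have a1: "adm k1 Q (\<eta>\<^sup>2)" by (rule adm_power)
  have "0 <= \<eta>" "2 * k1 <= m" using eta *(8) by (auto simp: k_def b_def)
  from 1[OF P *(2) good_dual1[OF gc] *(4) e2 a1 this(2) Lam_dual1_large[OF *(1-4,9) this(1), folded g0_def g2_def]]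
  have b1: "(\<eta>\<^sup>2) ^ k1 <= av (zp P) (%x. norm (av (zp (Q ^ (m - 2 * k1))) (%w. dual1 (Q ^ m) q1 q2 g0 g2 (x + q1 * int (Q ^ k1) * w))))" .
  obtain d where d: "d \<in> zp (Q ^ m)" "av (zp P) (%x. norm (av (zp (Q ^ (m - 2 * k1))) (%w. dual1 (Q ^ m) q1 q2 g0 g2 (x + q1 * int (Q ^ k1) * w)))) - 2 * real (Q ^ k1) * real (Q ^ (m - 2 * k1)) / real (Q ^ m) <=
   av (zp P) (%x. norm (av (zp (Q ^ (m - 2 * k1))) (%w. g2 (x + q2 * (d + int (Q ^ k1) * w)\<^sup>2))))"
   using dual1_window[OF P _ _ gc, of "Q ^ m" "Q ^ (m - 2 * k1)" q1 q2 "Q ^ k1"] Q0 by auto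
  have er: "2 * real (Q ^ k1) * real (Q ^ (m - 2 * k1)) / real (Q ^ m) <= 2 * (1 / q)"
  proof -
   have "2 * real (Q ^ k1) * real (Q ^ (m - 2 * k1)) / real (Q ^ m) = 2 * (q ^ k1 / q ^ (2 * k1))" unfolding W M using X0 by (simp add: q_def)
   also have "... <= 2 * (1 / q)" by (intro mult_left_mono sq) (use k1 in auto)
   finally show ?thesis .
  qed
  define \<zeta> where "\<zeta> = \<eta> ^ (2 * k1) / 2"
  define z where "z = \<zeta>\<^sup>2"
  have "4 <= q * \<eta> ^ (2 * k1)" by (rule ab[of 2 "2 * k1"]) (auto simp: k_def b_def)
  then have "2 * (1 / q) <= \<zeta>" using q1 by (simp add: \<zeta>_def field_simps)
  moreover have "(\<eta>\<^sup>2) ^ k1 = 2 * \<zeta>" by (simp add: \<zeta>_def power_mult)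
  ultimately have b2: "\<zeta> <= av (zp P) (%x. norm (av (zp (Q ^ (m - 2 * k1))) (%w. g2 (x + q2 * (d + int (Q ^ k1) * w)\<^sup>2))))"
   using b1 d(2) er by linarith
  have z0: "0 < \<zeta>" "\<zeta> <= 1" using eta power_le_one[of \<eta> "2 * k1"] by (auto simp: \<zeta>_def)
  then have z1: "0 < z" "z <= 1" by (auto simp: z_def intro: power_le_one)
  have zb: "\<eta> ^ b <= z"
  proof -
   have "\<eta> ^ (2 * k1 + 1) <= \<zeta>" unfolding power_add power_one_right \<zeta>_def using eta mult_left_mono[of \<eta> "1/2" "\<eta> ^ (2 * k1)"] by simp
   then have "(\<eta> ^ (2 * k1 + 1))\<^sup>2 <= z" unfolding z_def using eta by (intro power_mono) auto
   moreover have "(\<eta> ^ (2 * k1 + 1))\<^sup>2 = \<eta> ^ b" unfolding power_mult[symmetric] b_def by (rule arg_cong[where f = "%i. \<eta> ^ i"]) simp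
   ultimately show ?thesis by simp
  qed
  have zbj: "\<eta> ^ (b * j) <= z ^ j" for j unfolding power_mult using zb eta by (intro power_mono) auto
  have "z <= (av (zp P) (%x. norm (av (zp (Q ^ (m - 2 * k1))) (%w. g2 (x + q2 * (d + int (Q ^ k1) * w)\<^sup>2)))))\<^sup>2"
   unfolding z_def using b2 z0 by (intro power_mono) auto
  also have "... <= av (zp P) (%x. (norm (av (zp (Q ^ (m - 2 * k1))) (%w. g2 (x + q2 * (d + int (Q ^ k1) * w)\<^sup>2))))\<^sup>2)" by (rule av_square_le)
  finally have b3: "z <= av (zp P) (%x. (norm (av (zp (Q ^ (m - 2 * k1))) (%w. g2 (x + q2 * (d + int (Q ^ k1) * w)\<^sup>2))))\<^sup>2)" .
  have "z / 8 <= av (zp P) (%x. norm (av (zp (Q ^ (2 * m - b))) (%j. g2 (x + q2 * int ((Q ^ k1)\<^sup>2 * Q) * j))))"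
  proof (rule quadratic_progression_transfer[OF P gc(2) _ _ z1 b3])
   show "r dvd Q" if "1 <= r" "real r <= 288 / z\<^sup>2" for r
   proof -
    have "288 / z\<^sup>2 <= (1 / \<eta>) ^ 9 / \<eta> ^ (b * 2)"
     using half_powers(1)[OF eta, of 9] zbj[of 2] eta by (intro frac_le) auto
    also have "... = (1 / \<eta>) ^ (9 + b * 2)" by (simp add: power_add power_divide)
    also have "... <= (1 / \<eta>) ^ k" by (rule power_increasing) (use eta in "auto simp: k_def")
    finally have "real r <= (1 / \<eta>) ^ k" using that(2) by linarith
    then show ?thesis using adm that(1) unfolding adm_def by blast
   qed
   have "2 ^ 29 <= q * z ^ 7" by (rule ab[of 29 "b * 7"]) (use zbj[of 7] in "auto simp: k_def")
   then have "2 ^ 29 / z ^ 7 <= q ^ 1" using z1 by (simp add: field_simps)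
   also have "... <= q ^ (m - 2 * k1)" by (rule power_increasing) (use q1 *(8) in "auto simp: k_def b_def")
   finally show "2 ^ 29 / z ^ 7 <= real (Q ^ (m - 2 * k1))" by (simp add: q_def)
   have "2 ^ 24 <= q * z ^ 6" by (rule ab[of 24 "b * 6"]) (use zbj[of 6] in "auto simp: k_def")
   then have "2 ^ 24 * (X\<^sup>2 / q ^ (4 * k1 + 1)) <= q * z ^ 6 * (X\<^sup>2 / q ^ (4 * k1 + 1))" using q1 by (intro mult_right_mono) auto
   moreover have "2 ^ 24 * real (Q ^ (2 * m - b)) * real Q = 2 ^ 24 * (X\<^sup>2 / q ^ (4 * k1 + 1))"
    unfolding T unfolding q_def[symmetric] b_def using q1 by (simp add: power_add power2_eq_square)
   moreover have "z ^ 6 * (real (Q ^ (m - 2 * k1)))\<^sup>2 = q * z ^ 6 * (X\<^sup>2 / q ^ (4 * k1 + 1))"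
    unfolding W using q1 by (simp add: power_add power_divide power_mult[symmetric])
   ultimately show "2 ^ 24 * real (Q ^ (2 * m - b)) * real Q <= z ^ 6 * (real (Q ^ (m - 2 * k1)))\<^sup>2" by simp
  qed (use Q0 in auto)
  also have "... <= av (zp P) (%x. norm (av (zp (Q ^ (2 * m - 2 * k))) (%w. g2 (x + q2 * int ((Q ^ k1)\<^sup>2 * Q) * int (Q ^ (k - (2 * k1 + 1))) * w)))) + 2 * real (Q ^ (k - (2 * k1 + 1))) * real (Q ^ (2 * m - 2 * k)) / real (Q ^ (2 * m - b))"
   by (rule coarsen_progression[OF P _ _ gc(2)]) (use Q0 in auto)
  finally have b4: "z / 8 <= av (zp P) (%x. norm (av (zp (Q ^ (2 * m - 2 * k))) (%w. g2 (x + q2 * int ((Q ^ k1)\<^sup>2 * Q) * int (Q ^ (k - (2 * k1 + 1))) * w)))) + 2 * real (Q ^ (k - (2 * k1 + 1))) * real (Q ^ (2 * m - 2 * k)) / real (Q ^ (2 * m - b))" .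
  have step: "q2 * int ((Q ^ k1)\<^sup>2 * Q) * int (Q ^ (k - (2 * k1 + 1))) = q2 * int (Q ^ k)"
  proof -
   have "(Q ^ k1)\<^sup>2 * Q = Q ^ (2 * k1 + 1)" by (simp add: power_mult[symmetric] mult.commute)
   then have "(Q ^ k1)\<^sup>2 * Q * Q ^ (k - (2 * k1 + 1)) = Q ^ k" by (simp only: power_add[symmetric]) (simp add: k_def b_def)
   then have "int ((Q ^ k1)\<^sup>2 * Q) * int (Q ^ (k - (2 * k1 + 1))) = int (Q ^ k)" by (metis of_nat_mult)
   then show ?thesis by (simp only: mult.assoc)
  qed
  have e4: "2 * real (Q ^ (k - (2 * k1 + 1))) * real (Q ^ (2 * m - 2 * k)) / real (Q ^ (2 * m - b)) <= 2 * (1 / q)"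
  proof -
   have "2 * real (Q ^ (k - (2 * k1 + 1))) * real (Q ^ (2 * m - 2 * k)) / real (Q ^ (2 * m - b)) = 2 * (q ^ (k - (2 * k1 + 1) + b) / q ^ (2 * k))"
    unfolding T Tk using X0 q1 by (simp add: power_add q_def[symmetric])
   also have "... <= 2 * (1 / q)" by (intro mult_left_mono sq) (auto simp: k_def b_def)
   finally show ?thesis .
  qed
  have "32 <= q * z" by (rule ab[of 5 b]) (use zb in "auto simp: k_def")
  then have "2 * (1 / q) <= z / 16" using q1 by (simp add: field_simps)
  then have "z / 16 <= av (zp P) (%x. norm (av (zp (Q ^ (2 * m - 2 * k))) (%w. g2 (x + q2 * int (Q ^ k) * w))))"
   using b4 e4 unfolding step by linarith
  moreover have "\<eta> ^ k <= z / 16"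
  proof -
   have "\<eta> ^ k <= \<eta> ^ (b + 4)" by (rule power_decreasing) (use eta in "auto simp: k_def")
   also have "... <= z * (1 / 2) ^ 4" unfolding power_add using eta z1 by (intro mult_mono zb half_powers(2)) auto
   finally show ?thesis by (simp add: power_one_over)
  qed
  ultimately show "\<eta> ^ k <= av (zp P) (%x. norm (av (zp (Q ^ (2 * m - 2 * k))) (%w. f2 (x + q2 * int (Q ^ k) * w))))"
   unfolding g2_def norm_av_cnj by linarith
 qed
qed

section \<open>Conditional expectations on congruence classes inside blocks\<close>

lemma block_div: "0 <= y ==> y < B ==> (B * k + y) div B = (k::int)"
 by simp

lemma div_less_block: "0 < B ==> x < B * N ==> x div B < (N::int)"
proof (rule ccontr)
 assume *: "0 < B" "x < B * N" "\<not> x div B < N"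
 then have "B * N <= B * (x div B)" by (intro mult_left_mono) auto
 also have "... <= x" using mult_div_mod_eq[of B x] pos_mod_sign[OF *(1), of x] by linarith
 finally show False using * by simp
qed

lemma av_mixed_radix:
 assumes B: "B > 0"
 shows "av (zp (B * N)) F = av (zp N) (%k. av (zp B) (%y. F (int B * k + y)))"
proof -
 have "bij_betw (%p. int B * fst p + snd p) (zp N \<times> zp B) (zp (B * N))"
 proof (rule bij_betw_byWitness[where f' = "%x. (x div int B, x mod int B)"])
  show "(%p. int B * fst p + snd p) ` (zp N \<times> zp B) \<subseteq> zp (B * N)"
  proof
   fix x assume "x \<in> (%p. int B * fst p + snd p) ` (zp N \<times> zp B)"
   then obtain k y where x: "x = int B * k + y" "0 <= k" "k < int N" "0 <= y" "y < int B" by auto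
   have "int B * k + y < int B * (k + 1)" using x by (simp add: algebra_simps)
   also have "... <= int B * int N" using x by (intro mult_left_mono) auto
   finally show "x \<in> zp (B * N)" using x by simp
  qed
  show "(%x. (x div int B, x mod int B)) ` zp (B * N) \<subseteq> zp N \<times> zp B"
  proof
   fix p assume "p \<in> (%x. (x div int B, x mod int B)) ` zp (B * N)"
   then obtain x where x: "0 <= x" "x < int B * int N" "p = (x div int B, x mod int B)" by auto
   have "0 <= x div int B" using x B by (simp add: pos_imp_zdiv_nonneg_iff)
   moreover have "x div int B < int N" by (rule div_less_block) (use x(2) B in auto)
   ultimately show "p \<in> zp N \<times> zp B" using x B by simp
  qed
 qed (use B in auto)
 from av_reindex[OF this, of F] show ?thesis by (simp add: av_Times)
qed

text \<open>The least element of the cell of x, a cell being the R members of a class mod A inside a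
  block of length A R. Representing cells by a point makes measurability an equation.\<close>

definition base :: "nat => nat => int => int" where "base A R x = int (A * R) * (x div int (A * R)) + x mod int A"

definition cexp :: "nat => nat => (int => real) => int => real" where
 "cexp A R f x = av (zp R) (%w. f (base A R x + int A * w))"

definition meas :: "nat => nat => (int => real) => bool" where "meas A R h \<longleftrightarrow> (\<forall>x. h (base A R x) = h x)"

lemma base_grid:
 assumes "0 <= r" "r < int A" "0 <= w" "w < int R"
 shows "base A R (int (A * R) * k + r + int A * w) = int (A * R) * k + r"
proof -
 have "r + int A * w < int A * (w + 1)" using assms by (simp add: algebra_simps)
 also have "... <= int A * int R" using assms by (intro mult_left_mono) auto
 finally have lt: "r + int A * w < int (A * R)" by simp
 have pos: "0 <= r + int A * w" using assms by simp
 have "(int (A * R) * k + (r + int A * w)) div int (A * R) = k" by (rule block_div[OF pos lt])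
 moreover have "(int (A * R) * k + (r + int A * w)) mod int A = r"
 proof -
  have eq: "int (A * R) * k + (r + int A * w) = r + int A * (int R * k + w)" by (simp add: algebra_simps)
  show ?thesis unfolding eq using assms by simp
 qed
 ultimately show ?thesis unfolding base_def by (simp add: add.assoc)
qed

text \<open>Finer cells have a larger modulus and a shorter block: the block index survives because
  A' R' divides A R, the residue because A divides A'.\<close>

lemma base_nested:
 assumes A: "A > 0" "R > 0" "A' > 0" "R' > 0" and d: "A dvd A'" "A' * R' dvd A * R"
 shows "base A R (base A' R' x) = base A R x"
proof -
 obtain C where C: "A * R = A' * R' * C" using d(2) by (auto elim: dvdE)
 let ?B' = "int (A' * R')"
 have m: "0 <= x mod int A'" "x mod int A' < ?B'"
 proof -
  have "x mod int A' < int A'" using A by simp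
  also have "int A' * 1 <= int A' * int R'" using A by (intro mult_left_mono) auto
  finally show "x mod int A' < ?B'" by simp
 qed (use A in simp)
 have "base A' R' x div ?B' = x div ?B'" unfolding base_def by (rule block_div[OF m])
 then have 1: "base A' R' x div int (A * R) = x div int (A * R)"
  unfolding C of_nat_mult[of "A' * R'"] by (simp only: zdiv_zmult2_eq of_nat_0_le_iff)
 obtain c where c: "A' = A * c" using d(1) by (auto elim: dvdE)
 have "base A' R' x mod int A = x mod int A' mod int A"
  unfolding base_def c by (simp add: mult.assoc)
 also have "... = x mod int A" using d(1) by (intro mod_mod_cancel) simp
 finally have 2: "base A' R' x mod int A = x mod int A" .
 show ?thesis unfolding base_def[of A R] 1 2 ..
qed

lemma av_grid:
 assumes A: "A > 0" "R > 0"
 shows "av (zp (A * R * N)) F = av (zp N) (%k. av (zp A) (%r. av (zp R) (%w. F (int (A * R) * k + r + int A * w))))"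
proof -
 have "av (zp (A * R * N)) F = av (zp N) (%k. av (zp (A * R)) (%y. F (int (A * R) * k + y)))"
  by (rule av_mixed_radix) (use A in simp)
 also have "... = av (zp N) (%k. av (zp R) (%w. av (zp A) (%r. F (int (A * R) * k + (int A * w + r)))))"
  unfolding av_mixed_radix[OF A(1)] ..
 also have "... = av (zp N) (%k. av (zp A) (%r. av (zp R) (%w. F (int (A * R) * k + (int A * w + r)))))"
  by (rule av_cong1) (rule av_swap)
 finally show ?thesis by (simp only: add.assoc add.commute[of "int A * _"])
qed

lemma cexp_grid: "0 <= r ==> r < int A ==> 0 <= w ==> w < int R ==>
 cexp A R f (int (A * R) * k + r + int A * w) = av (zp R) (%w. f (int (A * R) * k + r + int A * w))"
 unfolding cexp_def base_grid ..

text \<open>The defining property of a conditional expectation. Divisibility of P by the block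
  length ensures that a period consists of whole cells.\<close>

lemma av_cexp_meas:
 assumes A: "A > 0" "R > 0" and P: "A * R dvd P" and h: "meas A R h"
 shows "av (zp P) (%x. cexp A R f x * h x) = av (zp P) (%x. f x * h x)"
proof -
 obtain N where N: "P = A * R * N" using P by (auto elim: dvdE)
 have rz: "finite (zp R)" "zp R ~= {}" using A by auto
 show ?thesis unfolding N av_grid[OF A]
 proof (rule av_cong1, rule av_cong1)
  fix k r assume r: "r \<in> zp A"
  have hh: "h (int (A * R) * k + r + int A * w) = h (int (A * R) * k + r)" if "w \<in> zp R" for w
   using h base_grid[of r A w R k] r that unfolding meas_def by (metis atLeastLessThan_iff)
  have "av (zp R) (%w. cexp A R f (int (A * R) * k + r + int A * w) * h (int (A * R) * k + r + int A * w)) =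
   av (zp R) (%w'. av (zp R) (%w. f (int (A * R) * k + r + int A * w)) * h (int (A * R) * k + r))"
  proof (rule av_cong1)
   fix w assume w: "w \<in> zp R"
   have c: "cexp A R f (int (A * R) * k + r + int A * w) = av (zp R) (%w. f (int (A * R) * k + r + int A * w))"
    by (rule cexp_grid) (use r w in auto)
   show "cexp A R f (int (A * R) * k + r + int A * w) * h (int (A * R) * k + r + int A * w) =
    av (zp R) (%w. f (int (A * R) * k + r + int A * w)) * h (int (A * R) * k + r)" unfolding c hh[OF w] ..
  qed
  also have "... = av (zp R) (%w. f (int (A * R) * k + r + int A * w) * h (int (A * R) * k + r))"
   unfolding av_const[OF rz] av_mult_right ..
  also have "... = av (zp R) (%w. f (int (A * R) * k + r + int A * w) * h (int (A * R) * k + r + int A * w))"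
   by (rule av_cong1) (use hh in auto)
  finally show "av (zp R) (%w. cexp A R f (int (A * R) * k + r + int A * w) * h (int (A * R) * k + r + int A * w)) =
   av (zp R) (%w. f (int (A * R) * k + r + int A * w) * h (int (A * R) * k + r + int A * w))" .
 qed
qed

lemma meas_cexp_nested:
 assumes "A > 0" "R > 0" "A' > 0" "R' > 0" "A dvd A'" "A' * R' dvd A * R"
 shows "meas A' R' (cexp A R f)"
 unfolding meas_def cexp_def base_nested[OF assms] by simp

lemma cexp_bounds: assumes "!!x. 0 <= f x" "!!x. f x <= 1" shows "0 <= cexp A R f x" "cexp A R f x <= 1"
 unfolding cexp_def by (auto intro!: av_nonneg av_le assms)

lemma per_cexp:
 assumes A: "A > 0" "R > 0" and P: "A * R dvd P" and f: "per P f"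
 shows "per P (cexp A R f)"
proof -
 obtain N where N: "P = A * R * N" using P by (auto elim: dvdE)
 have "base A R (x + int P) = base A R x + int P" for x
 proof -
  have "x + int P = x + int N * int (A * R)" unfolding N by simp
  then have "(x + int P) div int (A * R) = x div int (A * R) + int N" using A by simp
  moreover have "(x + int P) mod int A = x mod int A" unfolding N by (simp add: mult.assoc)
  ultimately show ?thesis unfolding base_def N by (simp add: algebra_simps)
 qed
 then have "f (base A R (x + int P) + int A * w) = f (base A R x + int A * w)" for x w
  using f[unfolded per_def, rule_format, of "base A R x + int A * w"] by (simp add: add_ac)
 then show ?thesis unfolding per_def cexp_def by simp
qed

text \<open>Pythagoras for nested partitions: the coarser expectation is measurable for the finer
  partition, so its pairings with f, with itself and with the finer expectation coincide.\<close>

lemma energy_difference: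
 assumes A: "A > 0" "R > 0" "A' > 0" "R' > 0" and d: "A dvd A'" "A' * R' dvd A * R" "A * R dvd P"
 shows "av (zp P) (%x. (cexp A' R' f x - cexp A R f x)\<^sup>2) = av (zp P) (%x. (cexp A' R' f x)\<^sup>2) - av (zp P) (%x. (cexp A R f x)\<^sup>2)"
proof -
 have d': "A' * R' dvd P" using d dvd_trans by blast
 have "av (zp P) (%x. cexp A' R' f x * cexp A R f x) = av (zp P) (%x. f x * cexp A R f x)"
  by (rule av_cexp_meas[OF A(3,4) d' meas_cexp_nested[OF A d(1,2)]])
 moreover have "av (zp P) (%x. cexp A R f x * cexp A R f x) = av (zp P) (%x. f x * cexp A R f x)"
  by (rule av_cexp_meas[OF A(1,2) d(3) meas_cexp_nested[OF A(1,2,1,2) dvd_refl dvd_refl]])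
 moreover have "(cexp A' R' f x - cexp A R f x)\<^sup>2 = (cexp A' R' f x)\<^sup>2 - 2 * (cexp A' R' f x * cexp A R f x) + cexp A R f x * cexp A R f x" for x
  by (simp add: power2_eq_square algebra_simps)
 ultimately show ?thesis by (simp only: av_add av_diff av_mult_left) (simp add: power2_eq_square)
qed

text \<open>After a shift by u < R steps, a progression of step A and length R n consists of n
  complete cells, on each of which f minus its cell average has mean 0.\<close>

lemma progression_cexp_small:
 fixes f :: "int => real"
 assumes A: "A > 0" "R > 0" and n: "n > 0" and f: "!!x. 0 <= f x" "!!x. f x <= 1"
 shows "norm (av (zp (R * n)) (%t. complex_of_real (f (x + int A * t) - cexp A R f (x + int A * t)))) <= 2 / real n"
proof -
 define g where "g x = f x - cexp A R f x" for x
 have g1: "norm (complex_of_real (g y)) <= 1" for y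
  unfolding g_def norm_of_real using f[of y] cexp_bounds[of f A R y, OF f] by linarith
 have rz: "finite (zp R)" "zp R ~= {}" using A by auto
 \<comment> \<open>The number of steps of length A that lead into the next block, or 0 if x lies in
   the first step of its own.\<close>
 define u where "u = (- (x div int A)) mod int R"
 have u: "0 <= u" "u < int R" unfolding u_def using A by auto
 have "int R dvd x div int A + u" unfolding u_def by (metis add.right_inverse dvd_eq_mod_eq_0 mod_add_right_eq mod_0)
 then obtain k where k: "x div int A + u = int R * k" by (auto elim: dvdE)
 define r where "r = x mod int A"
 have r: "0 <= r" "r < int A" unfolding r_def using A by auto
 have y: "x + int A * u = int (A * R) * k + r"
 proof -
  have "x + int A * u = int A * (x div int A + u) + r" unfolding r_def by (simp add: distrib_left)
  then show ?thesis unfolding k by simp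
 qed
 have "av (zp (R * n)) (%t. g (x + int A * u + int A * t)) = av (zp n) (%j. av (zp R) (%i. g (x + int A * u + int A * (int R * j + i))))"
  by (rule av_mixed_radix[OF A(2)])
 also have "... = av (zp n) (%j. 0)"
 proof (rule av_cong1)
  fix j
  have "x + int A * u + int A * (int R * j + i) = int (A * R) * (k + j) + r + int A * i" for i
   unfolding y by (simp add: algebra_simps)
  then have "av (zp R) (%i. g (x + int A * u + int A * (int R * j + i))) = av (zp R) (%i. f (int (A * R) * (k + j) + r + int A * i) - cexp A R f (int (A * R) * (k + j) + r + int A * i))"
   unfolding g_def by simp
  also have "... = av (zp R) (%i. f (int (A * R) * (k + j) + r + int A * i) - av (zp R) (%w. f (int (A * R) * (k + j) + r + int A * w)))"
  proof (rule av_cong1)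
   fix i assume i: "i \<in> zp R"
   have c: "cexp A R f (int (A * R) * (k + j) + r + int A * i) = av (zp R) (%w. f (int (A * R) * (k + j) + r + int A * w))"
    by (rule cexp_grid) (use r i in auto)
   show "f (int (A * R) * (k + j) + r + int A * i) - cexp A R f (int (A * R) * (k + j) + r + int A * i) =
    f (int (A * R) * (k + j) + r + int A * i) - av (zp R) (%w. f (int (A * R) * (k + j) + r + int A * w))" unfolding c ..
  qed
  also have "... = 0" unfolding av_diff av_const[OF rz] by simp
  finally show "av (zp R) (%i. g (x + int A * u + int A * (int R * j + i))) = 0" .
 qed
 finally have 0: "av (zp (R * n)) (%t. complex_of_real (g (x + int A * (t + u)))) = 0"
  unfolding of_real_av[symmetric] by (simp add: algebra_simps)
 have "shiftok (zp (R * n)) u (2 / real n)"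
 proof (rule shiftok_int')
  show "0 < R * n" using A n by simp
  have "real_of_int u <= real R" using u by linarith
  then have "2 * \<bar>real_of_int u\<bar> / real (R * n) <= 2 * real R / real (R * n)" using u by (intro divide_right_mono) auto
  also have "... = 2 / real n" using A by simp
  finally show "2 * \<bar>real_of_int u\<bar> / real (R * n) <= 2 / real n" .
 qed simp
 from shiftokD[OF this, of "%t. complex_of_real (g (x + int A * t))"] g1 0 show ?thesis by (simp add: g_def)
qed

text \<open>A shift by a multiple of A preserves the residue, so only points within v of the end of
  a block change cell.\<close>

lemma meas_shift_small:
 fixes h :: "int => real"
 assumes A: "A > 0" "R > 0" and N: "P = A * R * N" "N > 0" and h: "meas A R h" "!!x. 0 <= h x" "!!x. h x <= 1"
  and v: "v = int A * j" "0 <= v"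
 shows "av (zp P) (%x. \<bar>h (x + v) - h x\<bar>) <= real_of_int v / real (A * R)"
proof -
 let ?B = "A * R"
 have B: "?B > 0" using A by simp
 have "av (zp P) (%x. \<bar>h (x + v) - h x\<bar>) = av (zp N) (%k. av (zp ?B) (%y. \<bar>h (int ?B * k + y + v) - h (int ?B * k + y)\<bar>))"
  unfolding N(1) by (rule av_mixed_radix[OF B])
 also have "... <= av (zp N) (%k. av (zp ?B) (%y. of_bool (int ?B - v <= y)))"
 proof (rule av_mono, rule av_mono)
  fix k y assume y: "y \<in> zp ?B"
  show "\<bar>h (int ?B * k + y + v) - h (int ?B * k + y)\<bar> <= of_bool (int ?B - v <= y)"
  proof (cases "int ?B - v <= y")
   case True
   then show ?thesis using h(2,3)[of "int ?B * k + y + v"] h(2,3)[of "int ?B * k + y"] by simp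
  next
   case False
   have "(int ?B * k + (y + v)) div int ?B = k" "(int ?B * k + y) div int ?B = k"
   proof -
    have "0 <= y" "y < int ?B" using y by (simp_all del: of_nat_mult)
    moreover have "y + v < int ?B" using False by linarith
    ultimately show "(int ?B * k + (y + v)) div int ?B = k" "(int ?B * k + y) div int ?B = k" using v(2) by (auto intro!: block_div simp del: of_nat_mult)
   qed
   moreover have "(int ?B * k + y + v) mod int A = (int ?B * k + y) mod int A" unfolding v(1) by simp
   ultimately have "base A R (int ?B * k + y + v) = base A R (int ?B * k + y)" unfolding base_def by (simp add: add.assoc)
   then have "h (int ?B * k + y + v) = h (int ?B * k + y)" using h(1) unfolding meas_def by metis
   then show ?thesis by simp
  qed
 qed
 also have "... = av (zp ?B) (%y. of_bool (int ?B - v <= y))" using N by (simp add: av_const)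
 also have "... <= real_of_int v / real ?B"
 proof -
  have "card {y \<in> zp ?B. int ?B - v <= y} <= card {int ?B - v..<int ?B}" by (rule card_mono) auto
  also have "... = nat v" by simp
  finally have "real (card {y \<in> zp ?B. int ?B - v <= y}) <= real_of_int v" using v(2) by linarith
  then show ?thesis unfolding av_of_bool[OF finite_atLeastLessThan_int] by (simp add: divide_right_mono)
 qed
 finally show ?thesis .
qed

section \<open>The cube of the density as a lower bound\<close>

lemma cexp_pos:
 assumes A: "A > 0" "R > 0" and f: "!!x. 0 <= f x" and x: "0 < f x"
 shows "0 < cexp A R f x"
proof -
 let ?w = "x mod int (A * R) div int A"
 have B: "0 < int A * int R" using A by simp
 have w: "?w \<in> zp R"
 proof -
  have "x mod int (A * R) < int A * int R" using B by simp
  then have "?w < int R" by (intro div_less_block) (use A in auto)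
  moreover have "0 <= ?w" using A B by (simp add: pos_imp_zdiv_nonneg_iff)
  ultimately show ?thesis by simp
 qed
 have "base A R x + int A * ?w = x"
 proof -
  have "x mod int (A * R) = int A * ?w + x mod int (A * R) mod int A" by simp
  also have "x mod int (A * R) mod int A = x mod int A" by (rule mod_mod_cancel) simp
  finally have "int A * ?w + x mod int A = x mod int (A * R)" by simp
  then show ?thesis unfolding base_def using mult_div_mod_eq[of "int (A * R)" x] by linarith
 qed
 then have "0 < (\<Sum>w\<in>zp R. f (base A R x + int A * w))" using w x f by (intro sum_pos2[of _ ?w]) auto
 then show ?thesis unfolding cexp_def av_def using A by simp
qed

text \<open>The reciprocal is measurable, so f may be replaced by its conditional expectation; the
  quotient is then 1 or, where the expectation vanishes, 0 by the convention for
  \<open>inverse\<close>.\<close>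

lemma av_ratio_le_1:
 assumes A: "A > 0" "R > 0" and P: "A * R dvd P" and f: "!!x. 0 <= f x"
 shows "av (zp P) (%x. f x * inverse (cexp A R f x)) <= 1"
proof -
 have "meas A R (%x. inverse (cexp A R f x))"
  using meas_cexp_nested[OF A A dvd_refl dvd_refl, of f] unfolding meas_def by simp
 from av_cexp_meas[OF A P this, of f] have "av (zp P) (%x. f x * inverse (cexp A R f x)) = av (zp P) (%x. cexp A R f x * inverse (cexp A R f x))" by simp
 also have "... <= 1" by (intro av_le) (auto simp: field_simps divide_self_if)
 finally show ?thesis .
qed

text \<open>The arithmetic-geometric mean inequality for three terms with product \<delta>^3,
  reduced to one variable by passing to the geometric mean g of a and b.\<close>

lemma amgm_three:
 fixes a b \<delta> :: real
 assumes "0 < a" "0 < b" "0 < \<delta>"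
 shows "3 * \<delta> <= a * b / \<delta> + \<delta>\<^sup>2 * inverse a + \<delta>\<^sup>2 * inverse b"
proof -
 define g where "g = sqrt (a * b)"
 have g: "0 < g" "g\<^sup>2 = a * b" using assms by (auto simp: g_def)
 have "2 * g <= a + b" using arith_geo_mean_sqrt[of a b] assms by (simp add: g_def)
 then have "2 / g <= inverse a + inverse b"
 proof -
  assume h: "2 * g <= a + b"
  have "inverse a + inverse b = (a + b) / g\<^sup>2" unfolding g(2) using assms by (simp add: field_simps)
  moreover have "2 * g / g\<^sup>2 <= (a + b) / g\<^sup>2" by (rule divide_right_mono[OF h]) simp
  moreover have "2 * g / g\<^sup>2 = 2 / g" using g(1) by (simp add: power2_eq_square)
  ultimately show ?thesis by simp
 qed
 then have "\<delta>\<^sup>2 * (2 / g) <= \<delta>\<^sup>2 * (inverse a + inverse b)" by (rule mult_left_mono) simp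
 moreover have "3 * \<delta> <= g\<^sup>2 / \<delta> + \<delta>\<^sup>2 * (2 / g)"
 proof -
  \<comment> \<open>The factored form of the one-variable inequality after multiplication by
    \<delta> g.\<close>
  have "0 <= (g - \<delta>)\<^sup>2 * (g + 2 * \<delta>)" using g assms by simp
  also have "... = g ^ 3 - 3 * \<delta>\<^sup>2 * g + 2 * \<delta> ^ 3" by (simp add: power2_eq_square power3_eq_cube algebra_simps)
  finally have "0 <= (g ^ 3 - 3 * \<delta>\<^sup>2 * g + 2 * \<delta> ^ 3) / (\<delta> * g)" using g assms by simp
  also have "... = g\<^sup>2 / \<delta> + \<delta>\<^sup>2 * (2 / g) - 3 * \<delta>"
   using g(1) assms(3) by (simp add: field_simps power2_eq_square power3_eq_cube)
  finally show ?thesis by simp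
 qed
 ultimately show ?thesis by (simp add: g(2) distrib_left)
qed

text \<open>Averaging \<open>amgm_three\<close> at the two expectations with weight f: each
  reciprocal contributes at most \<delta>^2 by \<open>av_ratio_le_1\<close>, and 3 \<delta>^2 - 2
  \<delta>^2 remains. The argument treats the two partitions separately, so it works for moduli Q^i
  and Q^(2 i) alike.\<close>

lemma cexp_correlation:
 assumes A: "A1 > 0" "R1 > 0" "A2 > 0" "R2 > 0" and P: "A1 * R1 dvd P" "A2 * R2 dvd P" and f: "!!x. 0 <= f x"
 shows "(av (zp P) f) ^ 3 <= av (zp P) (%x. f x * cexp A1 R1 f x * cexp A2 R2 f x)"
proof (cases "av (zp P) f = 0")
 case True
 have "0 <= cexp A R f x" for A R x unfolding cexp_def by (intro av_nonneg f)
 then show ?thesis using True f by (auto intro!: av_nonneg mult_nonneg_nonneg)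
next
 case False
 define \<delta> where "\<delta> = av (zp P) f"
 have d: "0 < \<delta>" using False av_nonneg[of "zp P" f] f unfolding \<delta>_def by (simp add: less_le)
 define h1 where "h1 = cexp A1 R1 f"
 define h2 where "h2 = cexp A2 R2 f"
 have "av (zp P) (%x. f x * (3 * \<delta>)) <= av (zp P) (%x. f x * h1 x * h2 x / \<delta> + (\<delta>\<^sup>2 * (f x * inverse (h1 x)) + \<delta>\<^sup>2 * (f x * inverse (h2 x))))"
 proof (rule av_mono)
  fix x
  show "f x * (3 * \<delta>) <= f x * h1 x * h2 x / \<delta> + (\<delta>\<^sup>2 * (f x * inverse (h1 x)) + \<delta>\<^sup>2 * (f x * inverse (h2 x)))"
  proof (cases "f x = 0")
   case False
   then have fx: "0 < f x" using f[of x] by simp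
   have "0 < h1 x" "0 < h2 x" unfolding h1_def h2_def using A f fx by (auto intro: cexp_pos)
   from mult_left_mono[OF amgm_three[OF this d], of "f x"] fx show ?thesis by (simp add: algebra_simps)
  qed simp
 qed
 also have "... = av (zp P) (%x. f x * h1 x * h2 x) / \<delta> + (\<delta>\<^sup>2 * av (zp P) (%x. f x * inverse (h1 x)) + \<delta>\<^sup>2 * av (zp P) (%x. f x * inverse (h2 x)))"
  unfolding av_add av_divide av_mult_left ..
 also have "... <= av (zp P) (%x. f x * h1 x * h2 x) / \<delta> + (\<delta>\<^sup>2 * 1 + \<delta>\<^sup>2 * 1)"
  unfolding h1_def h2_def by (intro add_mono mult_left_mono order_refl av_ratio_le_1 A P f) auto
 finally have "\<delta> * (3 * \<delta>) <= av (zp P) (%x. f x * h1 x * h2 x) / \<delta> + 2 * \<delta>\<^sup>2" unfolding av_mult_right \<delta>_def by simp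
 then have "\<delta>\<^sup>2 <= av (zp P) (%x. f x * h1 x * h2 x) / \<delta>" by (simp add: power2_eq_square)
 then have "\<delta>\<^sup>2 * \<delta> <= av (zp P) (%x. f x * h1 x * h2 x)" using d by (simp add: pos_le_divide_eq)
 then show ?thesis unfolding \<delta>_def h1_def h2_def by (simp add: power2_eq_square power3_eq_cube)
qed

section \<open>A good scale by energy increment\<close>

definition tri :: "nat => nat => int => int => (int => real) => (int => real) => (int => real) => real" where
 "tri P M q1 q2 f0 f1 f2 = av (zp P) (%x. av (zp M) (%d. f0 x * f1 (x + q1 * d) * f2 (x + q2 * d\<^sup>2)))"

lemma Lam_of_real: "Lam P M q1 q2 (%x. complex_of_real (f0 x)) (%x. complex_of_real (f1 x)) (%x. complex_of_real (f2 x)) = complex_of_real (tri P M q1 q2 f0 f1 f2)"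
 unfolding Lam_def tri_def of_real_av by simp

lemma good_of_real: "per P f ==> (!!x. \<bar>f x\<bar> <= 1) ==> good P (%x. complex_of_real (f x))"
 by (simp add: good_def bdd_def per_def)

lemma tri_add2: "tri P M q1 q2 f0 (%x. g x + h x) f2 = tri P M q1 q2 f0 g f2 + tri P M q1 q2 f0 h f2"
 unfolding tri_def av_add[symmetric] by (simp add: distrib_left distrib_right)

lemma tri_add3: "tri P M q1 q2 f0 f1 (%x. g x + h x) = tri P M q1 q2 f0 f1 g + tri P M q1 q2 f0 f1 h"
 unfolding tri_def av_add[symmetric] by (simp add: distrib_left)

lemma abs_av_le: "\<bar>av S f\<bar> <= av S (%x. \<bar>f x\<bar>)" for f :: "'a => real"
 using norm_av_le[of S f] by simp

lemma abs_mult3_le: "\<bar>a\<bar> <= 1 ==> \<bar>b\<bar> <= 1 ==> \<bar>a * b * (c::real)\<bar> <= \<bar>c\<bar>"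
proof -
 assume "\<bar>a\<bar> <= 1" "\<bar>b\<bar> <= 1"
 then have "\<bar>a\<bar> * \<bar>b\<bar> * \<bar>c\<bar> <= 1 * 1 * \<bar>c\<bar>" by (intro mult_mono) auto
 then show ?thesis by (simp add: abs_mult)
qed

lemma tri_bound:
 assumes P: "P > 0" and M: "M > 0" and b: "!!x. \<bar>f x\<bar> <= 1" "!!x. \<bar>g x\<bar> <= 1" and h: "per P h"
 shows "\<bar>tri P M q1 q2 f g h\<bar> <= av (zp P) (%x. \<bar>h x\<bar>)" "\<bar>tri P M q1 q2 f h g\<bar> <= av (zp P) (%x. \<bar>h x\<bar>)"
proof -
 have hp: "per P (%x. \<bar>h x\<bar>)" using h by (simp add: per_def)
 have sh: "av (zp P) (%x. \<bar>h (x + a)\<bar>) = av (zp P) (%x. \<bar>h x\<bar>)" for a by (rule av_shift[OF P hp])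
 have mz: "finite (zp M)" "zp M ~= {}" using M by auto
 have "\<bar>tri P M q1 q2 f g h\<bar> <= av (zp P) (%x. av (zp M) (%d. \<bar>f x * g (x + q1 * d) * h (x + q2 * d\<^sup>2)\<bar>))"
  unfolding tri_def by (rule order_trans[OF abs_av_le], rule av_mono, rule abs_av_le)
 also have "... <= av (zp P) (%x. av (zp M) (%d. \<bar>h (x + q2 * d\<^sup>2)\<bar>))"
  by (intro av_mono abs_mult3_le b)
 also have "... = av (zp P) (%x. \<bar>h x\<bar>)" unfolding av_swap[of "zp P" "zp M"] sh av_const[OF mz] ..
 finally show "\<bar>tri P M q1 q2 f g h\<bar> <= av (zp P) (%x. \<bar>h x\<bar>)" .
 have "\<bar>tri P M q1 q2 f h g\<bar> <= av (zp P) (%x. av (zp M) (%d. \<bar>f x * g (x + q2 * d\<^sup>2) * h (x + q1 * d)\<bar>))"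
  unfolding tri_def by (rule order_trans[OF abs_av_le], rule av_mono, rule order_trans[OF abs_av_le]) (simp add: mult_ac)
 also have "... <= av (zp P) (%x. av (zp M) (%d. \<bar>h (x + q1 * d)\<bar>))"
  by (intro av_mono abs_mult3_le b)
 also have "... = av (zp P) (%x. \<bar>h x\<bar>)" unfolding av_swap[of "zp P" "zp M"] sh av_const[OF mz] ..
 finally show "\<bar>tri P M q1 q2 f h g\<bar> <= av (zp P) (%x. \<bar>h x\<bar>)" .
qed

text \<open>f1 and f2 are expectations on cells so fine that the inverse theorems cannot tell them
  from f; c1 and c2 live on blocks longer than the relevant shifts by a factor Q, so shifting them
  is harmless. Where fine and coarse expectations nearly agree, the count becomes the mean of f c1
  c2. Each of four replacements costs \<eta>, and the two shifts cost 2 / Q \<le> \<eta>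
  together.\<close>

lemma scale_correlation:
 assumes k1: "\<forall>P q1 q2 f0 f1 f2 Q m \<eta>. 0 < P --> good P f0 --> good P f1 --> good P f2 --> 0 < \<eta> --> \<eta> <= 1/2 --> adm k1 Q \<eta> --> 2 * k1 <= m -->
   \<eta> <= norm (Lam P (Q ^ m) q1 q2 f0 f1 f2) -->
   \<eta> ^ k1 <= av (zp P) (%x. norm (av (zp (Q ^ (m - 2 * k1))) (%w. f1 (x + q1 * int (Q ^ k1) * w))))"
  and k2: "\<forall>P q1 q2 f0 f1 f2 Q m \<eta>. 0 < P --> good P f0 --> good P f1 --> good P f2 --> 0 < \<eta> --> \<eta> <= 1/2 --> adm k2 Q \<eta> --> 2 * k2 <= m -->
   \<eta> <= norm (Lam P (Q ^ m) q1 q2 f0 f1 f2) -->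
   \<eta> ^ k2 <= av (zp P) (%x. norm (av (zp (Q ^ (2 * m - 2 * k2))) (%w. f2 (x + q2 * int (Q ^ k2) * w))))"
  and P: "P > 0" "Q ^ (2 * i + (2 * m + 1)) dvd P" and f: "per P f" "!!x. 0 <= f x" "!!x. f x <= 1" and eta: "0 < \<eta>" "\<eta> <= 1/2"
  and adm: "adm (k1 + k2 + 5) Q \<eta>" and m: "2 * k1 + 2 * k2 + 2 <= m"
  and small1: "av (zp P) (%x. \<bar>cexp (Q ^ (i + k1)) (Q ^ (m - 2 * k1 - 1)) f x - cexp (Q ^ i) (Q ^ (m + 1)) f x\<bar>) <= \<eta>"
  and small2: "av (zp P) (%x. \<bar>cexp (Q ^ (2 * i + k2)) (Q ^ (2 * m - 2 * k2 - 1)) f x - cexp (Q ^ (2 * i)) (Q ^ (2 * m + 1)) f x\<bar>) <= \<eta>"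
 shows "(av (zp P) f) ^ 3 - 5 * \<eta> <= tri P (Q ^ m) (int (Q ^ i)) (int (Q ^ (2 * i))) f f f"
proof -
 have Q0: "Q > 0" using adm by (simp add: adm_def)
 define q where "q = real Q"
 have q1: "1 <= q" "0 < q" using Q0 by (auto simp: q_def)
 have M0: "Q ^ m > 0" using Q0 by simp
 note ab = adm_absorb(1)[OF adm eta, folded q_def]
 have dv: "Q ^ a * Q ^ b dvd P" if "a + b <= 2 * i + (2 * m + 1)" for a b
  unfolding power_add[symmetric] using P(2) le_imp_power_dvd[OF that, of Q] dvd_trans by blast
 define f1 where "f1 = cexp (Q ^ (i + k1)) (Q ^ (m - 2 * k1 - 1)) f"
 define c1 where "c1 = cexp (Q ^ i) (Q ^ (m + 1)) f"
 define f2 where "f2 = cexp (Q ^ (2 * i + k2)) (Q ^ (2 * m - 2 * k2 - 1)) f"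
 define c2 where "c2 = cexp (Q ^ (2 * i)) (Q ^ (2 * m + 1)) f"
 have d1: "Q ^ i * Q ^ (m + 1) dvd P" and d2: "Q ^ (2 * i) * Q ^ (2 * m + 1) dvd P" by (rule dv, simp)+
 have pers: "per P f1" "per P c1" "per P f2" "per P c2"
  unfolding f1_def c1_def f2_def c2_def by (rule per_cexp[OF _ _ dv f(1)]; use Q0 m in simp)+
 have b01: "0 <= f1 x" "f1 x <= 1" "0 <= c1 x" "c1 x <= 1" "0 <= f2 x" "f2 x <= 1" "0 <= c2 x" "c2 x <= 1" for x
  unfolding f1_def c1_def f2_def c2_def using f by (auto intro: cexp_bounds)
 let ?T = "tri P (Q ^ m) (int (Q ^ i)) (int (Q ^ (2 * i)))"
 have af: "\<bar>f x\<bar> <= 1" for x using f(2,3)[of x] by simp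
 have fc: "\<bar>f x * c2 x\<bar> <= 1" for x using f(2,3)[of x] b01(7,8)[of x] by (simp add: mult_le_one)
 have gf: "good P (%x. complex_of_real (f x))" by (rule good_of_real[OF f(1) af])
 have gfc: "good P (%x. complex_of_real (f x * c2 x))" by (rule good_of_real[OF _ fc]) (use f(1) pers(4) in "auto intro: per_times")
 have g1: "good P (%x. complex_of_real (1::real))" by (rule good_of_real) (auto simp: per_def)
 have gd: "good P (%x. complex_of_real (f x - h x))" if "per P h" "!!x. 0 <= h x" "!!x. h x <= 1" for h
 proof (rule good_of_real)
  show "per P (%x. f x - h x)" using f(1) that(1) by (simp add: per_def)
  show "\<bar>f x - h x\<bar> <= 1" for x using f(2,3)[of x] that(2,3)[of x] by linarith
 qed
 have a1: "adm k1 Q \<eta>" and a2: "adm k2 Q \<eta>" by (rule adm_le[OF adm _ eta], simp)+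
 \<comment> \<open>The third factor is dealt with before the second: by then c2 has been moved to x,
   so it sits in the first slot and leaves 1 in the third.\<close>
 have A1: "\<bar>?T (%x. f x * c2 x) (%x. f x - f1 x) (%x. 1)\<bar> <= \<eta>"
 proof (rule ccontr)
  assume "\<not> ?thesis"
  then have "\<eta> <= norm (Lam P (Q ^ m) (int (Q ^ i)) (int (Q ^ (2 * i))) (%x. complex_of_real (f x * c2 x)) (%x. complex_of_real (f x - f1 x)) (%x. complex_of_real 1))"
   unfolding Lam_of_real by simp
  from k1[rule_format, OF P(1) gfc gd[OF pers(1) b01(1,2)] g1 eta a1 _ this] m
  have "\<eta> ^ k1 <= av (zp P) (%x. norm (av (zp (Q ^ (m - 2 * k1))) (%w. complex_of_real (f (x + int (Q ^ i) * int (Q ^ k1) * w) - f1 (x + int (Q ^ i) * int (Q ^ k1) * w)))))" by simp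
  also have "... <= 2 / real Q"
  proof (rule av_le)
   fix x
   have T: "Q ^ (m - 2 * k1) = Q ^ (m - 2 * k1 - 1) * Q"
   proof -
    have "m - 2 * k1 = Suc (m - 2 * k1 - 1)" using m by simp
    then show ?thesis by (metis power_Suc2)
   qed
   have s: "int (Q ^ i) * int (Q ^ k1) = int (Q ^ (i + k1))" by (simp add: power_add)
   show "norm (av (zp (Q ^ (m - 2 * k1))) (%w. complex_of_real (f (x + int (Q ^ i) * int (Q ^ k1) * w) - f1 (x + int (Q ^ i) * int (Q ^ k1) * w)))) <= 2 / real Q"
    unfolding T s f1_def by (rule progression_cexp_small) (use Q0 f in auto)
  qed simp
  finally have "\<eta> ^ k1 <= 2 / q" unfolding q_def .
  moreover have "4 <= q * \<eta> ^ k1" by (rule ab[of 2 k1]) auto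
  ultimately show False using q1 by (simp add: field_simps)
 qed
 have A2: "\<bar>?T f f (%x. f x - f2 x)\<bar> <= \<eta>"
 proof (rule ccontr)
  assume "\<not> ?thesis"
  then have "\<eta> <= norm (Lam P (Q ^ m) (int (Q ^ i)) (int (Q ^ (2 * i))) (%x. complex_of_real (f x)) (%x. complex_of_real (f x)) (%x. complex_of_real (f x - f2 x)))"
   unfolding Lam_of_real by simp
  from k2[rule_format, OF P(1) gf gf gd[OF pers(3) b01(5,6)] eta a2 _ this] m
  have "\<eta> ^ k2 <= av (zp P) (%x. norm (av (zp (Q ^ (2 * m - 2 * k2))) (%w. complex_of_real (f (x + int (Q ^ (2 * i)) * int (Q ^ k2) * w) - f2 (x + int (Q ^ (2 * i)) * int (Q ^ k2) * w)))))" by simp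
  also have "... <= 2 / real Q"
  proof (rule av_le)
   fix x
   have T: "Q ^ (2 * m - 2 * k2) = Q ^ (2 * m - 2 * k2 - 1) * Q"
   proof -
    have "2 * m - 2 * k2 = Suc (2 * m - 2 * k2 - 1)" using m by simp
    then show ?thesis by (metis power_Suc2)
   qed
   have s: "int (Q ^ (2 * i)) * int (Q ^ k2) = int (Q ^ (2 * i + k2))" by (simp add: power_add)
   show "norm (av (zp (Q ^ (2 * m - 2 * k2))) (%w. complex_of_real (f (x + int (Q ^ (2 * i)) * int (Q ^ k2) * w) - f2 (x + int (Q ^ (2 * i)) * int (Q ^ k2) * w)))) <= 2 / real Q"
    unfolding T s f2_def by (rule progression_cexp_small) (use Q0 f in auto)
  qed simp
  finally have "\<eta> ^ k2 <= 2 / q" unfolding q_def .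
  moreover have "4 <= q * \<eta> ^ k2" by (rule ab[of 2 k2]) auto
  ultimately show False using q1 by (simp add: field_simps)
 qed
 have one: "\<bar>1::real\<bar> <= 1" by simp
 have B2: "\<bar>?T f f (%x. f2 x - c2 x)\<bar> <= \<eta>"
  by (rule order_trans[OF tri_bound(1)[OF P(1) M0 af af]]) (use pers small2 in "auto simp: per_def f2_def c2_def")
 have B1: "\<bar>?T (%x. f x * c2 x) (%x. f1 x - c1 x) (%x. 1)\<bar> <= \<eta>"
  by (rule order_trans[OF tri_bound(2)[OF P(1) M0 fc one]]) (use pers small1 in "auto simp: per_def f1_def c1_def")
 have mz: "finite (zp (Q ^ m))" "zp (Q ^ m) ~= {}" using M0 by auto
 have sh: "av (zp P) (%x. \<bar>h (x + int A * j) - h x\<bar>) <= 1 / q"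
  if h: "h = cexp A R f" "A > 0" "R > 0" "A * R dvd P" and j: "0 <= j" "real_of_int j * q <= real R" for h A R j
 proof -
  obtain N where N: "P = A * R * N" using h(4) by (auto elim: dvdE)
  have "av (zp P) (%x. \<bar>h (x + int A * j) - h x\<bar>) <= real_of_int (int A * j) / real (A * R)"
   unfolding h(1) by (rule meas_shift_small[OF h(2,3) N]) (use P N h j f in "auto intro: meas_cexp_nested cexp_bounds")
  also have "... = real_of_int j / real R" using h(2) by simp
  also have "... <= 1 / q" using j(2) h(3) q1 by (simp add: field_simps)
  finally show ?thesis .
 qed
 have C2: "?T (%x. f x * c2 x) f (%x. 1) - 1 / q <= ?T f f c2"
 proof -
  have "?T (%x. f x * c2 x) f (%x. 1) - ?T f f c2 = av (zp P) (%x. av (zp (Q ^ m)) (%d. f x * f (x + int (Q ^ i) * d) * (c2 x - c2 (x + int (Q ^ (2 * i)) * d\<^sup>2))))"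
   unfolding tri_def av_diff[symmetric] by (simp add: algebra_simps)
  also have "... <= av (zp P) (%x. av (zp (Q ^ m)) (%d. \<bar>c2 (x + int (Q ^ (2 * i)) * d\<^sup>2) - c2 x\<bar>))"
   by (intro av_mono order_trans[OF abs_ge_self order_trans[OF abs_mult3_le[OF af af]]]) (simp add: abs_minus_commute)
  also have "... = av (zp (Q ^ m)) (%d. av (zp P) (%x. \<bar>c2 (x + int (Q ^ (2 * i)) * d\<^sup>2) - c2 x\<bar>))" by (rule av_swap)
  also have "... <= 1 / q"
  proof (rule av_le)
   fix d assume d: "d \<in> zp (Q ^ m)"
   have "d\<^sup>2 <= (int (Q ^ m))\<^sup>2" using d by (intro power_mono) auto
   then have "real_of_int (d\<^sup>2) <= real_of_int ((int (Q ^ m))\<^sup>2)" by (simp only: of_int_le_iff)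
   then have "real_of_int (d\<^sup>2) * q <= real_of_int ((int (Q ^ m))\<^sup>2) * q" using q1 by (intro mult_right_mono) auto
   also have "... = real (Q ^ (2 * m + 1))" by (simp add: q_def power_mult[symmetric] mult.commute)
   finally have "real_of_int (d\<^sup>2) * q <= real (Q ^ (2 * m + 1))" .
   then show "av (zp P) (%x. \<bar>c2 (x + int (Q ^ (2 * i)) * d\<^sup>2) - c2 x\<bar>) <= 1 / q"
    by (intro sh[OF c2_def _ _ d2]) (use Q0 in auto)
  qed (use q1 in simp)
  finally show ?thesis by simp
 qed
 have C1: "av (zp P) (%x. f x * c1 x * c2 x) - 1 / q <= ?T (%x. f x * c2 x) c1 (%x. 1)"
 proof -
  have "av (zp P) (%x. f x * c1 x * c2 x) = av (zp P) (%x. av (zp (Q ^ m)) (%d. f x * c1 x * c2 x))" unfolding av_const[OF mz] ..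
  then have "av (zp P) (%x. f x * c1 x * c2 x) - ?T (%x. f x * c2 x) c1 (%x. 1) = av (zp P) (%x. av (zp (Q ^ m)) (%d. (f x * c2 x) * 1 * (c1 x - c1 (x + int (Q ^ i) * d))))"
   unfolding tri_def by (simp only: av_diff[symmetric]) (simp add: algebra_simps)
  also have "... <= av (zp P) (%x. av (zp (Q ^ m)) (%d. \<bar>c1 (x + int (Q ^ i) * d) - c1 x\<bar>))"
   by (intro av_mono order_trans[OF abs_ge_self order_trans[OF abs_mult3_le[OF fc one]]]) (simp add: abs_minus_commute)
  also have "... = av (zp (Q ^ m)) (%d. av (zp P) (%x. \<bar>c1 (x + int (Q ^ i) * d) - c1 x\<bar>))" by (rule av_swap)
  also have "... <= 1 / q"
  proof (rule av_le)
   fix d assume d: "d \<in> zp (Q ^ m)"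
   have "real_of_int d <= real (Q ^ m)" using d by (metis atLeastLessThan_iff less_imp_le of_int_le_iff of_int_of_nat_eq)
   then have "real_of_int d * q <= real (Q ^ m) * q" using q1 by (intro mult_right_mono) auto
   also have "... = real (Q ^ (m + 1))" by (simp add: q_def)
   finally have "real_of_int d * q <= real (Q ^ (m + 1))" .
   then show "av (zp P) (%x. \<bar>c1 (x + int (Q ^ i) * d) - c1 x\<bar>) <= 1 / q"
    by (intro sh[OF c1_def _ _ d1]) (use Q0 d in auto)
  qed (use q1 in simp)
  finally show ?thesis by simp
 qed
 have "(av (zp P) f) ^ 3 <= av (zp P) (%x. f x * c1 x * c2 x)"
  unfolding c1_def c2_def by (rule cexp_correlation) (use Q0 d1 d2 f in auto)
 moreover have "?T f f f = ?T f f (%x. f x - f2 x) + ?T f f (%x. f2 x - c2 x) + ?T f f c2"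
  unfolding tri_add3[symmetric] by simp
 moreover have "?T (%x. f x * c2 x) f (%x. 1) = ?T (%x. f x * c2 x) (%x. f x - f1 x) (%x. 1) + ?T (%x. f x * c2 x) (%x. f1 x - c1 x) (%x. 1) + ?T (%x. f x * c2 x) c1 (%x. 1)"
  unfolding tri_add2[symmetric] by simp
 moreover have "2 * (1 / q) <= \<eta>"
 proof -
  have "2 <= q * \<eta>" by (rule ab[of 1 1]) auto
  then show ?thesis using q1 by (simp add: field_simps)
 qed
 ultimately show ?thesis using A1 A2 B1 B2 C1 C2 unfolding abs_le_iff by linarith
qed

text \<open>A telescoping sum in which the nonnegative gaps from \<open>fn s\<close> to
  \<open>en (Suc s)\<close> are dropped.\<close>

lemma energy_increment:
 fixes en fn :: "nat => real"
 assumes "!!s. s < n ==> fn s <= en (Suc s)" "0 <= en 0"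
 shows "(\<Sum>s<n. fn s - en s) <= en n"
 using assms
proof (induction n)
 case (Suc n)
 then have "(\<Sum>s<n. fn s - en s) <= en n" by simp
 then show ?case using Suc.prems(1)[of n] by simp
qed simp

lemma av_abs_le_of_square: "av S (%x. (h x)\<^sup>2) <= \<eta>\<^sup>2 ==> 0 <= \<eta> ==> av S (%x. \<bar>h x\<bar>) <= (\<eta>::real)"
proof -
 assume *: "av S (%x. (h x)\<^sup>2) <= \<eta>\<^sup>2" "0 <= \<eta>"
 have "(av S (%x. \<bar>h x\<bar>))\<^sup>2 <= av S (%x. \<bar>h x\<bar>\<^sup>2)" by (rule av_square_le)
 also have "... = av S (%x. (h x)\<^sup>2)" by simp
 also have "... <= \<eta>\<^sup>2" by (rule *)
 finally show ?thesis using *(2) by (rule power2_le_imp_le)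
qed

lemma fine_bounds:
 fixes i m E k1 k2 :: nat
 assumes "i + m <= E" "2 * (k1 + k2) + 2 <= m"
 shows "i + k1 + (m - 2 * k1 - 1) <= 2 * E + 1" "2 * i + k2 + (2 * m - 2 * k2 - 1) <= 2 * E + 1"
 using assms by auto

text \<open>From each scale to the next i grows by K and m shrinks by 2 K + 2, so the coarse
  partition at scale s + 1 refines the fine partition at scale s, for both factors. The two energies
  hence increase and stay below 1; among S \<ge> 2 / \<eta>^2 scales one has a total increment of at
  most \<eta>^2, which is an L1 distance of at most \<eta>.\<close>

lemma popular_scale:
 "\<exists>k. \<forall>\<eta> Q S P f. 0 < \<eta> --> \<eta> <= 1/2 --> adm k Q \<eta> --> 2 / \<eta>\<^sup>2 <= real S --> 0 < P --> Q ^ (2 * (k * (S + 1)) + 1) dvd P --> per P f -->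
   (\<forall>x. 0 <= f x \<and> f x <= 1) -->
   (\<exists>i m. 0 < m \<and> i + m <= k * (S + 1) \<and> (av (zp P) f) ^ 3 - 5 * \<eta> <= tri P (Q ^ m) (int (Q ^ i)) (int (Q ^ (2 * i))) f f f)"
proof -
 obtain k1 where "0 < k1" and k1: "\<forall>P q1 q2 f0 f1 f2 Q m \<eta>. 0 < P --> good P f0 --> good P f1 --> good P f2 --> 0 < \<eta> --> \<eta> <= 1/2 --> adm k1 Q \<eta> --> 2 * k1 <= m -->
   \<eta> <= norm (Lam P (Q ^ m) q1 q2 f0 f1 f2) -->
   \<eta> ^ k1 <= av (zp P) (%x. norm (av (zp (Q ^ (m - 2 * k1))) (%w. f1 (x + q1 * int (Q ^ k1) * w))))"
  using linear_factor_inverse by (elim exE conjE) (rule that)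
 obtain k2 where "0 < k2" and k2: "\<forall>P q1 q2 f0 f1 f2 Q m \<eta>. 0 < P --> good P f0 --> good P f1 --> good P f2 --> 0 < \<eta> --> \<eta> <= 1/2 --> adm k2 Q \<eta> --> 2 * k2 <= m -->
   \<eta> <= norm (Lam P (Q ^ m) q1 q2 f0 f1 f2) -->
   \<eta> ^ k2 <= av (zp P) (%x. norm (av (zp (Q ^ (2 * m - 2 * k2))) (%w. f2 (x + q2 * int (Q ^ k2) * w))))"
  using quadratic_factor_inverse by (elim exE conjE) (rule that)
 define K where "K = k1 + k2"
 define k where "k = 2 * K + 5"
 show ?thesis
 proof (rule exI[of _ k], intro allI impI)
  fix \<eta> :: real and Q S P :: nat and f :: "int => real"
  assume *: "0 < \<eta>" "\<eta> <= 1/2" "adm k Q \<eta>" "2 / \<eta>\<^sup>2 <= real S" "0 < P" "Q ^ (2 * (k * (S + 1)) + 1) dvd P" "per P f" "\<forall>x. 0 <= f x \<and> f x <= 1"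
  have f01: "0 <= f x" "f x <= 1" for x using *(8) by auto
  have Q0: "Q > 0" using *(3) by (simp add: adm_def)
  have S0: "0 < S" using *(1,4) by (cases "S = 0") (auto simp: divide_le_0_iff)
  define mm where "mm s = (2 * K + 2) * (S + 1 - s)" for s
  define ii where "ii s = K * s" for s
  have mS: "mm s = mm (Suc s) + (2 * K + 2)" if "s < S" for s
  proof -
   have "S + 1 - s = Suc (S + 1 - Suc s)" using that by simp
   then show ?thesis unfolding mm_def by simp
  qed
  have iS: "ii (Suc s) = ii s + K" for s by (simp add: ii_def)
  have mK: "2 * K + 2 <= mm s" if "s <= S" for s
  proof -
   have "1 <= S + 1 - s" using that by simp
   from mult_le_mono2[OF this, of "2 * K + 2"] show ?thesis unfolding mm_def by (simp only: mult_1_right)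
  qed
  have le: "ii s + mm s <= (2 * K + 2) * (S + 1)" if "s <= S" for s
  proof -
   have "ii s + mm s <= (2 * K + 2) * s + (2 * K + 2) * (S + 1 - s)" unfolding ii_def mm_def by (intro add_right_mono mult_right_mono) auto
   also have "... = (2 * K + 2) * (S + 1)" unfolding distrib_left[symmetric] using that by simp
   finally show ?thesis .
  qed
  have le': "ii s + mm s <= k * (S + 1)" if "s <= S" for s
  proof -
   have "(2 * K + 2) * (S + 1) <= k * (S + 1)" by (rule mult_right_mono) (auto simp: k_def)
   then show ?thesis using le[OF that] by linarith
  qed
  define en where "en a r = av (zp P) (%x. (cexp (Q ^ a) (Q ^ r) f x)\<^sup>2)" for a r
  have en01: "0 <= en a r" "en a r <= 1" for a r
   unfolding en_def by (auto intro!: av_nonneg av_le power_le_one cexp_bounds f01)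
  have dv: "Q ^ e dvd P" if "e <= 2 * (k * (S + 1)) + 1" for e
   using *(6) le_imp_power_dvd[OF that, of Q] dvd_trans by blast
  have en_diff: "av (zp P) (%x. (cexp (Q ^ a') (Q ^ r') f x - cexp (Q ^ a) (Q ^ r) f x)\<^sup>2) = en a' r' - en a r"
   if "a <= a'" "a' + r' <= a + r" "a + r <= 2 * (k * (S + 1)) + 1" for a r a' r'
   unfolding en_def by (rule energy_difference) (use that Q0 in "auto simp: power_add[symmetric] le_imp_power_dvd dv")
  have en_mono: "en a r <= en a' r'" if "a <= a'" "a' + r' <= a + r" "a + r <= 2 * (k * (S + 1)) + 1" for a r a' r'
   using en_diff[OF that] av_nonneg[of "zp P" "%x. (cexp (Q ^ a') (Q ^ r') f x - cexp (Q ^ a) (Q ^ r) f x)\<^sup>2"] by simp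
  define c1 where "c1 s = en (ii s) (mm s + 1)" for s
  define g1 where "g1 s = en (ii s + k1) (mm s - 2 * k1 - 1)" for s
  define c2 where "c2 s = en (2 * ii s) (2 * mm s + 1)" for s
  define g2 where "g2 s = en (2 * ii s + k2) (2 * mm s - 2 * k2 - 1)" for s
  have "(\<Sum>s<S. g1 s - c1 s) <= c1 S"
  proof (rule energy_increment)
   fix s assume s: "s < S"
   show "g1 s <= c1 (Suc s)" unfolding g1_def c1_def
   proof (rule en_mono)
    show "ii s + k1 <= ii (Suc s)" by (simp add: iS K_def)
    show "ii (Suc s) + (mm (Suc s) + 1) <= ii s + k1 + (mm s - 2 * k1 - 1)" unfolding iS mS[OF s] K_def by simp
    show "ii s + k1 + (mm s - 2 * k1 - 1) <= 2 * (k * (S + 1)) + 1"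
     by (rule fine_bounds(1)[OF le'[OF less_imp_le[OF s]] mK[OF less_imp_le[OF s], unfolded K_def]])
   qed
  qed (simp add: c1_def en01)
  moreover have "(\<Sum>s<S. g2 s - c2 s) <= c2 S"
  proof (rule energy_increment)
   fix s assume s: "s < S"
   show "g2 s <= c2 (Suc s)" unfolding g2_def c2_def
   proof (rule en_mono)
    show "2 * ii s + k2 <= 2 * ii (Suc s)" by (simp add: iS K_def)
    show "2 * ii (Suc s) + (2 * mm (Suc s) + 1) <= 2 * ii s + k2 + (2 * mm s - 2 * k2 - 1)" unfolding iS mS[OF s] K_def by simp
    show "2 * ii s + k2 + (2 * mm s - 2 * k2 - 1) <= 2 * (k * (S + 1)) + 1"
     by (rule fine_bounds(2)[OF le'[OF less_imp_le[OF s]] mK[OF less_imp_le[OF s], unfolded K_def]])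
   qed
  qed (simp add: c2_def en01)
  moreover have "c1 S <= 1" "c2 S <= 1" by (simp_all add: c1_def c2_def en01)
  ultimately have tot: "(\<Sum>s<S. (g1 s - c1 s) + (g2 s - c2 s)) <= 2" unfolding sum.distrib by linarith
  have "\<exists>s<S. (g1 s - c1 s) + (g2 s - c2 s) <= 2 / real S"
  proof (rule ccontr)
   assume "\<not> ?thesis"
   then have "(\<Sum>s<S. 2 / real S) < (\<Sum>s<S. (g1 s - c1 s) + (g2 s - c2 s))"
    by (intro sum_strict_mono) (use S0 in "auto simp: not_le")
   then show False using tot S0 by simp
  qed
  then obtain s where s: "s < S" "(g1 s - c1 s) + (g2 s - c2 s) <= 2 / real S" by blast
  have "2 / real S <= \<eta>\<^sup>2" using *(1,4) S0 by (simp add: field_simps)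
  then have s2: "(g1 s - c1 s) + (g2 s - c2 s) <= \<eta>\<^sup>2" using s(2) by linarith
  have ls: "s <= S" using s by simp
  have q1: "av (zp P) (%x. (cexp (Q ^ (ii s + k1)) (Q ^ (mm s - 2 * k1 - 1)) f x - cexp (Q ^ ii s) (Q ^ (mm s + 1)) f x)\<^sup>2) = g1 s - c1 s"
   unfolding g1_def c1_def by (rule en_diff) (use le'[OF ls] mK[OF ls] in "auto simp: K_def")
  have q2: "av (zp P) (%x. (cexp (Q ^ (2 * ii s + k2)) (Q ^ (2 * mm s - 2 * k2 - 1)) f x - cexp (Q ^ (2 * ii s)) (Q ^ (2 * mm s + 1)) f x)\<^sup>2) = g2 s - c2 s"
   unfolding g2_def c2_def by (rule en_diff) (use le'[OF ls] mK[OF ls] in "auto simp: K_def")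
  have p1: "0 <= g1 s - c1 s" unfolding q1[symmetric] by (intro av_nonneg) simp
  have p2: "0 <= g2 s - c2 s" unfolding q2[symmetric] by (intro av_nonneg) simp
  have "(av (zp P) f) ^ 3 - 5 * \<eta> <= tri P (Q ^ mm s) (int (Q ^ ii s)) (int (Q ^ (2 * ii s))) f f f"
  proof (rule scale_correlation[OF k1 k2 *(5) _ *(7) f01 *(1,2)])
   show "Q ^ (2 * ii s + (2 * mm s + 1)) dvd P" by (rule dv) (use le'[OF ls] in linarith)
   show "adm (k1 + k2 + 5) Q \<eta>" by (rule adm_le[OF *(3) _ *(1,2)]) (simp add: k_def K_def)
   show "2 * k1 + 2 * k2 + 2 <= mm s" using mK[OF ls] by (simp add: K_def)
   show "av (zp P) (%x. \<bar>cexp (Q ^ (ii s + k1)) (Q ^ (mm s - 2 * k1 - 1)) f x - cexp (Q ^ ii s) (Q ^ (mm s + 1)) f x\<bar>) <= \<eta>"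
    by (rule av_abs_le_of_square) (use q1 s2 p2 *(1) in auto)
   show "av (zp P) (%x. \<bar>cexp (Q ^ (2 * ii s + k2)) (Q ^ (2 * mm s - 2 * k2 - 1)) f x - cexp (Q ^ (2 * ii s)) (Q ^ (2 * mm s + 1)) f x\<bar>) <= \<eta>"
    by (rule av_abs_le_of_square) (use q2 s2 p1 *(1) in auto)
  qed
  moreover have "0 < mm s" using mK[OF ls] by simp
  ultimately show "\<exists>i m. 0 < m \<and> i + m <= k * (S + 1) \<and> (av (zp P) f) ^ 3 - 5 * \<eta> <= tri P (Q ^ m) (int (Q ^ i)) (int (Q ^ (2 * i))) f f f"
   using le'[OF ls] by blast
 qed
qed

section \<open>Parameters and the theorem\<close>

text \<open>The term d = 0 adds at most 1 / M < \<eta> to the mean, so some positive d does as well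
  as the mean minus \<eta>.\<close>

lemma good_difference:
 fixes B :: real
 assumes P: "P > 0" and M: "1 / \<eta> < real M" "0 < \<eta>" and f: "!!x. 0 <= f x" "!!x. f x <= 1"
  and big: "B + \<eta> <= tri P M q1 q2 f f f" and M2: "1 < M"
 shows "\<exists>d. 0 < d \<and> d < int M \<and> B <= av (zp P) (%x. f x * f (x + q1 * d) * f (x + q2 * d\<^sup>2))"
proof (rule ccontr)
 assume no: "\<not> ?thesis"
 define c where "c d = av (zp P) (%x. f x * f (x + q1 * d) * f (x + q2 * d\<^sup>2))" for d
 have c01: "0 <= c d" "c d <= 1" for d
  unfolding c_def by (auto intro!: av_nonneg av_le mult_nonneg_nonneg mult_le_one f)
 have lt: "c d < B" if "0 < d" "d < int M" for d using no that unfolding c_def by (auto simp: not_le)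
 have B0: "0 < B" using lt[of 1] c01(1)[of 1] M2 by simp
 have "tri P M q1 q2 f f f = av (zp M) c" unfolding tri_def c_def by (rule av_swap)
 also have "... <= av (zp M) (%d. B + of_bool (d = 0))"
 proof (rule av_mono)
  fix d assume "d \<in> zp M"
  then show "c d <= B + of_bool (d = 0)" using lt[of d] c01(2)[of d] B0 by (cases "d = 0") auto
 qed
 also have "... = B + av (zp M) (%d. of_bool (d = 0))" unfolding av_add using M2 by (simp add: av_const)
 also have "av (zp M) (%d. of_bool (d = 0)) = 1 / real M"
 proof -
  have "{d \<in> zp M. d = 0} = {0}" using M2 by auto
  then show ?thesis by (simp add: av_of_bool)
 qed
 finally have "\<eta> <= 1 / real M" using big by simp
 moreover have "1 / real M < \<eta>" using M M2 by (simp add: field_simps)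
 ultimately show False by simp
qed

text \<open>F! \<le> F^F \<le> exp (F^2), so the logarithm of the left side is bounded by a
  polynomial in x = 1 / \<epsilon>; numerical factors are swallowed by further powers of x, since x
  \<ge> 2.\<close>

lemma power_tower_bound:
 fixes \<epsilon> :: real
 assumes e: "0 < \<epsilon>" "\<epsilon> <= 1/2" and k: "1 <= k"
 defines "\<eta> \<equiv> \<epsilon> / 16"
 defines "F \<equiv> nat \<lceil>(1 / \<eta>) ^ k\<rceil>" and "S \<equiv> nat \<lceil>2 / \<eta>\<^sup>2\<rceil>"
 defines "C \<equiv> real (10 * k + 16)"
 shows "2 * real (fact F ^ (2 * (k * (S + 1)) + 1)) / \<eta> <= exp (C * \<epsilon> powr (- C))"
proof -
 define x where "x = 1 / \<epsilon>"
 have x: "2 <= x" unfolding x_def using e by (simp add: field_simps)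
 have x1: "1 <= x ^ j" for j using x by (intro one_le_power) simp
 have xm: "x ^ i <= x ^ j" if "i <= j" for i j using that x by (intro power_increasing) auto
 have two: "2 * x ^ j <= x ^ Suc j" for j using x x1[of j] by (simp add: mult_right_mono)
 have ie: "1 / \<eta> = 16 * x" by (simp add: \<eta>_def x_def)
 have x5: "1 / \<eta> <= x ^ 5"
 proof -
  have "2 ^ 4 * x <= x ^ 4 * x" using x by (intro mult_right_mono power_mono) auto
  then show ?thesis unfolding ie by (simp add: eval_nat_numeral)
 qed
 have e0: "0 <= 1 / \<eta>" using e by (simp add: \<eta>_def)
 have F: "real F <= x ^ (5 * k + 1)"
 proof -
  have "(1 / \<eta>) ^ k <= x ^ (5 * k)" unfolding power_mult by (rule power_mono[OF x5 e0])
  moreover have "real F <= (1 / \<eta>) ^ k + 1" unfolding F_def using e0 by (intro order_trans[OF _ of_int_ceiling_le_add_one]) simp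
  ultimately have "real F <= 2 * x ^ (5 * k)" using x1[of "5 * k"] by linarith
  also have "... <= x ^ Suc (5 * k)" by (rule two)
  finally show ?thesis by simp
 qed
 have S: "real S + 1 <= x ^ 12"
 proof -
  have "(1 / \<eta>)\<^sup>2 <= (x ^ 5)\<^sup>2" by (rule power_mono[OF x5 e0])
  moreover have "2 / \<eta>\<^sup>2 = 2 * (1 / \<eta>)\<^sup>2" by (simp add: power_divide)
  moreover have "real S <= 2 / \<eta>\<^sup>2 + 1" unfolding S_def by (intro order_trans[OF _ of_int_ceiling_le_add_one]) simp
  ultimately have "real S + 1 <= 2 * (x ^ 5)\<^sup>2 + 2" by linarith
  also have "... <= 4 * x ^ 10" using x1[of 10] by (simp add: power_mult[symmetric])
  also have "... <= x ^ 12" using two[of 10] two[of 11] by simp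
  finally show ?thesis .
 qed
 define E where "E = 2 * (k * (S + 1)) + (1::nat)"
 have "real (fact F) <= exp (real F * real F)"
 proof -
  have "real (fact F) <= real (F ^ F)" unfolding of_nat_fact by (rule fact_le_power)
  also have "... <= exp (real F) ^ F" unfolding of_nat_power
   using exp_ge_add_one_self[of "real F"] by (intro power_mono) linarith+
  also have "... = exp (real F * real F)" by (simp add: exp_of_nat_mult[symmetric])
  finally show ?thesis .
 qed
 then have "real (fact F) ^ E <= exp (real F * real F) ^ E" by (intro power_mono) auto
 also have "... = exp (real E * (real F * real F))" by (rule exp_of_nat_mult[symmetric])
 finally have 1: "real (fact F ^ E) <= exp (real E * (real F * real F))" by simp
 have 2: "2 / \<eta> <= exp (2 / \<eta>)" using exp_ge_add_one_self[of "2 / \<eta>"] by linarith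
 have "2 * real (fact F ^ E) / \<eta> = 2 / \<eta> * real (fact F ^ E)" by simp
 also have "... <= exp (2 / \<eta>) * exp (real E * (real F * real F))" using e0 by (intro mult_mono 1 2) auto
 also have "... = exp (2 / \<eta> + real E * (real F * real F))" by (rule exp_add[symmetric])
 also have "... <= exp (C * \<epsilon> powr (- C))"
 proof -
  have FF: "real F * real F <= x ^ (10 * k + 2)"
  proof -
   have "real F * real F <= x ^ (5 * k + 1) * x ^ (5 * k + 1)" by (intro mult_mono F) (use x in auto)
   also have "... = x ^ (10 * k + 2)" unfolding power_add[symmetric] by (rule arg_cong[where f = "%i. x ^ i"]) simp
   finally show ?thesis .
  qed
  have "real E <= 2 * real k * x ^ 12 + 1"
  proof -
   have "real k * (real S + 1) <= real k * x ^ 12" by (rule mult_left_mono[OF S]) simp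
   then show ?thesis unfolding E_def by (simp add: algebra_simps)
  qed
  also have "... <= (2 * real k + 1) * x ^ 12" using x1[of 12] by (simp add: algebra_simps)
  finally have E: "real E <= (2 * real k + 1) * x ^ 12" .
  have "real E * (real F * real F) <= (2 * real k + 1) * x ^ 12 * x ^ (10 * k + 2)"
   by (intro mult_mono E FF) (use x in auto)
  also have "... = (2 * real k + 1) * x ^ (10 * k + 14)"
  proof -
   have "12 + (10 * k + 2) = 10 * k + 14" by simp
   then show ?thesis unfolding mult.assoc power_add[symmetric] by (simp only:)
  qed
  finally have a: "real E * (real F * real F) <= (2 * real k + 1) * x ^ (10 * k + 14)" .
  have "2 / \<eta> <= 2 * x ^ 5" using x5 by simp
  also have "... <= x ^ Suc 5" by (rule two)
  also have "... <= x ^ (10 * k + 14)" by (rule xm) simp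
  finally have b: "2 / \<eta> <= x ^ (10 * k + 14)" .
  have "2 / \<eta> + real E * (real F * real F) <= (2 * real k + 2) * x ^ (10 * k + 14)"
   using a b by (simp add: algebra_simps)
  also have "... <= C * x ^ (10 * k + 16)" by (intro mult_mono xm) (use x in "auto simp: C_def")
  also have "x ^ (10 * k + 16) = \<epsilon> powr (- C)"
   unfolding C_def x_def powr_minus powr_realpow[OF e(1)] by (simp add: power_one_over inverse_eq_divide)
  finally show ?thesis by simp
 qed
 finally show ?thesis unfolding E_def .
qed

theorem theorem1p3:
  "\<exists>C::real. C > 0 \<and>
    (\<forall>(N::nat) (\<delta>::real) (A::int set) (\<epsilon>::real).
      N > 0 \<longrightarrow> 0 < \<delta> \<longrightarrow> \<delta> \<le> 1 \<longrightarrow>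
      A \<subseteq> {1..int N} \<longrightarrow> real (card A) \<ge> \<delta> * real N \<longrightarrow>
      0 < \<epsilon> \<longrightarrow> \<epsilon> \<le> 1/2 \<longrightarrow>
      (real N \<le> exp (C * \<epsilon> powr (-C)) \<or>
       (\<exists>d::int. d \<noteq> 0 \<and>
         real (card {x \<in> A. x + d \<in> A \<and> x + d\<^sup>2 \<in> A}) \<ge> (\<delta>^3 - \<epsilon>) * real N)))"
proof -
 obtain k where k: "\<forall>\<eta> Q S P f. 0 < \<eta> --> \<eta> <= 1/2 --> adm k Q \<eta> --> 2 / \<eta>\<^sup>2 <= real S --> 0 < P --> Q ^ (2 * (k * (S + 1)) + 1) dvd P --> per P f -->
   (\<forall>x. 0 <= f x \<and> f x <= 1) -->
   (\<exists>i m. 0 < m \<and> i + m <= k * (S + 1) \<and> (av (zp P) f) ^ 3 - 5 * \<eta> <= tri P (Q ^ m) (int (Q ^ i)) (int (Q ^ (2 * i))) f f f)"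
  using popular_scale by (elim exE) (rule that)
 \<comment> \<open>Three more than k, so that \<open>adm_ge\<close> also yields (1 / \<eta>)^2 \<le>
   Q, which excludes the degenerate case of a tiny range of d.\<close>
 define k' where "k' = k + 3"
 define C where "C = real (10 * k' + 16)"
 show ?thesis
 proof (rule exI[of _ C], intro conjI allI impI)
  show "0 < C" by (simp add: C_def)
  fix N :: nat and \<delta> :: real and A :: "int set" and \<epsilon> :: real
  assume *: "0 < N" "0 < \<delta>" "\<delta> <= 1" "A \<subseteq> {1..int N}" "\<delta> * real N <= real (card A)" "0 < \<epsilon>" "\<epsilon> <= 1/2"
  \<comment> \<open>Nine multiples of \<eta> are lost in the end, six in the count and three in the
    density.\<close>
  define \<eta> where "\<eta> = \<epsilon> / 16"
  have eta: "0 < \<eta>" "\<eta> <= 1/2" using *(6,7) by (auto simp: \<eta>_def)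
  define F where "F = nat \<lceil>(1 / \<eta>) ^ k'\<rceil>"
  define S where "S = nat \<lceil>2 / \<eta>\<^sup>2\<rceil>"
  define Q where "Q = (fact F :: nat)"
  define E where "E = 2 * (k' * (S + 1)) + 1"
  define B where "B = Q ^ E"
  have tower: "2 * real B / \<eta> <= exp (C * \<epsilon> powr (- C))"
   unfolding B_def Q_def E_def F_def S_def \<eta>_def C_def by (rule power_tower_bound) (use * in "auto simp: k'_def")
  show "real N <= exp (C * \<epsilon> powr (- C)) \<or> (\<exists>d::int. d ~= 0 \<and> (\<delta> ^ 3 - \<epsilon>) * real N <= real (card {x \<in> A. x + d \<in> A \<and> x + d\<^sup>2 \<in> A}))"
  proof (cases "real N <= 2 * real B / \<eta>")
   case True
   then show ?thesis using tower by linarith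
  next
   case False
   then have BN: "2 * real B <= \<eta> * real N" using eta by (simp add: field_simps)
   have adm': "adm k' Q \<eta>"
   proof -
    have "r dvd Q" if "1 <= r" "real r <= (1 / \<eta>) ^ k'" for r
    proof -
     have "real r <= of_int \<lceil>(1 / \<eta>) ^ k'\<rceil>" using that(2) le_of_int_ceiling order_trans by blast
     then have "int r <= \<lceil>(1 / \<eta>) ^ k'\<rceil>" by linarith
     then have "r <= F" unfolding F_def by linarith
     then show ?thesis unfolding Q_def using that(1) by (intro dvd_fact)
    qed
    then show ?thesis unfolding adm_def by (simp add: Q_def)
   qed
   have adm: "adm k Q \<eta>" by (rule adm_le[OF adm' _ eta]) (simp add: k'_def)
   have kS: "k * (S + 1) <= k' * (S + 1)" by (rule mult_right_mono) (auto simp: k'_def)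
   have Q0: "Q > 0" by (simp add: Q_def)
   have B0: "B > 0" using Q0 by (simp add: B_def)
   have Qbig: "(1 / \<eta>) ^ 2 <= real Q" by (rule adm_ge[OF adm' eta]) (simp add: k'_def)
   \<comment> \<open>A multiple of all block lengths. It exceeds N + B, so x + D and x + D^2 do not
     wrap around for x \<le> N when D^2 \<le> B; and it is at most N + 2 B \<le> (1 + \<eta>) N, so
     little density is lost.\<close>
   define P where "P = B * (N div B + 2)"
   have P0: "P > 0" using B0 by (simp add: P_def)
   have PN: "N + B < P" "P <= N + 2 * B"
   proof -
    have "N = B * (N div B) + N mod B" by simp
    moreover have "N mod B < B" using B0 by simp
    moreover have "P = B * (N div B) + 2 * B" by (simp add: P_def algebra_simps)
    ultimately show "N + B < P" "P <= N + 2 * B" by linarith+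
   qed
   define f where "f x = (of_bool (x mod int P \<in> A) :: real)" for x
   have fper: "per P f" by (simp add: per_def f_def)
   have f01: "0 <= f x" "f x <= 1" for x by (auto simp: f_def)
   have Az: "A \<subseteq> zp P" using *(4) PN(1) by (auto simp: subset_iff)
   have finA: "finite A" by (rule finite_subset[OF *(4)]) simp
   have avf: "av (zp P) f = real (card A) / real P"
   proof -
    have "{x \<in> zp P. x mod int P \<in> A} = A" using Az by (auto simp: subset_iff)
    then show ?thesis unfolding f_def by (simp add: av_of_bool)
   qed
   have S: "2 / \<eta>\<^sup>2 <= real S" unfolding S_def by (rule real_nat_ceiling_ge)
   have dvdP: "Q ^ (2 * (k * (S + 1)) + 1) dvd P"
   proof -
    have "2 * (k * (S + 1)) + 1 <= E" unfolding E_def by (rule add_right_mono, rule mult_left_mono[OF kS]) simp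
    then have "Q ^ (2 * (k * (S + 1)) + 1) dvd B" unfolding B_def by (rule le_imp_power_dvd)
    then show ?thesis unfolding P_def by simp
   qed
   obtain i m where im: "0 < m" "i + m <= k * (S + 1)" and
    big: "(av (zp P) f) ^ 3 - 5 * \<eta> <= tri P (Q ^ m) (int (Q ^ i)) (int (Q ^ (2 * i))) f f f"
    using k[rule_format, OF eta adm S P0 dvdP fper] f01 by blast
   have e2: "1 / \<eta> < (1 / \<eta>) ^ 2"
   proof -
    have "2 <= 1 / \<eta>" using eta by (simp add: field_simps)
    then have "1 / \<eta> * 1 < 1 / \<eta> * (1 / \<eta>)" by (intro mult_strict_left_mono) linarith+
    then show ?thesis by (simp only: power2_eq_square mult_1_right)
   qed
   have Mbig: "1 / \<eta> < real (Q ^ m)"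
   proof -
    have "Q ^ 1 <= Q ^ m" by (rule power_increasing) (use im Q0 in auto)
    then have "real Q <= real (Q ^ m)" by (simp only: power_one_right of_nat_le_iff)
    then show ?thesis using Qbig e2 by linarith
   qed
   have M1: "1 < Q ^ m"
   proof -
    have "1 < real (Q ^ m)" using Mbig eta by (intro less_trans[OF _ Mbig]) (simp add: field_simps)
    then have "real 1 < real (Q ^ m)" unfolding of_nat_1 .
    then show ?thesis by (simp only: of_nat_less_iff)
   qed
   have "(av (zp P) f) ^ 3 - 6 * \<eta> + \<eta> <= tri P (Q ^ m) (int (Q ^ i)) (int (Q ^ (2 * i))) f f f" using big by simp
   from good_difference[OF P0 Mbig eta(1) f01 this M1] obtain d where d: "0 < d" "d < int (Q ^ m)"
    and c: "(av (zp P) f) ^ 3 - 6 * \<eta> <= av (zp P) (%x. f x * f (x + int (Q ^ i) * d) * f (x + int (Q ^ (2 * i)) * d\<^sup>2))" by blast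
   \<comment> \<open>The difference sought: with it the shifts q1 d and q2 d^2 are D and
     D^2.\<close>
   define D where "D = int (Q ^ i) * d"
   have D2: "D\<^sup>2 = int (Q ^ (2 * i)) * d\<^sup>2" by (simp add: D_def power_mult_distrib power_mult[symmetric] mult.commute)
   have D0: "0 < D" using d(1) Q0 by (simp add: D_def)
   have DD: "D <= D\<^sup>2" using D0 by (simp add: power2_eq_square)
   have DB: "D\<^sup>2 <= int B"
   proof -
    have "D <= int (Q ^ i) * int (Q ^ m)" unfolding D_def using d by (intro mult_left_mono) auto
    also have "... = int (Q ^ (i + m))" by (simp add: power_add)
    finally have "D\<^sup>2 <= (int (Q ^ (i + m)))\<^sup>2" using D0 by (intro power_mono) auto
    also have "... = int (Q ^ (2 * (i + m)))" by (simp add: power_mult[symmetric] mult.commute)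
    also have "Q ^ (2 * (i + m)) <= B" unfolding B_def
    proof (rule power_increasing)
     show "2 * (i + m) <= E" unfolding E_def
      using mult_le_mono2[OF order_trans[OF im(2) kS], of 2] by (rule trans_le_add1)
    qed (use Q0 in simp)
    finally show ?thesis by simp
   qed
   let ?G = "{x \<in> A. x + D \<in> A \<and> x + D\<^sup>2 \<in> A}"
   have "av (zp P) (%x. f x * f (x + int (Q ^ i) * d) * f (x + int (Q ^ (2 * i)) * d\<^sup>2)) = av (zp P) (%x. of_bool (x mod int P \<in> A \<and> (x + D) mod int P \<in> A \<and> (x + D\<^sup>2) mod int P \<in> A))"
    unfolding D2[symmetric] unfolding D_def[symmetric] f_def by (simp add: of_bool_conj mult.assoc)
   also have "... = real (card {x \<in> zp P. x mod int P \<in> A \<and> (x + D) mod int P \<in> A \<and> (x + D\<^sup>2) mod int P \<in> A}) / real P"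
    by (simp add: av_of_bool)
   also have "{x \<in> zp P. x mod int P \<in> A \<and> (x + D) mod int P \<in> A \<and> (x + D\<^sup>2) mod int P \<in> A} \<subseteq> ?G"
   proof
    fix x assume x: "x \<in> {x \<in> zp P. x mod int P \<in> A \<and> (x + D) mod int P \<in> A \<and> (x + D\<^sup>2) mod int P \<in> A}"
    then have "x mod int P = x" by (intro mod_pos_pos_trivial) auto
    then have xA: "x \<in> A" using x by simp
    then have "1 <= x" "x <= int N" using *(4) by auto
    moreover have "int N + int B < int P" using PN(1) by linarith
    ultimately have "(x + D) mod int P = x + D" "(x + D\<^sup>2) mod int P = x + D\<^sup>2"
     using D0 DD DB by (auto intro!: mod_pos_pos_trivial)
    then show "x \<in> ?G" using x xA by auto
   qed
   then have "card {x \<in> zp P. x mod int P \<in> A \<and> (x + D) mod int P \<in> A \<and> (x + D\<^sup>2) mod int P \<in> A} <= card ?G"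
    by (rule card_mono[rotated]) (use finA in simp)
   then have "real (card {x \<in> zp P. x mod int P \<in> A \<and> (x + D) mod int P \<in> A \<and> (x + D\<^sup>2) mod int P \<in> A}) / real P <= real (card ?G) / real P"
    by (intro divide_right_mono) auto
   finally have cG: "(real (card A) / real P) ^ 3 - 6 * \<eta> <= real (card ?G) / real P" using c unfolding avf by linarith
   have "(\<delta> ^ 3 - \<epsilon>) * real N <= real (card ?G)"
   proof -
    have Nr: "0 < real N" "0 < real P" using *(1) P0 by auto
    have Pr: "real P <= (1 + \<eta>) * real N"
    proof -
     have "real P <= real N + 2 * real B" using PN(2) by linarith
     then show ?thesis using BN by (simp add: algebra_simps)
    qed
    define r where "r = real N / real P"
    have r: "1 - \<eta> <= r"
    proof -
     have "(1 - \<eta>) * real P <= (1 - \<eta>) * ((1 + \<eta>) * real N)" using Pr eta by (intro mult_left_mono) auto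
     also have "... = (1 - \<eta>\<^sup>2) * real N" by (simp add: algebra_simps power2_eq_square)
     also have "... <= 1 * real N" by (intro mult_right_mono) auto
     finally show ?thesis unfolding r_def using Nr by (simp add: field_simps)
    qed
    have d1: "\<delta> * r <= real (card A) / real P" unfolding r_def using *(5) Nr by (simp add: divide_right_mono)
    have "(\<delta> * (1 - \<eta>)) ^ 3 <= (real (card A) / real P) ^ 3"
    proof (rule power_mono)
     have "\<delta> * (1 - \<eta>) <= \<delta> * r" using r *(2) by (intro mult_left_mono) auto
     then show "\<delta> * (1 - \<eta>) <= real (card A) / real P" using d1 by linarith
    qed (use *(2) eta in auto)
    moreover have "\<delta> ^ 3 - 3 * \<eta> <= (\<delta> * (1 - \<eta>)) ^ 3"
    proof -
     have d3: "0 <= \<delta> ^ 3" "\<delta> ^ 3 <= 1" using *(2,3) by (auto intro: power_le_one)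
     have "1 - 3 * \<eta> <= (1 - \<eta>) ^ 3"
     proof -
      have "0 <= \<eta>\<^sup>2 * (3 - \<eta>)" using eta by (intro mult_nonneg_nonneg) auto
      then show ?thesis by (simp add: power2_eq_square power3_eq_cube algebra_simps)
     qed
     then have "\<delta> ^ 3 * (1 - 3 * \<eta>) <= \<delta> ^ 3 * (1 - \<eta>) ^ 3" using d3 by (intro mult_left_mono) auto
     moreover have "\<delta> ^ 3 * (3 * \<eta>) <= 1 * (3 * \<eta>)" using d3 eta by (intro mult_right_mono) auto
     moreover have "\<delta> ^ 3 * (1 - 3 * \<eta>) = \<delta> ^ 3 - \<delta> ^ 3 * (3 * \<eta>)" by (simp add: right_diff_distrib)
     moreover have "(\<delta> * (1 - \<eta>)) ^ 3 = \<delta> ^ 3 * (1 - \<eta>) ^ 3" by (rule power_mult_distrib)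
     ultimately show ?thesis by linarith
    qed
    ultimately have "\<delta> ^ 3 - 9 * \<eta> <= real (card ?G) / real P" using cG by linarith
    then have gP: "(\<delta> ^ 3 - 9 * \<eta>) * real P <= real (card ?G)" using Nr by (simp add: field_simps)
    show ?thesis
    \<comment> \<open>Replacing P by the smaller N needs a nonnegative coefficient; otherwise the
      claimed bound is at most 0.\<close>
    proof (cases "0 <= \<delta> ^ 3 - 9 * \<eta>")
     case True
     have "(\<delta> ^ 3 - \<epsilon>) * real N <= (\<delta> ^ 3 - 9 * \<eta>) * real N" using eta by (intro mult_right_mono) (auto simp: \<eta>_def)
     also have "... <= (\<delta> ^ 3 - 9 * \<eta>) * real P" using True PN(1) by (intro mult_left_mono) auto
     finally show ?thesis using gP by linarith
    next
     case False
     then have "(\<delta> ^ 3 - \<epsilon>) * real N <= 0" using *(6) Nr by (intro mult_nonpos_nonneg) (auto simp: \<eta>_def)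
     then show ?thesis by (rule order_trans) simp
    qed
   qed
   then show ?thesis using D0 by (intro disjI2 exI[of _ D]) auto
  qed
 qed
qed

end
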